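(* Fix an integer $r\ge0$, a non-square integer $m\ge1$, and an integer $N\ge1$ coprime to $m$. Then for each sign pattern $\sigma$ for $N$, $c_{2r}(m,N,k,\sigma)$ is nonzero with sign $(-1)^r$ for all but finitely many even integers $k\ge2$.
   Context: For $N\ge1$ and $k\ge2$ even, $S_k(N)$ is the complex vector space of cusp forms of weight $k$ on $\Gamma_0(N)$ (trivial character). For $m\ge1$ coprime to $N$, $T_m$ is the usual $m$-th Hecke operator on $S_k(N)$ and $T_m'=m^{-(k-1)/2}T_m$. Write $Q\parallel N$ if $Q\mid N$ and $\gcd(Q,N/Q)=1$; $W_Q$ is the Atkin–Lehner involution on $S_k(N)$, i.e. the weight-$k$ slash action $f\mapsto f|_k\gamma$, $(f|_k\gamma)(z)=\det(\gamma)^{k/2}(c'z+d')^{-k}f(\gamma z)$ ($c',d'$ the bottom row of $\gamma$), of any integer matrix $\gamma=\begin{pmatrix} Qx & y \\ N z & Q w \end{pmatrix}$ of determinant $Q$. The $W_Q$ commute with each other and with $T_m'$. A sign pattern for $N$ is a function $\sigma:\{Q\parallel N\}\to\{\pm1\}$ with $\sigma(QQ')=\sigma(Q)\sigma(Q')$ for coprime exact divisors $Q,Q'$ (and $\sigma(1)=1$). Set $S_k^\sigma(N)=\{f\in S_k(N): W_Qf=\sigma(Q)f\text{ for every }Q\parallel N\}$. Let $d=\dim S_k^\sigma(N)$ and let $\lambda_1,\dots,\lambda_d$ be the eigenvalues (with multiplicity) of $T_m'$ on $S_k^\sigma(N)$. The coefficients $c_r(m,N,k,\sigma)$ are those of the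 characteristic polynomial of $T_m'$ on $S_k^\sigma(N)$, $\sum_{0\le r\le d}c_r(m,N,k,\sigma)x^{d-r}$; equivalently $c_r(m,N,k,\sigma)=(-1)^r\sum_{1\le i_1<\dots<i_r\le d}\lambda_{i_1}\cdots\lambda_{i_r}$ (so $c_0=1$, and $c_r=0$ when $r>d$). *)

theory Defs
  imports
    "HOL-Analysis.Analysis"
    "HOL-Library.Function_Algebras"
    "HOL-Computational_Algebra.Nth_Powers"
    "Jordan_Normal_Form.Char_Poly"
begin

text \<open>
  A function on the upper half-plane is represented by a function \<^typ>\<open>complex \<Rightarrow> complex\<close> that
  vanishes off the half-plane, so that equality of such functions and linear independence have
  their usual meaning.  As \<^term>\<open>x / 0 = (0::complex)\<close>, the operators below preserve this
  normalisation.
\<close>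

definition upper_half_plane :: "complex set" where
  "upper_half_plane = {z. Im z > 0}"

definition cscale :: "complex \<Rightarrow> (complex \<Rightarrow> complex) \<Rightarrow> complex \<Rightarrow> complex" where
  "cscale c f = (\<lambda>z. c * f z)"

global_interpretation cfun: vector_space cscale
  by unfold_locales (auto simp: cscale_def fun_eq_iff algebra_simps)

definition slash :: "nat \<Rightarrow> int \<Rightarrow> int \<Rightarrow> int \<Rightarrow> int \<Rightarrow> (complex \<Rightarrow> complex) \<Rightarrow> complex \<Rightarrow> complex" where
  "slash k a b c d f = (\<lambda>z.
     complex_of_real (real_of_int (a * d - b * c) powr (real k / 2)) / (of_int c * z + of_int d) ^ k
       * f ((of_int a * z + of_int b) / (of_int c * z + of_int d)))"

text \<open>
  The last condition says that \<open>f\<close> vanishes at every cusp: every translate of \<open>f\<close> by \<open>SL\<^sub>2(\<int>)\<close> is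
  invariant under \<open>z \<mapsto> z + N\<close>, and its Fourier expansion in \<open>exp (2 \<pi> i z / N)\<close> is required to
  have positive exponents only.
\<close>

definition cusp_forms :: "nat \<Rightarrow> nat \<Rightarrow> (complex \<Rightarrow> complex) set" where
  "cusp_forms k N = {f.
     (\<forall>z. z \<notin> upper_half_plane \<longrightarrow> f z = 0) \<and>
     f holomorphic_on upper_half_plane \<and>
     (\<forall>a b c d. a * d - b * c = 1 \<and> int N dvd c \<longrightarrow> slash k a b c d f = f) \<and>
     (\<forall>a b c d. a * d - b * c = 1 \<longrightarrow>
        (\<exists>q :: nat \<Rightarrow> complex. q 0 = 0 \<and>
           (\<forall>z\<in>upper_half_plane.
              (\<lambda>n. q n * exp (2 * of_real pi * \<i> * of_nat n * z / of_nat N))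
                sums slash k a b c d f z)))}"

text \<open>
  The formula for the Hecke operator below is the usual one when \<open>m\<close> is coprime to the level.
\<close>

definition hecke :: "nat \<Rightarrow> nat \<Rightarrow> (complex \<Rightarrow> complex) \<Rightarrow> complex \<Rightarrow> complex" where
  "hecke k m f = (\<lambda>z. of_nat m ^ (k - 1) *
     (\<Sum>d | d dvd m. (\<Sum>b<d. f ((of_nat (m div d) * z + of_nat b) / of_nat d) / of_nat d ^ k)))"

definition hecke_normalized :: "nat \<Rightarrow> nat \<Rightarrow> (complex \<Rightarrow> complex) \<Rightarrow> complex \<Rightarrow> complex" where
  "hecke_normalized k m f =
     cscale (complex_of_real (real m powr (- ((real k - 1) / 2)))) (hecke k m f)"

definition exact_divisor :: "nat \<Rightarrow> nat \<Rightarrow> bool" where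
  "exact_divisor Q N \<longleftrightarrow> Q dvd N \<and> coprime Q (N div Q)"

text \<open>
  On \<^term>\<open>cusp_forms k N\<close> the result does not depend on the matrix chosen; for an exact
  divisor \<open>Q\<close> a suitable matrix exists.
\<close>

definition atkin_lehner :: "nat \<Rightarrow> nat \<Rightarrow> nat \<Rightarrow> (complex \<Rightarrow> complex) \<Rightarrow> complex \<Rightarrow> complex" where
  "atkin_lehner k N Q f =
     (let (x, y, z, w) = (SOME (x, y, z, w).
            (int Q * x) * (int Q * w) - y * (int N * z) = int Q)
      in slash k (int Q * x) y (int N * z) (int Q * w) f)"

text \<open>Only the values of \<open>\<sigma>\<close> at the exact divisors of \<open>N\<close> are relevant.\<close>

definition sign_pattern :: "nat \<Rightarrow> (nat \<Rightarrow> int) \<Rightarrow> bool" where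
  "sign_pattern N \<sigma> \<longleftrightarrow>
     (\<forall>Q. exact_divisor Q N \<longrightarrow> \<sigma> Q \<in> {1, -1}) \<and>
     \<sigma> 1 = 1 \<and>
     (\<forall>Q Q'. exact_divisor Q N \<and> exact_divisor Q' N \<and> coprime Q Q' \<longrightarrow> \<sigma> (Q * Q') = \<sigma> Q * \<sigma> Q')"

definition cusp_forms_sign :: "nat \<Rightarrow> nat \<Rightarrow> (nat \<Rightarrow> int) \<Rightarrow> (complex \<Rightarrow> complex) set" where
  "cusp_forms_sign k N \<sigma> = {f \<in> cusp_forms k N.
     \<forall>Q. exact_divisor Q N \<longrightarrow> atkin_lehner k N Q f = cscale (of_int (\<sigma> Q)) f}"

text \<open>
  The characteristic polynomial of an operator \<open>T\<close> on a finite-dimensional \<open>T\<close>-invariant subspace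
  \<open>V\<close>: that of the matrix of \<open>T\<close> in any ordered basis \<open>bs\<close> of \<open>V\<close>.
\<close>

definition char_poly_on ::
  "(complex \<Rightarrow> complex) set \<Rightarrow> ((complex \<Rightarrow> complex) \<Rightarrow> complex \<Rightarrow> complex) \<Rightarrow> complex poly" where
  "char_poly_on V T = (THE p. \<exists>bs A.
     distinct bs \<and> cfun.independent (set bs) \<and> cfun.span (set bs) = V \<and>
     A \<in> carrier_mat (length bs) (length bs) \<and>
     (\<forall>j<length bs. T (bs ! j) = (\<Sum>i<length bs. cscale (A $$ (i, j)) (bs ! i))) \<and>
     p = char_poly A)"

definition hecke_coeff :: "nat \<Rightarrow> nat \<Rightarrow> nat \<Rightarrow> nat \<Rightarrow> (nat \<Rightarrow> int) \<Rightarrow> complex" where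
  "hecke_coeff r m N k \<sigma> =
     (let V = cusp_forms_sign k N \<sigma>; d = cfun.dim V
      in if r \<le> d then coeff (char_poly_on V (hecke_normalized k m)) (d - r) else 0)"

end

theory Submission
 imports Defs "HOL-Complex_Analysis.Complex_Analysis" "HOL-Real_Asymp.Real_Asymp" "Jordan_Normal_Form.Schur_Decomposition"
begin

text \<open>
 Let \<open>k = 2 n\<close>, let \<open>p\<^sub>i\<close> be the \<open>i\<close>-th power sum of the eigenvalues of \<open>T\<^sub>m'\<close>, and let \<open>d\<close> be the
 dimension.  The space is spanned by the kernels
 \<open>w \<mapsto> \<Sum>\<^sub>g \<chi>(g) (\<dots>)\<^sup>-\<^sup>2\<^sup>n\<close> over the group \<open>ALG N\<close> of Atkin--Lehner matrices, which reproduce values; hence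
 the trace of a sum of slash operators is an integral, over a fundamental domain, of that sum applied
 to the kernel on the diagonal.  After division by the weight \<open>\<kappa>\<^sub>n \<rightarrow> \<infinity>\<close>, scalar matrices contribute
 a constant and all others tend to \<open>0\<close>, with rate \<open>O(1 / n)\<close> if there are no parabolic matrices.
 As \<open>m\<close> is not a square, \<open>T\<^sub>m\<close> involves no scalar and no parabolic matrix, so \<open>p\<^sub>1\<close> is bounded, whereas
 \<open>p\<^sub>2 / \<kappa>\<^sub>n\<close> tends to some \<open>M > 0\<close> and \<open>d = O(\<kappa>\<^sub>n)\<close>.  The eigenvalues are bounded, thus
 \<open>p\<^sub>i / \<kappa>\<^sub>n\<^bsup>i/2\<^esup> \<rightarrow> 0\<close> for \<open>i \<noteq> 2\<close>, and Newton's identities give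
 \<open>c\<^sub>2\<^sub>r / \<kappa>\<^sub>n\<^sup>r \<rightarrow> (- M / 2)\<^sup>r / r!\<close>.
\<close>

subsection \<open>The hyperbolic measure and the reproducing kernel\<close>

text \<open>Traces are read off from values: in a basis dual to finitely many point evaluations, the
  trace of U is the sum of the values of \<open>U (g j)\<close> at \<open>z j\<close>, and each of
  these is reproduced by the kernel. The obstacle is that the domain is not compact. Bounding the
  kernel by a sum over all integer matrices of a given determinant costs a factor proportional to
  the height y, and y has a logarithmically divergent integral at the cusps. The integral is
  therefore cut at height 2 n N. Below it, elliptic matrices cost O(1/n), parabolic ones O(log n /
  sqrt n), and all others decay geometrically up to a logarithm. Above it, the kernel is a cusp form
  in one variable and is exponentially small. The rates matter: the error in \<open>p_1\<close> gets
  multiplied by \<kappa> = O(n), which the rate O(1/n) just offsets, while for \<open>p_2\<close>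
  only the limit of \<open>p_2 / \<kappa>\<close> enters and the parabolic rate suffices. M is
  positive because a product of two upper triangular Hecke matrices becomes scalar only through a
  group element of determinant 1, where the sign is 1; nothing can cancel.\<close>

definition mob :: "real => real => real => real => complex => complex" where
 "mob a b c d z = (of_real a * z + of_real b) / (of_real c * z + of_real d)"

lemma mob_denom_nonzero:
 assumes "Im z > 0" "a * d - b * c > (0::real)"
 shows "of_real c * z + of_real d \<noteq> 0"
proof
 assume h: "of_real c * z + of_real d = 0"
 have "Im (of_real c * z + of_real d) = c * Im z" by simp
 with h have "c = 0" using assms(1) by (metis mult_eq_0_iff not_less_iff_gr_or_eq zero_complex.simps(2))
 with h have "d = 0" by simp
 with \<open>c = 0\<close> assms(2) show False by simp
qed

lemma Im_mob: "Im (mob a b c d z) = (a * d - b * c) * Im z / (cmod (of_real c * z + of_real d))\<^sup>2"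
proof -
 have "Im (mob a b c d z) = ((a * Im z) * (c * Re z + d) - (a * Re z + b) * (c * Im z)) / ((c * Re z + d)\<^sup>2 + (c * Im z)\<^sup>2)"
  by (simp add: mob_def Im_divide)
 also have "\<dots> = (a * d - b * c) * Im z / ((c * Re z + d)\<^sup>2 + (c * Im z)\<^sup>2)"
  by (simp add: algebra_simps)
 also have "(c * Re z + d)\<^sup>2 + (c * Im z)\<^sup>2 = (cmod (of_real c * z + of_real d))\<^sup>2"
  by (simp add: cmod_power2)
 finally show ?thesis .
qed

lemma Im_mob_pos:
 assumes "Im z > 0" "a * d - b * c > (0::real)"
 shows "Im (mob a b c d z) > 0"
 using mob_denom_nonzero[OF assms] assms by (simp add: Im_mob)

lemma measurable_mob [measurable]: "mob a b c d \<in> borel_measurable borel"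
 unfolding mob_def by measurable

text \<open>The coordinates x = exp t * s, y = exp t turn the invariant measure dx dy / y^2 into
  Lebesgue measure ds dt. A dilation then shifts t with s fixed, and a translation shifts s with t
  fixed.\<close>

definition hypP :: "real \<times> real => complex" where
 "hypP p = Complex (exp (snd p) * fst p) (exp (snd p))"

definition hyp :: "complex measure" where
 "hyp = distr lborel borel hypP"

lemma measurable_hypP [measurable]: "hypP \<in> borel_measurable borel"
proof -
 have "hypP = (\<lambda>p. of_real (exp (snd p) * fst p) + \<i> * of_real (exp (snd p)))"
  by (auto simp: hypP_def complex_eq_iff)
 also have "\<dots> \<in> borel_measurable borel" by (intro borel_measurable_continuous_onI continuous_intros)
 finally show ?thesis .
qed

lemma sets_hyp [measurable_cong, simp]: "sets hyp = sets borel"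
 and space_hyp [simp]: "space hyp = UNIV"
 by (simp_all add: hyp_def)

lemma nn_integral_hyp:
 assumes [measurable]: "f \<in> borel_measurable borel"
 shows "nn_integral hyp f = (\<integral>\<^sup>+t. \<integral>\<^sup>+s. f (Complex (exp t * s) (exp t)) \<partial>lborel \<partial>lborel)"
proof -
 have m: "(\<lambda>p. f (hypP p)) \<in> borel_measurable (lborel \<Otimes>\<^sub>M lborel)"
  by (simp add: lborel_prod)
 have "nn_integral hyp f = (\<integral>\<^sup>+p. f (hypP p) \<partial>lborel)"
  unfolding hyp_def by (subst nn_integral_distr) auto
 also have "\<dots> = (\<integral>\<^sup>+p. f (hypP p) \<partial>(lborel \<Otimes>\<^sub>M lborel))" by (simp add: lborel_prod)
 also have "\<dots> = (\<integral>\<^sup>+t. \<integral>\<^sup>+s. f (hypP (s, t)) \<partial>lborel \<partial>lborel)"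
  using lborel_pair.nn_integral_snd[OF m] by simp
 finally show ?thesis by (simp add: hypP_def)
qed

lemma nn_integral_hyp':
 assumes [measurable]: "f \<in> borel_measurable borel"
 shows "nn_integral hyp f = (\<integral>\<^sup>+s. \<integral>\<^sup>+t. f (Complex (exp t * s) (exp t)) \<partial>lborel \<partial>lborel)"
proof -
 have m: "(\<lambda>p. f (hypP p)) \<in> borel_measurable (lborel \<Otimes>\<^sub>M lborel)"
  by (simp add: lborel_prod)
 have "nn_integral hyp f = (\<integral>\<^sup>+p. f (hypP p) \<partial>lborel)"
  unfolding hyp_def by (subst nn_integral_distr) auto
 also have "\<dots> = (\<integral>\<^sup>+p. f (hypP p) \<partial>(lborel \<Otimes>\<^sub>M lborel))" by (simp add: lborel_prod)
 also have "\<dots> = (\<integral>\<^sup>+s. \<integral>\<^sup>+t. f (hypP (s, t)) \<partial>lborel \<partial>lborel)"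
  using lborel.nn_integral_fst[OF m] by simp
 finally show ?thesis by (simp add: hypP_def)
qed

lemma AE_hyp_pos: "AE w in hyp. Im w > 0"
 unfolding hyp_def by (subst AE_distr_iff) (auto simp: hypP_def)

lemma hyp_translate:
 assumes [measurable]: "f \<in> borel_measurable borel"
 shows "(\<integral>\<^sup>+w. f (w + of_real h) \<partial>hyp) = nn_integral hyp f"
proof -
 have C: "Complex (exp t * s) (exp t) = of_real (exp t * s) + \<i> * of_real (exp t)" for s t :: real
  by (simp add: complex_eq_iff)
 have "(\<integral>\<^sup>+w. f (w + of_real h) \<partial>hyp)
   = (\<integral>\<^sup>+t. \<integral>\<^sup>+s. f (Complex (exp t * s) (exp t) + of_real h) \<partial>lborel \<partial>lborel)"
  by (subst nn_integral_hyp) auto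
 also have "\<dots> = (\<integral>\<^sup>+t. \<integral>\<^sup>+s. f (Complex (exp t * s) (exp t)) \<partial>lborel \<partial>lborel)"
 proof (rule nn_integral_cong)
  fix t :: real
  have eq: "Complex (exp t * s) (exp t) + of_real h = Complex (exp t * (h * exp (- t) + 1 * s)) (exp t)" for s
   by (simp add: complex_eq_iff algebra_simps exp_minus field_simps)
  have "(\<integral>\<^sup>+s. f (Complex (exp t * s) (exp t)) \<partial>lborel) =
   (\<integral>\<^sup>+s. f (Complex (exp t * (h * exp (- t) + 1 * s)) (exp t)) \<partial>lborel)"
   by (subst nn_integral_real_affine[of "\<lambda>s. f (Complex (exp t * s) (exp t))" 1 "h * exp (- t)"])
    (simp_all add: C)
  then show "(\<integral>\<^sup>+s. f (Complex (exp t * s) (exp t) + of_real h) \<partial>lborel) =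
   (\<integral>\<^sup>+s. f (Complex (exp t * s) (exp t)) \<partial>lborel)"
   by (simp only: eq)
 qed
 also have "\<dots> = nn_integral hyp f" by (subst nn_integral_hyp) auto
 finally show ?thesis .
qed

lemma hyp_scale:
 assumes [measurable]: "f \<in> borel_measurable borel" and r: "r > 0"
 shows "(\<integral>\<^sup>+w. f (of_real r * w) \<partial>hyp) = nn_integral hyp f"
proof -
 have C: "Complex (exp t * s) (exp t) = of_real (exp t * s) + \<i> * of_real (exp t)" for s t :: real
  by (simp add: complex_eq_iff)
 have "(\<integral>\<^sup>+w. f (of_real r * w) \<partial>hyp)
   = (\<integral>\<^sup>+s. \<integral>\<^sup>+t. f (of_real r * Complex (exp t * s) (exp t)) \<partial>lborel \<partial>lborel)"
  by (subst nn_integral_hyp') auto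
 also have "\<dots> = (\<integral>\<^sup>+s. \<integral>\<^sup>+t. f (Complex (exp t * s) (exp t)) \<partial>lborel \<partial>lborel)"
 proof (rule nn_integral_cong)
  fix s :: real
  have eq: "of_real r * Complex (exp t * s) (exp t) = Complex (exp (ln r + 1 * t) * s) (exp (ln r + 1 * t))" for t
   using r by (simp add: complex_eq_iff exp_add)
  have "(\<integral>\<^sup>+t. f (Complex (exp t * s) (exp t)) \<partial>lborel) =
   (\<integral>\<^sup>+t. f (Complex (exp (ln r + 1 * t) * s) (exp (ln r + 1 * t))) \<partial>lborel)"
   by (subst nn_integral_real_affine[of "\<lambda>t. f (Complex (exp t * s) (exp t))" 1 "ln r"])
    (simp_all add: C)
  then show "(\<integral>\<^sup>+t. f (of_real r * Complex (exp t * s) (exp t)) \<partial>lborel) =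
   (\<integral>\<^sup>+t. f (Complex (exp t * s) (exp t)) \<partial>lborel)"
   by (simp only: eq)
 qed
 also have "\<dots> = nn_integral hyp f" by (subst nn_integral_hyp') auto
 finally show ?thesis .
qed

text \<open>The map -1/w sends (s, t) to (-s, -t - ln (1 + s^2)). For fixed s this is a reflection
  and a shift in t, followed by the reflection of s.\<close>

lemma hyp_inversion:
 assumes [measurable]: "f \<in> borel_measurable borel"
 shows "(\<integral>\<^sup>+w. f (- 1 / w) \<partial>hyp) = nn_integral hyp f"
proof -
 have C: "Complex (exp t * s) (exp t) = of_real (exp t * s) + \<i> * of_real (exp t)" for s t :: real
  by (simp add: complex_eq_iff)
 define g where "g s = (\<integral>\<^sup>+t. f (Complex (exp t * s) (exp t)) \<partial>lborel)" for s
 have g [measurable]: "g \<in> borel_measurable borel"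
  unfolding g_def C by measurable
 have "(\<integral>\<^sup>+w. f (- 1 / w) \<partial>hyp)
   = (\<integral>\<^sup>+s. \<integral>\<^sup>+t. f (- 1 / Complex (exp t * s) (exp t)) \<partial>lborel \<partial>lborel)"
  by (subst nn_integral_hyp') auto
 also have "\<dots> = (\<integral>\<^sup>+s. g (0 + (-1) * s) \<partial>lborel)"
 proof (rule nn_integral_cong)
  fix s :: real
  have pos: "1 + s\<^sup>2 > 0" by (simp add: add_pos_nonneg)
  have eq: "- 1 / Complex (exp t * s) (exp t) =
    Complex (exp (- ln (1 + s\<^sup>2) + (-1) * t) * (- s)) (exp (- ln (1 + s\<^sup>2) + (-1) * t))" for t
  proof -
   have n0: "Complex (exp t * s) (exp t) \<noteq> 0" by (simp add: complex_eq_iff)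
   have e: "exp (- ln (1 + s\<^sup>2) + (-1) * t) = 1 / ((1 + s\<^sup>2) * exp t)"
    using pos by (simp add: exp_add exp_minus exp_diff field_simps)
   have "Complex (exp t * s) (exp t) * Complex (- s / ((1 + s\<^sup>2) * exp t)) (1 / ((1 + s\<^sup>2) * exp t)) = -1"
   proof -
    define q where "q = 1 + s\<^sup>2"
    have q: "q \<noteq> 0" "s * s = q - 1" using pos by (auto simp: q_def power2_eq_square)
    show ?thesis unfolding q_def[symmetric] using q by (simp add: complex_eq_iff field_simps)
   qed
   moreover have "-1 / x = y" if "x * y = -1" "x \<noteq> 0" for x y :: complex
    using that by (simp add: field_simps)
   ultimately show ?thesis using n0 unfolding e by (simp add: mult.commute)
  qed
  have "g (- s) =
   (\<integral>\<^sup>+t. f (Complex (exp (- ln (1 + s\<^sup>2) + (-1) * t) * (- s)) (exp (- ln (1 + s\<^sup>2) + (-1) * t))) \<partial>lborel)"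
  proof -
   have m: "(\<lambda>t. f (Complex (exp t * r) (exp t))) \<in> borel_measurable borel" for r
    by (simp add: C)
   show ?thesis unfolding g_def
    by (subst nn_integral_real_affine[of "\<lambda>t. f (Complex (exp t * (- s)) (exp t))" "-1" "- ln (1 + s\<^sup>2)"])
     (use m[of "- s"] in simp_all)
  qed
  then show "(\<integral>\<^sup>+t. f (- 1 / Complex (exp t * s) (exp t)) \<partial>lborel) = g (0 + (-1) * s)"
   by (simp only: eq) simp
 qed
 also have "\<dots> = (\<integral>\<^sup>+s. g s \<partial>lborel)"
  by (subst nn_integral_real_affine[of g "-1" 0]) simp_all
 also have "\<dots> = nn_integral hyp f" unfolding g_def by (subst nn_integral_hyp') auto
 finally show ?thesis .
qed

text \<open>For c \<noteq> 0 the map is a/c - r / (w + d/c) with r = (a d - b c) / c^2, a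
  composition of translations, a dilation and the inversion. The identity is used on the half-plane,
  which has full measure.\<close>

lemma nn_integral_hyp_mob:
 assumes [measurable]: "f \<in> borel_measurable borel" and D: "a * d - b * c > 0"
 shows "(\<integral>\<^sup>+w. f (mob a b c d w) \<partial>hyp) = nn_integral hyp f"
proof (cases "c = 0")
 case True
 with D have ad: "a / d > 0" "d \<noteq> 0" by (auto simp: zero_less_mult_iff divide_pos_pos divide_neg_neg)
 have eq: "mob a b c d w = of_real (a / d) * w + of_real (b / d)" for w
  using True ad by (simp add: mob_def add_divide_distrib)
 have "(\<integral>\<^sup>+w. f (mob a b c d w) \<partial>hyp) = (\<integral>\<^sup>+w. f (of_real (a / d) * w + of_real (b / d)) \<partial>hyp)"
  by (simp only: eq)
 also have "\<dots> = (\<integral>\<^sup>+w. f (w + of_real (b / d)) \<partial>hyp)"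
  using hyp_scale[of "\<lambda>w. f (w + of_real (b / d))" "a / d"] ad by simp
 also have "\<dots> = nn_integral hyp f" by (rule hyp_translate) simp
 finally show ?thesis .
next
 case False
 define r where "r = (a * d - b * c) / c\<^sup>2"
 have r: "r > 0" using D False by (simp add: r_def)
 have eq: "mob a b c d w = of_real r * (-1 / (w + of_real (d / c))) + of_real (a / c)" if "Im w > 0" for w
 proof -
  have n0: "of_real c * w + of_real d \<noteq> 0" using mob_denom_nonzero[OF that D] .
  have e: "of_real c * w + of_real d = of_real c * (w + of_real (d / c))" using False by (simp add: algebra_simps)
  with n0 have n1: "w + of_real (d / c) \<noteq> 0" by auto
  define u where "u = w + of_real (d / c)"
  have w: "w = u - of_real (d / c)" by (simp add: u_def)
  have "mob a b c d w = (of_real a * (u - of_real (d / c)) + of_real b) / (of_real c * u)"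
   unfolding mob_def e by (simp add: u_def)
  also have "\<dots> = of_real r * (-1 / u) + of_real (a / c)"
   using n1[folded u_def] False by (simp add: r_def field_simps power2_eq_square)
  finally show ?thesis by (simp add: u_def)
 qed
 have "(\<integral>\<^sup>+w. f (mob a b c d w) \<partial>hyp) = (\<integral>\<^sup>+w. f (of_real r * (-1 / (w + of_real (d / c))) + of_real (a / c)) \<partial>hyp)"
  by (rule nn_integral_cong_AE) (use AE_hyp_pos in eventually_elim, simp add: eq)
 also have "\<dots> = (\<integral>\<^sup>+w. f (of_real r * (-1 / w) + of_real (a / c)) \<partial>hyp)"
  by (rule hyp_translate[of "\<lambda>w. f (of_real r * (-1 / w) + of_real (a / c))"]) simp
 also have "\<dots> = (\<integral>\<^sup>+w. f (of_real r * w + of_real (a / c)) \<partial>hyp)"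
  by (rule hyp_inversion[of "\<lambda>w. f (of_real r * w + of_real (a / c))"]) simp
 also have "\<dots> = (\<integral>\<^sup>+w. f (w + of_real (a / c)) \<partial>hyp)"
  by (rule hyp_scale[of "\<lambda>w. f (w + of_real (a / c))"]) (use r in simp_all)
 also have "\<dots> = nn_integral hyp f" by (rule hyp_translate) simp
 finally show ?thesis .
qed

lemma distr_hyp_mob:
 assumes "a * d - b * c > 0"
 shows "distr hyp borel (mob a b c d) = hyp"
proof (rule measure_eqI)
 fix A assume "A \<in> sets (distr hyp borel (mob a b c d))"
 then have [measurable]: "A \<in> sets borel" by simp
 have "emeasure (distr hyp borel (mob a b c d)) A = (\<integral>\<^sup>+w. indicator A w \<partial>distr hyp borel (mob a b c d))"
  by simp
 also have "\<dots> = (\<integral>\<^sup>+w. indicator A (mob a b c d w) \<partial>hyp)"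
  by (subst nn_integral_distr) simp_all
 also have "\<dots> = emeasure hyp A"
  by (subst nn_integral_hyp_mob) (use assms in simp_all)
 finally show "emeasure (distr hyp borel (mob a b c d)) A = emeasure hyp A" .
qed simp

lemma integral_hyp_mob:
 fixes f :: "complex => 'a :: {banach, second_countable_topology}"
 assumes [measurable]: "f \<in> borel_measurable borel" and D: "a * d - b * c > 0"
 shows "(\<integral>w. f (mob a b c d w) \<partial>hyp) = integral\<^sup>L hyp f"
  and "integrable hyp (\<lambda>w. f (mob a b c d w)) \<longleftrightarrow> integrable hyp f"
proof -
 have "integral\<^sup>L (distr hyp borel (mob a b c d)) f = (\<integral>w. f (mob a b c d w) \<partial>hyp)"
  by (rule integral_distr) simp_all
 then show "(\<integral>w. f (mob a b c d w) \<partial>hyp) = integral\<^sup>L hyp f" by (simp add: distr_hyp_mob[OF D])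
 have "integrable (distr hyp borel (mob a b c d)) f = integrable hyp (\<lambda>w. f (mob a b c d w))"
  by (rule integrable_distr_eq) simp_all
 then show "integrable hyp (\<lambda>w. f (mob a b c d w)) \<longleftrightarrow> integrable hyp f" by (simp add: distr_hyp_mob[OF D])
qed

text \<open>The part of \<open>A i\<close> in the half-plane is the square |s|, |t| \<le> i in the
  coordinates of \<open>hypP\<close>. The closed lower half-plane has measure 0 and is added so that
  the sets cover the whole plane.\<close>

lemma sigma_finite_hyp: "sigma_finite_measure hyp"
proof
 define A :: "nat => complex set" where
  "A i = {w. Im w \<le> 0} \<union> {w. Im w > 0 \<and> \<bar>Re w\<bar> \<le> real i * Im w \<and> \<bar>ln (Im w)\<bar> \<le> real i}" for i
 have mA: "A i \<in> sets borel" for i unfolding A_def by measurable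
 have fin: "emeasure hyp (A i) \<noteq> \<infinity>" for i
 proof -
  have "emeasure hyp (A i) = emeasure lborel (hypP -` A i \<inter> space lborel)"
   unfolding hyp_def by (rule emeasure_distr) (use mA in simp_all)
  also have "hypP -` A i \<inter> space lborel = cbox (- real i, - real i) (real i, real i)"
  proof (rule Set.set_eqI)
   fix p :: "real \<times> real"
   obtain a b where p: "p = (a, b)" by (cases p)
   have "\<bar>exp b * a\<bar> \<le> real i * exp b \<longleftrightarrow> \<bar>a\<bar> \<le> real i"
    by (simp only: abs_mult abs_exp_cancel mult.commute[of "exp b"]) simp
   then have "p \<in> hypP -` A i \<inter> space lborel \<longleftrightarrow> \<bar>a\<bar> \<le> real i \<and> \<bar>b\<bar> \<le> real i"
    by (simp add: A_def hypP_def p del: abs_le_iff)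
   then show "p \<in> hypP -` A i \<inter> space lborel \<longleftrightarrow> p \<in> cbox (- real i, - real i) (real i, real i)"
    unfolding p cbox_Pair_eq by auto
  qed
  also have "emeasure lborel \<dots> < \<infinity>" by (rule emeasure_lborel_cbox_finite)
  finally show ?thesis by simp
 qed
 have un: "(\<Union>i. A i) = UNIV"
 proof (rule UNIV_eq_I[symmetric, OF ], goal_cases)
  case (1 w)
  show ?case
  proof (cases "Im w > 0")
   case True
   obtain i :: nat where "real i \<ge> max (\<bar>Re w\<bar> / Im w) \<bar>ln (Im w)\<bar>" using real_arch_simple by blast
   then have "w \<in> A i" using True by (auto simp: A_def field_simps)
   then show ?thesis by blast
  qed (auto simp: A_def)
 qed
 show "\<exists>A. countable A \<and> A \<subseteq> sets hyp \<and> \<Union> A = space hyp \<and> (\<forall>a\<in>A. emeasure hyp a \<noteq> \<infinity>)"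
  using mA fin un by (intro exI[of _ "range A"]) auto
qed

interpretation hyp: sigma_finite_measure hyp by (rule sigma_finite_hyp)

section \<open>Powers of the radial function and the normalising integral\<close>

lemma nn_integral_even_le:
 assumes [measurable]: "f \<in> borel_measurable borel" and ev: "!!x::real. f (- x) = f x"
 shows "(\<integral>\<^sup>+x. f x \<partial>lborel) \<le> 2 * (\<integral>\<^sup>+x. f x * indicator {0..} x \<partial>lborel)"
proof -
 have "(\<integral>\<^sup>+x. f x \<partial>lborel) \<le> (\<integral>\<^sup>+x. f x * indicator {0..} x + f x * indicator {..0} x \<partial>lborel)"
  by (rule nn_integral_mono) (auto split: split_indicator)
 also have "\<dots> = (\<integral>\<^sup>+x. f x * indicator {0..} x \<partial>lborel) + (\<integral>\<^sup>+x. f x * indicator {..0} x \<partial>lborel)"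
  by (rule nn_integral_add) auto
 also have "(\<integral>\<^sup>+x. f x * indicator {..0} x \<partial>lborel) = (\<integral>\<^sup>+x. f (0 + -1 * x) * indicator {..0} (0 + -1 * x) \<partial>lborel)"
  by (subst nn_integral_real_affine[of _ "-1" 0]) auto
 also have "\<dots> = (\<integral>\<^sup>+x. f x * indicator {0..} x \<partial>lborel)"
  by (rule nn_integral_cong) (auto simp: ev split: split_indicator)
 finally show ?thesis by (simp add: mult_2)
qed

lemma nn_integral_inverse_quadratic:
 assumes c: "c > 0"
 shows "(\<integral>\<^sup>+s. ennreal (1 / (1 + c * (s - x)\<^sup>2)) \<partial>lborel) \<le> ennreal (pi / sqrt c)"
proof -
 have pos: "1 + c * s\<^sup>2 > 0" for s using c by (simp add: add_pos_nonneg)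
 have "(\<integral>\<^sup>+s. ennreal (1 / (1 + c * (s - x)\<^sup>2)) \<partial>lborel) = (\<integral>\<^sup>+s. ennreal (1 / (1 + c * s\<^sup>2)) \<partial>lborel)"
  by (subst nn_integral_real_affine[of _ 1 x]) auto
 also have "\<dots> \<le> 2 * (\<integral>\<^sup>+s. ennreal (1 / (1 + c * s\<^sup>2)) * indicator {0..} s \<partial>lborel)"
  by (rule nn_integral_even_le) auto
 also have "(\<integral>\<^sup>+s. ennreal (1 / (1 + c * s\<^sup>2)) * indicator {0..} s \<partial>lborel) = ennreal (pi / 2 / sqrt c - arctan (sqrt c * 0) / sqrt c)"
 proof (rule nn_integral_FTC_atLeast)
  show "((\<lambda>s. arctan (sqrt c * s) / sqrt c) has_real_derivative 1 / (1 + c * s\<^sup>2)) (at s)" for s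
  proof -
   define q where "q = sqrt c"
   have q: "q > 0" "c = q\<^sup>2" using c by (auto simp: q_def)
   have "((\<lambda>s. arctan (q * s) / q) has_real_derivative (inverse (1 + (q * s)\<^sup>2) * q) / q) (at s)"
    using q by (auto intro!: derivative_eq_intros)
   moreover have "(inverse (1 + (q * s)\<^sup>2) * q) / q = 1 / (1 + c * s\<^sup>2)"
    using q by (simp add: power_mult_distrib inverse_eq_divide)
   ultimately show ?thesis by (simp add: q_def)
  qed
  have "((\<lambda>s. arctan (sqrt c * s)) \<longlongrightarrow> pi / 2) at_top"
   by (rule filterlim_compose[OF tendsto_arctan_at_top])
    (rule filterlim_tendsto_pos_mult_at_top[OF tendsto_const _ filterlim_ident], use c in simp)
  then show "((\<lambda>s. arctan (sqrt c * s) / sqrt c) \<longlongrightarrow> pi / 2 / sqrt c) at_top"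
   by (intro tendsto_divide tendsto_const) (use c in auto)
 qed (use pos in \<open>auto simp: less_imp_le\<close>)
 also have "2 * ennreal (pi / 2 / sqrt c - arctan (sqrt c * 0) / sqrt c) = ennreal (pi / sqrt c)"
  using c by (subst ennreal_numeral[symmetric], subst ennreal_mult[symmetric]) auto
 finally show ?thesis .
qed

lemma nn_integral_exp_abs: "(\<integral>\<^sup>+t. ennreal (exp (- \<bar>t::real\<bar>)) \<partial>lborel) \<le> ennreal 2"
proof -
 have "(\<integral>\<^sup>+t. ennreal (exp (- \<bar>t\<bar>)) \<partial>lborel) \<le> 2 * (\<integral>\<^sup>+t. ennreal (exp (- \<bar>t\<bar>)) * indicator {0..} t \<partial>lborel)"
  by (rule nn_integral_even_le) auto
 also have "(\<integral>\<^sup>+t. ennreal (exp (- \<bar>t\<bar>)) * indicator {0..} t \<partial>lborel) = (\<integral>\<^sup>+t. ennreal (exp (- t)) * indicator {0..} t \<partial>lborel)"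
  by (rule nn_integral_cong) (auto split: split_indicator)
 also have "\<dots> = ennreal (0 - (- exp (- 0)))"
 proof (rule nn_integral_FTC_atLeast)
  have "((\<lambda>x::real. exp (- x)) \<longlongrightarrow> 0) at_top"
   by (rule filterlim_compose[OF exp_at_bot filterlim_uminus_at_bot_at_top])
  then show "((\<lambda>x::real. - exp (- x)) \<longlongrightarrow> 0) at_top" using tendsto_minus by fastforce
 qed (auto intro!: derivative_eq_intros)
 finally show ?thesis by simp
qed

text \<open>In the disc coordinate \<open>cay\<close> below this is 1 - |cay w|^2, that is cosh^-2
  of half the hyperbolic distance from \<i> to w; hence it is invariant under rotations about
  \<i>.\<close>

definition hrho :: "complex => real" where
 "hrho w = 4 * Im w / (cmod (w + \<i>))\<^sup>2"

definition hypJ :: "nat => real" where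
 "hypJ n = (\<integral>w. hrho w ^ n \<partial>hyp)"

lemma measurable_hrho [measurable]: "hrho \<in> borel_measurable borel"
 unfolding hrho_def by measurable

lemma hrho_denom: "(cmod (w + \<i>))\<^sup>2 = (cmod (w - \<i>))\<^sup>2 + 4 * Im w"
 unfolding cmod_power2 by (simp add: power2_eq_square algebra_simps)

lemma hrho_bounds:
 assumes "Im w > 0"
 shows "hrho w > 0" "hrho w \<le> 1" "w \<noteq> \<i> ==> hrho w < 1"
 using assms unfolding hrho_def hrho_denom
 by (auto simp: divide_le_eq divide_less_eq add_nonneg_pos)

lemma hrho_hypP: "hrho (Complex (exp t * s) (exp t)) = 1 / ((exp t + 1)\<^sup>2 / (4 * exp t) + exp t / 4 * s\<^sup>2)"
proof -
 have "(cmod (Complex (exp t * s) (exp t) + \<i>))\<^sup>2 = exp t * exp t * s\<^sup>2 + (exp t + 1)\<^sup>2"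
  unfolding cmod_power2 by (simp add: power2_eq_square algebra_simps)
 moreover have "exp t * exp t * s\<^sup>2 + (exp t + 1)\<^sup>2 > 0"
 proof -
  have "exp t + 1 > 0" by (simp add: add_pos_pos)
  then show ?thesis by (intro add_nonneg_pos) auto
 qed
 ultimately show ?thesis unfolding hrho_def
  by (simp add: field_simps) 
qed

text \<open>1/hrho has the form A + B s^2 with A and B depending on t. By (A + B s^2)^2 \<ge> A (A +
  B s^2) the inner integral is bounded by an arctangent integral, with value 16 pi x / (x + 1)^3 for
  x = exp t, and this is at most 16 pi exp (-|t|).\<close>

lemma nn_integral_hrho2: "(\<integral>\<^sup>+w. ennreal (hrho w ^ 2) \<partial>hyp) < \<infinity>"
proof -
 have "(\<integral>\<^sup>+w. ennreal (hrho w ^ 2) \<partial>hyp) =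
  (\<integral>\<^sup>+t. \<integral>\<^sup>+s. ennreal (hrho (Complex (exp t * s) (exp t)) ^ 2) \<partial>lborel \<partial>lborel)"
  by (rule nn_integral_hyp) measurable
 also have "\<dots> \<le> (\<integral>\<^sup>+t. ennreal (16 * pi) * ennreal (exp (- \<bar>t\<bar>)) \<partial>lborel)"
 proof (rule nn_integral_mono)
  fix t :: real
  define x where "x = exp t"
  have x: "x > 0" by (simp add: x_def)
  define A where "A = (x + 1)\<^sup>2 / (4 * x)"
  define B where "B = x / 4"
  have A: "A > 0" and B: "B > 0" using x by (auto simp: A_def B_def add_pos_pos)
  have AB: "B / A = (x / (x + 1))\<^sup>2"
   using x by (simp add: A_def B_def power_divide field_simps power2_eq_square)
  have "(\<integral>\<^sup>+s. ennreal (hrho (Complex (exp t * s) (exp t)) ^ 2) \<partial>lborel)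
   \<le> (\<integral>\<^sup>+s. ennreal (1 / A\<^sup>2) * ennreal (1 / (1 + B / A * (s - 0)\<^sup>2)) \<partial>lborel)"
  proof (rule nn_integral_mono)
   fix s :: real
   have "hrho (Complex (exp t * s) (exp t)) ^ 2 = 1 / (A + B * s\<^sup>2)\<^sup>2"
    by (simp add: hrho_hypP A_def B_def x_def power_divide)
   also have "\<dots> \<le> 1 / (A\<^sup>2 * (1 + B / A * s\<^sup>2))"
   proof (rule divide_left_mono)
    have "A\<^sup>2 * (1 + B / A * s\<^sup>2) = A * (A + B * s\<^sup>2)" using A by (simp add: field_simps power2_eq_square)
    also have "\<dots> \<le> (A + B * s\<^sup>2) * (A + B * s\<^sup>2)" using A B by (intro mult_right_mono) auto
    finally show "A\<^sup>2 * (1 + B / A * s\<^sup>2) \<le> (A + B * s\<^sup>2)\<^sup>2" by (simp add: power2_eq_square)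
    show "0 < (A + B * s\<^sup>2)\<^sup>2 * (A\<^sup>2 * (1 + B / A * s\<^sup>2))"
     using A B by (intro mult_pos_pos zero_less_power add_pos_nonneg) auto
   qed simp
   finally show "ennreal (hrho (Complex (exp t * s) (exp t)) ^ 2) \<le> ennreal (1 / A\<^sup>2) * ennreal (1 / (1 + B / A * (s - 0)\<^sup>2))"
    using A B by (subst ennreal_mult[symmetric]) (auto intro!: ennreal_leI)
  qed
  also have "\<dots> = ennreal (1 / A\<^sup>2) * (\<integral>\<^sup>+s. ennreal (1 / (1 + B / A * (s - 0)\<^sup>2)) \<partial>lborel)"
   by (rule nn_integral_cmult) measurable
  also have "\<dots> \<le> ennreal (1 / A\<^sup>2) * ennreal (pi / sqrt (B / A))"
   by (intro mult_left_mono nn_integral_inverse_quadratic) (use A B in auto)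
  also have "\<dots> = ennreal (16 * pi * (x / (x + 1) ^ 3))"
  proof -
   have "sqrt (B / A) = x / (x + 1)" unfolding AB using x by simp
   then have "1 / A\<^sup>2 * (pi / sqrt (B / A)) = 16 * pi * (x / (x + 1) ^ 3)"
   proof -
    define y where "y = x + 1"
    have "y > 0" "A = y\<^sup>2 / (4 * x)" "sqrt (B / A) = x / y"
     using x \<open>sqrt (B / A) = _\<close> by (auto simp: y_def A_def)
    note y = this
    have "1 / (y\<^sup>2 / (4 * x))\<^sup>2 * (pi / (x / y)) = 16 * pi * (x / y ^ 3)"
     using x y(1) by (simp add: field_simps power2_eq_square power3_eq_cube)
    then show ?thesis unfolding y_def[symmetric] y(3) unfolding y(2) .
   qed
   then show ?thesis by (subst ennreal_mult[symmetric]) (use A B in auto)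
  qed
  also have "\<dots> \<le> ennreal (16 * pi * exp (- \<bar>t\<bar>))"
  proof (intro ennreal_leI mult_left_mono)
   show "x / (x + 1) ^ 3 \<le> exp (- \<bar>t\<bar>)"
   proof (cases "t \<ge> 0")
    case True
    have "x / (x + 1) ^ 3 \<le> x / x ^ 2"
    proof (rule divide_left_mono)
     have "x ^ 2 \<le> (x + 1) ^ 2" using x by (intro power_mono) auto
     also have "\<dots> \<le> (x + 1) ^ 3" using x by (intro power_increasing) auto
     finally show "x ^ 2 \<le> (x + 1) ^ 3" .
    qed (use x in auto)
    also have "\<dots> = exp (- \<bar>t\<bar>)" using True x by (simp add: power2_eq_square x_def exp_minus inverse_eq_divide)
    finally show ?thesis .
   next
    case False
    have "x / (x + 1) ^ 3 \<le> x / 1" using x by (intro divide_left_mono one_le_power) auto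
    then show ?thesis using False by (simp add: x_def)
   qed
  qed simp
  finally show "(\<integral>\<^sup>+s. ennreal (hrho (Complex (exp t * s) (exp t)) ^ 2) \<partial>lborel) \<le> ennreal (16 * pi) * ennreal (exp (- \<bar>t\<bar>))"
   by (simp add: ennreal_mult)
 qed
 also have "\<dots> = ennreal (16 * pi) * (\<integral>\<^sup>+t. ennreal (exp (- \<bar>t\<bar>)) \<partial>lborel)"
  by (rule nn_integral_cmult) measurable
 also have "\<dots> \<le> ennreal (16 * pi) * ennreal 2" by (intro mult_left_mono nn_integral_exp_abs) auto
 also have "\<dots> < \<infinity>" by (simp add: ennreal_mult_less_top)
 finally show ?thesis .
qed

lemma integrable_hrho_power:
 assumes "n \<ge> 2"
 shows "integrable hyp (\<lambda>w. hrho w ^ n)"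
proof (rule Bochner_Integration.integrable_bound)
 show "integrable hyp (\<lambda>w. hrho w ^ 2)"
  by (rule integrableI_nonneg) (use nn_integral_hrho2 in auto)
 show "AE w in hyp. norm (hrho w ^ n) \<le> norm (hrho w ^ 2)"
  using AE_hyp_pos
 proof eventually_elim
  case (elim w)
  show ?case using hrho_bounds[OF elim] assms by (simp add: power_decreasing)
 qed
qed measurable

text \<open>\<open>hrho\<close> is below 1 except at \<i>, so dominated convergence applies with
  \<open>hrho ^ 2\<close> as majorant. This is what makes the trace weight \<open>tw\<close> tend to
  infinity.\<close>

lemma hypJ_tendsto_0: "hypJ \<longlonglongrightarrow> 0"
proof -
 have ne: "AE w in hyp. w \<noteq> \<i>"
 proof -
  have "emeasure hyp {\<i>} = emeasure lborel (hypP -` {\<i>} \<inter> space lborel)"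
   unfolding hyp_def by (rule emeasure_distr) simp_all
  also have "hypP -` {\<i>} \<inter> space lborel = {(0, 0)}" by (auto simp: hypP_def complex_eq_iff)
  also have "emeasure lborel {(0::real, 0::real)} = 0" by simp
  finally have "{\<i>} \<in> null_sets hyp" by (auto simp: null_sets_def)
  from AE_not_in[OF this] show ?thesis by simp
 qed
 have "(\<lambda>n. \<integral>w. hrho w ^ (n + 2) \<partial>hyp) \<longlonglongrightarrow> (\<integral>w. 0 \<partial>hyp)"
 proof (rule integral_dominated_convergence[where w = "\<lambda>w. hrho w ^ 2"])
  show "AE w in hyp. (\<lambda>n. hrho w ^ (n + 2)) \<longlonglongrightarrow> 0"
   using AE_hyp_pos ne
  proof eventually_elim
   case (elim w)
   have "(\<lambda>n. hrho w ^ n) \<longlonglongrightarrow> 0"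
    by (rule LIMSEQ_power_zero) (use hrho_bounds[OF elim(1)] elim(2) in auto)
   then show ?case by (rule LIMSEQ_ignore_initial_segment)
  qed
  show "AE w in hyp. norm (hrho w ^ (n + 2)) \<le> hrho w ^ 2" for n
   using AE_hyp_pos
  proof eventually_elim
   case (elim w)
   show ?case using hrho_bounds[OF elim] power_decreasing[of 2 "n + 2" "hrho w"] by simp
  qed
 qed (use integrable_hrho_power[of 2] in auto)
 then have "(\<lambda>n. hypJ (n + 2)) \<longlonglongrightarrow> 0" by (simp add: hypJ_def)
 then show ?thesis by (rule LIMSEQ_offset)
qed

text \<open>The square |s|, |t| \<le> 1 / sqrt n has area 4/n, and on it 1/hrho \<le> 1 + 8/n, so
  the n-th power loses at most a factor exp 8. The bound keeps \<open>tw n\<close> of order at most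
  n.\<close>

lemma hypJ_lower_bound:
 assumes n: "n \<ge> 2"
 shows "hypJ n \<ge> 4 * exp (- 8) / real n"
proof -
 define e where "e = 1 / sqrt (real n)"
 have e: "e > 0" "e \<le> 1" "e\<^sup>2 = 1 / real n" using n by (auto simp: e_def power_divide)
 have "ennreal (4 * exp (- 8) / real n) = ennreal (exp (- 8)) * emeasure lborel (cbox (- e, - e) (e, e))"
 proof -
  have "emeasure lborel (cbox (- e, - e) (e, e)) = emeasure (lborel \<Otimes>\<^sub>M lborel) (cbox (- e) e \<times> cbox (- e) e)"
   by (simp only: lborel_prod cbox_Pair_eq)
  also have "\<dots> = ennreal (2 * e) * ennreal (2 * e)"
   using e by (subst lborel.emeasure_pair_measure_Times) auto
  also have "\<dots> = ennreal (4 * e\<^sup>2)" using e by (subst ennreal_mult[symmetric]) (auto simp: power2_eq_square)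
  finally show ?thesis using e(3) by (simp add: ennreal_mult[symmetric])
 qed
 also have "\<dots> = (\<integral>\<^sup>+p. ennreal (exp (- 8)) * indicator (cbox (- e, - e) (e, e)) p \<partial>lborel)"
  by (rule nn_integral_cmult_indicator[symmetric]) simp
 also have "\<dots> \<le> (\<integral>\<^sup>+p. ennreal (hrho (hypP p) ^ n) \<partial>lborel)"
 proof (rule nn_integral_mono)
  fix p :: "real \<times> real"
  obtain s t where p: "p = (s, t)" by (cases p)
  show "ennreal (exp (- 8)) * indicator (cbox (- e, - e) (e, e)) p \<le> ennreal (hrho (hypP p) ^ n)"
  proof (cases "p \<in> cbox (- e, - e) (e, e)")
   case True
   then have st: "\<bar>s\<bar> \<le> e" "\<bar>t\<bar> \<le> e" unfolding p cbox_Pair_eq by auto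
   have st2: "s\<^sup>2 \<le> 1 / real n" "t\<^sup>2 \<le> 1 / real n"
    using st e power_mono[OF st(1), of 2] power_mono[OF st(2), of 2] by auto
   have t1: "\<bar>t\<bar> \<le> 1" using st e by simp
   define x where "x = exp t"
   have x: "x > 0" "x \<le> 3" "x \<ge> 1 / 3"
   proof -
    have "exp t \<le> exp 1" using t1 by simp
    also have "\<dots> \<le> 3" by (rule exp_le)
    finally show "x \<le> 3" by (simp add: x_def)
    have "exp (- t) \<le> exp 1" using t1 by simp
    also have "\<dots> \<le> 3" by (rule exp_le)
    finally have "inverse x \<le> 3" by (simp add: x_def exp_minus)
    then show "x \<ge> 1 / 3" using inverse_le_iff_le[of x "inverse 3"] 
     by (simp add: x_def field_simps)
   qed (simp add: x_def)
   have xt: "\<bar>x - 1\<bar> \<le> 3 * \<bar>t\<bar>"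
   proof -
    have "\<bar>exp t - 1\<bar> \<le> \<bar>t\<bar> * exp \<bar>t\<bar>" 
    proof (cases "t \<ge> 0")
     case True
     have "1 - t \<le> exp (- t)" using exp_ge_add_one_self[of "- t"] by simp
     then have "(1 - t) * exp t \<le> 1" by (simp add: exp_minus field_simps)
     then show ?thesis using True by (simp add: algebra_simps)
    next
     case False
     have "1 + t \<le> exp t" by (rule exp_ge_add_one_self)
     moreover have "- t * 1 \<le> - t * exp (- t)" using False by (intro mult_left_mono) auto
     moreover have "\<bar>exp t - 1\<bar> = 1 - exp t" "\<bar>t\<bar> * exp \<bar>t\<bar> = - t * exp (- t)" using False by auto
     ultimately show ?thesis by linarith
    qed
    also have "\<dots> \<le> \<bar>t\<bar> * 3" using t1 exp_le order_trans[of "exp \<bar>t\<bar>" "exp 1" 3] by (intro mult_left_mono) auto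
    finally show ?thesis by (simp add: x_def)
   qed
   define Q where "Q = (x + 1)\<^sup>2 / (4 * x) + x / 4 * s\<^sup>2"
   have "(x + 1)\<^sup>2 / (4 * x) = 1 + (x - 1)\<^sup>2 / (4 * x)" using x by (simp add: field_simps power2_eq_square)
   moreover have "(x - 1)\<^sup>2 / (4 * x) \<le> 27 / 4 * (1 / real n)"
   proof -
    have "(x - 1)\<^sup>2 \<le> 9 * t\<^sup>2" using power_mono[OF xt, of 2] by (simp add: power_mult_distrib)
    also have "\<dots> \<le> 9 * (1 / real n)" using st2 by simp
    finally have "(x - 1)\<^sup>2 \<le> 9 * (1 / real n)" .
    then have "(x - 1)\<^sup>2 / (4 * x) \<le> 9 * (1 / real n) / (4 * (1 / 3))"
     using x by (intro frac_le) auto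
    then show ?thesis by simp
   qed
   moreover have "x / 4 * s\<^sup>2 \<le> 3 / 4 * (1 / real n)" using x st2 by (intro mult_mono) auto
   moreover have "0 \<le> 1 / real n" by simp
   ultimately have "Q \<le> 1 + 27 / 4 * (1 / real n) + 3 / 4 * (1 / real n)" "0 \<le> 1 / real n"
    unfolding Q_def by simp_all
   \<comment> \<open>27/4 + 3/4 = 15/2 is rounded up to 8.\<close>
   then have "Q \<le> 1 + 8 * (1 / real n)" by argo
   then have Q: "Q \<le> 1 + 8 / real n" by simp
   have Q0: "Q > 0" using x unfolding Q_def by (intro add_pos_nonneg) auto
   have "Q ^ n \<le> (1 + 8 / real n) ^ n" using Q Q0 by (intro power_mono) auto
   also have "\<dots> \<le> exp (8 / real n) ^ n" by (intro power_mono exp_ge_add_one_self) auto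
   also have "\<dots> = exp 8" using n by (simp add: exp_of_nat_mult[symmetric])
   finally have "1 / exp 8 \<le> 1 / Q ^ n" using Q0 by (intro divide_left_mono) auto
   also have "1 / Q ^ n = hrho (hypP p) ^ n"
    by (simp add: p hypP_def hrho_hypP Q_def x_def power_one_over)
   finally show ?thesis using True by (simp add: exp_minus inverse_eq_divide ennreal_leI)
  qed simp
 qed
 also have "\<dots> = (\<integral>\<^sup>+w. ennreal (hrho w ^ n) \<partial>hyp)"
  unfolding hyp_def by (subst nn_integral_distr) auto
 also have "\<dots> = ennreal (hypJ n)" unfolding hypJ_def
 proof (rule nn_integral_eq_integral[OF integrable_hrho_power[OF n]])
  show "AE w in hyp. 0 \<le> hrho w ^ n"
   using AE_hyp_pos by eventually_elim (use hrho_bounds in \<open>auto simp: less_imp_le\<close>)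
 qed
 finally have "ennreal (4 * exp (- 8) / real n) \<le> ennreal (hypJ n)" .
 moreover have "4 * exp (- 8) / real n > 0" using n by simp
 ultimately show ?thesis unfolding ennreal_le_iff2 by linarith
qed

section \<open>Rotations about \<i>, the mean value property and reproduction of values\<close>

lemma mean_value_unit_circle:
 assumes h: "h holomorphic_on ball 0 R" and R: "R > 1"
 shows "((\<lambda>t. h (exp (2 * of_real pi * \<i> * of_real t))) has_integral h 0) {0..1}"
proof -
 have "cball 0 1 \<subseteq> ball (0::complex) R" using R by auto
 then have "h holomorphic_on cball 0 1" using h holomorphic_on_subset by blast
 then have "((\<lambda>u. h u / (u - 0)) has_contour_integral (2 * of_real pi * \<i> * h 0)) (circlepath 0 1)"
  by (rule Cauchy_integral_circlepath_simple) simp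
 then have "((\<lambda>x. h (circlepath 0 1 x) / (circlepath 0 1 x) * vector_derivative (circlepath 0 1) (at x within {0..1}))
   has_integral (2 * of_real pi * \<i> * h 0)) {0..1}"
  by (simp add: has_contour_integral_def)
 then have "((\<lambda>x. 2 * of_real pi * \<i> * h (exp (2 * of_real pi * \<i> * of_real x)))
   has_integral (2 * of_real pi * \<i> * h 0)) {0..1}"
  by (rule has_integral_eq[rotated]) (simp add: vector_derivative_circlepath01, simp add: circlepath)
 then have "((\<lambda>x. 1 / (2 * of_real pi * \<i>) * (2 * of_real pi * \<i> * h (exp (2 * of_real pi * \<i> * of_real x))))
   has_integral (1 / (2 * of_real pi * \<i>) * (2 * of_real pi * \<i> * h 0))) {0..1}"
  by (rule has_integral_mult_right)
 then show ?thesis by simp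
qed

text \<open>In the coordinate \<open>cay\<close> this is multiplication by exp (2 pi \<i> t), while
  the matrix turns by half that angle. So t in the unit interval runs once around each circle about
  \<i>.\<close>

definition hrot :: "real => complex => complex" where
 "hrot t = mob (cos (pi * t)) (sin (pi * t)) (- sin (pi * t)) (cos (pi * t))"

definition cay :: "complex => complex" where "cay w = (w - \<i>) / (w + \<i>)"
definition icay :: "complex => complex" where "icay z = \<i> * (1 + z) / (1 - z)"

lemma Im_plus_i_nonzero: "Im w > 0 ==> w + \<i> \<noteq> 0"
 by (auto simp: complex_eq_iff)

lemma measurable_cnj [measurable]: "cnj \<in> borel_measurable borel"
 by (intro borel_measurable_continuous_onI continuous_intros)

lemma hrho_cay:
 assumes "Im w > 0"
 shows "hrho w = 1 - (cmod (cay w))\<^sup>2"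
proof -
 have "(cmod (w + \<i>))\<^sup>2 > 0" using Im_plus_i_nonzero[OF assms] by simp
 then have "1 - (cmod (w - \<i>))\<^sup>2 / (cmod (w + \<i>))\<^sup>2 = ((cmod (w + \<i>))\<^sup>2 - (cmod (w - \<i>))\<^sup>2) / (cmod (w + \<i>))\<^sup>2"
  by (simp add: diff_divide_distrib)
 also have "(cmod (w + \<i>))\<^sup>2 - (cmod (w - \<i>))\<^sup>2 = 4 * Im w" by (simp add: hrho_denom)
 finally show ?thesis by (simp add: hrho_def cay_def norm_divide power_divide)
qed

lemma icay_cay:
 assumes "Im w > 0"
 shows "icay (cay w) = w"
proof -
 have ne: "w + \<i> \<noteq> 0" using Im_plus_i_nonzero[OF assms] .
 have "1 + cay w = 2 * w / (w + \<i>)" "1 - cay w = 2 * \<i> / (w + \<i>)"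
  using ne by (simp_all add: cay_def divide_simps)
 then show ?thesis using ne by (simp add: icay_def)
qed

lemma Im_icay: "cmod z < 1 ==> Im (icay z) > 0"
proof -
 assume z: "cmod z < 1"
 then have ne: "1 - z \<noteq> 0" by auto
 have "Im (icay z) = (1 - (cmod z)\<^sup>2) / (cmod (1 - z))\<^sup>2"
  unfolding icay_def cmod_power2 by (simp add: Im_divide power2_eq_square algebra_simps)
 moreover have "(cmod z)\<^sup>2 < 1" using z by (simp add: abs_square_less_1)
 ultimately show ?thesis using ne by simp
qed

lemma norm_cay: "Im w > 0 ==> cmod (cay w) < 1"
 using hrho_cay[of w] hrho_bounds(1)[of w] by (simp add: abs_square_less_1)

lemma Im_hrot: "Im w > 0 ==> Im (hrot t w) > 0"
 unfolding hrot_def by (rule Im_mob_pos) (simp_all flip: power2_eq_square)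

lemma cay_hrot:
 assumes w: "Im w > 0"
 shows "cay (hrot t w) = exp (2 * of_real pi * \<i> * of_real t) * cay w"
proof -
 define c where "c = complex_of_real (cos (pi * t))"
 define s where "s = complex_of_real (sin (pi * t))"
 have e: "exp (of_real pi * \<i> * of_real t) = c + \<i> * s"
  using exp_Euler[of "of_real (pi * t)", unfolded cos_of_real sin_of_real] by (simp add: c_def s_def mult_ac)
 have e': "exp (- (of_real pi * \<i> * of_real t)) = c - \<i> * s"
  using exp_Euler[of "- of_real (pi * t)", unfolded cos_minus sin_minus cos_of_real sin_of_real]
  by (simp add: c_def s_def mult_ac)
 have d: "- s * w + c \<noteq> 0"
  using mob_denom_nonzero[of w "cos (pi * t)" "cos (pi * t)" "sin (pi * t)" "- sin (pi * t)"] w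
  by (simp add: c_def s_def flip: power2_eq_square)
 have r: "hrot t w = (c * w + s) / (- s * w + c)" by (simp add: hrot_def mob_def c_def s_def)
 have "cay (hrot t w) = ((c * w + s) - \<i> * (- s * w + c)) / ((c * w + s) + \<i> * (- s * w + c))"
  unfolding cay_def r using d by (simp add: divide_simps)
 also have "\<dots> = ((c + \<i> * s) * (w - \<i>)) / ((c - \<i> * s) * (w + \<i>))"
  by (simp add: algebra_simps)
 also have "\<dots> = (c + \<i> * s) / (c - \<i> * s) * cay w" by (simp add: cay_def)
 also have "(c + \<i> * s) / (c - \<i> * s) = exp (of_real pi * \<i> * of_real t - (- (of_real pi * \<i> * of_real t)))"
  unfolding exp_diff e e' ..
 also have "\<dots> = exp (2 * of_real pi * \<i> * of_real t)" by (simp add: algebra_simps)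
 finally show ?thesis .
qed

lemma hrho_hrot: "Im w > 0 ==> hrho (hrot t w) = hrho w"
 by (simp add: hrho_cay Im_hrot cay_hrot norm_mult)

lemma hrot_mean_value:
 assumes g: "g holomorphic_on upper_half_plane" and w: "Im w > 0"
 shows "((\<lambda>t. g (hrot t w)) has_integral g \<i>) {0..1}"
\<comment> \<open>The point \<i> is fixed by every rotation; for all other points the disc of radius
  1 / |cay w| > 1 contains the closed unit disc.\<close>
proof (cases "cay w = 0")
 case True
 then have wi: "w = \<i>" using Im_plus_i_nonzero[OF w] by (auto simp: cay_def)
 have "hrot t w = \<i>" for t
  using icay_cay[OF Im_hrot[OF w, of t]] cay_hrot[OF w, of t] True by (simp add: icay_def)
 then show ?thesis using has_integral_const_real[of "g \<i>" 0 1] by simp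
next
 case False
 define h where "h u = g (icay (u * cay w))" for u
 have n: "cmod (cay w) < 1" by (rule norm_cay[OF w])
 have "h holomorphic_on ball 0 (1 / cmod (cay w))"
 proof -
  have b: "cmod (u * cay w) < 1" if "u \<in> ball 0 (1 / cmod (cay w))" for u
   using that False by (simp add: norm_mult field_simps)
  have "(\<lambda>u. icay (u * cay w)) holomorphic_on ball 0 (1 / cmod (cay w))"
   unfolding icay_def using b by (intro holomorphic_intros) force
  then have "(g \<circ> (\<lambda>u. icay (u * cay w))) holomorphic_on ball 0 (1 / cmod (cay w))"
   by (rule holomorphic_on_compose_gen[OF _ g]) (use b Im_icay in \<open>auto simp: upper_half_plane_def\<close>)
  then show ?thesis by (simp add: h_def[abs_def] o_def)
 qed
 then have "((\<lambda>t. h (exp (2 * of_real pi * \<i> * of_real t))) has_integral h 0) {0..1}"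
  by (rule mean_value_unit_circle) (use n False in \<open>simp add: field_simps\<close>)
 moreover have "h 0 = g \<i>" by (simp add: h_def icay_def)
 moreover have "h (exp (2 * of_real pi * \<i> * of_real t)) = g (hrot t w)" for t
  unfolding h_def cay_hrot[OF w, symmetric] by (simp add: icay_cay Im_hrot w)
 ultimately show ?thesis by simp
qed

text \<open>\<open>F\<close> is a holomorphic factor \<open>g\<close> times a power of
  \<open>hrho\<close>, which is constant on circles about \<i>. Averaging over rotations replaces
  \<open>g w\<close> by \<open>g \<i>\<close>, which is f(\<i>) (2 \<i>)^(2n), and the radial factor
  integrates to \<open>hypJ (2 * n)\<close> up to a power of 16. The growth bound gives |F| \<le> M
  hrho^n, hence integrability from n = 2 on.\<close>

lemma reproducing_at_i:
 assumes n: "n \<ge> 2" and f: "f holomorphic_on upper_half_plane"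
  and [measurable]: "f \<in> borel_measurable borel"
  and bd: "!!w. Im w > 0 ==> cmod (f w) * Im w ^ n \<le> M"
 defines "F \<equiv> \<lambda>w. f w * of_real (Im w ^ (2 * n)) / (\<i> - cnj w) ^ (2 * n)"
 shows "integrable hyp F"
  and "integral\<^sup>L hyp F = of_real ((-1) ^ n / 4 ^ n * hypJ (2 * n)) * f \<i>"
proof -
 have mF [measurable]: "F \<in> borel_measurable borel" unfolding F_def by measurable
 define g where "g w = f w * (w + \<i>) ^ (2 * n)" for w
 have g: "g holomorphic_on upper_half_plane" unfolding g_def by (intro holomorphic_intros f)
 have FG: "F w = g w * of_real ((hrho w / 4) ^ (2 * n))" if w: "Im w > 0" for w
 proof -
  have e: "\<i> - cnj w = - cnj (w + \<i>)" by (simp add: complex_eq_iff)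
  have ne: "cnj (w + \<i>) \<noteq> 0" using Im_plus_i_nonzero[OF w] by (metis complex_cnj_zero_iff)
  have "F w = f w * of_real (Im w ^ (2 * n)) / cnj (w + \<i>) ^ (2 * n)"
  proof -
   have "(- x) ^ (2 * n) = x ^ (2 * n)" for x :: complex by (simp add: power_mult)
   then show ?thesis unfolding F_def e by (simp only:)
  qed
  also have "\<dots> = f w * (w + \<i>) ^ (2 * n) * of_real (Im w ^ (2 * n)) / ((w + \<i>) * cnj (w + \<i>)) ^ (2 * n)"
   using Im_plus_i_nonzero[OF w] by (simp add: power_mult_distrib)
  also have "(w + \<i>) * cnj (w + \<i>) = of_real ((cmod (w + \<i>))\<^sup>2)"
   by (rule complex_norm_square[symmetric])
  finally show ?thesis by (simp add: g_def hrho_def power_divide)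
 qed
 have normF: "cmod (F w) \<le> M * (hrho w) ^ n" if w: "Im w > 0" for w
 proof -
  have ne: "cmod (w + \<i>) > 0" using Im_plus_i_nonzero[OF w] by simp
  have "cmod (F w) = cmod (f w) * Im w ^ n * (Im w / (cmod (w + \<i>))\<^sup>2) ^ n"
  proof -
   have "cmod (F w) = cmod (f w) * cmod (w + \<i>) ^ (2 * n) * (Im w / (cmod (w + \<i>))\<^sup>2) ^ (2 * n)"
   proof -
    have r: "hrho w / 4 = Im w / (cmod (w + \<i>))\<^sup>2" by (simp add: hrho_def)
    have "cmod (F w) = cmod (g w) * \<bar>(hrho w / 4) ^ (2 * n)\<bar>"
     unfolding FG[OF w] norm_mult norm_of_real ..
    then show ?thesis unfolding r using w by (simp add: g_def norm_mult norm_power)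
   qed
   also have "\<dots> = cmod (f w) * ((cmod (w + \<i>))\<^sup>2 * (Im w / (cmod (w + \<i>))\<^sup>2) * (Im w / (cmod (w + \<i>))\<^sup>2)) ^ n"
   proof -
    have "x ^ (2 * n) * r ^ (2 * n) = (x\<^sup>2 * r * r) ^ n" for x r :: real
     by (simp add: power_mult power_mult_distrib power2_eq_square)
    then show ?thesis by (simp only: mult.assoc)
   qed
   also have "(cmod (w + \<i>))\<^sup>2 * (Im w / (cmod (w + \<i>))\<^sup>2) * (Im w / (cmod (w + \<i>))\<^sup>2) = Im w * (Im w / (cmod (w + \<i>))\<^sup>2)"
    using ne by simp
   finally show ?thesis by (simp only: power_mult_distrib mult.assoc)
  qed
  also have "\<dots> \<le> M * (Im w / (cmod (w + \<i>))\<^sup>2) ^ n"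
   using w bd[OF w] by (intro mult_right_mono) auto
  also have "\<dots> \<le> M * (hrho w) ^ n"
  proof (rule mult_left_mono)
   show "(Im w / (cmod (w + \<i>))\<^sup>2) ^ n \<le> hrho w ^ n"
    unfolding hrho_def using w by (intro power_mono divide_right_mono) auto
   have "0 \<le> cmod (f w) * Im w ^ n" using w by simp
   then show "0 \<le> M" using bd[OF w] by linarith
  qed
  finally show ?thesis .
 qed
 show int: "integrable hyp F"
 proof (rule Bochner_Integration.integrable_bound)
  show "integrable hyp (\<lambda>w. M * hrho w ^ n)" using integrable_hrho_power[OF n] by simp
  show "AE w in hyp. norm (F w) \<le> norm (M * hrho w ^ n)"
   using AE_hyp_pos by eventually_elim (use normF in fastforce)
 qed simp
 interpret pair_sigma_finite "lborel :: real measure" hyp ..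
 have mrot [measurable]: "(\<lambda>(t, w). hrot t w) \<in> borel_measurable (lborel \<Otimes>\<^sub>M hyp)"
 proof -
  have c [measurable]: "(\<lambda>t. cos (pi * t)) \<in> borel_measurable borel" "(\<lambda>t. sin (pi * t)) \<in> borel_measurable borel"
   by (intro borel_measurable_continuous_onI continuous_intros)+
  show ?thesis unfolding hrot_def mob_def by measurable
 qed
 \<comment> \<open>Every rotated copy of \<open>F\<close> has the same integral, so this integral is
   also the average over t in the unit interval; \<open>H\<close> prepares the exchange of the two
   integrations.\<close>
 define H where "H t w = indicator {0..1::real} t *\<^sub>R F (hrot t w)" for t w
 have Frot: "(\<integral>w. F (hrot t w) \<partial>hyp) = integral\<^sup>L hyp F" "integrable hyp (\<lambda>w. F (hrot t w))"
  for t
  unfolding hrot_def using integral_hyp_mob[of F "cos (pi * t)" "cos (pi * t)" "sin (pi * t)" "- sin (pi * t)"] int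
  by (simp_all flip: power2_eq_square)
 have Frotn: "(\<integral>w. norm (F (hrot t w)) \<partial>hyp) = (\<integral>w. norm (F w) \<partial>hyp)"
  for t
  unfolding hrot_def using integral_hyp_mob(1)[of "\<lambda>w. norm (F w)" "cos (pi * t)" "cos (pi * t)" "sin (pi * t)" "- sin (pi * t)"]
  by (simp flip: power2_eq_square)
 have mH [measurable]: "case_prod H \<in> borel_measurable (lborel \<Otimes>\<^sub>M hyp)"
 proof -
  have "(\<lambda>p. F ((\<lambda>(t, w). hrot t w) p)) \<in> borel_measurable (lborel \<Otimes>\<^sub>M hyp)" by measurable
  then have [measurable]: "(\<lambda>p. F (hrot (fst p) (snd p))) \<in> borel_measurable (lborel \<Otimes>\<^sub>M hyp)"
   by (simp add: case_prod_beta)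
  show ?thesis unfolding H_def case_prod_beta by measurable
 qed
 have intH: "integrable (lborel \<Otimes>\<^sub>M hyp) (case_prod H)"
 proof (rule Fubini_integrable)
  have "(\<lambda>t. \<integral>w. norm (case_prod H (t, w)) \<partial>hyp) = (\<lambda>t. indicator {0..1::real} t *\<^sub>R (\<integral>w. norm (F w) \<partial>hyp))"
   by (auto simp: H_def Frotn fun_eq_iff)
  moreover have "integrable lborel \<dots>" by (intro integrable_real_indicator integrable_scaleR_left) auto
  ultimately show "integrable lborel (\<lambda>t. \<integral>w. norm (case_prod H (t, w)) \<partial>hyp)" by simp
  show "AE t in lborel. integrable hyp (\<lambda>w. case_prod H (t, w))"
   by (intro AE_I2) (simp add: H_def Frot)
 qed simp
 have "integral\<^sup>L hyp F = (\<integral>t. (\<integral>w. H t w \<partial>hyp) \<partial>lborel)"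
  by (simp add: H_def Frot)
 also have "\<dots> = (\<integral>w. (\<integral>t. H t w \<partial>lborel) \<partial>hyp)"
  using Fubini_integral[OF intH] by simp
 also have "\<dots> = (\<integral>w. of_real ((hrho w / 4) ^ (2 * n)) * g \<i> \<partial>hyp)"
 proof (rule integral_cong_AE)
  show "AE w in hyp. (\<integral>t. H t w \<partial>lborel) = of_real ((hrho w / 4) ^ (2 * n)) * g \<i>"
   using AE_hyp_pos
  proof eventually_elim
   case (elim w)
   have "(\<integral>t. H t w \<partial>lborel) = (\<integral>t. of_real ((hrho w / 4) ^ (2 * n)) * (indicator {0..1} t *\<^sub>R g (hrot t w)) \<partial>lborel)"
    by (intro Bochner_Integration.integral_cong)
     (simp_all add: H_def FG Im_hrot elim hrho_hrot split: split_indicator)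
   also have "\<dots> = of_real ((hrho w / 4) ^ (2 * n)) * (\<integral>t. indicator {0..1} t *\<^sub>R g (hrot t w) \<partial>lborel)"
    by (rule integral_mult_right_zero)
   also have "(\<integral>t. indicator {0..1} t *\<^sub>R g (hrot t w) \<partial>lborel) = g \<i>"
   proof -
    have "complex_of_real (cos (pi * t)) \<noteq> complex_of_real (sin (pi * t)) * w" for t
     using mob_denom_nonzero[OF elim, of "cos (pi * t)" "cos (pi * t)" "sin (pi * t)" "- sin (pi * t)"]
     by (auto simp flip: power2_eq_square)
    then have "continuous_on {0..1} (\<lambda>t. hrot t w)"
     unfolding hrot_def mob_def by (intro continuous_intros) auto
    then have "continuous_on {0..1} (\<lambda>t. g (hrot t w))"
     by (rule continuous_on_compose2[OF holomorphic_on_imp_continuous_on[OF g]])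
      (auto simp: upper_half_plane_def Im_hrot elim)
    then have "set_integrable lborel {0..1} (\<lambda>t. g (hrot t w))"
     by (rule borel_integrable_atLeastAtMost')
    then have "(LINT t:{0..1}|lborel. g (hrot t w)) = integral {0..1} (\<lambda>t. g (hrot t w))"
     by (rule set_borel_integral_eq_integral(2))
    also have "\<dots> = g \<i>" using hrot_mean_value[OF g elim] by (rule integral_unique)
    finally show ?thesis by (simp add: set_lebesgue_integral_def)
   qed
   finally show ?case .
  qed
 qed measurable
 also have "\<dots> = of_real (\<integral>w. (hrho w / 4) ^ (2 * n) \<partial>hyp) * g \<i>"
  unfolding integral_mult_left_zero integral_complex_of_real ..
 also have "(\<integral>w. (hrho w / 4) ^ (2 * n) \<partial>hyp) = hypJ (2 * n) / 16 ^ n"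
  by (simp add: hypJ_def power_divide power_mult)
 also have "g \<i> = f \<i> * (- 4) ^ n" by (simp add: g_def power_mult power2_eq_square)
 also have "(- 4) ^ n = (of_real ((-1) ^ n * 4 ^ n) :: complex)" by (simp flip: power_mult_distrib)
 also have "of_real (hypJ (2 * n) / 16 ^ n) * (f \<i> * of_real ((-1) ^ n * 4 ^ n)) = of_real ((-1) ^ n / 4 ^ n * hypJ (2 * n)) * f \<i>"
 proof -
  have "(16::real) ^ n = 4 ^ n * 4 ^ n" by (simp flip: power_mult_distrib)
  then have "hypJ (2 * n) / 16 ^ n * ((-1) ^ n * 4 ^ n) = (-1) ^ n / 4 ^ n * hypJ (2 * n)" by simp
  then show ?thesis by (metis (no_types, lifting) mult.assoc mult.commute of_real_mult)
 qed
 finally show "integral\<^sup>L hyp F = of_real ((-1) ^ n / 4 ^ n * hypJ (2 * n)) * f \<i>" .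
qed

text \<open>The affine map w -> y w + Re z carries \<i> to z, and under it the powers of y in the
  numerator and in the denominator cancel.\<close>

lemma reproducing:
 assumes n: "n \<ge> 2" and f: "f holomorphic_on upper_half_plane"
  and [measurable]: "f \<in> borel_measurable borel"
  and bd: "!!w. Im w > 0 ==> cmod (f w) * Im w ^ n \<le> M" and z: "Im z > 0"
 defines "F \<equiv> \<lambda>w. f w * of_real (Im w ^ (2 * n)) / (z - cnj w) ^ (2 * n)"
 shows "integrable hyp F"
  and "integral\<^sup>L hyp F = of_real ((-1) ^ n / 4 ^ n * hypJ (2 * n)) * f z"
proof -
 have mF [measurable]: "F \<in> borel_measurable borel" unfolding F_def by measurable
 define y where "y = Im z"
 have y: "y > 0" using z by (simp add: y_def)
 define A where "A = mob y (Re z) 0 1"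
 have A: "A w = of_real y * w + of_real (Re z)" for w by (simp add: A_def mob_def)
 have ImA: "Im (A w) = y * Im w" for w by (simp add: A)
 have [measurable]: "A \<in> borel_measurable borel" by (simp add: A_def)
 define f' where "f' w = f (A w)" for w
 have F': "F (A w) = f' w * of_real (Im w ^ (2 * n)) / (\<i> - cnj w) ^ (2 * n)" for w
 proof -
  have "z - cnj (A w) = of_real y * (\<i> - cnj w)" by (simp add: A complex_eq_iff y_def algebra_simps)
  then show ?thesis unfolding F_def f'_def ImA using y by (simp add: power_mult_distrib)
 qed
 have hol: "f' holomorphic_on upper_half_plane"
 proof -
  have "A holomorphic_on upper_half_plane" unfolding A[abs_def] by (intro holomorphic_intros)
  then have "(f \<circ> A) holomorphic_on upper_half_plane"
   by (rule holomorphic_on_compose_gen[OF _ f]) (use y in \<open>auto simp: upper_half_plane_def ImA\<close>)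
  then show ?thesis by (simp add: f'_def[abs_def] o_def)
 qed
 have bd': "cmod (f' w) * Im w ^ n \<le> M / y ^ n" if "Im w > 0" for w
  using bd[of "A w"] y that by (simp add: f'_def ImA power_mult_distrib field_simps)
 have [measurable]: "f' \<in> borel_measurable borel" unfolding f'_def by measurable
 have D: "y * 1 - Re z * 0 > 0" using y by simp
 have Ai: "f' \<i> = f z" by (simp add: f'_def A y_def complex_eq_iff mult.commute)
   (metis add.commute complex_eq mult.commute)
 show "integrable hyp F"
  using reproducing_at_i(1)[OF n hol _ bd'] integral_hyp_mob(2)[OF mF D, folded A_def] by (simp add: F')
 show "integral\<^sup>L hyp F = of_real ((-1) ^ n / 4 ^ n * hypJ (2 * n)) * f z"
  using reproducing_at_i(2)[OF n hol _ bd'] integral_hyp_mob(1)[OF mF D, folded A_def] by (simp add: F' Ai)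
qed

subsection \<open>Integer matrices and lattice sums\<close>

text \<open>With q = r^2 and a = m + 1, the inequality r^2 + a^2 \<ge> (r + a)^2 / 2 bounds each
  term by 2 r^2 (1 / (r + m) - 1 / (r + m + 1)), and the sum telescopes to 2 r.\<close>

lemma suminf_inverse_quadratic:
 assumes q: "q > 0"
 shows "(\<Sum>n. ennreal (1 / (1 + (real (Suc n))\<^sup>2 / q))) \<le> ennreal (2 * sqrt q)"
proof -
 define r where "r = sqrt q"
 have r: "r > 0" "q = r\<^sup>2" using q by (auto simp: r_def)
 have le: "1 / (1 + (real (Suc n))\<^sup>2 / q) \<le> 2 * r\<^sup>2 * (1 / (r + real n) - 1 / (r + real (Suc n)))" for n
 proof -
  define m where "m = real n"
  have m: "m \<ge> 0" by (simp add: m_def)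
  have "1 / (1 + (m + 1)\<^sup>2 / q) = r\<^sup>2 / (r\<^sup>2 + (m + 1)\<^sup>2)" using r m by (simp add: r(2) field_simps)
  also have "\<dots> \<le> r\<^sup>2 / ((r + m) * (r + (m + 1)) / 2)"
  proof (intro divide_left_mono)
   have "0 \<le> (r - (m + 1))\<^sup>2" by simp
   then have "(r + (m + 1)) * (r + (m + 1)) / 2 \<le> r\<^sup>2 + (m + 1)\<^sup>2" by (simp add: power2_eq_square algebra_simps)
   moreover have "(r + m) * (r + (m + 1)) \<le> (r + (m + 1)) * (r + (m + 1))" using r m by (intro mult_right_mono) auto
   ultimately show "(r + m) * (r + (m + 1)) / 2 \<le> r\<^sup>2 + (m + 1)\<^sup>2" by linarith
   show "0 < (r\<^sup>2 + (m + 1)\<^sup>2) * ((r + m) * (r + (m + 1)) / 2)"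
    using r m by (intro mult_pos_pos divide_pos_pos add_pos_pos add_pos_nonneg) auto
  qed (use r in auto)
  also have "\<dots> = 2 * r\<^sup>2 * (1 / (r + m) - 1 / (r + (m + 1)))"
  proof -
   have "r + m > 0" "r + (m + 1) > 0" using r m by auto
   then show ?thesis by (simp add: diff_frac_eq)
  qed
  finally show ?thesis by (simp add: m_def add.commute)
 qed
 have "(\<lambda>n. 1 / (r + real n)) \<longlonglongrightarrow> 0"
  by (rule tendsto_divide_0[OF tendsto_const])
   (rule filterlim_at_top_imp_at_infinity, rule filterlim_tendsto_add_at_top[OF tendsto_const filterlim_real_sequentially])
 from telescope_sums'[OF this]
 have "(\<lambda>n. 2 * r\<^sup>2 * (1 / (r + real n) - 1 / (r + real (Suc n)))) sums (2 * r\<^sup>2 * (1 / (r + real 0) - 0))"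
  by (rule sums_mult)
 moreover have "2 * r\<^sup>2 * (1 / (r + real 0) - 0) = 2 * r" using r by (simp add: power2_eq_square)
 ultimately have s: "(\<lambda>n. 2 * r\<^sup>2 * (1 / (r + real n) - 1 / (r + real (Suc n)))) sums (2 * r)" by simp
 have nn: "0 \<le> 1 / (1 + (real (Suc n))\<^sup>2 / q)" for n using q by simp
 have "(\<Sum>n. ennreal (1 / (1 + (real (Suc n))\<^sup>2 / q))) \<le> (\<Sum>n. ennreal (2 * r\<^sup>2 * (1 / (r + real n) - 1 / (r + real (Suc n)))))"
  by (intro suminf_le ennreal_leI le) auto
 also have "\<dots> = ennreal (2 * r)"
  by (rule suminf_ennreal_eq[OF _ s]) (use nn le order_trans in blast)
 finally show ?thesis by (simp add: r_def)
qed

lemma nn_integral_count_space_int: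
 "(\<integral>\<^sup>+j. f j \<partial>count_space (UNIV :: int set)) = (\<Sum>n. f (int n)) + (\<Sum>n. f (- int n - 1))"
proof -
 have "(\<integral>\<^sup>+j. f j \<partial>count_space (UNIV :: int set)) = (\<integral>\<^sup>+j. f j * indicator {0..} j + f j * indicator {..-1} j \<partial>count_space UNIV)"
  by (rule nn_integral_cong) (auto split: split_indicator)
 also have "\<dots> = (\<integral>\<^sup>+j. f j * indicator {0..} j \<partial>count_space UNIV) + (\<integral>\<^sup>+j. f j * indicator {..-1} j \<partial>count_space UNIV)"
  by (rule nn_integral_add) auto
 also have "(\<integral>\<^sup>+j. f j * indicator {0..} j \<partial>count_space UNIV) = (\<integral>\<^sup>+j. f j \<partial>count_space {0..})"
  by (rule nn_integral_count_space_indicator[symmetric]) simp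
 also have "\<dots> = (\<integral>\<^sup>+n. f (int n) \<partial>count_space UNIV)"
  by (rule nn_integral_bij_count_space[symmetric])
   (rule bij_betwI[of _ _ _ nat], auto)
 also have "\<dots> = (\<Sum>n. f (int n))" by (rule nn_integral_count_space_nat)
 also have "(\<integral>\<^sup>+j. f j * indicator {..-1} j \<partial>count_space UNIV) = (\<integral>\<^sup>+j. f j \<partial>count_space {..-1})"
  by (rule nn_integral_count_space_indicator[symmetric]) simp
 also have "\<dots> = (\<integral>\<^sup>+n. f (- int n - 1) \<partial>count_space UNIV)"
  by (rule nn_integral_bij_count_space[symmetric])
   (rule bij_betwI[of _ _ _ "\<lambda>j. nat (- j - 1)"], auto)
 also have "\<dots> = (\<Sum>n. f (- int n - 1))" by (rule nn_integral_count_space_nat)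
 finally show ?thesis .
qed

text \<open>After a shift of b only the fractional part u of t remains. Both |n + u| and |-n - 1 +
  u| are at least n, so each half-line costs 1 for n = 0 plus the bound of
  \<open>suminf_inverse_quadratic\<close>.\<close>

lemma sum_int_inverse_quadratic:
 assumes q: "q > 0"
 shows "(\<integral>\<^sup>+b. ennreal (1 / (1 + (real_of_int b + t)\<^sup>2 / q)) \<partial>count_space UNIV) \<le> ennreal (2 + 4 * sqrt q)"
proof -
 define u where "u = frac t"
 have u: "0 \<le> u" "u < 1" by (auto simp: u_def frac_lt_1)
 define h where "h n = (if n = 0 then 1 else 1 / (1 + (real n)\<^sup>2 / q))" for n
 have hs: "(\<Sum>n. ennreal (h n)) \<le> ennreal (1 + 2 * sqrt q)"
 proof -
  have "(\<Sum>n. ennreal (h n)) = (\<Sum>n. ennreal (h (Suc n))) + ennreal (h 0)"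
   using suminf_offset[of "\<lambda>n. ennreal (h n)" 1] by (simp add: add.commute)
  also have "\<dots> \<le> ennreal (2 * sqrt q) + ennreal 1"
   using suminf_inverse_quadratic[OF q] by (intro add_mono) (simp_all add: h_def)
  also have "\<dots> = ennreal (1 + 2 * sqrt q)" using q by (subst ennreal_plus[symmetric]) auto
  finally show ?thesis .
 qed
 have le: "1 / (1 + x\<^sup>2 / q) \<le> h n" if "\<bar>x\<bar> \<ge> real n" for x n
 proof (cases "n = 0")
  case True
  then show ?thesis using q by (simp add: h_def add_pos_nonneg)
 next
  case False
  have "(real n)\<^sup>2 \<le> x\<^sup>2" using power_mono[OF that, of 2] by simp
  then show ?thesis using False q by (auto simp: h_def intro!: divide_left_mono add_left_mono divide_right_mono mult_pos_pos add_pos_nonneg)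
 qed
 have "(\<integral>\<^sup>+b. ennreal (1 / (1 + (real_of_int b + t)\<^sup>2 / q)) \<partial>count_space UNIV)
   = (\<integral>\<^sup>+j. ennreal (1 / (1 + (real_of_int (j - \<lfloor>t\<rfloor>) + t)\<^sup>2 / q)) \<partial>count_space UNIV)"
  by (rule nn_integral_bij_count_space[symmetric]) (rule bij_betwI[of _ _ _ "\<lambda>j. j + \<lfloor>t\<rfloor>"], auto)
 also have "\<dots> = (\<integral>\<^sup>+j. ennreal (1 / (1 + (real_of_int j + u)\<^sup>2 / q)) \<partial>count_space UNIV)"
  by (simp add: u_def frac_def algebra_simps)
 also have "\<dots> = (\<Sum>n. ennreal (1 / (1 + (real_of_int (int n) + u)\<^sup>2 / q))) + (\<Sum>n. ennreal (1 / (1 + (real_of_int (- int n - 1) + u)\<^sup>2 / q)))"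
  by (rule nn_integral_count_space_int)
 also have "\<dots> \<le> (\<Sum>n. ennreal (h n)) + (\<Sum>n. ennreal (h n))"
  by (intro add_mono suminf_le ennreal_leI le) (use u in auto)
 also have "\<dots> \<le> ennreal (1 + 2 * sqrt q) + ennreal (1 + 2 * sqrt q)" by (intro add_mono hs)
 also have "\<dots> = ennreal (2 + 4 * sqrt q)" using q by (subst ennreal_plus[symmetric]) auto
 finally show ?thesis .
qed

section \<open>Integer two by two matrices and their action\<close>

type_synonym imat = "int \<times> int \<times> int \<times> int"

fun idet :: "imat => int" where "idet (a, b, c, d) = a * d - b * c"

fun imul :: "imat => imat => imat" where
 "imul (a, b, c, d) (a', b', c', d') = (a * a' + b * c', a * b' + b * d', c * a' + d * c', c * b' + d * d')"

fun iadj :: "imat => imat" where "iadj (a, b, c, d) = (d, - b, - c, a)"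

fun imob :: "imat => complex => complex" where
 "imob (a, b, c, d) z = (of_int a * z + of_int b) / (of_int c * z + of_int d)"

fun iden :: "imat => complex => complex" where
 "iden (a, b, c, d) z = of_int c * z + of_int d"

text \<open>This is \<open>(imob g z - cnj w) * iden g z\<close> with the denominator cleared. Up to
  the determinant factor, its power -2n is the translate by g of (z - cnj w)^(-2n).\<close>

fun iL :: "imat => complex => complex => complex" where
 "iL (a, b, c, d) z w = of_int a * z + of_int b - cnj w * (of_int c * z + of_int d)"

text \<open>If \<open>g\<^sub>z\<close> is the affine map that sends \<open>\<i>\<close> to \<open>z\<close>, this is the squared Euclidean
 norm of the matrix \<open>g\<^sub>w\<^sup>-\<^sup>1 g g\<^sub>z\<close>.\<close>

fun iX :: "imat => complex => complex => real" where
 "iX (a, b, c, d) z w =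
  (of_int a - Re w * of_int c)\<^sup>2 * (Im z / Im w)
  + (of_int a * Re z + of_int b - Re w * (of_int c * Re z + of_int d))\<^sup>2 / (Im z * Im w)
  + (of_int c)\<^sup>2 * (Im z * Im w)
  + (of_int c * Re z + of_int d)\<^sup>2 * (Im w / Im z)"

lemma norm_iL:
 assumes "Im z > 0" "Im w > 0"
 shows "(cmod (iL g z w))\<^sup>2 = Im z * Im w * (iX g z w + 2 * of_int (idet g))"
proof (cases g)
 case (fields a b c d)
 define x y u v A B C D where "x = Re z" "y = Im z" "u = Re w" "v = Im w"
  and "A = real_of_int a" "B = real_of_int b" "C = real_of_int c" "D = real_of_int d"
 note defs = this
 have y: "y > 0" "v > 0" using assms by (auto simp: defs)
 have "(cmod (iL g z w))\<^sup>2 = ((A * x + B - u * (C * x + D)) - v * C * y)\<^sup>2 + ((A - u * C) * y + v * (C * x + D))\<^sup>2"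
  unfolding cmod_power2 fields defs by (simp add: algebra_simps)
 also have "\<dots> = ((A - u * C) * y)\<^sup>2 + (A * x + B - u * (C * x + D))\<^sup>2 + (v * C * y)\<^sup>2 + (v * (C * x + D))\<^sup>2 + 2 * y * v * (A * D - B * C)"
  by (simp add: power2_eq_square algebra_simps)
 also have "\<dots> = y * v * ((A - u * C)\<^sup>2 * (y / v) + (A * x + B - u * (C * x + D))\<^sup>2 / (y * v) + C\<^sup>2 * (y * v) + (C * x + D)\<^sup>2 * (v / y)
   + 2 * (A * D - B * C))"
 proof -
  have e: "y * v * (p\<^sup>2 * (y / v) + q\<^sup>2 / (y * v) + C\<^sup>2 * (y * v) + s\<^sup>2 * (v / y) + 2 * k)
    = (p * y)\<^sup>2 + q\<^sup>2 + (v * C * y)\<^sup>2 + (v * s)\<^sup>2 + 2 * y * v * k" for p q s k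
   using y by (simp add: field_simps power2_eq_square)
  show ?thesis by (rule e[symmetric])
 qed
 finally show ?thesis by (simp add: fields defs)
qed

lemma iX_nonneg: "Im z > 0 ==> Im w > 0 ==> iX g z w \<ge> 0"
 by (cases g) auto

text \<open>For a real matrix with rows (p, q) and (C, s), the squared norm minus twice the
  determinant is (p - s)^2 + (q + C)^2. The same identity appears here with entries rescaled by the
  heights of z and w.\<close>

lemma iX_ge_2det:
 assumes "Im z > 0" "Im w > 0"
 shows "iX g z w \<ge> 2 * of_int (idet g)"
proof (cases g)
 case (fields a b c d)
 define x y u v A B C D where "x = Re z" "y = Im z" "u = Re w" "v = Im w"
  and "A = real_of_int a" "B = real_of_int b" "C = real_of_int c" "D = real_of_int d"
 note defs = this
 have y: "y > 0" "v > 0" using assms by (auto simp: defs)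
 have e: "y * v * (p\<^sup>2 * (y / v) + q\<^sup>2 / (y * v) + C\<^sup>2 * (y * v) + s\<^sup>2 * (v / y) - 2 * (p * s - q * C))
    = (p * y - v * s)\<^sup>2 + (q + v * C * y)\<^sup>2" for p q s
   using y by (simp add: field_simps power2_eq_square)
 have "y * v * (iX g z w - 2 * (A * D - B * C)) = y * v * ((A - u * C)\<^sup>2 * (y / v) + (A * x + B - u * (C * x + D))\<^sup>2 / (y * v) + C\<^sup>2 * (y * v) + (C * x + D)\<^sup>2 * (v / y)
   - 2 * ((A - u * C) * (C * x + D) - (A * x + B - u * (C * x + D)) * C))"
  by (simp add: fields defs algebra_simps)
 also have "\<dots> \<ge> 0" unfolding e by simp
 finally have "0 \<le> y * v * (iX g z w - 2 * (A * D - B * C))" .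
 moreover have "y * v > 0" using y by simp
 ultimately have "iX g z w - 2 * (A * D - B * C) \<ge> 0" by (metis zero_le_mult_iff not_le)
 then show ?thesis by (simp add: fields defs)
qed

text \<open>\<open>1 + iX\<close> is at least 1 plus each of its four squares, so its fourth power
  dominates a product with one factor for each matrix entry. This is the origin of the exponent 4
  used throughout. The summation is over b first, whose shift depends on the other three entries,
  then over d and a, whose shifts depend on c, and last over c.\<close>

lemma lattice_sum_bound:
 assumes y: "Im z > 0" "Im w > 0"
 shows "(\<integral>\<^sup>+g. ennreal (1 / (1 + iX g z w) ^ 4) \<partial>count_space UNIV) \<le>
  ennreal ((2 + 4 * sqrt (Im z * Im w)) * (2 + 4 * sqrt (Im z / Im w)) * (2 + 4 * sqrt (Im w / Im z)) * (2 + 4 * sqrt (1 / (Im z * Im w))))"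
  (is "_ \<le> ennreal (?b * ?d * ?a * ?c)")
proof -
 define fa where "fa a c = 1 / (1 + (real_of_int a + - Re w * of_int c)\<^sup>2 / (Im w / Im z))" for a c :: int
 define fd where "fd d c = 1 / (1 + (real_of_int d + of_int c * Re z)\<^sup>2 / (Im z / Im w))" for d c :: int
 define fc where "fc c = 1 / (1 + (real_of_int c + 0)\<^sup>2 / (1 / (Im z * Im w)))" for c :: int
 define fb where "fb a b c d = 1 / (1 + (real_of_int b + (of_int a * Re z - Re w * (of_int c * Re z + of_int d)))\<^sup>2 / (Im z * Im w))" for a b c d :: int
 have nn: "fa a c \<ge> 0" "fd d c \<ge> 0" "fc c \<ge> 0" "fb a b c d \<ge> 0" for a b c d
  using y by (simp_all add: fa_def fd_def fc_def fb_def)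
 have le: "1 / (1 + iX (a, b, c, d) z w) ^ 4 \<le> fc c * (fa a c * (fd d c * fb a b c d))" for a b c d
 proof -
  define p1 where "p1 = (real_of_int a + - Re w * of_int c)\<^sup>2 / (Im w / Im z)"
  define p2 where "p2 = (real_of_int d + of_int c * Re z)\<^sup>2 / (Im z / Im w)"
  define p3 where "p3 = (real_of_int c + 0)\<^sup>2 / (1 / (Im z * Im w))"
  define p4 where "p4 = (real_of_int b + (of_int a * Re z - Re w * (of_int c * Re z + of_int d)))\<^sup>2 / (Im z * Im w)"
  have p: "p1 \<ge> 0" "p2 \<ge> 0" "p3 \<ge> 0" "p4 \<ge> 0" using y by (simp_all add: p1_def p2_def p3_def p4_def)
  have X: "iX (a, b, c, d) z w = p1 + p4 + p3 + p2"
   by (simp add: p1_def p2_def p3_def p4_def algebra_simps)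
  define s where "s = p1 + p4 + p3 + p2"
  have "(1 + p3) * ((1 + p1) * ((1 + p2) * (1 + p4))) \<le> (1 + s) * ((1 + s) * ((1 + s) * (1 + s)))"
   unfolding s_def using p by (intro mult_mono) auto
  moreover have "s \<ge> 0" using p by (simp add: s_def)
  ultimately have "1 / (1 + s) ^ 4 \<le> 1 / ((1 + p3) * ((1 + p1) * ((1 + p2) * (1 + p4))))"
   using p by (intro divide_left_mono) (auto simp: power4_eq_xxxx mult.assoc intro!: mult_pos_pos add_pos_nonneg)
  then show ?thesis unfolding X s_def[symmetric]
   by (simp add: fa_def fb_def fc_def fd_def p1_def p2_def p3_def p4_def)
 qed
 define r :: "imat => imat" where "r = (\<lambda>(c, a, d, b). (a, b, c, d))"
 have bij: "bij_betw r UNIV UNIV"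
  by (rule bij_betwI[of _ _ _ "\<lambda>(a, b, c, d). (c, a, d, b)"]) (auto simp: r_def)
 have "(\<integral>\<^sup>+g. ennreal (1 / (1 + iX g z w) ^ 4) \<partial>count_space UNIV)
   = (\<integral>\<^sup>+p. ennreal (1 / (1 + iX (r p) z w) ^ 4) \<partial>count_space UNIV)"
  by (rule nn_integral_bij_count_space[OF bij, symmetric])
 also have "\<dots> \<le> (\<integral>\<^sup>+p. (case p of (c, a, d, b) => ennreal (fc c) * (ennreal (fa a c) * (ennreal (fd d c) * ennreal (fb a b c d)))) \<partial>count_space UNIV)"
 proof (rule nn_integral_mono)
  fix p :: imat
  obtain c a d b where p: "p = (c, a, d, b)" by (cases p)
  have "ennreal (1 / (1 + iX (r p) z w) ^ 4) \<le> ennreal (fc c * (fa a c * (fd d c * fb a b c d)))"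
   using le[of a b c d] by (intro ennreal_leI) (simp add: p r_def)
  also have "\<dots> = ennreal (fc c) * (ennreal (fa a c) * (ennreal (fd d c) * ennreal (fb a b c d)))"
   using nn by (simp add: ennreal_mult)
  finally show "ennreal (1 / (1 + iX (r p) z w) ^ 4) \<le> (case p of (c, a, d, b) => ennreal (fc c) * (ennreal (fa a c) * (ennreal (fd d c) * ennreal (fb a b c d))))"
   by (simp add: p)
 qed
 also have "\<dots> = (\<integral>\<^sup>+c. \<integral>\<^sup>+a. \<integral>\<^sup>+d. \<integral>\<^sup>+b. ennreal (fc c) * (ennreal (fa a c) * (ennreal (fd d c) * ennreal (fb a b c d))) \<partial>count_space UNIV \<partial>count_space UNIV \<partial>count_space UNIV \<partial>count_space UNIV)"
  by (simp add: nn_integral_fst_count_space[symmetric])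
 also have "\<dots> \<le> (\<integral>\<^sup>+c. \<integral>\<^sup>+a. \<integral>\<^sup>+d. ennreal (fc c) * (ennreal (fa a c) * (ennreal (fd d c) * ennreal ?b)) \<partial>count_space UNIV \<partial>count_space UNIV \<partial>count_space UNIV)"
 proof (intro nn_integral_mono)
  fix c a d :: int
  have "(\<integral>\<^sup>+b. ennreal (fb a b c d) \<partial>count_space UNIV) \<le> ennreal ?b"
   unfolding fb_def by (rule sum_int_inverse_quadratic) (use y in simp)
  then show "(\<integral>\<^sup>+b. ennreal (fc c) * (ennreal (fa a c) * (ennreal (fd d c) * ennreal (fb a b c d))) \<partial>count_space UNIV)
   \<le> ennreal (fc c) * (ennreal (fa a c) * (ennreal (fd d c) * ennreal ?b))"
   by (simp add: nn_integral_cmult mult_left_mono)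
 qed
 also have "\<dots> \<le> (\<integral>\<^sup>+c. \<integral>\<^sup>+a. ennreal (fc c) * (ennreal (fa a c) * (ennreal ?d * ennreal ?b)) \<partial>count_space UNIV \<partial>count_space UNIV)"
 proof (intro nn_integral_mono)
  fix c a :: int
  have "(\<integral>\<^sup>+d. ennreal (fd d c) \<partial>count_space UNIV) \<le> ennreal ?d"
   unfolding fd_def by (rule sum_int_inverse_quadratic) (use y in simp)
  then show "(\<integral>\<^sup>+d. ennreal (fc c) * (ennreal (fa a c) * (ennreal (fd d c) * ennreal ?b)) \<partial>count_space UNIV)
   \<le> ennreal (fc c) * (ennreal (fa a c) * (ennreal ?d * ennreal ?b))"
   by (simp add: nn_integral_cmult nn_integral_multc mult_left_mono mult_right_mono)
 qed
 also have "\<dots> \<le> (\<integral>\<^sup>+c. ennreal (fc c) * (ennreal ?a * (ennreal ?d * ennreal ?b)) \<partial>count_space UNIV)"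
 proof (intro nn_integral_mono)
  fix c :: int
  have "(\<integral>\<^sup>+a. ennreal (fa a c) \<partial>count_space UNIV) \<le> ennreal ?a"
   unfolding fa_def by (rule sum_int_inverse_quadratic) (use y in simp)
  then show "(\<integral>\<^sup>+a. ennreal (fc c) * (ennreal (fa a c) * (ennreal ?d * ennreal ?b)) \<partial>count_space UNIV)
   \<le> ennreal (fc c) * (ennreal ?a * (ennreal ?d * ennreal ?b))"
   by (simp add: nn_integral_cmult nn_integral_multc mult_left_mono mult_right_mono)
 qed
 also have "\<dots> \<le> ennreal ?c * (ennreal ?a * (ennreal ?d * ennreal ?b))"
 proof -
  have "(\<integral>\<^sup>+c. ennreal (fc c) \<partial>count_space UNIV) \<le> ennreal ?c"
   unfolding fc_def by (rule sum_int_inverse_quadratic) (use y in simp)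
  then show ?thesis by (simp add: nn_integral_multc mult_right_mono)
 qed
 also have "\<dots> = ennreal (?b * ?d * ?a * ?c)"
 proof -
  have "ennreal c * (ennreal a * (ennreal d * ennreal b)) = ennreal (b * d * a * c)"
   if "0 \<le> a" "0 \<le> b" "0 \<le> c" "0 \<le> d" for a b c d
   using that by (simp add: ennreal_mult[symmetric] mult_ac)
  then show ?thesis by this (use y in auto)
 qed
 finally show ?thesis .
qed

fun iscale :: "int => imat => imat" where
 "iscale t (a, b, c, d) = (t * a, t * b, t * c, t * d)"

lemma idet_imul [simp]: "idet (imul g h) = idet g * idet h"
 by (cases g; cases h) (simp add: algebra_simps)

lemma idet_iadj [simp]: "idet (iadj g) = idet g"
 by (cases g) (simp add: algebra_simps)

lemma idet_iscale [simp]: "idet (iscale t g) = t\<^sup>2 * idet g"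
 by (cases g) (simp add: algebra_simps power2_eq_square)

lemma imul_assoc: "imul (imul g h) k = imul g (imul h k)"
 by (cases g; cases h; cases k) (simp add: algebra_simps)

lemma imul_one [simp]: "imul (1, 0, 0, 1) g = g" "imul g (1, 0, 0, 1) = g"
 by (cases g; simp)+

lemma imul_iadj: "imul g (iadj g) = iscale (idet g) (1, 0, 0, 1)" "imul (iadj g) g = iscale (idet g) (1, 0, 0, 1)"
 by (cases g; simp add: algebra_simps)+

lemma iadj_iadj [simp]: "iadj (iadj g) = g"
 by (cases g) simp

lemma imul_iscale: "imul (iscale t g) h = iscale t (imul g h)" "imul g (iscale t h) = iscale t (imul g h)"
 by (cases g; cases h; simp add: algebra_simps)+

lemma iscale_iscale: "iscale s (iscale t g) = iscale (s * t) g"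
 by (cases g) simp

lemma iscale_1 [simp]: "iscale 1 g = g"
 by (cases g) simp

lemma iscale_inj: "t \<noteq> 0 ==> iscale t g = iscale t h \<longleftrightarrow> g = h"
 by (cases g; cases h) simp

lemma imob_eq_mob: "imob (a, b, c, d) z = mob (of_int a) (of_int b) (of_int c) (of_int d) z"
 by (simp add: mob_def)

lemma measurable_imob [measurable]: "imob g \<in> borel_measurable borel"
 by (cases g) (simp add: imob_eq_mob cong: measurable_cong)

lemma iden_nonzero:
 assumes "Im z > 0" "idet g > 0"
 shows "iden g z \<noteq> 0"
proof (cases g)
 case (fields a b c d)
 have "real_of_int a * of_int d - of_int b * of_int c > 0"
  using assms(2) unfolding fields idet.simps by (metis of_int_diff of_int_mult of_int_0_less_iff)
 from mob_denom_nonzero[OF assms(1) this] show ?thesis by (simp add: fields)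
qed

lemma Im_imob:
 "Im (imob g z) = of_int (idet g) * Im z / (cmod (iden g z))\<^sup>2"
 by (cases g) (simp add: imob_eq_mob Im_mob del: imob.simps)

lemma Im_imob_pos: "Im z > 0 ==> idet g > 0 ==> Im (imob g z) > 0"
 by (simp add: Im_imob iden_nonzero)

lemma iden_imul: "iden h z \<noteq> 0 ==> iden (imul g h) z = iden g (imob h z) * iden h z"
 by (cases g; cases h) (simp add: field_simps)

lemma imob_imul: "iden h z \<noteq> 0 ==> imob (imul g h) z = imob g (imob h z)"
proof -
 assume n: "iden h z \<noteq> 0"
 obtain a b c d where g: "g = (a, b, c, d)" by (cases g)
 obtain p q r s where h: "h = (p, q, r, s)" by (cases h)
 define u where "u = of_int p * z + of_int q"
 define v where "v = of_int r * z + of_int s"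
 have v: "v \<noteq> 0" using n by (simp add: h v_def)
 have "imob (imul g h) z = (of_int a * u + of_int b * v) / (of_int c * u + of_int d * v)"
  by (simp add: g h u_def v_def algebra_simps)
 also have "\<dots> = ((of_int a * u + of_int b * v) / v) / ((of_int c * u + of_int d * v) / v)"
  using v by simp
 also have "\<dots> = imob g (imob h z)" using v by (simp add: g h u_def[symmetric] v_def[symmetric] add_divide_distrib)
 finally show ?thesis .
qed

lemma iden_iscale: "iden (iscale t g) z = of_int t * iden g z"
 by (cases g) (simp add: algebra_simps)

lemma imob_iscale: "t \<noteq> 0 ==> imob (iscale t g) z = imob g z"
proof -
 assume t: "t \<noteq> 0"
 obtain a b c d where g: "g = (a, b, c, d)" by (cases g)
 have "imob (iscale t g) z = (of_int t * (of_int a * z + of_int b)) / (of_int t * (of_int c * z + of_int d))"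
  by (simp add: g algebra_simps)
 then show ?thesis using t by (simp add: g)
qed

lemma iL_iscale: "iL (iscale t g) z w = of_int t * iL g z w"
 by (cases g) (simp add: algebra_simps)

lemma iL_imul: "iden h z \<noteq> 0 ==> iL (imul g h) z w = iL g (imob h z) w * iden h z"
proof -
 assume n: "iden h z \<noteq> 0"
 obtain a b c d where g: "g = (a, b, c, d)" by (cases g)
 obtain p q r s where h: "h = (p, q, r, s)" by (cases h)
 define u where "u = of_int p * z + of_int q"
 define v where "v = of_int r * z + of_int s"
 have v: "v \<noteq> 0" using n by (simp add: h v_def)
 have "iL (imul g h) z w = of_int a * u + of_int b * v - cnj w * (of_int c * u + of_int d * v)"
  by (simp add: g h u_def v_def algebra_simps)
 also have "\<dots> = (of_int a * (u / v) + of_int b - cnj w * (of_int c * (u / v) + of_int d)) * v"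
  using v by (simp add: field_simps)
 finally show ?thesis by (simp add: g h u_def v_def)
qed

lemma iL_imob_right:
 "iden h w \<noteq> 0 ==> iL g z (imob h w) * cnj (iden h w) = iL (imul (iadj h) g) z w"
proof -
 assume n: "iden h w \<noteq> 0"
 obtain a b c d where g: "g = (a, b, c, d)" by (cases g)
 obtain p q r s where h: "h = (p, q, r, s)" by (cases h)
 have n': "cnj (of_int r * w + of_int s) \<noteq> 0" using n by (simp only: complex_cnj_zero_iff h iden.simps not_False_eq_True)
 have "iL g z (imob h w) * cnj (iden h w) =
  (of_int a * z + of_int b) * cnj (of_int r * w + of_int s) - cnj (of_int p * w + of_int q) * (of_int c * z + of_int d)"
  using n' unfolding g h iL.simps imob.simps iden.simps complex_cnj_divide
  by (simp add: left_diff_distrib)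
 also have "\<dots> = iL (imul (iadj h) g) z w"
  by (simp add: g h algebra_simps)
 finally show ?thesis .
qed

lemma iL_nonzero:
 assumes "Im z > 0" "Im w > 0" "idet g > 0"
 shows "iL g z w \<noteq> 0"
proof -
 have "(cmod (iL g z w))\<^sup>2 > 0"
  unfolding norm_iL[OF assms(1,2)] using assms iX_nonneg[OF assms(1,2), of g]
  by (intro mult_pos_pos add_nonneg_pos) auto
 then show ?thesis by auto
qed

text \<open>In weight 2 n the factor det^(k/2) is the integral power det^n, so real powers
  disappear; \<open>slash_eq_sl\<close> gives the agreement for positive determinant.\<close>

definition sl :: "nat => imat => (complex => complex) => complex => complex" where
 "sl n g f = (\<lambda>z. of_int (idet g) ^ n / iden g z ^ (2 * n) * f (imob g z))"

lemma slash_eq_sl: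
 assumes "a * d - b * c > 0"
 shows "slash (2 * n) a b c d f = sl n (a, b, c, d) f"
proof
 fix z
 have "real_of_int (a * d - b * c) powr (real (2 * n) / 2) = real_of_int (a * d - b * c) ^ n"
  using assms by (simp add: powr_realpow flip: of_int_mult of_int_diff)
 then have "complex_of_real (real_of_int (a * d - b * c) powr (real (2 * n) / 2)) = of_int (idet (a, b, c, d)) ^ n"
  by (simp only: idet.simps of_real_power of_real_of_int_eq)
 then show "slash (2 * n) a b c d f z = sl n (a, b, c, d) f z"
  by (simp only: slash_def sl_def iden.simps imob.simps)
qed

lemma sl_imul:
 assumes "Im z > 0" "idet h > 0"
 shows "sl n (imul g h) f z = sl n h (sl n g f) z"
 using iden_nonzero[OF assms]
 by (simp add: sl_def iden_imul imob_imul power_mult_distrib mult_ac)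

lemma sl_one [simp]: "sl n (1, 0, 0, 1) f = f"
 by (simp add: sl_def)

text \<open>The kernel with \<open>kap n g\<close> applied to \<open>(z, w)\<close> is the translate by \<open>g\<close> of \<open>(z - cnj w)\<^sup>-\<^sup>2\<^sup>n\<close>.\<close>

definition kap :: "nat => imat => complex => complex => complex" where
 "kap n g z w = of_int (idet g) ^ n / iL g z w ^ (2 * n)"

lemma kap_iscale: "t \<noteq> 0 ==> kap n (iscale t g) z w = kap n g z w"
 by (simp add: kap_def iL_iscale power_mult_distrib power_mult)

lemma sl_kap:
 assumes "Im z > 0" "idet h > 0"
 shows "sl n h (\<lambda>z. kap n g z w) z = kap n (imul g h) z w"
 using iden_nonzero[OF assms] by (simp add: sl_def kap_def iL_imul power_mult_distrib mult_ac)

section \<open>The Atkin-Lehner group and its sign character\<close>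

definition AL :: "nat => nat => imat set" where
 "AL N Q = {(a, b, c, d). int Q dvd a \<and> int N dvd c \<and> int Q dvd d \<and> a * d - b * c = int Q}"

definition ALG :: "nat => imat set" where
 "ALG N = (\<Union>Q\<in>{Q. exact_divisor Q N}. AL N Q)"

text \<open>An element of \<open>AL N Q\<close> has determinant Q, so the sign belonging to it can
  be read off from the determinant.\<close>

definition chi :: "(nat => int) => imat => int" where
 "chi \<sigma> g = \<sigma> (nat (idet g))"

lemma AL_idet: "g \<in> AL N Q ==> idet g = int Q"
 by (auto simp: AL_def)

lemma exact_divisor_pos: "N > 0 ==> exact_divisor Q N ==> Q > 0"
 by (auto simp: exact_divisor_def intro: Nat.gr0I)

lemma ALG_idet_pos: "N > 0 ==> g \<in> ALG N ==> idet g > 0"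
 by (auto simp: ALG_def AL_idet exact_divisor_pos)

lemma chi_AL: "g \<in> AL N Q ==> chi \<sigma> g = \<sigma> Q"
 by (simp add: chi_def AL_idet)

lemma iadj_AL: "g \<in> AL N Q ==> iadj g \<in> AL N Q"
 by (auto simp: AL_def algebra_simps)

lemma iadj_ALG: "g \<in> ALG N ==> iadj g \<in> ALG N"
 by (auto simp: ALG_def iadj_AL)

text \<open>N is a product g q q' t of pairwise coprime factors with Q = g q and Q' = g q', and
  every claim is read off from this factorisation. In terms of sets of primes, q q' is the symmetric
  difference of Q and Q'.\<close>

lemma exact_divisor_mult:
 assumes N: "N > 0" and Q: "exact_divisor Q N" and Q': "exact_divisor Q' N"
 defines "g \<equiv> gcd Q Q'"
 shows "exact_divisor ((Q div g) * (Q' div g)) N" "exact_divisor g N"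
  "exact_divisor (Q div g) N" "exact_divisor (Q' div g) N"
  "coprime g (Q div g)" "coprime g (Q' div g)" "coprime (Q div g) (Q' div g)"
  "g * ((Q div g) * (Q' div g)) dvd N"
proof -
 have Q0: "Q > 0" and Q'0: "Q' > 0" using exact_divisor_pos N Q Q' by auto
 have g0: "g > 0" using Q0 by (simp add: g_def)
 define q where "q = Q div g"
 define q' where "q' = Q' div g"
 have Qq: "Q = g * q" and Qq': "Q' = g * q'" by (simp_all add: q_def q'_def g_def)
 have q0: "q > 0" "q' > 0" using Q0 Q'0 Qq Qq' by (auto intro: Nat.gr0I)
 have cqq: "coprime q q'" unfolding q_def q'_def g_def using Q0 by (intro div_gcd_coprime) auto
 obtain r where r: "N = Q * r" using Q by (auto simp: exact_divisor_def)
 obtain r' where r': "N = Q' * r'" using Q' by (auto simp: exact_divisor_def)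
 have cr: "coprime Q r" using Q Q0 by (simp add: exact_divisor_def r)
 have cr': "coprime Q' r'" using Q' Q'0 by (simp add: exact_divisor_def r')
 have e: "q * r = q' * r'" using r r' g0 by (simp add: Qq Qq' mult.assoc)
 have "q' dvd q * r" using e by simp
 then have "q' dvd r" using cqq by (simp add: coprime_dvd_mult_right_iff coprime_commute)
 then obtain t where t: "r = q' * t" by auto
 have r't: "r' = q * t" using e q0 by (simp add: t mult.left_commute)
 have cop: "coprime g q'" "coprime g t" "coprime q q'" "coprime q t" 
  using cr by (simp_all add: Qq t coprime_mult_left_iff coprime_mult_right_iff)
 have cop': "coprime g q" "coprime q' q" "coprime q' t"
  using cr' by (simp_all add: Qq' r't coprime_mult_left_iff coprime_mult_right_iff)
 have NN: "N = g * (q * (q' * t))" by (simp add: r Qq t mult_ac)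
 have aux: "N div a = b" if "N = a * b" "a > 0" for a b
  using that by simp
 have d1: "N div (q * q') = g * t" using q0 by (intro aux) (auto simp: NN mult_ac)
 have d2: "N div g = q * (q' * t)" using g0 by (simp add: NN)
 have d3: "N div q = g * (q' * t)" using q0 by (intro aux) (auto simp: NN mult_ac)
 have d4: "N div q' = g * (q * t)" using q0 by (intro aux) (auto simp: NN mult_ac)
 note c = cop cop' cop[THEN coprime_commute[THEN iffD1]] cop'[THEN coprime_commute[THEN iffD1]]
 have dv: "q * q' dvd N" "g dvd N" "q dvd N" "q' dvd N" "g * (q * q') dvd N"
  by (rule dvdI[of _ _ "g * t"], simp add: NN mult_ac, simp add: NN,
    rule dvdI[of _ _ "g * (q' * t)"], simp add: NN mult_ac, rule dvdI[of _ _ "g * (q * t)"], simp add: NN mult_ac,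
    rule dvdI[of _ _ t], simp add: NN mult_ac)
 show "exact_divisor ((Q div g) * (Q' div g)) N" "exact_divisor g N"
  "exact_divisor (Q div g) N" "exact_divisor (Q' div g) N"
  "coprime g (Q div g)" "coprime g (Q' div g)" "coprime (Q div g) (Q' div g)"
  "g * ((Q div g) * (Q' div g)) dvd N"
  unfolding q_def[symmetric] q'_def[symmetric] exact_divisor_def d1 d2 d3 d4
  using dv c by (simp_all add: coprime_mult_left_iff coprime_mult_right_iff)
qed

text \<open>All entries of the product have the common factor gcd Q Q'; what remains has determinant
  Q Q' / gcd^2. This is why the Atkin-Lehner matrices form a group only modulo scalars.\<close>

lemma AL_mult:
 assumes N: "N > 0" and Q: "exact_divisor Q N" and Q': "exact_divisor Q' N"
  and g: "\<gamma> \<in> AL N Q" and h: "\<delta> \<in> AL N Q'"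
 shows "\<exists>e \<in> AL N ((Q div gcd Q Q') * (Q' div gcd Q Q')). imul \<gamma> \<delta> = iscale (int (gcd Q Q')) e"
proof -
 define k where "k = int (gcd Q Q')"
 define q where "q = int (Q div gcd Q Q')"
 define q' where "q' = int (Q' div gcd Q Q')"
 have k0: "k > 0" using exact_divisor_pos[OF N Q] by (simp add: k_def)
 have Qq: "int Q = k * q" "int Q' = k * q'"
  by (simp_all add: k_def q_def q'_def flip: of_nat_mult)
 obtain t where t: "int N = k * (q * q') * t"
 proof -
  have "int (gcd Q Q' * ((Q div gcd Q Q') * (Q' div gcd Q Q'))) dvd int N"
   using exact_divisor_mult(8)[OF N Q Q'] by (subst int_dvd_int_iff)
  then show ?thesis using that by (auto simp: k_def q_def q'_def dvd_def)
 qed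
 obtain a b c d where ge: "\<gamma> = (k * q * a, b, k * (q * q') * t * c, k * q * d)" and gd: "k * q * a * (k * q * d) - b * (k * (q * q') * t * c) = k * q"
  using g unfolding AL_def Qq t by (auto elim!: dvdE)
 obtain a' b' c' d' where he: "\<delta> = (k * q' * a', b', k * (q * q') * t * c', k * q' * d')"
   and hd: "k * q' * a' * (k * q' * d') - b' * (k * (q * q') * t * c') = k * q'"
  using h unfolding AL_def Qq t by (auto elim!: dvdE)
 define e where "e = (q * q' * (k * a * a' + b * t * c'), q * a * b' + b * (q' * d'), k * (q * q') * t * (q' * c * a' + q * d * c'), q * q' * (t * c * b' + k * d * d'))"
 have me: "imul \<gamma> \<delta> = iscale k e"
  by (simp add: ge he e_def algebra_simps)
 have "k\<^sup>2 * idet e = idet \<gamma> * idet \<delta>" using arg_cong[OF me, of idet] by simp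
 also have "\<dots> = k\<^sup>2 * (q * q')" using AL_idet[OF g] AL_idet[OF h] by (simp add: Qq power2_eq_square)
 finally have "idet e = q * q'" using k0 by simp
 then have "e \<in> AL N ((Q div gcd Q Q') * (Q' div gcd Q Q'))"
 proof -
  have "int ((Q div gcd Q Q') * (Q' div gcd Q Q')) = q * q'" by (simp add: q_def q'_def)
  then show ?thesis using \<open>idet e = q * q'\<close> unfolding AL_def by (auto simp: e_def t)
 qed
 with me show ?thesis unfolding k_def by blast
qed

definition icont :: "imat => int" where
 "icont g = (case g of (a, b, c, d) => gcd (gcd a b) (gcd c d))"

lemma icont_iscale: "t > 0 ==> icont (iscale t g) = t * icont g"
 by (cases g) (simp add: icont_def gcd_mult_left[symmetric] flip: gcd_mult_distrib_int)

text \<open>Dividing the determinant equation by Q expresses 1 as an integral combination of the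
  entries. A primitive matrix is determined by each of its positive multiples, and this makes
  \<open>rmul\<close> single-valued.\<close>

lemma icont_ALG:
 assumes N: "N > 0" and g: "g \<in> ALG N"
 shows "icont g = 1"
proof -
 obtain Q where Q: "exact_divisor Q N" "g \<in> AL N Q" using g by (auto simp: ALG_def)
 obtain t where t: "N = Q * t" using Q by (auto simp: exact_divisor_def)
 have Q0: "Q > 0" using exact_divisor_pos[OF N Q(1)] .
 obtain a b c d where ge: "g = (int Q * a, b, int Q * int t * c, int Q * d)"
  and gd: "int Q * a * (int Q * d) - b * (int Q * int t * c) = int Q"
  using Q(2) unfolding AL_def t by (auto elim!: dvdE)
 have "int Q * (int Q * a * d - b * int t * c) = int Q * 1" using gd by (simp add: algebra_simps)
 then have one: "int Q * a * d - b * int t * c = 1" using Q0 by (subst (asm) mult_cancel_left) auto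
 define p where "p = icont g"
 have p: "p dvd int Q * a" "p dvd b" "p dvd int Q * int t * c" "p dvd int Q * d"
  unfolding p_def icont_def ge by (auto intro: dvd_trans[OF gcd_dvd1] dvd_trans[OF gcd_dvd2])
 have "p dvd int Q * a * d - b * int t * c" using p by (intro dvd_diff) (auto intro: dvd_mult2)
 then have "p dvd 1" using one by simp
 then show ?thesis unfolding p_def icont_def by (simp add: ge)
qed

lemma ALG_iscale_eq:
 assumes N: "N > 0" and "g \<in> ALG N" "h \<in> ALG N" "s > 0" "t > 0" and eq: "iscale s g = iscale t h"
 shows "g = h"
proof -
 have "s = t" using arg_cong[OF eq, of icont] assms(4,5)
  by (simp add: icont_iscale icont_ALG[OF N assms(2)] icont_ALG[OF N assms(3)])
 then show ?thesis using eq assms by (simp add: iscale_inj)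
qed

text \<open>Right multiplication in the group \<open>ALG N\<close>, whose elements are taken modulo scalars.\<close>

definition rmul :: "nat => imat => imat => imat" where
 "rmul N h g = (SOME e. e \<in> ALG N \<and> (\<exists>t>0. imul g h = iscale t e))"

text \<open>\<sigma> is multiplicative on coprime divisors only. Splitting off gcd Q Q' from both
  arguments leaves the square of its sign, which is 1.\<close>

lemma sign_pattern_div:
 assumes N: "N > 0" and s: "sign_pattern N \<sigma>" and Q: "exact_divisor Q N" and Q': "exact_divisor Q' N"
 shows "\<sigma> ((Q div gcd Q Q') * (Q' div gcd Q Q')) = \<sigma> Q * \<sigma> Q'"
proof -
 note e = exact_divisor_mult[OF N Q Q']
 have m: "\<sigma> (A * B) = \<sigma> A * \<sigma> B" if "exact_divisor A N" "exact_divisor B N" "coprime A B" for A B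
  using s that by (auto simp: sign_pattern_def)
 have "\<sigma> Q = \<sigma> (gcd Q Q') * \<sigma> (Q div gcd Q Q')" using m[OF e(2,3,5)] by simp
 moreover have "\<sigma> Q' = \<sigma> (gcd Q Q') * \<sigma> (Q' div gcd Q Q')" using m[OF e(2,4,6)] by simp
 moreover have "\<sigma> (gcd Q Q') * \<sigma> (gcd Q Q') = 1" using s e(2) by (auto simp: sign_pattern_def)
 moreover have "a * b * (a * c) = a * a * (b * c)" for a b c :: int by (simp add: mult_ac)
 ultimately show ?thesis using m[OF e(3,4,7)] by simp
qed

lemma rmul_ex:
 assumes N: "N > 0" and g: "g \<in> ALG N" and h: "h \<in> ALG N"
 obtains e t where "e \<in> ALG N" "t > 0" "imul g h = iscale t e"
  "!!\<sigma>. sign_pattern N \<sigma> ==> chi \<sigma> e = chi \<sigma> g * chi \<sigma> h"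
proof -
 obtain Q where Q: "exact_divisor Q N" "g \<in> AL N Q" using g by (auto simp: ALG_def)
 obtain Q' where Q': "exact_divisor Q' N" "h \<in> AL N Q'" using h by (auto simp: ALG_def)
 obtain e where e: "e \<in> AL N ((Q div gcd Q Q') * (Q' div gcd Q Q'))" "imul g h = iscale (int (gcd Q Q')) e"
  using AL_mult[OF N Q(1) Q'(1) Q(2) Q'(2)] by blast
 show ?thesis
 proof (rule that[of e "int (gcd Q Q')"])
  show "e \<in> ALG N" using e(1) exact_divisor_mult(1)[OF N Q(1) Q'(1)] by (auto simp: ALG_def)
  show "int (gcd Q Q') > 0" using exact_divisor_pos[OF N Q(1)] by simp
  show "imul g h = iscale (int (gcd Q Q')) e" by fact
  show "chi \<sigma> e = chi \<sigma> g * chi \<sigma> h" if "sign_pattern N \<sigma>" for \<sigma>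
   using sign_pattern_div[OF N that Q(1) Q'(1)] chi_AL e(1) Q(2) Q'(2) by metis
 qed
qed

lemma rmul:
 assumes N: "N > 0" and g: "g \<in> ALG N" and h: "h \<in> ALG N"
 shows "rmul N h g \<in> ALG N" "\<exists>t>0. imul g h = iscale t (rmul N h g)"
  "sign_pattern N \<sigma> ==> chi \<sigma> (rmul N h g) = chi \<sigma> g * chi \<sigma> h"
proof -
 obtain e t where e: "e \<in> ALG N" "t > 0" "imul g h = iscale t e"
  "!!\<sigma>. sign_pattern N \<sigma> ==> chi \<sigma> e = chi \<sigma> g * chi \<sigma> h" using rmul_ex[OF N g h] by blast
 have *: "rmul N h g \<in> ALG N \<and> (\<exists>t>0. imul g h = iscale t (rmul N h g))"
  unfolding rmul_def by (rule someI[of _ e]) (use e in blast)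
 then obtain s where s: "s > 0" "imul g h = iscale s (rmul N h g)" by blast
 have "rmul N h g = e" by (rule ALG_iscale_eq[OF N _ e(1) s(1) e(2)]) (use * s e in auto)
 with e * show "rmul N h g \<in> ALG N" "\<exists>t>0. imul g h = iscale t (rmul N h g)"
  "sign_pattern N \<sigma> ==> chi \<sigma> (rmul N h g) = chi \<sigma> g * chi \<sigma> h" by auto
qed

lemma rmul_rmul_iadj:
 assumes N: "N > 0" and g: "g \<in> ALG N" and h: "h \<in> ALG N"
 shows "rmul N (iadj h) (rmul N h g) = g"
proof -
 obtain s where s: "s > 0" "imul g h = iscale s (rmul N h g)" using rmul(2)[OF N g h] by blast
 note r = rmul(1)[OF N g h]
 obtain t where t: "t > 0" "imul (rmul N h g) (iadj h) = iscale t (rmul N (iadj h) (rmul N h g))"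
  using rmul(2)[OF N r iadj_ALG[OF h]] by blast
 have "iscale (s * t) (rmul N (iadj h) (rmul N h g)) = iscale s (imul (rmul N h g) (iadj h))"
  by (simp add: t(2) iscale_iscale)
 also have "\<dots> = imul (imul g h) (iadj h)" by (simp add: s(2) imul_iscale)
 also have "\<dots> = iscale (idet h) g" by (simp add: imul_assoc imul_iadj(1) imul_iscale del: iscale.simps)
 finally have eq: "iscale (s * t) (rmul N (iadj h) (rmul N h g)) = iscale (idet h) g" .
 show ?thesis
  by (rule ALG_iscale_eq[OF N rmul(1)[OF N r iadj_ALG[OF h]] g _ _ eq]) (use s t ALG_idet_pos[OF N h] in auto)
qed

text \<open>For reindexing sums over the group by a translation; \<open>iadj h\<close> is the
  inverse of h up to a scalar.\<close>

lemma bij_rmul: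
 assumes N: "N > 0" and h: "h \<in> ALG N"
 shows "bij_betw (rmul N h) (ALG N) (ALG N)"
proof (rule bij_betwI[of _ _ _ "rmul N (iadj h)"])
 show "rmul N h (rmul N (iadj h) g) = g" if "g \<in> ALG N" for g
  using rmul_rmul_iadj[OF N that iadj_ALG[OF h]] by simp
qed (use rmul rmul_rmul_iadj N h iadj_ALG in auto)

lemma imob_rmul:
 assumes N: "N > 0" and g: "g \<in> ALG N" and h: "h \<in> ALG N" and z: "Im z > 0"
 shows "imob (rmul N h g) z = imob g (imob h z)"
proof -
 obtain s where s: "s > 0" "imul g h = iscale s (rmul N h g)" using rmul(2)[OF N g h] by blast
 have "imob (rmul N h g) z = imob (imul g h) z" using s by (simp add: imob_iscale)
 also have "\<dots> = imob g (imob h z)" by (rule imob_imul) (rule iden_nonzero[OF z ALG_idet_pos[OF N h]])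
 finally show ?thesis .
qed

lemma kap_rmul:
 assumes N: "N > 0" and g: "g \<in> ALG N" and h: "h \<in> ALG N"
 shows "kap n (rmul N h g) z w = kap n (imul g h) z w"
proof -
 obtain s where s: "s > 0" "imul g h = iscale s (rmul N h g)" using rmul(2)[OF N g h] by blast
 then show ?thesis by (simp add: kap_iscale)
qed

text \<open>Bezout for Q and N/Q. It ensures that the choice in \<open>atkin_lehner\<close> yields a
  matrix of determinant Q.\<close>

lemma AL_nonempty:
 assumes N: "N > 0" and Q: "exact_divisor Q N"
 shows "\<exists>x y z w. (int Q * x) * (int Q * w) - y * (int N * z) = int Q"
proof -
 obtain t where t: "N = Q * t" using Q by (auto simp: exact_divisor_def)
 have "coprime Q t" using Q exact_divisor_pos[OF N Q] by (simp add: exact_divisor_def t)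
 then have "coprime (int Q) (int t)" by simp
 then obtain u v where uv: "u * int Q + v * int t = 1" using bezout_int[of "int Q" "int t"] by auto
 have "(int Q * u) * (int Q * 1) - (- v) * (int N * 1) = int Q * (u * int Q + v * int t)"
  by (simp add: t algebra_simps)
 then have "(int Q * u) * (int Q * 1) - (- v) * (int N * 1) = int Q" using uv by simp
 then show ?thesis by blast
qed

lemma atkin_lehner_eq:
 assumes N: "N > 0" and Q: "exact_divisor Q N"
 shows "\<exists>g\<in>AL N Q. atkin_lehner (2 * n) N Q f = sl n g f"
proof -
 define P where "P = (\<lambda>(x, y, z, w). (int Q * x) * (int Q * w) - y * (int N * z) = int Q)"
 have ex: "\<exists>p. P p" using AL_nonempty[OF N Q] by (auto simp: P_def)
 obtain x y z w where p: "(SOME p. P p) = (x, y, z, w)" by (cases "SOME p. P p")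
 have "P (x, y, z, w)" using someI_ex[OF ex] p by simp
 then have e: "(int Q * x) * (int Q * w) - y * (int N * z) = int Q" by (simp add: P_def)
 have "atkin_lehner (2 * n) N Q f = slash (2 * n) (int Q * x) y (int N * z) (int Q * w) f"
  unfolding atkin_lehner_def using p unfolding P_def by simp
 also have "\<dots> = sl n (int Q * x, y, int N * z, int Q * w) f"
  by (rule slash_eq_sl) (use e exact_divisor_pos[OF N Q] in simp)
 finally show ?thesis using e by (intro bexI[of _ "(int Q * x, y, int N * z, int Q * w)"]) (auto simp: AL_def)
qed

section \<open>Hecke matrices: representatives and commutation with the group\<close>

definition HB :: "nat => imat set" where
 "HB m = {(a, b, c, d). a > 0 \<and> d > 0 \<and> c = 0 \<and> a * d = int m \<and> 0 \<le> b \<and> b < d}"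

lemma HB_idet: "g \<in> HB m ==> idet g = int m"
 by (auto simp: HB_def)

lemma HB_bij: "m > 0 ==> bij_betw (\<lambda>(d, b). (int (m div d), int b, 0, int d)) (SIGMA d:{d. d dvd m}. {..<d}) (HB m)"
proof (rule bij_betwI[of _ _ _ "\<lambda>(a, b, c, d). (nat d, nat b)"], goal_cases)
 case 1
 then show ?case by (auto simp: HB_def dvd_div_eq_0_iff dest: dvd_pos_nat intro!: Nat.gr0I simp flip: of_nat_mult)
next
 case 2
 have "nat d dvd m" if "a * d = int m" "d > 0" for a d
 proof -
  have "d dvd int m" using that by (metis dvd_triv_right)
  then show ?thesis using that by (simp add: nat_dvd_iff)
 qed
 then show ?case by (auto simp: HB_def nat_less_iff)
next
 case (3 x)
 then show ?case by auto
next
 case (4 y)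
 then obtain a b d where y: "y = (a, b, 0, d)" "a > 0" "d > 0" "a * d = int m" "0 \<le> b" "b < d" by (auto simp: HB_def)
 have "int (m div nat d) = a" using y by (simp add: zdiv_int flip: y(4))
 then show ?case using y by simp
qed

lemma finite_HB: "m > 0 ==> finite (HB m)"
 using HB_bij[of m] by (rule bij_betw_finite[THEN iffD1]) auto

text \<open>For k = 2 n the two normalising factors multiply to m^(n - 1/2). The slash action of a
  matrix of determinant m carries m^n, so 1 / sqrt m is left over.\<close>

lemma hecke_normalized_eq:
 assumes m: "m > 0" and n: "n > 0"
 shows "hecke_normalized (2 * n) m f = (\<lambda>z. of_real (1 / sqrt (real m)) * (\<Sum>g\<in>HB m. sl n g f z))"
proof
 fix z
 have fin: "finite {d. d dvd m}" using m by simp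
 have "(\<Sum>g\<in>HB m. sl n g f z) = (\<Sum>(d, b)\<in>(SIGMA d:{d. d dvd m}. {..<d}). sl n (int (m div d), int b, 0, int d) f z)"
  by (rule sum.reindex_bij_betw[OF HB_bij[OF m], symmetric, THEN trans]) (simp add: case_prod_beta)
 also have "\<dots> = (\<Sum>d | d dvd m. \<Sum>b<d. sl n (int (m div d), int b, 0, int d) f z)"
  by (rule sum.Sigma[symmetric]) (use fin in auto)
 also have "\<dots> = (\<Sum>d | d dvd m. \<Sum>b<d. of_nat m ^ n * (f ((of_nat (m div d) * z + of_nat b) / of_nat d) / of_nat d ^ (2 * n)))"
  by (intro sum.cong refl) (simp add: sl_def flip: of_nat_mult)
 also have "\<dots> = of_nat m ^ n * (\<Sum>d | d dvd m. (\<Sum>b<d. f ((of_nat (m div d) * z + of_nat b) / of_nat d) / of_nat d ^ (2 * n)))"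
  by (simp add: sum_distrib_left)
 finally have S: "(\<Sum>g\<in>HB m. sl n g f z) = \<dots>" .
 have "real m powr (- ((real (2 * n) - 1) / 2)) * real m ^ (2 * n - 1) = 1 / sqrt (real m) * real m ^ n"
 proof -
  have "real m powr (- ((real (2 * n) - 1) / 2)) * real m ^ (2 * n - 1) = real m powr (- ((real (2 * n) - 1) / 2)) * real m powr real (2 * n - 1)"
   using m by (simp add: powr_realpow)
  also have "\<dots> = real m powr (real n - 1 / 2)"
   using m n by (simp add: powr_add[symmetric] of_nat_diff field_simps)
  also have "\<dots> = 1 / sqrt (real m) * real m ^ n"
   using m by (simp add: powr_diff powr_realpow powr_half_sqrt)
  finally show ?thesis .
 qed
 note h = this
 have "complex_of_real (real m powr (- ((real (2 * n) - 1) / 2))) * of_nat m ^ (2 * n - 1) = of_real (1 / sqrt (real m)) * of_nat m ^ n"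
 proof -
  have "complex_of_real (real m powr (- ((real (2 * n) - 1) / 2)) * real m ^ (2 * n - 1)) = complex_of_real (1 / sqrt (real m) * real m ^ n)"
   by (simp only: h)
  then show ?thesis by (simp only: of_real_mult of_real_power of_real_of_nat_eq)
 qed
 then show "hecke_normalized (2 * n) m f z = of_real (1 / sqrt (real m)) * (\<Sum>g\<in>HB m. sl n g f z)"
  unfolding S hecke_normalized_def hecke_def cscale_def by (simp only: mult.assoc[symmetric])
qed

text \<open>The first column determines the upper triangular factor. With q removed from its lower
  entry its gcd is h, which divides m, so it is prime to N and divides \<open>a1\<close> and
  \<open>c2\<close>. Bezout completes the remaining column to a matrix of \<open>AL N Q\<close>, and
  \<open>r\<close> is the quotient that brings the upper right entry of \<beta> below
  \<open>d'\<close>.\<close>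

lemma Hecke_decompose:
 assumes N: "N > 0" and Q: "exact_divisor Q N" and m: "m > 0" and cop: "coprime N m"
  and g: "int Q dvd a" "int Q dvd d" "int N dvd c" "a * d - b * c = int Q * int m"
 shows "\<exists>\<gamma>\<in>AL N Q. \<exists>\<beta>\<in>HB m. (a, b, c, d) = imul \<gamma> \<beta>"
proof -
 define q where "q = int Q"
 obtain t' where t': "N = Q * t'" using Q by (auto simp: exact_divisor_def)
 define t where "t = int t'"
 have Q0: "q > 0" using exact_divisor_pos[OF N Q] by (simp add: q_def)
 have Nqt: "int N = q * t" by (simp add: t' q_def t_def)
 have "coprime Q t'" using Q exact_divisor_pos[OF N Q] by (simp add: exact_divisor_def t')
 then have cqt: "coprime q t" by (simp add: q_def t_def)
 have "coprime (int N) (int m)" using cop by simp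
 then have cqm: "coprime q (int m)" and ctm: "coprime t (int m)"
  by (simp_all add: Nqt coprime_mult_left_iff)
 obtain a1 d1 c2 where abc: "a = q * a1" "d = q * d1" "c = q * t * c2"
  using g unfolding Nqt q_def[symmetric] by (auto elim!: dvdE)
 have "q * (q * a1 * d1 - b * (t * c2)) = q * int m" using g(4) by (simp add: abc q_def algebra_simps)
 then have det: "q * a1 * d1 - b * (t * c2) = int m" using Q0 by (subst (asm) mult_cancel_left) auto
 define h where "h = gcd (q * a1) (t * c2)"
 have hm: "h dvd int m" unfolding det[symmetric] h_def by (intro dvd_diff) (auto intro: dvd_mult2 dvd_mult)
 have h0: "h > 0"
 proof -
  have "h \<noteq> 0" using hm m by auto
  then show ?thesis unfolding h_def by (simp add: order_less_le)
 qed
 have chq: "coprime h q" and cht: "coprime h t"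
  using cqm ctm hm by (meson coprime_commute coprime_divisors dvd_refl)+
 have "h dvd a1" using chq by (metis h_def gcd_dvd1 coprime_dvd_mult_right_iff)
 moreover have "h dvd c2" using cht by (metis h_def gcd_dvd2 coprime_dvd_mult_right_iff)
 ultimately obtain x z where xz: "a1 = h * x" "c2 = h * z" by (auto elim!: dvdE)
 have "coprime (q * x) (t * z)"
 proof -
  have "gcd (h * (q * x)) (h * (t * z)) = h" using h_def by (simp add: xz mult_ac)
  then have "h * gcd (q * x) (t * z) = h * 1" using h0 by (simp add: gcd_mult_distrib_int[symmetric])
  then show ?thesis using h0 by (simp only: mult_cancel_left coprime_iff_gcd_eq_1) auto
 qed
 then obtain u v where uv: "u * (q * x) + v * (t * z) = 1" using bezout_int[of "q * x" "t * z"] by auto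
 define d' where "d' = q * x * d1 - t * z * b"
 define b' where "b' = u * b + v * d1"
 have "h * d' = int m" using det by (simp add: d'_def xz algebra_simps)
 then have d'0: "d' > 0" using m h0 by (metis of_nat_0_less_iff zero_less_mult_pos)
 define r where "r = b' div d'"
 define \<beta> where "\<beta> = (h, b' mod d', 0::int, d')"
 define \<gamma> where "\<gamma> = (q * x, - v + r * (q * x), q * t * z, q * u + r * (q * t * z))"
 have "\<beta> \<in> HB m" using h0 d'0 \<open>h * d' = int m\<close> by (auto simp: \<beta>_def HB_def)
 moreover have "\<gamma> \<in> AL N Q"
 proof -
  have "q * x * (q * u + r * (q * t * z)) - (- v + r * (q * x)) * (q * t * z) = q * (u * (q * x) + v * (t * z))"
   by (simp add: algebra_simps)
  then show ?thesis unfolding AL_def \<gamma>_def q_def[symmetric] Nqt using uv by auto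
 qed
 moreover have "(a, b, c, d) = imul \<gamma> \<beta>"
 proof -
  have bm: "r * d' + b' mod d' = b'" by (simp add: r_def)
  have e1: "q * x * (b' mod d') + (- v + r * (q * x)) * d' = q * x * (r * d' + b' mod d') - v * d'"
   by (simp add: algebra_simps)
  have e2: "q * t * z * (b' mod d') + (q * u + r * (q * t * z)) * d' = q * (t * z * (r * d' + b' mod d') + u * d')"
   by (simp add: algebra_simps)
  have "q * x * b' - v * d' = (u * (q * x) + v * (t * z)) * b"
   by (simp add: b'_def d'_def algebra_simps)
  moreover have "t * z * b' + u * d' = (u * (q * x) + v * (t * z)) * d1"
   by (simp add: b'_def d'_def algebra_simps)
  ultimately show ?thesis unfolding \<gamma>_def \<beta>_def imul.simps e1 e2 bm uv
   by (simp add: abc xz)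
 qed
 ultimately show ?thesis by blast
qed

lemma HB_unique:
 assumes "\<beta> \<in> HB m" "\<beta>' \<in> HB m" "idet \<epsilon> = 1" "\<beta> = imul \<epsilon> \<beta>'"
 shows "\<beta> = \<beta>'"
proof -
 obtain a b d where B: "\<beta> = (a, b, 0, d)" "a > 0" "d > 0" "a * d = int m" "0 \<le> b" "b < d"
  using assms(1) by (auto simp: HB_def)
 obtain a' b' d' where B': "\<beta>' = (a', b', 0, d')" "a' > 0" "d' > 0" "a' * d' = int m" "0 \<le> b'" "b' < d'"
  using assms(2) by (auto simp: HB_def)
 obtain p q r s where e: "\<epsilon> = (p, q, r, s)" by (cases \<epsilon>)
 have eqs: "a = p * a'" "b = p * b' + q * d'" "0 = r * a'" "d = r * b' + s * d'"
  using assms(4) by (simp_all add: B B' e)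
 have r: "r = 0" using eqs(3) B' by simp
 have ps: "p * s = 1" using assms(3) by (simp add: e r)
 have "p > 0" using eqs(1) B B' by (metis zero_less_mult_pos2)
 then have p1: "p = 1" "s = 1" using ps by (auto simp: zmult_eq_1_iff)
 have "d = d'" "a = a'" using eqs p1 r by auto
 moreover have "b = b'"
 proof -
  have "\<bar>q * d'\<bar> < d'" using eqs(2) p1 B B' \<open>d = d'\<close> by auto
  then have "\<bar>q\<bar> * d' < 1 * d'" using B' by (simp add: abs_mult)
  then have "q = 0" using B' by (simp only: mult_less_cancel_right) auto
  then show ?thesis using eqs(2) p1 by simp
 qed
 ultimately show ?thesis by (simp add: B B')
qed

text \<open>The product \<beta> \<gamma> satisfies the divisibilities of
  \<open>Hecke_decompose\<close>, so \<gamma> moves to the left, within the same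
  \<open>AL N Q\<close>. Two \<beta> with the same image differ by a left factor of determinant 1
  and agree by \<open>HB_unique\<close>; finiteness then gives surjectivity.\<close>

lemma Hecke_commute:
 assumes N: "N > 0" and m: "m > 0" and cop: "coprime N m"
  and Q: "exact_divisor Q N" and g: "\<gamma> \<in> AL N Q"
 obtains p where "bij_betw p (HB m) (HB m)" "!!\<beta>. \<beta> \<in> HB m ==> \<exists>\<gamma>'\<in>AL N Q. imul \<beta> \<gamma> = imul \<gamma>' (p \<beta>)"
proof -
 have ex: "\<exists>\<beta>'\<in>HB m. \<exists>\<gamma>'\<in>AL N Q. imul \<beta> \<gamma> = imul \<gamma>' \<beta>'" if b: "\<beta> \<in> HB m" for \<beta>
 proof -
  obtain p q s where B: "\<beta> = (p, q, 0, s)" using b by (auto simp: HB_def)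
  obtain a b c d where G: "\<gamma> = (a, b, c, d)" by (cases \<gamma>)
  have G': "int Q dvd a" "int N dvd c" "int Q dvd d" "a * d - b * c = int Q" using g by (auto simp: AL_def G)
  have QN: "int Q dvd int N" using Q by (simp add: exact_divisor_def)
  have "\<exists>\<gamma>'\<in>AL N Q. \<exists>\<beta>'\<in>HB m. (p * a + q * c, p * b + q * d, s * c, s * d) = imul \<gamma>' \<beta>'"
  proof (rule Hecke_decompose[OF N Q m cop])
   show "int Q dvd p * a + q * c" using G' QN by (intro dvd_add dvd_mult) (auto intro: dvd_trans)
   show "(p * a + q * c) * (s * d) - (p * b + q * d) * (s * c) = int Q * int m"
   proof -
    have "(p * a + q * c) * (s * d) - (p * b + q * d) * (s * c) = (p * s) * (a * d - b * c)"
     by (simp add: algebra_simps)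
    moreover have "p * s = int m" using HB_idet[OF b] by (simp add: B)
    ultimately show ?thesis using G'(4) by simp
   qed
  qed (use G' in auto)
  moreover have "imul \<beta> \<gamma> = (p * a + q * c, p * b + q * d, s * c, s * d)" by (simp add: B G)
  ultimately show ?thesis by auto
 qed
 then obtain p where p: "!!\<beta>. \<beta> \<in> HB m ==> p \<beta> \<in> HB m \<and> (\<exists>\<gamma>'\<in>AL N Q. imul \<beta> \<gamma> = imul \<gamma>' (p \<beta>))"
  by metis
 have inj: "inj_on p (HB m)"
 proof (rule inj_onI)
  fix \<beta>1 \<beta>2 assume b: "\<beta>1 \<in> HB m" "\<beta>2 \<in> HB m" "p \<beta>1 = p \<beta>2"
  obtain g1 where g1: "g1 \<in> AL N Q" "imul \<beta>1 \<gamma> = imul g1 (p \<beta>1)" using p[OF b(1)] by blast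
  obtain g2 where g2: "g2 \<in> AL N Q" "imul \<beta>2 \<gamma> = imul g2 (p \<beta>1)" using p[OF b(2)] b(3) by auto
  have Q0: "int Q > 0" using exact_divisor_pos[OF N Q] by simp
  obtain e where e: "e \<in> AL N 1" "imul g1 (iadj g2) = iscale (int Q) e"
   using AL_mult[OF N Q Q g1(1) iadj_AL[OF g2(1)]] exact_divisor_pos[OF N Q] by auto
  have "imul (imul (imul g1 (iadj g2)) \<beta>2) \<gamma> = imul g1 (imul (imul (iadj g2) g2) (p \<beta>1))"
   by (simp add: imul_assoc g2(2))
  also have "\<dots> = iscale (int Q) (imul \<beta>1 \<gamma>)"
   by (simp add: imul_iadj(2) AL_idet[OF g2(1)] imul_iscale g1(2) del: iscale.simps)
  finally have "iscale (int Q) (imul (imul e \<beta>2) \<gamma>) = iscale (int Q) (imul \<beta>1 \<gamma>)"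
   by (simp add: e(2) imul_iscale)
  then have "imul (imul e \<beta>2) \<gamma> = imul \<beta>1 \<gamma>" using Q0 by (simp add: iscale_inj)
  then have "imul (imul (imul e \<beta>2) \<gamma>) (iadj \<gamma>) = imul (imul \<beta>1 \<gamma>) (iadj \<gamma>)" by simp
  then have "iscale (int Q) (imul e \<beta>2) = iscale (int Q) \<beta>1"
   by (simp add: imul_assoc imul_iadj(1) AL_idet[OF g] imul_iscale del: iscale.simps)
  then have "\<beta>1 = imul e \<beta>2" using Q0 by (simp add: iscale_inj)
  then show "\<beta>1 = \<beta>2" using HB_unique[OF b(1,2)] AL_idet[OF e(1)] by simp
 qed
 have "p ` HB m = HB m" by (rule endo_inj_surj[OF finite_HB[OF m] _ inj]) (use p in auto)
 then have "bij_betw p (HB m) (HB m)" using inj by (simp add: bij_betw_def)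
 then show ?thesis using that p by blast
qed

subsection \<open>A fundamental domain\<close>

lemma measurable_nn_integral_count_space:
 assumes A: "countable A" and f: "!!a. a \<in> A ==> f a \<in> borel_measurable M"
 shows "(\<lambda>x. \<integral>\<^sup>+a. f a x \<partial>count_space A) \<in> borel_measurable M"
proof -
 interpret sigma_finite_measure "count_space A" by (rule sigma_finite_measure_count_space_countable[OF A])
 have "(\<lambda>p. f (fst p) (snd p)) \<in> borel_measurable (count_space A \<Otimes>\<^sub>M M)"
  by (rule measurable_pair_measure_countable1[OF A]) (use f in simp)
 from measurable_pair_swap[OF this]
 have "(\<lambda>(x, a). f a x) \<in> borel_measurable (M \<Otimes>\<^sub>M count_space A)" by (simp add: case_prod_beta')
 then show ?thesis by (rule borel_measurable_nn_integral)
qed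

lemma finite_linear_forms:
 assumes w: "Im w > 0"
 shows "finite {p :: int \<times> int. cmod (of_int (fst p) * w + of_int (snd p)) \<le> M}"
proof -
 define K where "K = \<lceil>M / Im w\<rceil> + \<lceil>M + M / Im w * cmod w\<rceil>"
 have sub: "p \<in> {- \<lceil>M / Im w\<rceil>..\<lceil>M / Im w\<rceil>} \<times> {- \<lceil>M + M / Im w * cmod w\<rceil>..\<lceil>M + M / Im w * cmod w\<rceil>}"
  if "cmod (of_int (fst p) * w + of_int (snd p)) \<le> M" for p :: "int \<times> int"
 proof -
  have "\<bar>Im (of_int (fst p) * w + of_int (snd p))\<bar> \<le> M" using abs_Im_le_cmod that order_trans by blast
  then have "\<bar>real_of_int (fst p)\<bar> * Im w \<le> M" using w by (simp add: abs_mult)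
  then have 1: "\<bar>real_of_int (fst p)\<bar> \<le> M / Im w" using w by (simp add: field_simps)
  have "\<bar>real_of_int (snd p)\<bar> = cmod (of_int (snd p))" by simp
  also have "\<dots> = cmod ((of_int (fst p) * w + of_int (snd p)) - of_int (fst p) * w)" by simp
  also have "\<dots> \<le> M + cmod (of_int (fst p) * w)" using that norm_triangle_ineq4 order_trans by (metis add_mono_thms_linordered_semiring(3))
  also have "\<dots> \<le> M + M / Im w * cmod w" using mult_right_mono[OF 1, of "cmod w"] by (simp add: norm_mult)
  finally have 2: "\<bar>real_of_int (snd p)\<bar> \<le> M + M / Im w * cmod w" .
  have "\<bar>real_of_int (fst p)\<bar> \<le> of_int \<lceil>M / Im w\<rceil>" "\<bar>real_of_int (snd p)\<bar> \<le> of_int \<lceil>M + M / Im w * cmod w\<rceil>"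
   using 1 2 le_of_int_ceiling order_trans by blast+
  then have "\<bar>fst p\<bar> \<le> \<lceil>M / Im w\<rceil>" "\<bar>snd p\<bar> \<le> \<lceil>M + M / Im w * cmod w\<rceil>" by linarith+
  then show ?thesis by (cases p) auto
 qed
 show ?thesis by (rule finite_subset[of _ "{- \<lceil>M / Im w\<rceil>..\<lceil>M / Im w\<rceil>} \<times> {- \<lceil>M + M / Im w * cmod w\<rceil>..\<lceil>M + M / Im w * cmod w\<rceil>}"]) (use sub in auto)
qed

text \<open>A Siegel set for the full modular group. The height 4/5 is a rational number below sqrt
  3 / 2; overlaps of translates are compensated by \<open>fphi\<close>.\<close>

definition sieg :: "complex set" where
 "sieg = {z. \<bar>Re z\<bar> \<le> 1 / 2 \<and> Im z \<ge> 4 / 5}"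

lemma sieg_measurable [measurable]: "sieg \<in> sets borel"
 unfolding sieg_def by measurable

lemma sieg_Im_pos: "z \<in> sieg ==> Im z > 0"
 by (auto simp: sieg_def)

text \<open>Among the nonzero integral forms c z + d one has least modulus; it is primitive, hence
  the bottom row of some g, and a translation arranges |Re (g z)| \<le> 1/2. The top row is a
  nonzero form as well, whence |g z| \<ge> 1 by minimality and Im^2 \<ge> 3/4 \<ge> (4/5)^2.\<close>

lemma sieg_cover:
 assumes z: "Im z > 0"
 shows "\<exists>g. idet g = 1 \<and> imob g z \<in> sieg"
proof -
 define nm where "nm p = cmod (of_int (fst p) * z + of_int (snd p))" for p :: "int \<times> int"
 define S where "S = {p. p \<noteq> (0, 0) \<and> nm p \<le> 1}"
 have fS: "finite S" unfolding S_def nm_def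
  by (rule finite_subset[OF _ finite_linear_forms[OF z, of 1]]) auto
 have "(0, 1) \<in> S" by (auto simp: S_def nm_def)
 then obtain p where p: "p \<in> S" and pmin: "!!q. q \<in> S ==> nm p \<le> nm q"
  using arg_min_if_finite[OF fS, of nm] by (metis empty_iff not_le)
 have min: "nm p \<le> nm q" if "q \<noteq> (0, 0)" for q
  using pmin[of q] p that by (cases "nm q \<le> 1") (auto simp: S_def)
 obtain c d where cd: "p = (c, d)" by (cases p)
 have cd0: "(c, d) \<noteq> (0, 0)" using p by (auto simp: S_def cd)
 have pos: "nm q > 0" if q: "q \<noteq> (0, 0)" for q
 proof -
  have "of_int (fst q) * z + of_int (snd q) \<noteq> 0"
  proof
   assume h: "of_int (fst q) * z + of_int (snd q) = 0"
   then have "Im (of_int (fst q) * z + of_int (snd q)) = 0" by simp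
   then have "fst q = 0" using z by simp
   with h q show False by (cases q) auto
  qed
  then show ?thesis by (simp add: nm_def)
 qed
 define t where "t = gcd c d"
 have t0: "t > 0" using cd0 by (simp add: t_def)
 obtain c' d' where c'd': "c = t * c'" "d = t * d'" unfolding t_def by (meson dvdE gcd_dvd1 gcd_dvd2)
 have "nm (c, d) = of_int t * nm (c', d')"
 proof -
  have "of_int c * z + of_int d = of_int t * (of_int c' * z + of_int d')" by (simp add: c'd' algebra_simps)
  then show ?thesis using t0 by (simp add: nm_def norm_mult)
 qed
 moreover have "(c', d') \<noteq> (0, 0)" using cd0 c'd' by auto
 ultimately have "of_int t * nm (c', d') \<le> 1 * nm (c', d')" "nm (c', d') > 0"
  using min[of "(c', d')"] pos[of "(c', d')"] by (simp_all add: cd)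
 then have "real_of_int t \<le> 1" by (metis mult_le_cancel_right not_less_iff_gr_or_eq)
 then have "t = 1" using t0 by linarith
 then have "gcd c d = 1" by (simp add: t_def)
 then obtain u v where uv: "u * c + v * d = 1" using bezout_int[of c d] by auto
 define w where "w = imob (v, - u, c, d) z"
 have dw: "idet (v, - u, c, d) = 1" using uv by (simp add: algebra_simps)
 define k where "k = \<lfloor>1 / 2 - Re w\<rfloor>"
 define g where "g = (v + k * c, - u + k * d, c, d)"
 have dg: "idet g = 1" using uv by (simp add: g_def algebra_simps)
 have n0: "of_int c * z + of_int d \<noteq> 0" using pos[OF cd0] by (simp add: nm_def)
 have gw: "imob g z = w + of_int k"
  using n0 by (simp add: g_def w_def field_simps)
 have Re: "\<bar>Re (imob g z)\<bar> \<le> 1 / 2" 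
 proof -
  have "of_int k \<le> 1 / 2 - Re w" "1 / 2 - Re w < of_int k + 1" unfolding k_def by linarith+
  moreover have "Re (imob g z) = Re w + of_int k" by (simp only: gw) simp
  ultimately show ?thesis unfolding abs_le_iff by linarith
 qed
 have Im: "Im (imob g z) > 0" by (rule Im_imob_pos) (use z dg in auto)
 have "(v + k * c, - u + k * d) \<noteq> (0, 0)"
 proof
  assume "(v + k * c, - u + k * d) = (0, 0)"
  then have "idet g = 0" by (simp add: g_def)
  then show False using dg by simp
 qed
 from min[OF this] have "nm (c, d) \<le> nm (v + k * c, - u + k * d)" by (simp add: cd)
 then have "cmod (imob g z) \<ge> 1" using pos[OF cd0] by (simp add: g_def nm_def norm_divide)
 then have "1 \<le> (cmod (imob g z))\<^sup>2" by simp
 also have "\<dots> = (Re (imob g z))\<^sup>2 + (Im (imob g z))\<^sup>2" by (rule cmod_power2)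
 also have "(Re (imob g z))\<^sup>2 \<le> (1 / 2)\<^sup>2" using power_mono[OF Re, of 2] by simp
 finally have "(4 / 5)\<^sup>2 \<le> (Im (imob g z))\<^sup>2" by (simp add: power2_eq_square)
 then have "4 / 5 \<le> Im (imob g z)" by (rule power2_le_imp_le) (use Im in linarith)
 then show ?thesis using dg Re by (intro exI[of _ g]) (simp add: sieg_def)
qed

text \<open>The height of g w being at least 4/5 bounds |c w + d| from above by \<open>M1\<close>,
  integrality bounds it from below by \<open>m\<close>, and then the numerator is bounded by
  \<open>M2\<close>. Only finitely many integral forms have bounded modulus at w.\<close>

lemma finite_sieg_translates:
 assumes w: "Im w > 0"
 shows "finite {g. 1 \<le> idet g \<and> idet g \<le> K \<and> imob g w \<in> sieg}"
proof -
 define v where "v = Im w"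
 define M1 where "M1 = sqrt (5 / 4 * of_int K * v)"
 define m where "m = min v 1"
 define M2 where "M2 = 1 / 2 * M1 + of_int K * v / m"
 have v: "v > 0" "m > 0" using w by (simp_all add: v_def m_def)
 let ?L = "\<lambda>p :: int \<times> int. cmod (of_int (fst p) * w + of_int (snd p))"
 have fin: "finite {p. ?L p \<le> M}" for M by (rule finite_linear_forms[OF w])
 define f where "f = (\<lambda>(p :: int \<times> int, q :: int \<times> int). (fst p, snd p, fst q, snd q))"
 have "{g. 1 \<le> idet g \<and> idet g \<le> K \<and> imob g w \<in> sieg} \<subseteq> f ` ({p. ?L p \<le> M2} \<times> {p. ?L p \<le> M1})"
 proof
  fix g assume "g \<in> {g. 1 \<le> idet g \<and> idet g \<le> K \<and> imob g w \<in> sieg}"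
  then have g: "1 \<le> idet g" "idet g \<le> K" "imob g w \<in> sieg" by auto
  obtain a b c d where ge: "g = (a, b, c, d)" by (cases g)
  define D where "D = real_of_int (idet g)"
  have D: "1 \<le> D" "D \<le> of_int K" using g by (simp_all add: D_def)
  define j where "j = iden g w"
  have j0: "cmod j > 0" using iden_nonzero[OF w] g by (simp add: j_def)
  have I: "Im (imob g w) = D * v / (cmod j)\<^sup>2" by (simp add: Im_imob D_def v_def j_def)
  have s: "\<bar>Re (imob g w)\<bar> \<le> 1 / 2" "Im (imob g w) \<ge> 4 / 5" using g(3) by (auto simp: sieg_def)
  have "4 / 5 * (cmod j)\<^sup>2 \<le> D * v" using s(2) j0 unfolding I by (simp add: field_simps)
  also have "\<dots> \<le> of_int K * v" using D v by simp
  finally have "(cmod j)\<^sup>2 \<le> 5 / 4 * of_int K * v" by simp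
  then have jM: "cmod j \<le> M1" unfolding M1_def using real_le_rsqrt by blast
  have jm: "cmod j \<ge> m"
  proof (cases "c = 0")
   case True
   then have "d \<noteq> 0" using g by (auto simp: ge)
   then have "1 \<le> \<bar>real_of_int d\<bar>" by linarith
   then show ?thesis using True by (simp add: j_def ge m_def)
  next
   case False
   then have "1 \<le> \<bar>real_of_int c\<bar>" by linarith
   then have "1 * v \<le> \<bar>real_of_int c\<bar> * v" using v by (intro mult_right_mono) auto
   also have "\<dots> = \<bar>Im j\<bar>" using v by (simp add: j_def ge v_def abs_mult)
   also have "\<dots> \<le> cmod j" by (rule abs_Im_le_cmod)
   finally show ?thesis by (simp add: m_def)
  qed
  have num: "of_int a * w + of_int b = imob g w * j" using j0 by (simp add: ge j_def)
  have "cmod (of_int a * w + of_int b) = cmod (imob g w) * cmod j" by (simp add: num norm_mult)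
  also have "\<dots> \<le> (1 / 2 + D * v / (cmod j)\<^sup>2) * cmod j"
  proof (rule mult_right_mono)
   have "cmod (imob g w) \<le> \<bar>Re (imob g w)\<bar> + \<bar>Im (imob g w)\<bar>" by (rule cmod_le)
   then show "cmod (imob g w) \<le> 1 / 2 + D * v / (cmod j)\<^sup>2" using s I by linarith
  qed simp
  also have "\<dots> = 1 / 2 * cmod j + D * v / cmod j" using j0 by (simp add: algebra_simps power2_eq_square)
  also have "\<dots> \<le> M2" unfolding M2_def using jM jm D v j0 by (intro add_mono mult_mono frac_le) auto
  finally have "?L (a, b) \<le> M2" by simp
  moreover have "?L (c, d) \<le> M1" using jM by (simp add: j_def ge)
  ultimately show "g \<in> f ` ({p. ?L p \<le> M2} \<times> {p. ?L p \<le> M1})"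
   by (intro image_eqI[of _ _ "((a, b), (c, d))"]) (auto simp: f_def ge)
 qed
 then show ?thesis using fin by (meson finite_SigmaI finite_imageI finite_subset)
qed

definition cosets :: "nat => imat set" where
 "cosets N = (SOME R. finite R \<and> (\<forall>r\<in>R. idet r = 1) \<and>
  (\<forall>h. idet h = 1 --> (\<exists>\<gamma>\<in>AL N 1. \<exists>r\<in>R. h = imul \<gamma> r)))"

text \<open>The bottom row modulo N determines the coset: if two matrices of determinant 1 agree
  there, the quotient h r^-1 has lower left entry divisible by N. So representatives can be indexed
  by the finitely many values of \<open>key\<close>.\<close>

lemma cosets:
 assumes N: "N > 0"
 shows "finite (cosets N)" "r \<in> cosets N ==> idet r = 1"
  "idet h = 1 ==> \<exists>\<gamma>\<in>AL N 1. \<exists>r\<in>cosets N. h = imul \<gamma> r"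
proof -
 define key where "key g = (case g of (a, b, c, d) => (c mod int N, d mod int N))" for g :: imat
 define D where "D = {g. idet g = 1}"
 define rep where "rep v = (SOME g. g \<in> D \<and> key g = v)" for v
 define R where "R = rep ` (key ` D)"
 have rep: "rep v \<in> D \<and> key (rep v) = v" if "v \<in> key ` D" for v
  unfolding rep_def by (rule someI_ex) (use that in auto)
 have "key ` D \<subseteq> {0..<int N} \<times> {0..<int N}" using N by (auto simp: key_def)
 then have fin: "finite R" unfolding R_def by (meson finite_SigmaI finite_atLeastLessThan_int finite_imageI finite_subset)
 have "\<exists>\<gamma>\<in>AL N 1. \<exists>r\<in>R. h = imul \<gamma> r" if h: "idet h = 1" for h
 proof -
  define r where "r = rep (key h)"
  have r: "r \<in> R" "idet r = 1" "key r = key h" using h rep[of "key h"] by (auto simp: R_def r_def D_def)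
  obtain a b c d where he: "h = (a, b, c, d)" by (cases h)
  obtain p q u s where re: "r = (p, q, u, s)" by (cases r)
  have c: "int N dvd c - u" "int N dvd d - s" 
  proof -
   have "c mod int N = u mod int N" "d mod int N = s mod int N" using r(3) by (simp_all add: key_def he re)
   then show "int N dvd c - u" "int N dvd d - s" by (simp_all only: mod_eq_dvd_iff)
  qed
  then have "int N dvd (c - u) * s - (d - s) * u"
   by (rule dvd_diff[OF dvd_mult2 dvd_mult2])
  then have dv: "int N dvd c * s - d * u" by (simp add: algebra_simps)
  have "imul h (iadj r) \<in> AL N 1"
   using h r(2) idet_imul[of h "iadj r"] dv by (auto simp: AL_def he re algebra_simps)
  moreover have "imul (imul h (iadj r)) r = h"
   using r(2) by (simp add: imul_assoc imul_iadj(2) imul_iscale del: iscale.simps)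
  ultimately show ?thesis using r(1) by (intro bexI[of _ "imul h (iadj r)"] bexI[of _ r]) auto
 qed
 then have "\<exists>R. finite R \<and> (\<forall>r\<in>R. idet r = 1) \<and> (\<forall>h. idet h = 1 --> (\<exists>\<gamma>\<in>AL N 1. \<exists>r\<in>R. h = imul \<gamma> r))"
  using fin rep by (intro exI[of _ R]) (auto simp: R_def D_def)
 from someI_ex[OF this] show "finite (cosets N)" "r \<in> cosets N ==> idet r = 1"
  "idet h = 1 ==> \<exists>\<gamma>\<in>AL N 1. \<exists>r\<in>cosets N. h = imul \<gamma> r"
  unfolding cosets_def by blast+
qed

lemma AL_1_ALG: "AL N 1 \<subseteq> ALG N"
 by (auto simp: ALG_def exact_divisor_def intro!: exI[of _ 1])

definition fdom :: "nat => complex set" where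
 "fdom N = (\<Union>r\<in>cosets N. {w. Im w > 0 \<and> imob (iadj r) w \<in> sieg})"

lemma fdom_measurable [measurable]: "N > 0 ==> fdom N \<in> sets borel"
 unfolding fdom_def by (intro sets.finite_UN cosets(1)) measurable

lemma imob_iadj:
 assumes "idet g > 0" "Im z > 0"
 shows "imob (iadj g) (imob g z) = z" "imob g (imob (iadj g) z) = z"
proof -
 have "imob (imul (iadj g) g) z = z" "imob (imul g (iadj g)) z = z"
  using assms by (simp_all add: imul_iadj)
 then show "imob (iadj g) (imob g z) = z" "imob g (imob (iadj g) z) = z"
  using assms iden_nonzero by (simp_all add: imob_imul)
qed

lemma fdom_cover:
 assumes N: "N > 0" and w: "Im w > 0"
 shows "\<exists>g\<in>ALG N. imob g w \<in> fdom N"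
proof -
 obtain h where h: "idet h = 1" "imob h w \<in> sieg" using sieg_cover[OF w] by blast
 obtain \<gamma> r where gr: "\<gamma> \<in> AL N 1" "r \<in> cosets N" "iadj h = imul \<gamma> r"
  using cosets(3)[OF N, of "iadj h"] h by auto
 have dg: "idet \<gamma> = 1" using AL_idet[OF gr(1)] by simp
 define u where "u = imob (iadj \<gamma>) w"
 have u: "Im u > 0" unfolding u_def by (rule Im_imob_pos) (use w dg in auto)
 have "iadj (imul \<gamma> r) = imul (iadj r) (iadj \<gamma>)" by (cases \<gamma>; cases r) (simp add: algebra_simps)
 then have "h = imul (iadj r) (iadj \<gamma>)" using gr(3) by (metis iadj_iadj)
 then have "imob h w = imob (iadj r) u"
  unfolding u_def by (simp add: imob_imul iden_nonzero w dg)
 then have "u \<in> fdom N" using gr(2) u h(2) by (auto simp: fdom_def)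
 then show ?thesis using iadj_AL[OF gr(1)] AL_1_ALG unfolding u_def by blast
qed

lemma finite_fdom_translates:
 assumes N: "N > 0" and w: "Im w > 0"
 shows "finite {g\<in>ALG N. imob g w \<in> fdom N}"
proof -
 define T where "T = {g. 1 \<le> idet g \<and> idet g \<le> int N \<and> imob g w \<in> sieg}"
 have "{g\<in>ALG N. imob g w \<in> fdom N} \<subseteq> (\<Union>r\<in>cosets N. imul r ` T)"
 proof
  fix g assume "g \<in> {g\<in>ALG N. imob g w \<in> fdom N}"
  then have g: "g \<in> ALG N" "imob g w \<in> fdom N" by auto
  then obtain r where r: "r \<in> cosets N" "imob (iadj r) (imob g w) \<in> sieg" by (auto simp: fdom_def)
  obtain Q where Q: "exact_divisor Q N" "g \<in> AL N Q" using g by (auto simp: ALG_def)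
  have d: "idet g > 0" "idet g \<le> int N"
   using ALG_idet_pos[OF N g(1)] AL_idet[OF Q(2)] Q(1) N by (auto simp: exact_divisor_def dvd_imp_le)
  have "imul (iadj r) g \<in> T"
   using cosets(2)[OF N r(1)] d r(2) w by (auto simp: T_def imob_imul iden_nonzero)
  moreover have "g = imul r (imul (iadj r) g)"
   using cosets(2)[OF N r(1)] by (simp add: imul_assoc[symmetric] imul_iadj imul_iscale del: iscale.simps)
  ultimately show "g \<in> (\<Union>r\<in>cosets N. imul r ` T)" using r(1) by blast
 qed
 moreover have "finite T" unfolding T_def by (rule finite_sieg_translates[OF w])
 ultimately show ?thesis using cosets(1)[OF N] by (meson finite_UN finite_imageI finite_subset)
qed

section \<open>A partition of unity on the orbits of the group\<close>

definition fpsi :: "nat => complex => ennreal" where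
 "fpsi N w = (\<integral>\<^sup>+g. indicator (fdom N) (imob g w) \<partial>count_space (ALG N))"

text \<open>Dividing by the number of group elements that move w into \<open>fdom N\<close> makes
  the translates sum to 1. This replaces the indicator of a strict fundamental domain and accounts
  for overlaps, stabilizers and the pair g, -g.\<close>

definition fphi :: "nat => complex => real" where
 "fphi N w = indicator (fdom N) w / enn2real (fpsi N w)"

lemma countable_imat: "countable (A :: imat set)"
 by simp

lemma fpsi_measurable [measurable]:
 assumes "N > 0"
 shows "fpsi N \<in> borel_measurable borel"
proof -
 note fdom_measurable[OF assms, measurable]
 show ?thesis unfolding fpsi_def
  by (rule measurable_nn_integral_count_space[OF countable_imat]) measurable
qed

lemma fphi_measurable [measurable]:
 assumes "N > 0"
 shows "fphi N \<in> borel_measurable borel"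
proof -
 note fdom_measurable[OF assms, measurable] fpsi_measurable[OF assms, measurable]
 show ?thesis unfolding fphi_def by measurable
qed

lemma fpsi_eq_card:
 assumes N: "N > 0" and w: "Im w > 0"
 shows "fpsi N w = ennreal (real (card {g\<in>ALG N. imob g w \<in> fdom N}))"
proof -
 let ?A = "{g\<in>ALG N. imob g w \<in> fdom N}"
 have "fpsi N w = (\<integral>\<^sup>+g. indicator ?A g \<partial>count_space (ALG N))"
  unfolding fpsi_def by (rule nn_integral_cong) (auto split: split_indicator)
 also have "\<dots> = emeasure (count_space (ALG N)) ?A" by (rule nn_integral_indicator) auto
 also have "\<dots> = ennreal (real (card ?A))"
  by (subst emeasure_count_space_finite) (auto simp: finite_fdom_translates[OF N w] ennreal_of_nat_eq_real_of_nat)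
 finally show ?thesis .
qed

lemma fpsi_ge_1:
 assumes N: "N > 0" and w: "Im w > 0"
 shows "enn2real (fpsi N w) \<ge> 1"
proof -
 have "card {g\<in>ALG N. imob g w \<in> fdom N} > 0"
  using fdom_cover[OF N w] finite_fdom_translates[OF N w] unfolding card_gt_0_iff by blast
 then show ?thesis by (simp add: fpsi_eq_card[OF N w])
qed

lemma fpsi_invariant:
 assumes N: "N > 0" and w: "Im w > 0" and h: "h \<in> ALG N"
 shows "fpsi N (imob h w) = fpsi N w"
proof -
 have "fpsi N w = (\<integral>\<^sup>+g. indicator (fdom N) (imob (rmul N h g) w) \<partial>count_space (ALG N))"
  unfolding fpsi_def by (rule nn_integral_bij_count_space[OF bij_rmul[OF N h], symmetric])
 also have "\<dots> = fpsi N (imob h w)" unfolding fpsi_def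
  by (rule nn_integral_cong) (simp add: imob_rmul[OF N _ h w])
 finally show ?thesis ..
qed

lemma fphi_nonneg: "fphi N w \<ge> 0"
 by (simp add: fphi_def)

lemma fphi_le:
 assumes N: "N > 0"
 shows "fphi N w \<le> indicator (fdom N) w"
proof (cases "w \<in> fdom N")
 case True
 then have "Im w > 0" by (auto simp: fdom_def)
 from fpsi_ge_1[OF N this] True show ?thesis by (simp add: fphi_def)
qed (simp add: fphi_def)

lemma fphi_sum:
 assumes N: "N > 0" and w: "Im w > 0"
 shows "(\<integral>\<^sup>+g. ennreal (fphi N (imob g w)) \<partial>count_space (ALG N)) = 1"
proof -
 have pos: "enn2real (fpsi N w) > 0" using fpsi_ge_1[OF N w] by simp
 have "(\<integral>\<^sup>+g. ennreal (fphi N (imob g w)) \<partial>count_space (ALG N))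
   = (\<integral>\<^sup>+g. indicator (fdom N) (imob g w) * ennreal (1 / enn2real (fpsi N w)) \<partial>count_space (ALG N))"
  by (rule nn_integral_cong) (auto simp: fphi_def fpsi_invariant[OF N w] split: split_indicator)
 also have "\<dots> = fpsi N w * ennreal (1 / enn2real (fpsi N w))"
  unfolding fpsi_def by (rule nn_integral_multc) simp
 also have "fpsi N w = ennreal (enn2real (fpsi N w))" by (simp add: fpsi_eq_card[OF N w])
 also have "ennreal (enn2real (fpsi N w)) * ennreal (1 / enn2real (ennreal (enn2real (fpsi N w)))) = 1"
  using pos by (subst ennreal_mult[symmetric]) auto
 finally show ?thesis .
qed

lemma nn_integral_hyp_imob:
 assumes "f \<in> borel_measurable borel" and "idet g > 0"
 shows "(\<integral>\<^sup>+w. f (imob g w) \<partial>hyp) = nn_integral hyp f"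
proof -
 obtain a b c d where g: "g = (a, b, c, d)" by (cases g)
 have "real_of_int a * of_int d - of_int b * of_int c > 0"
  using assms(2) unfolding g idet.simps by (metis of_int_diff of_int_mult of_int_0_less_iff)
 from nn_integral_hyp_mob[OF assms(1) this] show ?thesis by (simp add: g imob_eq_mob del: imob.simps)
qed

lemma integral_hyp_imob:
 fixes f :: "complex => 'a :: {banach, second_countable_topology}"
 assumes "f \<in> borel_measurable borel" and "idet g > 0"
 shows "(\<integral>w. f (imob g w) \<partial>hyp) = integral\<^sup>L hyp f"
  "integrable hyp (\<lambda>w. f (imob g w)) \<longleftrightarrow> integrable hyp f"
proof -
 obtain a b c d where g: "g = (a, b, c, d)" by (cases g)
 have "real_of_int a * of_int d - of_int b * of_int c > 0"
  using assms(2) unfolding g idet.simps by (metis of_int_diff of_int_mult of_int_0_less_iff)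
 from integral_hyp_mob[OF assms(1) this] show "(\<integral>w. f (imob g w) \<partial>hyp) = integral\<^sup>L hyp f"
  "integrable hyp (\<lambda>w. f (imob g w)) \<longleftrightarrow> integrable hyp f" by (simp_all add: g imob_eq_mob del: imob.simps)
qed

text \<open>\<open>fphi\<close> is at most 1 and lives on the translates of the Siegel set by the
  coset representatives. A change of variables in each of them moves every cusp to infinity.\<close>

lemma nn_integral_fphi_le:
 assumes N: "N > 0" and [measurable]: "b \<in> borel_measurable borel"
 shows "(\<integral>\<^sup>+w. ennreal (fphi N w) * b w \<partial>hyp) \<le>
  (\<Sum>r\<in>cosets N. \<integral>\<^sup>+z. indicator sieg z * b (imob r z) \<partial>hyp)"
proof -
 have "(\<integral>\<^sup>+w. ennreal (fphi N w) * b w \<partial>hyp) \<le> (\<integral>\<^sup>+w. (\<Sum>r\<in>cosets N. indicator sieg (imob (iadj r) w) * b w) \<partial>hyp)"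
 proof (rule nn_integral_mono)
  fix w
  show "ennreal (fphi N w) * b w \<le> (\<Sum>r\<in>cosets N. indicator sieg (imob (iadj r) w) * b w)"
  proof (cases "w \<in> fdom N")
   case True
   then obtain r where r: "r \<in> cosets N" "imob (iadj r) w \<in> sieg" by (auto simp: fdom_def)
   have "ennreal (fphi N w) \<le> 1" using fphi_le[OF N, of w] True by simp
   then have "ennreal (fphi N w) * b w \<le> 1 * b w" by (rule mult_right_mono) simp
   also have "\<dots> = indicator sieg (imob (iadj r) w) * b w" using r by simp
   also have "\<dots> \<le> (\<Sum>r\<in>cosets N. indicator sieg (imob (iadj r) w) * b w)"
    by (rule member_le_sum[OF r(1)]) (use cosets(1)[OF N] in auto)
   finally show ?thesis .
  qed (simp add: fphi_def)
 qed
 also have "\<dots> = (\<Sum>r\<in>cosets N. \<integral>\<^sup>+w. indicator sieg (imob (iadj r) w) * b w \<partial>hyp)"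
  by (rule nn_integral_sum) measurable
 also have "\<dots> = (\<Sum>r\<in>cosets N. \<integral>\<^sup>+z. indicator sieg z * b (imob r z) \<partial>hyp)"
 proof (rule sum.cong[OF refl])
  fix r assume "r \<in> cosets N"
  then have d: "idet r > 0" using cosets(2)[OF N] by simp
  have "(\<integral>\<^sup>+w. indicator sieg (imob (iadj r) w) * b w \<partial>hyp) = (\<integral>\<^sup>+z. indicator sieg (imob (iadj r) (imob r z)) * b (imob r z) \<partial>hyp)"
   by (rule nn_integral_hyp_imob[OF _ d, symmetric]) measurable
  also have "\<dots> = (\<integral>\<^sup>+z. indicator sieg z * b (imob r z) \<partial>hyp)"
   by (rule nn_integral_cong_AE) (use AE_hyp_pos in eventually_elim, simp add: imob_iadj d)
  finally show "(\<integral>\<^sup>+w. indicator sieg (imob (iadj r) w) * b w \<partial>hyp) = (\<integral>\<^sup>+z. indicator sieg z * b (imob r z) \<partial>hyp)" .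
 qed
 finally show ?thesis .
qed

text \<open>In the coordinates of \<open>hypP\<close> the vertical strip of width 1 has width exp
  (-t) in the variable s.\<close>

lemma nn_integral_sieg_Im:
 assumes [measurable]: "b \<in> borel_measurable borel"
 shows "(\<integral>\<^sup>+z. indicator sieg z * b (Im z) \<partial>hyp) \<le> (\<integral>\<^sup>+t. indicator {ln (4 / 5)..} t * ennreal (exp (- t)) * b (exp t) \<partial>lborel)"
proof -
 have "(\<integral>\<^sup>+z. indicator sieg z * b (Im z) \<partial>hyp) =
  (\<integral>\<^sup>+t. \<integral>\<^sup>+s. indicator sieg (Complex (exp t * s) (exp t)) * b (exp t) \<partial>lborel \<partial>lborel)"
  by (subst nn_integral_hyp) auto
 also have "\<dots> \<le> (\<integral>\<^sup>+t. indicator {ln (4 / 5)..} t * ennreal (exp (- t)) * b (exp t) \<partial>lborel)"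
 proof (rule nn_integral_mono)
  fix t :: real
  have e: "indicator sieg (Complex (exp t * s) (exp t)) \<le> (indicator {ln (4 / 5)..} t * indicator {- (exp (- t) / 2)..exp (- t) / 2} s :: ennreal)" for s
  proof (cases "Complex (exp t * s) (exp t) \<in> sieg")
   case True
   then have "\<bar>exp t * s\<bar> \<le> 1 / 2" "exp t \<ge> 4 / 5" by (auto simp: sieg_def)
   moreover have "ln (4 / 5) \<le> ln (exp t)" using calculation(2) by (subst ln_le_cancel_iff) auto
   ultimately have "exp t * \<bar>s\<bar> \<le> 1 / 2" "t \<ge> ln (4 / 5)" by (auto simp: abs_mult)
   then have "\<bar>s\<bar> \<le> exp (- t) / 2" "t \<ge> ln (4 / 5)" by (auto simp: exp_minus field_simps)
   then show ?thesis by (auto simp: abs_le_iff split: split_indicator)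
  qed simp
  have "(\<integral>\<^sup>+s. indicator sieg (Complex (exp t * s) (exp t)) * b (exp t) \<partial>lborel)
   \<le> (\<integral>\<^sup>+s. indicator {ln (4 / 5)..} t * b (exp t) * indicator {- (exp (- t) / 2)..exp (- t) / 2} s \<partial>lborel)"
   by (rule nn_integral_mono) (use mult_right_mono[OF e, of "b (exp t)"] in \<open>simp add: mult_ac\<close>)
  also have "\<dots> = indicator {ln (4 / 5)..} t * b (exp t) * emeasure lborel {- (exp (- t) / 2)..exp (- t) / 2}"
   by (rule nn_integral_cmult_indicator) simp
  also have "emeasure lborel {- (exp (- t) / 2)..exp (- t) / 2} = ennreal (exp (- t))" by simp
  finally show "(\<integral>\<^sup>+s. indicator sieg (Complex (exp t * s) (exp t)) * b (exp t) \<partial>lborel)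
   \<le> indicator {ln (4 / 5)..} t * ennreal (exp (- t)) * b (exp t)" by (simp add: mult_ac)
 qed
 finally show ?thesis .
qed

lemma nn_integral_sieg: "(\<integral>\<^sup>+z. indicator sieg z \<partial>hyp) \<le> ennreal (5 / 4)"
proof -
 have "(\<integral>\<^sup>+z. indicator sieg z \<partial>hyp) \<le> (\<integral>\<^sup>+t. indicator {ln (4 / 5)..} t * ennreal (exp (- t)) * 1 \<partial>lborel)"
  using nn_integral_sieg_Im[of "\<lambda>_. 1"] by simp
 also have "\<dots> = (\<integral>\<^sup>+t. ennreal (exp (- t)) * indicator {ln (4 / 5)..} t \<partial>lborel)" by (simp add: mult_ac)
 also have "\<dots> = ennreal (0 - (- exp (- ln (4 / 5))))"
 proof (rule nn_integral_FTC_atLeast)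
  have "((\<lambda>x::real. exp (- x)) \<longlongrightarrow> 0) at_top"
   by (rule filterlim_compose[OF exp_at_bot filterlim_uminus_at_bot_at_top])
  then show "((\<lambda>x::real. - exp (- x)) \<longlongrightarrow> 0) at_top" using tendsto_minus by fastforce
 qed (auto intro!: derivative_eq_intros)
 also have "0 - (- exp (- ln (4 / 5))) = (5 / 4 :: real)" by (simp add: exp_minus)
 finally show ?thesis .
qed

lemma nn_integral_fphi_finite:
 assumes N: "N > 0"
 shows "(\<integral>\<^sup>+w. ennreal (fphi N w) \<partial>hyp) < \<infinity>"
proof -
 have "(\<integral>\<^sup>+w. ennreal (fphi N w) \<partial>hyp) \<le> (\<Sum>r\<in>cosets N. \<integral>\<^sup>+z. indicator sieg z \<partial>hyp)"
  using nn_integral_fphi_le[OF N, of "\<lambda>_. 1"] by simp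
 also have "\<dots> \<le> (\<Sum>r\<in>cosets N. ennreal (5 / 4))" by (intro sum_mono nn_integral_sieg)
 also have "\<dots> < \<infinity>" by (simp add: ennreal_mult_less_top of_nat_less_top)
 finally show ?thesis .
qed

definition fvol :: "nat => real" where "fvol N = (\<integral>w. fphi N w \<partial>hyp)"

lemma integrable_fphi: "N > 0 ==> integrable hyp (fphi N)"
 by (rule integrableI_nonneg) (use nn_integral_fphi_finite fphi_nonneg in auto)

text \<open>If the integral vanished, so would that of every translate of \<open>fphi\<close>, and
  summing these by \<open>fphi_sum\<close> would give the half-plane measure 0.\<close>

lemma fvol_pos:
 assumes N: "N > 0"
 shows "fvol N > 0"
proof -
 note fphi_measurable[OF N, measurable]
 have nn: "ennreal (fvol N) = (\<integral>\<^sup>+w. ennreal (fphi N w) \<partial>hyp)"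
  unfolding fvol_def using nn_integral_eq_integral[OF integrable_fphi[OF N]] fphi_nonneg by simp
 have "(\<integral>\<^sup>+w. ennreal (fphi N w) \<partial>hyp) \<noteq> 0"
 proof
  assume 0: "(\<integral>\<^sup>+w. ennreal (fphi N w) \<partial>hyp) = 0"
  have "(\<integral>\<^sup>+w. 1 \<partial>hyp) = (\<integral>\<^sup>+w. \<integral>\<^sup>+g. ennreal (fphi N (imob g w)) \<partial>count_space (ALG N) \<partial>hyp)"
   by (rule nn_integral_cong_AE) (use AE_hyp_pos in eventually_elim, simp add: fphi_sum[OF N])
  also have "\<dots> = (\<integral>\<^sup>+g. \<integral>\<^sup>+w. ennreal (fphi N (imob g w)) \<partial>hyp \<partial>count_space (ALG N))"
   by (rule nn_integral_count_space_nn_integral) (simp_all add: countable_imat)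
  also have "\<dots> = (\<integral>\<^sup>+g. 0 \<partial>count_space (ALG N))"
   by (rule nn_integral_cong) (use 0 in \<open>simp add: nn_integral_hyp_imob[of "\<lambda>w. ennreal (fphi N w)"] ALG_idet_pos[OF N]\<close>)
  finally have "emeasure hyp UNIV = 0" by simp
  then have "emeasure lborel (UNIV :: (real \<times> real) set) = 0"
   unfolding hyp_def by (subst (asm) emeasure_distr) auto
  then show False by simp
 qed
 then show ?thesis using nn by (metis ennreal_neg not_le)
qed

subsection \<open>Forms with prescribed signs\<close>

lemma norm_sl:
 assumes "Im z > 0" "idet g > 0"
 shows "cmod (sl n g f z) * Im z ^ n = cmod (f (imob g z)) * Im (imob g z) ^ n"
proof -
 have j: "cmod (iden g z) > 0" using iden_nonzero[OF assms] by simp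
 have "Im (imob g z) ^ n = of_int (idet g) ^ n * Im z ^ n / cmod (iden g z) ^ (2 * n)"
  by (simp add: Im_imob power_divide power_mult_distrib power_mult)
 moreover have "cmod (sl n g f z) = of_int (idet g) ^ n / cmod (iden g z) ^ (2 * n) * cmod (f (imob g z))"
  using assms by (simp add: sl_def norm_mult norm_divide norm_power)
 ultimately show ?thesis by simp
qed

lemma sl_zero:
 assumes "!!z. Im z \<le> 0 ==> f z = 0" "Im z \<le> 0" "idet g > 0"
 shows "sl n g f z = 0"
proof -
 have "Im (imob g z) \<le> 0" unfolding Im_imob using assms(2,3)
  by (intro divide_nonpos_nonneg mult_nonneg_nonpos) auto
 then show ?thesis by (simp add: sl_def assms(1))
qed

lemma sl_holomorphic:
 assumes f: "f holomorphic_on upper_half_plane" and g: "idet g > 0"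
 shows "sl n g f holomorphic_on upper_half_plane"
proof -
 obtain a b c d where ge: "g = (a, b, c, d)" by (cases g)
 have ne: "of_int c * z + of_int d \<noteq> 0" if "z \<in> upper_half_plane" for z
  using iden_nonzero[of z g] that g by (simp add: upper_half_plane_def ge)
 have m: "imob g holomorphic_on upper_half_plane"
  unfolding ge imob.simps[abs_def] using ne by (intro holomorphic_intros) auto
 have "f \<circ> imob g holomorphic_on upper_half_plane"
  by (rule holomorphic_on_compose_gen[OF m f]) (use g in \<open>auto simp: upper_half_plane_def intro: Im_imob_pos\<close>)
 then have fm: "(\<lambda>z. f (imob g z)) holomorphic_on upper_half_plane" by (simp add: o_def)
 show ?thesis unfolding sl_def
  by (intro holomorphic_intros fm) (use ne in \<open>auto simp: ge intro!: holomorphic_intros\<close>)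
qed

text \<open>The expansions at the cusps are replaced by boundedness of |f| (Im z)^n, which the slash
  operators transport by \<open>norm_sl\<close>. In this form closure under Hecke operators is easy
  to see; \<open>cusp_forms_sign_eq_Vsp\<close> identifies the spaces for n > 0.\<close>

definition Vsp :: "nat => nat => (nat => int) => (complex => complex) set" where
 "Vsp n N \<sigma> = {f. (\<forall>z. Im z \<le> 0 --> f z = 0) \<and> f holomorphic_on upper_half_plane \<and>
  (\<forall>g\<in>ALG N. sl n g f = cscale (of_int (chi \<sigma> g)) f) \<and>
  (\<exists>M. \<forall>z. Im z > 0 --> cmod (f z) * Im z ^ n \<le> M)}"

section \<open>Expansions at the cusps and growth\<close>

lemma power_exp_bound:
 fixes c y :: real
 assumes c: "c > 0" and y: "y > 0"
 shows "y ^ n * exp (- c * y) \<le> fact n / c ^ n"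
proof -
 have "(c * y) ^ n / fact n \<le> exp (c * y)"
 proof -
  have "(c * y) ^ n / fact n = (\<Sum>m\<in>{n}. (c * y) ^ m / fact m)" by simp
  also have "\<dots> \<le> (\<Sum>m. (c * y) ^ m / fact m)"
   by (rule sum_le_suminf) (use c y summable_exp_generic[of "c * y"] in \<open>auto simp: field_simps\<close>)
  also have "\<dots> = exp (c * y)" by (simp add: exp_def field_simps)
  finally show ?thesis .
 qed
 then show ?thesis using c y by (simp add: exp_minus power_mult_distrib field_simps)
qed

lemma exp_qpow: "exp (2 * of_real pi * \<i> * of_nat m * z / of_nat N) = exp (2 * of_real pi * \<i> * z / of_nat N) ^ m"
 by (simp add: exp_of_nat_mult[symmetric] field_simps)

lemma norm_qexp: "cmod (exp (2 * of_real pi * \<i> * z / of_nat N)) = exp (- (2 * pi / real N) * Im z)"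
 by (simp add: norm_exp_eq_Re)

lemma q_series_bounded:
 assumes N: "N > 0" and q0: "q 0 = 0"
  and s: "!!z. Im z > 0 ==> (\<lambda>m. q m * exp (2 * of_real pi * \<i> * of_nat m * z / of_nat N)) sums h z"
 shows "\<exists>M. \<forall>z. Im z \<ge> 4 / 5 --> cmod (h z) * Im z ^ n \<le> M"
proof -
 define c where "c = 2 * pi / real N"
 have c: "c > 0" using N by (simp add: c_def)
 \<comment> \<open>Convergence at height 2/5 gives absolute convergence on the smaller circle
   belonging to height 4/5. As \<open>q 0\<close> vanishes, a factor |x| can be taken out, which
   gives exponential decay.\<close>
 define R where "R = exp (- c * (2 / 5))"
 define \<rho> where "\<rho> = exp (- c * (4 / 5))"
 have R: "0 < \<rho>" "\<rho> < R" using c by (simp_all add: R_def \<rho>_def)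
 have "summable (\<lambda>m. q m * exp (2 * of_real pi * \<i> * of_nat m * (\<i> * of_real (2 / 5)) / of_nat N))"
  by (rule sums_summable[OF s]) simp
 then have "summable (\<lambda>m. q m * exp (2 * of_real pi * \<i> * (\<i> * of_real (2 / 5)) / of_nat N) ^ m)"
  by (simp only: exp_qpow)
 moreover have "cmod (of_real \<rho>) < cmod (exp (2 * of_real pi * \<i> * (\<i> * of_real (2 / 5)) / of_nat N))"
  unfolding norm_qexp using R by (simp add: R_def c_def)
 ultimately have "summable (\<lambda>m. norm (q m * (of_real \<rho>) ^ m))" by (rule powser_insidea)
 then have sm: "summable (\<lambda>m. cmod (q m) * \<rho> ^ m)" using R by (simp add: norm_mult norm_power)
 define C where "C = (\<Sum>m. cmod (q m) * \<rho> ^ m) / \<rho>"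
 have bd: "cmod (h z) \<le> C * exp (- c * Im z)" if z: "Im z \<ge> 4 / 5" for z
 proof -
  define x where "x = exp (2 * of_real pi * \<i> * z / of_nat N)"
  have nx: "cmod x = exp (- c * Im z)" by (simp only: x_def norm_qexp c_def)
  have x\<rho>: "cmod x \<le> \<rho>" unfolding nx \<rho>_def using z c by simp
  have le: "cmod (q m * x ^ m) \<le> cmod x / \<rho> * (cmod (q m) * \<rho> ^ m)" for m
  proof (cases m)
   case 0 then show ?thesis by (simp add: q0)
  next
   case (Suc k)
   have "cmod (q m * x ^ m) = cmod (q m) * (cmod x * cmod x ^ k)" by (simp add: norm_mult norm_power Suc)
   also have "\<dots> \<le> cmod (q m) * (cmod x * \<rho> ^ k)" using x\<rho> by (intro mult_left_mono power_mono) auto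
   also have "\<dots> = cmod x / \<rho> * (cmod (q m) * \<rho> ^ m)" using R by (simp add: Suc)
   finally show ?thesis .
  qed
  have sm': "summable (\<lambda>m. cmod x / \<rho> * (cmod (q m) * \<rho> ^ m))" using sm by (rule summable_mult)
  have "h z = (\<Sum>m. q m * x ^ m)" using s[of z] z by (simp add: exp_qpow x_def sums_iff)
  also have "cmod \<dots> \<le> (\<Sum>m. cmod x / \<rho> * (cmod (q m) * \<rho> ^ m))"
   by (rule norm_suminf_le[OF le sm'])
  also have "\<dots> = cmod x / \<rho> * (\<Sum>m. cmod (q m) * \<rho> ^ m)" using sm by (rule suminf_mult)
  finally show ?thesis by (simp add: C_def nx mult.commute)
 qed
 have "cmod (h z) * Im z ^ n \<le> \<bar>C\<bar> * (fact n / c ^ n)" if z: "Im z \<ge> 4 / 5" for z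
 proof -
  have "cmod (h z) * Im z ^ n \<le> (\<bar>C\<bar> * exp (- c * Im z)) * Im z ^ n"
  proof (rule mult_right_mono)
   show "cmod (h z) \<le> \<bar>C\<bar> * exp (- c * Im z)"
    using bd[OF z] by (rule order_trans) (auto intro: mult_right_mono)
  qed (use z in auto)
  also have "\<dots> = \<bar>C\<bar> * (Im z ^ n * exp (- c * Im z))" by simp
  also have "\<dots> \<le> \<bar>C\<bar> * (fact n / c ^ n)" using z c by (intro mult_left_mono power_exp_bound) auto
  finally show ?thesis .
 qed
 then show ?thesis by blast
qed

lemma exp_eq_period:
 assumes N: "N > 0" and eq: "exp (2 * of_real pi * \<i> * z / of_nat N) = exp (2 * of_real pi * \<i> * z' / of_nat N)"
 shows "\<exists>k::int. z = z' + of_int k * of_nat N"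
proof -
 obtain k :: int where "2 * of_real pi * \<i> * z / of_nat N = 2 * of_real pi * \<i> * z' / of_nat N + of_int (2 * k) * pi * \<i>"
  using eq unfolding exp_eq by auto
 then have "2 * of_real pi * \<i> * z = 2 * of_real pi * \<i> * (z' + of_int k * of_nat N)"
  using N by (simp add: field_simps)
 then have "z = z' + of_int k * of_nat N" by simp
 then show ?thesis by blast
qed

text \<open>A periodic form is a function of \<open>exp (2 \<pi> i z / N)\<close>, and the growth condition makes
 the singularity at \<open>0\<close> removable.\<close>

lemma q_function:
 assumes N: "N > 0" and n: "n > 0" and h: "h holomorphic_on upper_half_plane"
  and per: "!!z. Im z > 0 ==> h (z + of_nat N) = h z"
  and bd: "!!z. Im z > 1 ==> cmod (h z) * Im z ^ n \<le> M"
 obtains H where "H holomorphic_on ball 0 1" "H 0 = 0"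
  "!!z. Im z > 0 ==> h z = H (exp (2 * of_real pi * \<i> * z / of_nat N))"
proof -
 define e where "e z = exp (2 * of_real pi * \<i> * z / of_nat N)" for z
 define l where "l w = of_nat N / (2 * of_real pi * \<i>) * w" for w
 have el: "e (l w) = exp w" for w using N by (simp add: e_def l_def)
 have Iml: "Im (l w) = - real N / (2 * pi) * Re w" for w
  
 proof -
  have "l w = of_real (real N / (2 * pi)) * (- \<i> * w)" by (simp add: l_def field_simps)
  then show ?thesis by (simp del: of_real_divide of_real_mult)
 qed
 have pern: "h (z + of_nat k * of_nat N) = h z" if "Im z > 0" for z and k :: nat
 proof (induction k)
  case (Suc k)
  have "h (z + of_nat (Suc k) * of_nat N) = h ((z + of_nat k * of_nat N) + of_nat N)" by (simp add: algebra_simps)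
  also have "\<dots> = h (z + of_nat k * of_nat N)" by (rule per) (use that in simp)
  finally show ?case using Suc by simp
 qed simp
 have peri: "h (z + of_int k * of_nat N) = h z" if z: "Im z > 0" for z and k :: int
 proof (cases "k \<ge> 0")
  case True
  then show ?thesis using pern[OF z, of "nat k"] by simp
 next
  case False
  have "h ((z + of_int k * of_nat N) + of_nat (nat (- k)) * of_nat N) = h (z + of_int k * of_nat N)"
   by (rule pern) (use z in simp)
  then show ?thesis using False by (simp add: algebra_simps)
 qed
 have inv: "h z = h z'" if "e z = e z'" "Im z' > 0" for z z'
  using exp_eq_period[OF N that(1)[unfolded e_def]] peri[OF that(2)] by auto
 define H where "H q = (if q = 0 then 0 else h (l (Ln q)))" for q
 have ImLn: "Im (l w) > 0" if "exp w = q" "q \<in> ball 0 1" for w q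
 proof -
  have "exp (Re w) < 1" using that by (metis norm_exp_eq_Re mem_ball_0)
  then have "Re w < 0" by simp
  then show ?thesis unfolding Iml using N by (auto intro!: divide_neg_pos mult_pos_neg)
 qed
 have Hh: "h z = H (e z)" if z: "Im z > 0" for z
 proof -
  have ne: "e z \<noteq> 0" by (simp add: e_def)
  have "e (l (Ln (e z))) = e z" using ne by (simp add: el)
  from inv[OF this z] show ?thesis using ne by (simp add: H_def)
 qed
 have hol0: "H holomorphic_on ball 0 1 - {0}"
 proof -
  have "\<exists>S. open S \<and> q0 \<in> S \<and> H holomorphic_on S" if q0: "q0 \<in> ball 0 1 - {0}" for q0
  proof (intro exI conjI)
   define S where "S = ball q0 (cmod q0) \<inter> ball 0 1"
   show "open (ball q0 (cmod q0) \<inter> ball 0 1)" "q0 \<in> ball q0 (cmod q0) \<inter> ball 0 1" using q0 by auto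
   have S: "q / q0 \<notin> \<real>\<^sub>\<le>\<^sub>0" "q \<noteq> 0" if "q \<in> S" for q
   proof -
    have "cmod (q0 - q) < cmod q0" using that by (simp add: S_def dist_norm)
    moreover have "1 - q / q0 = (q0 - q) / q0" using q0 by (simp add: diff_divide_distrib)
    ultimately have "cmod (1 - q / q0) < 1" using q0 by (simp add: norm_divide)
    then have "Re (q / q0) > 0" using complex_Re_le_cmod[of "1 - q / q0"] by simp
    then show "q / q0 \<notin> \<real>\<^sub>\<le>\<^sub>0" "q \<noteq> 0" by (auto simp: complex_nonpos_Reals_iff)
   qed
   \<comment> \<open>\<open>Ln\<close> jumps on the negative axis. Near q0 the branch
     \<open>Ln (q / q0) + Ln q0\<close> is holomorphic, and it differs from \<open>Ln q\<close> by a
     period of the exponential, that is by a translation under which h is invariant.\<close>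
   have "(\<lambda>q. l (Ln (q / q0) + Ln q0)) holomorphic_on S"
    unfolding l_def using S q0 by (intro holomorphic_intros) auto
   moreover have eq: "exp (Ln (q / q0) + Ln q0) = q" if "q \<in> S" for q
    using S[OF that] q0 by (simp add: exp_add)
   ultimately have "(h \<circ> (\<lambda>q. l (Ln (q / q0) + Ln q0))) holomorphic_on S"
    by (intro holomorphic_on_compose_gen[OF _ h]) (auto simp: upper_half_plane_def S_def intro: ImLn)
   then have "(\<lambda>q. h (l (Ln (q / q0) + Ln q0))) holomorphic_on S" by (simp add: o_def)
   then show "H holomorphic_on ball q0 (cmod q0) \<inter> ball 0 1" unfolding S_def[symmetric]
   proof (rule holomorphic_transform)
    fix q assume q: "q \<in> S"
    have "e (l (Ln (q / q0) + Ln q0)) = e (l (Ln q))" using eq[OF q] S[OF q] by (simp add: el)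
    then have "h (l (Ln (q / q0) + Ln q0)) = h (l (Ln q))"
     by (rule inv) (rule ImLn[of _ q], use S[OF q] q in \<open>auto simp: S_def\<close>)
    then show "h (l (Ln (q / q0) + Ln q0)) = H q" using S[OF q] by (simp add: H_def)
   qed
  qed
  then show ?thesis unfolding holomorphic_on_def[of H "ball 0 1 - {0}"]
   by (meson field_differentiable_at_within holomorphic_on_imp_differentiable_at)
 qed
 \<comment> \<open>With y = - N / (2 pi) * ln |q| the growth condition reads |H q| \<le> |M| / y^n,
   and y tends to infinity as q tends to 0. The restriction |q| < exp (-2 pi / N) says that y >
   1.\<close>
 have lim: "(H \<longlongrightarrow> 0) (at 0)"
 proof (rule Lim_null_comparison)
  have ev: "\<forall>\<^sub>F q in at (0::complex). cmod q < exp (- (2 * pi / real N)) \<and> q \<noteq> 0"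
   by (auto simp: eventually_at intro!: exI[of _ "exp (- (2 * pi / real N))"])
  show "\<forall>\<^sub>F q in at 0. norm (H q) \<le> \<bar>M\<bar> / (- real N / (2 * pi) * ln (cmod q)) ^ n"
   using ev
  proof eventually_elim
   case (elim q)
   define y where "y = Im (l (Ln q))"
   have ye: "y = - real N / (2 * pi) * ln (cmod q)" using elim by (simp add: y_def Iml)
   have "ln (cmod q) < ln (exp (- (2 * pi / real N)))" using elim by (subst ln_less_cancel_iff) auto
   then have "- ln (cmod q) > 2 * pi / real N" by simp
   then have "real N / (2 * pi) * (2 * pi / real N) < real N / (2 * pi) * (- ln (cmod q))"
    using N by (intro mult_strict_left_mono) auto
   then have y: "y > 1" unfolding ye using N by simp
   have "norm (H q) * y ^ n \<le> \<bar>M\<bar>" using bd[of "l (Ln q)"] y elim by (simp add: H_def y_def)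
   then show ?case unfolding ye[symmetric] using y by (simp add: field_simps)
  qed
  have r: "filterlim (\<lambda>q::complex. cmod q) (at_right 0) (at 0)"
   by (auto simp: filterlim_at eventually_at_filter intro!: tendsto_eq_intros)
  have "filterlim (\<lambda>q::complex. ln (cmod q)) at_bot (at 0)"
   by (rule filterlim_compose[OF ln_at_0 r])
  then have lt: "filterlim (\<lambda>q::complex. - ln (cmod q)) at_top (at 0)"
   by (rule filterlim_compose[OF filterlim_uminus_at_top_at_bot])
  have "filterlim (\<lambda>q::complex. real N / (2 * pi) * (- ln (cmod q))) at_top (at 0)"
   by (rule filterlim_tendsto_pos_mult_at_top[OF tendsto_const _ lt]) (use N in simp)
  then have "filterlim (\<lambda>q::complex. (real N / (2 * pi) * (- ln (cmod q))) ^ n) at_top (at 0)"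
   using n by (intro filterlim_pow_at_top) auto
  then have "filterlim (\<lambda>q::complex. (- real N / (2 * pi) * ln (cmod q)) ^ n) at_top (at 0)"
   by simp
  then show "((\<lambda>q. \<bar>M\<bar> / (- real N / (2 * pi) * ln (cmod q)) ^ n) \<longlongrightarrow> 0) (at 0)"
   by (intro tendsto_divide_0[OF tendsto_const] filterlim_at_top_imp_at_infinity)
 qed
 have "continuous_on (ball 0 1) H"
 proof -
  have "isCont H q" if "q \<in> ball 0 1" for q
  proof (cases "q = 0")
   case True
   then show ?thesis using lim by (simp add: isCont_def H_def)
  next
   case False
   have "continuous_on (ball 0 1 - {0}) H" using hol0 by (rule holomorphic_on_imp_continuous_on)
   then show ?thesis using that False by (auto simp: continuous_on_eq_continuous_at open_Diff)
  qed
  then show ?thesis by (simp add: continuous_at_imp_continuous_on)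
 qed
 then have "H holomorphic_on ball 0 1"
  by (rule no_isolated_singularity[OF _ hol0]) auto
 moreover have "H 0 = 0" by (simp add: H_def)
 ultimately show ?thesis using that Hh by (auto simp: e_def)
qed

lemma upper_half_plane_iff: "z \<in> upper_half_plane \<longleftrightarrow> Im z > 0"
 by (simp add: upper_half_plane_def)

lemma VspD:
 assumes "f \<in> Vsp n N \<sigma>"
 shows "Im z \<le> 0 ==> f z = 0" "f holomorphic_on upper_half_plane"
  "g \<in> ALG N ==> sl n g f = cscale (of_int (chi \<sigma> g)) f"
  "\<exists>M. \<forall>z. Im z > 0 --> cmod (f z) * Im z ^ n \<le> M"
 using assms by (auto simp: Vsp_def)

lemma sl_cscale: "sl n g (cscale c f) = cscale c (sl n g f)"
 by (simp add: sl_def cscale_def fun_eq_iff)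

lemma imul_eq_AL1:
 assumes N: "N > 0" and Q: "exact_divisor Q N" and g: "g \<in> AL N Q" and g0: "g0 \<in> AL N Q"
 obtains e where "e \<in> AL N 1" "g = imul e g0"
proof -
 have Q0: "Q > 0" by (rule exact_divisor_pos[OF N Q])
 obtain e where e: "e \<in> AL N 1" "imul g (iadj g0) = iscale (int Q) e"
  using AL_mult[OF N Q Q g iadj_AL[OF g0]] Q0 by auto
 have "iscale (int Q) (imul e g0) = imul (imul g (iadj g0)) g0" by (simp add: e(2) imul_iscale)
 also have "\<dots> = iscale (int Q) g"
  by (simp add: imul_assoc imul_iadj(2) imul_iscale AL_idet[OF g0] del: iscale.simps)
 finally have "g = imul e g0" using Q0 by (simp add: iscale_inj)
 then show ?thesis using that e by blast
qed

lemma sl_imul_zero: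
 assumes z: "!!z. Im z \<le> 0 ==> f z = 0" and d: "idet g > 0" "idet h > 0"
 shows "sl n (imul g h) f = sl n h (sl n g f)"
proof
 fix z
 show "sl n (imul g h) f z = sl n h (sl n g f) z"
 proof (cases "Im z > 0")
  case True
  then show ?thesis by (rule sl_imul) (rule d)
 next
  case False
  then have "sl n (imul g h) f z = 0" "sl n h (sl n g f) z = 0"
   using d by (auto intro!: sl_zero z)
  then show ?thesis by simp
 qed
qed

text \<open>Moves an arbitrary point into the Siegel set at the price of replacing f by its
  translate under one of finitely many representatives; |f| y^n keeps its value by
  \<open>norm_sl\<close>.\<close>

lemma AL1_reduce:
 assumes N: "N > 0" and zero: "!!z. Im z \<le> 0 ==> f z = 0" and one: "!!e. e \<in> AL N 1 ==> sl n e f = f"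
  and w: "Im w > 0"
 obtains r u where "r \<in> cosets N" "u \<in> sieg" "cmod (f w) * Im w ^ n = cmod (sl n r f u) * Im u ^ n"
proof -
 obtain h where h: "idet h = 1" "imob h w \<in> sieg" using sieg_cover[OF w] by blast
 obtain \<gamma> r where gr: "\<gamma> \<in> AL N 1" "r \<in> cosets N" "iadj h = imul \<gamma> r"
  using cosets(3)[OF N, of "iadj h"] h by auto
 have d: "idet r = 1" "idet \<gamma> = 1" using cosets(2)[OF N gr(2)] AL_idet[OF gr(1)] by auto
 define u where "u = imob h w"
 have u: "Im u > 0" unfolding u_def by (rule Im_imob_pos) (use w h in auto)
 have wu: "imob (imul \<gamma> r) u = w" unfolding gr(3)[symmetric] u_def by (rule imob_iadj) (use w h in auto)
 have "sl n (imul \<gamma> r) f = sl n r f"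
  using sl_imul_zero[where f = f and g = \<gamma> and h = r and n = n, OF zero] d one[OF gr(1)] by simp
 then have "cmod (f w) * Im w ^ n = cmod (sl n r f u) * Im u ^ n"
  using norm_sl[OF u, of "imul \<gamma> r" n f] d by (simp add: wu)
 then show ?thesis using that gr(2) h(2) by (simp add: u_def)
qed

lemma bounded_of_cosets:
 assumes N: "N > 0" and zero: "!!z. Im z \<le> 0 ==> f z = 0" and one: "!!e. e \<in> AL N 1 ==> sl n e f = f"
  and bd: "!!r. r \<in> cosets N ==> \<exists>M. \<forall>z. Im z \<ge> 4 / 5 --> cmod (sl n r f z) * Im z ^ n \<le> M"
 shows "\<exists>M. \<forall>z. Im z > 0 --> cmod (f z) * Im z ^ n \<le> M"
proof -
 obtain Mr where Mr: "!!r z. r \<in> cosets N ==> Im z \<ge> 4 / 5 ==> cmod (sl n r f z) * Im z ^ n \<le> Mr r"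
  using bd by metis
 define M where "M = (\<Sum>r\<in>cosets N. \<bar>Mr r\<bar>)"
 have "cmod (f w) * Im w ^ n \<le> M" if w: "Im w > 0" for w
 proof -
  obtain r u where ru: "r \<in> cosets N" "u \<in> sieg" "cmod (f w) * Im w ^ n = cmod (sl n r f u) * Im u ^ n"
   using AL1_reduce[where f = f and n = n, OF N zero one w] by blast
  have "cmod (sl n r f u) * Im u ^ n \<le> Mr r" by (rule Mr[OF ru(1)]) (use ru in \<open>simp add: sieg_def\<close>)
  also have "\<dots> \<le> \<bar>Mr r\<bar>" by simp
  also have "\<dots> \<le> M" unfolding M_def by (rule member_le_sum[OF ru(1)]) (use cosets(1)[OF N] in auto)
  finally show ?thesis using ru(3) by simp
 qed
 then show ?thesis by blast
qed

text \<open>The conjugate by g of the translation by N is congruent to 1 modulo N, hence lies in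
  \<open>AL N 1\<close>.\<close>

lemma sl_periodic:
 assumes N: "N > 0" and zero: "!!z. Im z \<le> 0 ==> f z = 0" and one: "!!e. e \<in> AL N 1 ==> sl n e f = f"
  and g: "idet g = 1" and z: "Im z > 0"
 shows "sl n g f (z + of_nat N) = sl n g f z"
proof -
 obtain a b c d where ge: "g = (a, b, c, d)" by (cases g)
 have ad: "a * d - b * c = 1" using g by (simp add: ge)
 define T where "T = (1::int, int N, 0::int, 1::int)"
 define e where "e = imul (imul g T) (iadj g)"
 have dT: "idet T = 1" by (simp add: T_def)
 have de: "idet e = 1" using g dT by (simp add: e_def)
 have "e \<in> AL N 1" using de by (simp add: e_def T_def ge AL_def algebra_simps)
 then have ef: "sl n e f = f" by (rule one)
 have "imul e g = imul g T"
  unfolding e_def by (simp add: imul_assoc imul_iadj(2) imul_iscale g del: iscale.simps)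
 then have "sl n T (sl n g f) = sl n g (sl n e f)"
  using sl_imul_zero[where f = f and g = g and h = T and n = n, OF zero] sl_imul_zero[where f = f and g = e and h = g and n = n, OF zero] g dT de by simp
 then have "sl n T (sl n g f) z = sl n g f z" by (simp add: ef)
 moreover have "sl n T F z = F (z + of_nat N)" for F by (simp add: sl_def T_def)
 ultimately show ?thesis by simp
qed

lemma cusp_forms_sign_subset:
 assumes N: "N > 0" and s: "sign_pattern N \<sigma>"
 shows "cusp_forms_sign (2 * n) N \<sigma> \<subseteq> Vsp n N \<sigma>"
proof
 fix f assume f: "f \<in> cusp_forms_sign (2 * n) N \<sigma>"
 then have fc: "f \<in> cusp_forms (2 * n) N" and fW: "!!Q. exact_divisor Q N ==> atkin_lehner (2 * n) N Q f = cscale (of_int (\<sigma> Q)) f"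
  by (auto simp: cusp_forms_sign_def)
 have z: "f z = 0" if "Im z \<le> 0" for z using fc that by (auto simp: cusp_forms_def upper_half_plane_def)
 have hol: "f holomorphic_on upper_half_plane" using fc by (auto simp: cusp_forms_def)
 have one: "sl n e f = f" if "e \<in> AL N 1" for e
 proof -
  obtain a b c d where e: "e = (a, b, c, d)" by (cases e)
  have "a * d - b * c = 1" "int N dvd c" using that by (auto simp: AL_def e)
  moreover from this have "slash (2 * n) a b c d f = sl n e f" unfolding e by (intro slash_eq_sl) simp
  moreover have "slash (2 * n) a b c d f = f" using fc calculation(1,2) by (auto simp: cusp_forms_def)
  ultimately show ?thesis by simp
 qed
 \<comment> \<open>\<open>atkin_lehner\<close> uses one unspecified matrix of \<open>AL N Q\<close>;
   any other one differs from it by a left factor in \<open>AL N 1\<close>, which fixes f.\<close>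
 have inv: "sl n g f = cscale (of_int (chi \<sigma> g)) f" if g: "g \<in> ALG N" for g
 proof -
  obtain Q where Q: "exact_divisor Q N" "g \<in> AL N Q" using g by (auto simp: ALG_def)
  obtain g0 where g0: "g0 \<in> AL N Q" "atkin_lehner (2 * n) N Q f = sl n g0 f"
   using atkin_lehner_eq[OF N Q(1)] by blast
  obtain e where e: "e \<in> AL N 1" "g = imul e g0" using imul_eq_AL1[OF N Q g0(1)] by blast
  have "sl n g f = sl n g0 (sl n e f)" unfolding e(2)
   by (rule sl_imul_zero[OF z]) (use AL_idet[OF e(1)] AL_idet[OF g0(1)] exact_divisor_pos[OF N Q(1)] in auto)
  then show ?thesis using one[OF e(1)] g0(2) fW[OF Q(1)] chi_AL[OF Q(2)] by simp
 qed
 have "\<exists>M. \<forall>z. Im z \<ge> 4 / 5 --> cmod (sl n r f z) * Im z ^ n \<le> M" if r: "r \<in> cosets N" for r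
 proof -
  have d: "idet r = 1" using cosets(2)[OF N r] .
  obtain a b c d where re: "r = (a, b, c, d)" by (cases r)
  have ad: "a * d - b * c = 1" using d by (simp add: re)
  then have "slash (2 * n) a b c d f = sl n r f" unfolding re by (intro slash_eq_sl) simp
  then obtain q :: "nat => complex" where "q 0 = 0" "\<forall>z\<in>upper_half_plane.
       (\<lambda>m. q m * exp (2 * of_real pi * \<i> * of_nat m * z / of_nat N)) sums sl n r f z"
   using fc ad unfolding cusp_forms_def by (smt (verit) mem_Collect_eq)
  then show ?thesis by (intro q_series_bounded[OF N, of q]) (auto simp: upper_half_plane_def)
 qed
 note bd = this
 have "\<exists>M. \<forall>z. Im z > 0 --> cmod (f z) * Im z ^ n \<le> M"
  by (rule bounded_of_cosets[where f = f and n = n, OF N z one bd])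
 then show "f \<in> Vsp n N \<sigma>" unfolding Vsp_def using z hol inv by blast
qed

lemma Vsp_AL1:
 assumes s: "sign_pattern N \<sigma>" and f: "f \<in> Vsp n N \<sigma>" and e: "e \<in> AL N 1"
 shows "sl n e f = f"
 using VspD(3)[OF f, of e] AL_1_ALG e chi_AL[OF e, of \<sigma>] s by (auto simp: cscale_def sign_pattern_def)

lemma Vsp_reduce:
 assumes N: "N > 0" and s: "sign_pattern N \<sigma>" and f: "f \<in> Vsp n N \<sigma>" and w: "Im w > 0"
 obtains r u where "r \<in> cosets N" "u \<in> sieg" "cmod (f w) * Im w ^ n = cmod (sl n r f u) * Im u ^ n"
 using AL1_reduce[where f = f and n = n, OF N VspD(1)[OF f] Vsp_AL1[OF s f] w] by blast

lemma Vsp_bounded_sl: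
 assumes "!!z. Im z > 0 ==> cmod (f z) * Im z ^ n \<le> M" "idet g > 0" "Im z > 0"
 shows "cmod (sl n g f z) * Im z ^ n \<le> M"
 using norm_sl[OF assms(3,2), of n f] assms(1)[OF Im_imob_pos[OF assms(3,2)]] by simp

lemma Vsp_q_function:
 assumes N: "N > 0" and n: "n > 0" and s: "sign_pattern N \<sigma>" and f: "f \<in> Vsp n N \<sigma>" and g: "idet g = 1"
 obtains H where "H holomorphic_on ball 0 1" "H 0 = 0"
  "!!z. Im z > 0 ==> sl n g f z = H (exp (2 * of_real pi * \<i> * z / of_nat N))"
proof -
 obtain M where M: "!!z. Im z > 0 ==> cmod (f z) * Im z ^ n \<le> M" using VspD(4)[OF f] by blast
 have g0: "idet g > 0" using g by simp
 show ?thesis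
 proof (rule q_function[OF N n sl_holomorphic[OF VspD(2)[OF f] g0]])
  show "sl n g f (z + of_nat N) = sl n g f z" if "Im z > 0" for z
   by (rule sl_periodic[where f = f and n = n, OF N VspD(1)[OF f] Vsp_AL1[OF s f] g that])
  show "cmod (sl n g f z) * Im z ^ n \<le> M" if "Im z > 1" for z
   by (rule Vsp_bounded_sl[OF M g0]) (use that in auto)
 qed (use that in auto)
qed

lemma Vsp_subset_cusp_forms_sign:
 assumes N: "N > 0" and n: "n > 0" and s: "sign_pattern N \<sigma>"
 shows "Vsp n N \<sigma> \<subseteq> cusp_forms_sign (2 * n) N \<sigma>"
proof
 fix f assume f: "f \<in> Vsp n N \<sigma>"
 have s1: "\<sigma> 1 = 1" using s by (simp add: sign_pattern_def)
 have q: "\<exists>q :: nat => complex. q 0 = 0 \<and> (\<forall>z\<in>upper_half_plane.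
       (\<lambda>m. q m * exp (2 * of_real pi * \<i> * of_nat m * z / of_nat N)) sums slash (2 * n) a b c d f z)"
  if ad: "a * d - b * c = 1" for a b c d
 proof -
  obtain H where H: "H holomorphic_on ball 0 1" "H 0 = 0"
   "!!z. Im z > 0 ==> sl n (a, b, c, d) f z = H (exp (2 * of_real pi * \<i> * z / of_nat N))"
   using Vsp_q_function[OF N n s f, of "(a, b, c, d)"] ad by auto
  have sl: "slash (2 * n) a b c d f = sl n (a, b, c, d) f" by (rule slash_eq_sl) (use ad in simp)
  \<comment> \<open>The Fourier coefficients are the Taylor coefficients at 0 of the function of exp
    (2 pi \<i> z / N) that extends over the cusp.\<close>
  define q where "q m = (deriv ^^ m) H 0 / fact m" for m
  have "(\<lambda>m. q m * exp (2 * of_real pi * \<i> * of_nat m * z / of_nat N)) sums slash (2 * n) a b c d f z"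
   if z: "Im z > 0" for z
  proof -
   have "exp (2 * of_real pi * \<i> * z / of_nat N) \<in> ball 0 1"
    using z N by (simp only: mem_ball_0 norm_qexp) simp
   from holomorphic_power_series[OF H(1) this] show ?thesis
    unfolding q_def sl exp_qpow using H(3)[OF z] by simp
  qed
  moreover have "q 0 = 0" by (simp add: q_def H(2))
  ultimately show ?thesis by (auto simp: upper_half_plane_def)
 qed
 have inv: "slash (2 * n) a b c d f = f" if "a * d - b * c = 1" "int N dvd c" for a b c d
 proof -
  have e: "(a, b, c, d) \<in> AL N 1" using that by (simp add: AL_def)
  have "slash (2 * n) a b c d f = sl n (a, b, c, d) f" by (rule slash_eq_sl) (use that in simp)
  also have "\<dots> = f" using VspD(3)[OF f, of "(a, b, c, d)"] e AL_1_ALG chi_AL[OF e, of \<sigma>] s1 by (auto simp: cscale_def)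
  finally show ?thesis .
 qed
 have al: "atkin_lehner (2 * n) N Q f = cscale (of_int (\<sigma> Q)) f" if Q: "exact_divisor Q N" for Q
 proof -
  obtain g where g: "g \<in> AL N Q" "atkin_lehner (2 * n) N Q f = sl n g f"
   using atkin_lehner_eq[OF N Q] by blast
  then show ?thesis using VspD(3)[OF f, of g] chi_AL[OF g(1), of \<sigma>] Q by (auto simp: ALG_def)
 qed
 show "f \<in> cusp_forms_sign (2 * n) N \<sigma>"
  unfolding cusp_forms_sign_def cusp_forms_def using VspD(1,2)[OF f] q inv al
  by (auto simp: upper_half_plane_def)
qed

lemma cusp_forms_sign_eq_Vsp:
 assumes "N > 0" "n > 0" "sign_pattern N \<sigma>"
 shows "cusp_forms_sign (2 * n) N \<sigma> = Vsp n N \<sigma>"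
 using cusp_forms_sign_subset[of N \<sigma> n] Vsp_subset_cusp_forms_sign[of N n \<sigma>] assms by blast

text \<open>Decay like 1 / Im z at the cusps already makes the singularity at q = 0 removable with
  value 0. The expansion then decays exponentially, and the bound with exponent n follows.\<close>

lemma VspI:
 assumes N: "N > 0" and s: "sign_pattern N \<sigma>" and zero: "!!z. Im z \<le> 0 ==> f z = 0"
  and hol: "f holomorphic_on upper_half_plane"
  and inv: "!!g. g \<in> ALG N ==> sl n g f = cscale (of_int (chi \<sigma> g)) f"
  and bd: "!!r. r \<in> cosets N ==> \<exists>M. \<forall>z. Im z > 1 --> cmod (sl n r f z) * Im z \<le> M"
 shows "f \<in> Vsp n N \<sigma>"
proof -
 have one: "sl n e f = f" if "e \<in> AL N 1" for e
  using inv[of e] AL_1_ALG that chi_AL[OF that, of \<sigma>] s by (auto simp: cscale_def sign_pattern_def)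
 have "\<exists>M. \<forall>z. Im z > 0 --> cmod (f z) * Im z ^ n \<le> M"
 proof (rule bounded_of_cosets[where f = f and n = n, OF N zero one])
  fix r assume r: "r \<in> cosets N"
  have d: "idet r = 1" using cosets(2)[OF N r] .
  obtain M where M: "\<forall>z. Im z > 1 --> cmod (sl n r f z) * Im z \<le> M" using bd[OF r] by blast
  obtain H where H: "H holomorphic_on ball 0 1" "H 0 = 0"
   "!!z. Im z > 0 ==> sl n r f z = H (exp (2 * of_real pi * \<i> * z / of_nat N))"
  proof (rule q_function[of N 1 "sl n r f" M])
   show "sl n r f holomorphic_on upper_half_plane" by (rule sl_holomorphic[OF hol]) (use d in simp)
   show "sl n r f (z + of_nat N) = sl n r f z" if "Im z > 0" for z
    by (rule sl_periodic[where f = f and n = n, OF N zero one d that])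
  qed (use N M that in auto)
  define q where "q m = (deriv ^^ m) H 0 / fact m" for m
  show "\<exists>M. \<forall>z. Im z \<ge> 4 / 5 --> cmod (sl n r f z) * Im z ^ n \<le> M"
  proof (rule q_series_bounded[OF N, of q])
   show "q 0 = 0" by (simp add: q_def H(2))
   fix z assume z: "Im z > 0"
   have "exp (2 * of_real pi * \<i> * z / of_nat N) \<in> ball 0 1"
    using z N by (simp only: mem_ball_0 norm_qexp) simp
   from holomorphic_power_series[OF H(1) this]
   show "(\<lambda>m. q m * exp (2 * of_real pi * \<i> * of_nat m * z / of_nat N)) sums sl n r f z"
    unfolding q_def exp_qpow using H(3)[OF z] by simp
  qed
 qed
 then show ?thesis using zero hol inv by (auto simp: Vsp_def)
qed

lemma sl_add: "sl n g (f + h) = sl n g f + sl n g h"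
 by (simp add: sl_def fun_eq_iff distrib_left)

lemma Vsp_subspace: "cfun.subspace (Vsp n N \<sigma>)"
proof (rule cfun.subspaceI)
 show "0 \<in> Vsp n N \<sigma>" by (auto simp: Vsp_def sl_def cscale_def fun_eq_iff zero_fun_def)
 fix f h assume f: "f \<in> Vsp n N \<sigma>" and h: "h \<in> Vsp n N \<sigma>"
 obtain M where M: "!!z. Im z > 0 ==> cmod (f z) * Im z ^ n \<le> M" using VspD(4)[OF f] by blast
 obtain M' where M': "!!z. Im z > 0 ==> cmod (h z) * Im z ^ n \<le> M'" using VspD(4)[OF h] by blast
 have "cmod ((f + h) z) * Im z ^ n \<le> M + M'" if "Im z > 0" for z
 proof -
  have "cmod ((f + h) z) * Im z ^ n \<le> (cmod (f z) + cmod (h z)) * Im z ^ n"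
   using that by (intro mult_right_mono) (auto intro: norm_triangle_ineq)
  then show ?thesis using M[OF that] M'[OF that] by (simp add: algebra_simps)
 qed
 moreover have "(f + h) holomorphic_on upper_half_plane"
  unfolding plus_fun_def by (intro holomorphic_intros VspD(2)[OF f] VspD(2)[OF h])
 moreover have "sl n g (f + h) = cscale (of_int (chi \<sigma> g)) (f + h)" if "g \<in> ALG N" for g
  using VspD(3)[OF f that] VspD(3)[OF h that] by (simp add: sl_add cscale_def fun_eq_iff algebra_simps)
 ultimately show "f + h \<in> Vsp n N \<sigma>" using VspD(1)[OF f] VspD(1)[OF h] by (auto simp: Vsp_def)
next
 fix c f assume f: "f \<in> Vsp n N \<sigma>"
 obtain M where M: "!!z. Im z > 0 ==> cmod (f z) * Im z ^ n \<le> M" using VspD(4)[OF f] by blast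
 have "cmod (cscale c f z) * Im z ^ n \<le> cmod c * M" if "Im z > 0" for z
  using mult_left_mono[OF M[OF that], of "cmod c"] by (simp add: cscale_def norm_mult mult.assoc)
 moreover have "cscale c f holomorphic_on upper_half_plane"
  unfolding cscale_def by (intro holomorphic_intros VspD(2)[OF f])
 moreover have "sl n g (cscale c f) = cscale (of_int (chi \<sigma> g)) (cscale c f)" if "g \<in> ALG N" for g
  using VspD(3)[OF f that] by (simp add: sl_cscale)
 ultimately show "cscale c f \<in> Vsp n N \<sigma>" using VspD(1)[OF f] by (auto simp: Vsp_def cscale_def)
qed

section \<open>Hecke operators on the space of forms\<close>

definition HeckeU :: "nat => nat => (complex => complex) => complex => complex" where
 "HeckeU n m f = (\<lambda>z. \<Sum>\<beta>\<in>HB m. sl n \<beta> f z)"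

lemma sl_sum: "sl n g (\<lambda>z. \<Sum>i\<in>I. F i z) = (\<lambda>z. \<Sum>i\<in>I. sl n g (F i) z)"
 by (simp add: sl_def sum_distrib_left)

text \<open>By \<open>Hecke_commute\<close> an element of \<open>AL N Q\<close> passes through the
  sum by permuting \<open>HB m\<close>. What appears on the other side lies in the same
  \<open>AL N Q\<close> and so has the same sign.\<close>

lemma HeckeU_Vsp:
 assumes N: "N > 0" and m: "m > 0" and cop: "coprime N m" and f: "f \<in> Vsp n N \<sigma>"
 shows "HeckeU n m f \<in> Vsp n N \<sigma>"
proof -
 have zero: "!!z. Im z \<le> 0 ==> f z = 0" using VspD(1)[OF f] .
 have dB: "idet \<beta> > 0" if "\<beta> \<in> HB m" for \<beta> using HB_idet[OF that] m by simp
 obtain M where M: "!!z. Im z > 0 ==> cmod (f z) * Im z ^ n \<le> M" using VspD(4)[OF f] by blast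
 have bd: "cmod (HeckeU n m f z) * Im z ^ n \<le> real (card (HB m)) * M" if "Im z > 0" for z
 proof -
  have "cmod (HeckeU n m f z) * Im z ^ n \<le> (\<Sum>\<beta>\<in>HB m. cmod (sl n \<beta> f z)) * Im z ^ n"
   unfolding HeckeU_def using that by (intro mult_right_mono norm_sum) auto
  also have "\<dots> = (\<Sum>\<beta>\<in>HB m. cmod (sl n \<beta> f z) * Im z ^ n)" by (rule sum_distrib_right)
  also have "\<dots> \<le> (\<Sum>\<beta>\<in>HB m. M)" by (intro sum_mono Vsp_bounded_sl[OF M]) (use dB that in auto)
  finally show ?thesis by simp
 qed
 have hol: "HeckeU n m f holomorphic_on upper_half_plane" unfolding HeckeU_def
  by (intro holomorphic_intros sl_holomorphic VspD(2)[OF f] dB)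
 have inv: "sl n g (HeckeU n m f) = cscale (of_int (chi \<sigma> g)) (HeckeU n m f)" if g: "g \<in> ALG N" for g
 proof -
  obtain Q where Q: "exact_divisor Q N" "g \<in> AL N Q" using g by (auto simp: ALG_def)
  obtain p where p: "bij_betw p (HB m) (HB m)" "!!\<beta>. \<beta> \<in> HB m ==> \<exists>\<gamma>'\<in>AL N Q. imul \<beta> g = imul \<gamma>' (p \<beta>)"
   using Hecke_commute[OF N m cop Q] by blast
  have dg: "idet g > 0" by (rule ALG_idet_pos[OF N g])
  have each: "sl n g (sl n \<beta> f) = cscale (of_int (chi \<sigma> g)) (sl n (p \<beta>) f)" if b: "\<beta> \<in> HB m" for \<beta>
  proof -
   obtain \<gamma>' where \<gamma>': "\<gamma>' \<in> AL N Q" "imul \<beta> g = imul \<gamma>' (p \<beta>)" using p(2)[OF b] by blast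
   have pb: "p \<beta> \<in> HB m" using p(1) b by (auto simp: bij_betw_def)
   have g': "\<gamma>' \<in> ALG N" using \<gamma>'(1) Q by (auto simp: ALG_def)
   have "sl n g (sl n \<beta> f) = sl n (imul \<beta> g) f" using sl_imul_zero[OF zero dB[OF b] dg] by simp
   also have "\<dots> = sl n (p \<beta>) (sl n \<gamma>' f)" unfolding \<gamma>'(2)
    by (rule sl_imul_zero[OF zero ALG_idet_pos[OF N g'] dB[OF pb]])
   also have "sl n \<gamma>' f = cscale (of_int (chi \<sigma> g)) f" using VspD(3)[OF f g'] chi_AL[OF \<gamma>'(1)] chi_AL[OF Q(2)] by simp
   finally show ?thesis by (simp add: sl_cscale)
  qed
  have "sl n g (HeckeU n m f) = (\<lambda>z. \<Sum>\<beta>\<in>HB m. sl n g (sl n \<beta> f) z)" unfolding HeckeU_def by (rule sl_sum)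
  also have "\<dots> = (\<lambda>z. \<Sum>\<beta>\<in>HB m. of_int (chi \<sigma> g) * sl n (p \<beta>) f z)"
   by (intro ext sum.cong refl) (simp add: each cscale_def)
  also have "\<dots> = (\<lambda>z. of_int (chi \<sigma> g) * (\<Sum>\<beta>\<in>HB m. sl n \<beta> f z))"
   by (simp add: sum_distrib_left[symmetric] sum.reindex_bij_betw[OF p(1), of "\<lambda>\<beta>. sl n \<beta> f _"])
  finally show ?thesis by (simp add: cscale_def HeckeU_def)
 qed
 have "HeckeU n m f z = 0" if "Im z \<le> 0" for z
  unfolding HeckeU_def by (intro sum.neutral ballI sl_zero[OF zero that dB])
 then show ?thesis using bd hol inv by (auto simp: Vsp_def)
qed

lemma Vsp_measurable:
 assumes f: "f \<in> Vsp n N \<sigma>"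
 shows "f \<in> borel_measurable borel"
proof -
 have "f = (\<lambda>z. indicator upper_half_plane z *\<^sub>R f z)"
  using VspD(1)[OF f] by (auto simp: fun_eq_iff upper_half_plane_def split: split_indicator)
 moreover have "\<dots> \<in> borel_measurable borel"
 proof (rule borel_measurable_continuous_on_indicator)
  have "open upper_half_plane" unfolding upper_half_plane_def by (rule open_halfspace_Im_gt)
  then show "upper_half_plane \<in> sets borel" by simp
 qed (rule holomorphic_on_imp_continuous_on[OF VspD(2)[OF f]])
 ultimately show ?thesis by simp
qed

section \<open>Finite dimension and interpolation at points\<close>

definition cond_linear :: "(complex => complex) set => ((complex => complex) => complex) => bool" where
 "cond_linear V l \<longleftrightarrow> (\<forall>f\<in>V. \<forall>g\<in>V. l (f + g) = l f + l g) \<and> (\<forall>f\<in>V. \<forall>c. l (cscale c f) = c * l f)"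

text \<open>A biorthogonal system of length d. If the functionals in L separate V, a system of
  maximal length is a basis whose coordinates are its own functionals.\<close>

definition lagrange :: "(complex => complex) set => ((complex => complex) => complex) set => nat =>
  (nat => complex => complex) => (nat => (complex => complex) => complex) => bool" where
 "lagrange V L d g l \<longleftrightarrow> (\<forall>i<d. g i \<in> V \<and> l i \<in> L) \<and> (\<forall>i<d. \<forall>j<d. l i (g j) = (if i = j then 1 else 0))"

lemma cond_linear_add: "cond_linear V l ==> f \<in> V ==> g \<in> V ==> l (f + g) = l f + l g"
 and cond_linear_scale: "cond_linear V l ==> f \<in> V ==> l (cscale c f) = c * l f"
 unfolding cond_linear_def by blast+

lemma cond_linear_sum:
 assumes V: "cfun.subspace V" and l: "cond_linear V l" and g: "!!i. i \<in> I ==> g i \<in> V"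
 shows "l (\<Sum>i\<in>I. cscale (c i) (g i)) = (\<Sum>i\<in>I. c i * l (g i))"
 using g
proof (induction I rule: infinite_finite_induct)
 case (insert x F)
 have "(\<Sum>i\<in>F. cscale (c i) (g i)) \<in> V" using insert by (intro cfun.subspace_sum[OF V] cfun.subspace_scale[OF V]) auto
 moreover have "cscale (c x) (g x) \<in> V" using insert by (intro cfun.subspace_scale[OF V]) auto
 ultimately have "l (cscale (c x) (g x) + (\<Sum>i\<in>F. cscale (c i) (g i))) = c x * l (g x) + (\<Sum>i\<in>F. c i * l (g i))"
  using insert by (subst cond_linear_add[OF l]) (auto simp: cond_linear_scale[OF l])
 then show ?case unfolding sum.insert[OF insert(1,2)] .
next
 case empty
 have "l (cscale 0 0) = 0 * l 0" using l cfun.subspace_0[OF V] unfolding cond_linear_def by blast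
 then show ?case by (simp add: zero_fun_def)
next
 case (infinite A)
 have "l (cscale 0 0) = 0 * l 0" using l cfun.subspace_0[OF V] unfolding cond_linear_def by blast
 with infinite show ?case by (simp add: zero_fun_def)
qed

text \<open>The interpolation defect of f is killed by all old functionals, while a separating
  functional \<open>l0\<close> detects it and gives the new pair. The old vectors are then corrected
  so that \<open>l0\<close> vanishes on them.\<close>

lemma lagrange_extend:
 assumes V: "cfun.subspace V" and L: "!!l. l \<in> L ==> cond_linear V l"
  and sep: "!!f. f \<in> V ==> (!!l. l \<in> L ==> l f = 0) ==> f = 0"
  and lag: "lagrange V L d g l" and f: "f \<in> V" and ne: "f \<noteq> (\<Sum>i<d. cscale (l i f) (g i))"
 shows "\<exists>g' l'. lagrange V L (Suc d) g' l'"
proof -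
 have gV: "g i \<in> V" and lL: "l i \<in> L" if "i < d" for i using lag that by (auto simp: lagrange_def)
 have lg: "l i (g j) = (if i = j then 1 else 0)" if "i < d" "j < d" for i j using lag that by (auto simp: lagrange_def)
 define p where "p = (\<Sum>i<d. cscale (l i f) (g i))"
 have pV: "p \<in> V" unfolding p_def by (intro cfun.subspace_sum[OF V] cfun.subspace_scale[OF V] gV) auto
 define h where "h = f + cscale (-1) p"
 have hV: "h \<in> V" unfolding h_def by (intro cfun.subspace_add[OF V] cfun.subspace_scale[OF V] f pV)
 have lh: "l j h = 0" if j: "j < d" for j
 proof -
  have "l j p = (\<Sum>i<d. l i f * l j (g i))"
   unfolding p_def by (rule cond_linear_sum[OF V L[OF lL[OF j]]]) (use gV in auto)
  also have "\<dots> = (\<Sum>i<d. if i = j then l j f else 0)" by (rule sum.cong) (auto simp: lg j)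
  also have "\<dots> = l j f" using j by simp
  finally have "l j p = l j f" .
  have "cscale (-1) p \<in> V" using pV by (rule cfun.subspace_scale[OF V])
  note l = L[OF lL[OF j]]
  have "l j h = l j f + (-1) * l j p"
   unfolding h_def using cond_linear_add[OF l f \<open>cscale (-1) p \<in> V\<close>] cond_linear_scale[OF l pV] by (simp only:)
  then show ?thesis using \<open>l j p = l j f\<close> by simp
 qed
 have "h \<noteq> 0"
 proof
  assume "h = 0"
  then have "f = p" by (simp add: h_def cscale_def fun_eq_iff)
  with ne[folded p_def] show False by (rule notE)
 qed
 then obtain l0 where l0: "l0 \<in> L" "l0 h \<noteq> 0" using sep[OF hV] by blast
 define g0 where "g0 = cscale (1 / l0 h) h"
 have g0V: "g0 \<in> V" unfolding g0_def by (rule cfun.subspace_scale[OF V hV])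
 have l0g0: "l0 g0 = 1" using cond_linear_scale[OF L[OF l0(1)] hV] l0(2) by (simp add: g0_def)
 have lg0: "l j g0 = 0" if "j < d" for j using cond_linear_scale[OF L[OF lL[OF that]] hV] lh[OF that] by (simp add: g0_def)
 define g' where "g' i = (if i < d then g i + cscale (- l0 (g i)) g0 else g0)" for i
 define l' where "l' i = (if i < d then l i else l0)" for i
 have sc: "cscale c g0 \<in> V" for c using g0V by (rule cfun.subspace_scale[OF V])
 have "lagrange V L (Suc d) g' l'"
  unfolding lagrange_def
 proof (intro conjI allI impI)
  fix i assume "i < Suc d"
  show "g' i \<in> V" using gV g0V sc cfun.subspace_add[OF V] by (auto simp: g'_def simp del: cfun.scale_minus_left)
  show "l' i \<in> L" using lL l0 by (auto simp: l'_def)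
 next
  fix i j assume ij: "i < Suc d" "j < Suc d"
  have lin: "k (g j + cscale c g0) = k (g j) + c * k g0" if "k \<in> L" "j < d" for k j c
   using cond_linear_add[OF L[OF that(1)] gV[OF that(2)] sc] cond_linear_scale[OF L[OF that(1)] g0V] by (simp only:)
  show "l' i (g' j) = (if i = j then 1 else 0)"
   using ij lin[OF lL] lin[OF l0(1)] lg lg0 l0g0 by (auto simp: l'_def g'_def less_Suc_eq simp del: cfun.scale_minus_left)
 qed
 then show ?thesis by blast
qed

lemma lagrange_exists:
 assumes V: "cfun.subspace V" and L: "!!l. l \<in> L ==> cond_linear V l"
  and sep: "!!f. f \<in> V ==> (!!l. l \<in> L ==> l f = 0) ==> f = 0"
  and bd: "!!d g l. lagrange V L d g l ==> d \<le> B"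
 shows "\<exists>d g l. lagrange V L d g l \<and> (\<forall>f\<in>V. f = (\<Sum>i<d. cscale (l i f) (g i)))"
proof -
 define P where "P d \<longleftrightarrow> (\<exists>g l. lagrange V L d g l)" for d
 have "P 0" by (simp add: P_def lagrange_def)
 have fin: "finite {d. P d}"
  by (rule finite_subset[of _ "{..B}"]) (use bd in \<open>auto simp: P_def\<close>)
 define d where "d = Max {d. P d}"
 have d: "P d" "!!d'. P d' ==> d' \<le> d"
  using Max_in[OF fin] Max_ge[OF fin] \<open>P 0\<close> by (auto simp: d_def)
 then obtain g l where gl: "lagrange V L d g l" unfolding P_def by blast
 have "f = (\<Sum>i<d. cscale (l i f) (g i))" if f: "f \<in> V" for f
 proof (rule ccontr)
  assume "f \<noteq> (\<Sum>i<d. cscale (l i f) (g i))"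
  from lagrange_extend[OF V L sep gl f this] have "P (Suc d)" unfolding P_def .
  from d(2)[OF this] show False by simp
 qed
 then show ?thesis using gl by blast
qed

lemma lagrange_independent:
 assumes V: "cfun.subspace V" and L: "!!l. l \<in> L ==> cond_linear V l" and lag: "lagrange V L d g l"
 shows "inj_on g {..<d}" "cfun.independent (g ` {..<d})"
proof -
 have gV: "g i \<in> V" and lL: "l i \<in> L" if "i < d" for i using lag that by (auto simp: lagrange_def)
 have lg: "l i (g j) = (if i = j then 1 else 0)" if "i < d" "j < d" for i j using lag that by (auto simp: lagrange_def)
 show inj: "inj_on g {..<d}"
 proof (rule inj_onI)
  fix i j assume "i \<in> {..<d}" "j \<in> {..<d}" "g i = g j"
  then show "i = j" using lg[of i i] lg[of i j] by (cases "i = j") auto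
 qed
 show "cfun.independent (g ` {..<d})"
 proof
  assume "cfun.dependent (g ` {..<d})"
  then obtain u v where uv: "v \<in> g ` {..<d}" "u v \<noteq> 0" "(\<Sum>w\<in>g ` {..<d}. cscale (u w) w) = 0"
   by (auto simp: cfun.dependent_finite)
  then obtain j where j: "j < d" "v = g j" by auto
  have "(\<Sum>i<d. cscale (u (g i)) (g i)) = 0" using uv(3) by (simp add: sum.reindex[OF inj])
  then have "0 = l j (\<Sum>i<d. cscale (u (g i)) (g i))"
   using cond_linear_sum[OF V L[OF lL[OF j(1)]], of "{}" g "\<lambda>_. 0"] by simp
  also have "\<dots> = (\<Sum>i<d. u (g i) * l j (g i))"
   by (rule cond_linear_sum[OF V L[OF lL[OF j(1)]]]) (use gV in auto)
  also have "\<dots> = (\<Sum>i<d. if i = j then u (g j) else 0)" by (rule sum.cong) (auto simp: lg j)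
  also have "\<dots> = u v" using j by simp
  finally show False using uv(2) by simp
 qed
qed

text \<open>Schwarz's lemma for a zero of order k: divide by q^k and apply the maximum principle on
  the disc of radius R.\<close>

lemma zero_order_bound:
 assumes H: "H holomorphic_on ball 0 1" and z: "!!m. m < k ==> (deriv ^^ m) H 0 = 0"
  and R: "0 < R" "R < 1" and B: "!!q. cmod q \<le> R ==> cmod (H q) \<le> B" and q: "cmod q \<le> R"
 shows "cmod (H q) \<le> B * (cmod q / R) ^ k"
proof -
 define a where "a m = (deriv ^^ m) H 0 / fact m" for m
 have a0: "a m = 0" if "m < k" for m using z[OF that] by (simp add: a_def)
 have s: "(\<lambda>m. a m * w ^ m) sums H w" if "w \<in> ball 0 1" for w
  using holomorphic_power_series[OF H that] by (simp add: a_def)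
 define G where "G w = (if w = 0 then a k else H w / w ^ k)" for w
 have sG: "(\<lambda>m. a (m + k) * (w - 0) ^ m) sums G w" if w: "w \<in> ball 0 1" for w
 proof (cases "w = 0")
  case True
  then show ?thesis using powser_sums_zero[of "\<lambda>m. a (m + k)"] by (simp add: G_def)
 next
  case False
  have "(\<lambda>m. a (m + k) * w ^ (m + k)) sums (H w - (\<Sum>m<k. a m * w ^ m))"
   using s[OF w] by (simp add: sums_iff_shift[of "\<lambda>m. a m * w ^ m" k])
  then have "(\<lambda>m. a (m + k) * w ^ (m + k)) sums H w" by (simp add: a0)
  then have "(\<lambda>m. a (m + k) * w ^ (m + k) / w ^ k) sums (H w / w ^ k)" by (rule sums_divide)
  then show ?thesis using False by (simp add: G_def power_add)
 qed
 have Ghol: "G holomorphic_on ball 0 1" using sG by (rule power_series_holomorphic)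
 have HG: "H w = w ^ k * G w" if w: "w \<in> ball 0 1" for w
 proof (cases "w = 0")
  case True
  have "H 0 = a 0" by (simp add: a_def)
  then show ?thesis using True a0[of 0] by (cases "k = 0") (auto simp: G_def)
 qed (simp add: G_def)
 have sub: "cball 0 R \<subseteq> ball (0::complex) 1" using R by auto
 have "cmod (G q) \<le> B / R ^ k"
 proof (rule maximum_modulus_frontier[of G "cball 0 R"])
  show "G holomorphic_on interior (cball 0 R)" using Ghol sub interior_subset holomorphic_on_subset by blast
  show "continuous_on (closure (cball 0 R)) G"
   using holomorphic_on_imp_continuous_on[OF Ghol] sub by (simp add: continuous_on_subset)
  fix w assume "w \<in> frontier (cball (0::complex) R)"
  then have w: "cmod w = R" using R by (simp add: frontier_cball sphere_def)
  have "R ^ k * cmod (G w) = cmod (H w)" using HG[of w] w R by (simp add: norm_mult norm_power)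
  also have "\<dots> \<le> B" using B w by simp
  finally show "cmod (G w) \<le> B / R ^ k" using R by (simp add: field_simps)
 qed (use q in auto)
 then have "cmod q ^ k * cmod (G q) \<le> cmod q ^ k * (B / R ^ k)" by (intro mult_left_mono) auto
 then show ?thesis using HG[of q] q R by (simp add: norm_mult norm_power power_divide mult.commute)
qed

text \<open>The expansion at the cusp of r as a function of q, written with the principal logarithm
  so that it is visibly linear in f. The value 0 at q = 0 is the one forced on cusp forms.\<close>

definition qH :: "nat => nat => imat => (complex => complex) => complex => complex" where
 "qH n N r f = (\<lambda>q. if q = 0 then 0 else sl n r f (of_nat N / (2 * of_real pi * \<i>) * Ln q))"

lemma qH:
 assumes N: "N > 0" and n: "n > 0" and s: "sign_pattern N \<sigma>" and f: "f \<in> Vsp n N \<sigma>" and g: "idet g = 1"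
 shows "qH n N g f holomorphic_on ball 0 1"
  "Im z > 0 ==> sl n g f z = qH n N g f (exp (2 * of_real pi * \<i> * z / of_nat N))"
proof -
 obtain H where H: "H holomorphic_on ball 0 1" "H 0 = 0"
  "!!z. Im z > 0 ==> sl n g f z = H (exp (2 * of_real pi * \<i> * z / of_nat N))"
  using Vsp_q_function[OF N n s f g] by blast
 have eq: "H q = qH n N g f q" if q: "q \<in> ball 0 1" for q
 proof (cases "q = 0")
  case True then show ?thesis by (simp add: H(2) qH_def)
 next
  case False
  define z where "z = of_nat N / (2 * of_real pi * \<i>) * Ln q"
  have "z = of_real (real N / (2 * pi)) * (- \<i> * Ln q)" by (simp add: z_def field_simps)
  then have "Im z = real N / (2 * pi) * (- ln (cmod q))" using False by (simp del: of_real_divide of_real_mult)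
  also have "\<dots> > 0" using q False N by (intro mult_pos_pos) auto
  finally have z: "Im z > 0" .
  have "exp (2 * of_real pi * \<i> * z / of_nat N) = q" using N False by (simp add: z_def)
  then show ?thesis using H(3)[OF z] False by (simp add: qH_def z_def)
 qed
 show "qH n N g f holomorphic_on ball 0 1" by (rule holomorphic_transform[OF H(1) eq])
 assume z: "Im z > 0"
 have "exp (2 * of_real pi * \<i> * z / of_nat N) \<in> ball 0 1"
  using z N by (simp only: mem_ball_0 norm_qexp) simp
 then show "sl n g f z = qH n N g f (exp (2 * of_real pi * \<i> * z / of_nat N))"
  using H(3)[OF z] eq by simp
qed

text \<open>A form whose expansions at all cusps vanish to high order is \<open>0\<close>, because its supremum
 norm can then be halved.\<close>

lemma Vsp_order_zero:
 assumes N: "N > 0" and n: "n > 0" and s: "sign_pattern N \<sigma>"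
 obtains k where "!!f. f \<in> Vsp n N \<sigma> ==> (!!r m. r \<in> cosets N ==> m < k ==> (deriv ^^ m) (qH n N r f) 0 = 0) ==> f = 0"
proof -
 define c where "c = 2 * pi / real N"
 have c: "c > 0" using N by (simp add: c_def)
 \<comment> \<open>(5/2)^n comes from using the sup norm down to height 2/5, and n! / (c/4)^n is the
   bound of \<open>power_exp_bound\<close> for y^n exp (-c y / 4).\<close>
 define A where "A = (5 / 2) ^ n * (fact n / (c / 4) ^ n)"
 have A: "A > 0" using c by (simp add: A_def)
 have "(\<lambda>k. A * exp (- (c / 5)) ^ k) \<longlonglongrightarrow> A * 0"
  by (intro tendsto_mult tendsto_const LIMSEQ_power_zero) (use c in simp)
 then have "\<forall>\<^sub>F k in sequentially. A * exp (- (c / 5)) ^ k < 1 / 2"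
  by (rule order_tendstoD(2)) simp
 then obtain k0 where k0: "A * exp (- (c / 5)) ^ k0 < 1 / 2" by (auto simp: eventually_sequentially)
 \<comment> \<open>One of the k zeros pays for the growth of y^n; the other k0 push the remaining
   constant below 1/2.\<close>
 define k where "k = k0 + 1"
 have half: "\<forall>w. Im w > 0 --> cmod (f w) * Im w ^ n \<le> M / 2"
  if f: "f \<in> Vsp n N \<sigma>" and z: "!!r m. r \<in> cosets N ==> m < k ==> (deriv ^^ m) (qH n N r f) 0 = 0"
   and M: "\<forall>w. Im w > 0 --> cmod (f w) * Im w ^ n \<le> M" for f M
 proof (intro allI impI)
  fix w :: complex assume w: "Im w > 0"
  have M0: "M \<ge> 0" using M[rule_format, OF w] w by (intro order_trans[OF _ M[rule_format, OF w]]) auto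
  obtain r u where ru: "r \<in> cosets N" "u \<in> sieg" "cmod (f w) * Im w ^ n = cmod (sl n r f u) * Im u ^ n"
   using Vsp_reduce[OF N s f w] by blast
  have d: "idet r = 1" using cosets(2)[OF N ru(1)] .
  note H = qH[OF N n s f d]
  have u: "Im u \<ge> 4 / 5" using ru(2) by (simp add: sieg_def)
  \<comment> \<open>The expansion is bounded on the disc of height 2/5 and evaluated at height at
    least 4/5. The gap makes (|q| / R)^k small.\<close>
  define R where "R = exp (- c * (2 / 5))"
  have R: "0 < R" "R < 1" using c by (simp_all add: R_def)
  define q where "q = exp (2 * of_real pi * \<i> * u / of_nat N)"
  have nq: "cmod q = exp (- c * Im u)" unfolding q_def norm_qexp c_def ..
  have B: "cmod (qH n N r f p) \<le> M * (5 / 2) ^ n" if p: "cmod p \<le> R" for p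
  proof (cases "p = 0")
   case True then show ?thesis using M0 by (simp add: qH_def)
  next
   case False
   define v where "v = of_nat N / (2 * of_real pi * \<i>) * Ln p"
   have "v = of_real (real N / (2 * pi)) * (- \<i> * Ln p)" by (simp add: v_def field_simps)
   then have Iv: "Im v = real N / (2 * pi) * (- ln (cmod p))" using False by (simp del: of_real_divide of_real_mult)
   have "ln (cmod p) \<le> ln R" using p False R by simp
   then have "- ln (cmod p) \<ge> c * (2 / 5)" by (simp add: R_def)
   then have "Im v \<ge> real N / (2 * pi) * (c * (2 / 5))" unfolding Iv by (intro mult_left_mono) auto
   then have v: "Im v \<ge> 2 / 5" using N by (simp add: c_def)
   have "cmod (qH n N r f p) = cmod (sl n r f v)" using False by (simp add: qH_def v_def)
   moreover have "cmod (sl n r f v) * (2 / 5) ^ n \<le> cmod (sl n r f v) * Im v ^ n"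
    using v by (intro mult_left_mono power_mono) auto
   moreover have "\<dots> \<le> M" by (rule Vsp_bounded_sl) (use M v d in auto)
   ultimately have "cmod (qH n N r f p) * (2 / 5) ^ n \<le> M" by simp
   then have "cmod (qH n N r f p) \<le> M / (2 / 5) ^ n" by (simp add: field_simps)
   then show ?thesis by (simp add: power_divide)
  qed
  have "cmod (sl n r f u) = cmod (qH n N r f q)" using H(2)[of u] u by (simp add: q_def)
  also have "\<dots> \<le> M * (5 / 2) ^ n * (cmod q / R) ^ k"
  proof (rule zero_order_bound[OF H(1) _ R B])
   show "cmod q \<le> R" unfolding nq R_def using u c by simp
  qed (use z[OF ru(1)] in auto)
  also have "(cmod q / R) ^ k \<le> exp (- (c / 4) * Im u) * exp (- (c / 5)) ^ k0"
  proof -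
   have e: "cmod q / R = exp (- c * (Im u - 2 / 5))"
    unfolding nq R_def by (simp add: exp_diff[symmetric] algebra_simps)
   have k1: "exp (- c * (Im u - 2 / 5)) \<le> exp (- (c / 4) * Im u)"
    using c u mult_left_mono[of "Im u / 4" "Im u - 2 / 5" c] by simp
   have k2: "exp (- c * (Im u - 2 / 5)) \<le> exp (- (c / 5))"
    using c u mult_left_mono[of "1 / 5" "Im u - 2 / 5" c] by simp
   show ?thesis unfolding e k_def using k1 power_mono[OF k2, of k0] by (simp add: mult_mono)
  qed
  finally have "cmod (sl n r f u) \<le> M * (5 / 2) ^ n * (exp (- (c / 4) * Im u) * exp (- (c / 5)) ^ k0)"
   using M0 by (simp add: mult_left_mono)
  then have "cmod (sl n r f u) * Im u ^ n \<le> M * (5 / 2) ^ n * (exp (- (c / 4) * Im u) * exp (- (c / 5)) ^ k0) * Im u ^ n"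
   using u by (intro mult_right_mono) auto
  also have "\<dots> = M * (5 / 2) ^ n * exp (- (c / 5)) ^ k0 * (Im u ^ n * exp (- (c / 4) * Im u))" by simp
  also have "\<dots> \<le> M * (5 / 2) ^ n * exp (- (c / 5)) ^ k0 * (fact n / (c / 4) ^ n)"
   using M0 c u by (intro mult_left_mono power_exp_bound) auto
  also have "\<dots> = M * (A * exp (- (c / 5)) ^ k0)" by (simp add: A_def)
  also have "\<dots> \<le> M * (1 / 2)" using k0 M0 by (intro mult_left_mono) auto
  finally show "cmod (f w) * Im w ^ n \<le> M / 2" using ru(3) by simp
 qed
 show ?thesis
 proof (rule that[of k])
  fix f assume f: "f \<in> Vsp n N \<sigma>" and z: "!!r m. r \<in> cosets N ==> m < k ==> (deriv ^^ m) (qH n N r f) 0 = 0"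
  obtain M where M: "\<forall>w. Im w > 0 --> cmod (f w) * Im w ^ n \<le> M" using VspD(4)[OF f] by blast
  have Mj: "\<forall>w. Im w > 0 --> cmod (f w) * Im w ^ n \<le> M * (1 / 2) ^ j" for j
  proof (induction j)
   case (Suc j)
   from half[OF f z Suc] show ?case by simp
  qed (use M in simp)
  have "f w = 0" if w: "Im w > 0" for w
  proof -
   have "(\<lambda>j. M * (1 / 2) ^ j) \<longlonglongrightarrow> M * 0" by (intro tendsto_mult tendsto_const LIMSEQ_power_zero) simp
   then have "cmod (f w) * Im w ^ n \<le> M * 0" by (rule LIMSEQ_le_const) (use Mj w in blast)
   moreover have "Im w ^ n > 0" using w by simp
   ultimately show ?thesis by (auto simp: mult_le_0_iff)
  qed
  then show "f = 0" using VspD(1)[OF f] by (auto simp: fun_eq_iff not_less) (metis not_le)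
 qed
qed

lemma cond_linear_qH:
 assumes N: "N > 0" and n: "n > 0" and s: "sign_pattern N \<sigma>" and g: "idet g = 1"
 shows "cond_linear (Vsp n N \<sigma>) (\<lambda>f. (deriv ^^ m) (qH n N g f) 0)"
 unfolding cond_linear_def
proof (intro conjI ballI allI)
 fix f h assume f: "f \<in> Vsp n N \<sigma>" and h: "h \<in> Vsp n N \<sigma>"
 have "qH n N g (f + h) = (\<lambda>q. qH n N g f q + qH n N g h q)"
  by (auto simp: qH_def sl_add)
 then show "(deriv ^^ m) (qH n N g (f + h)) 0 = (deriv ^^ m) (qH n N g f) 0 + (deriv ^^ m) (qH n N g h) 0"
  using higher_deriv_add[OF qH(1)[OF N n s f g] qH(1)[OF N n s h g], of 0 m] by simp
next
 fix f c assume f: "f \<in> Vsp n N \<sigma>"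
 have "qH n N g (cscale c f) = (\<lambda>q. c * qH n N g f q)"
  by (auto simp: qH_def sl_cscale fun_eq_iff) (simp add: cscale_def)
 then show "(deriv ^^ m) (qH n N g (cscale c f)) 0 = c * (deriv ^^ m) (qH n N g f) 0"
  using higher_deriv_mult[of "\<lambda>_. c" "ball 0 1" "qH n N g f" 0 m] qH(1)[OF N n s f g]
  by (simp add: higher_deriv_cmult[OF qH(1)[OF N n s f g]])
qed

text \<open>Interpolation is used twice. Finitely many Taylor coefficients separate the forms by
  \<open>Vsp_order_zero\<close> and bound the dimension. With this bound the infinite family of
  point evaluations can serve as functionals, and these are what the kernel reproduces.\<close>

lemma Vsp_lagrange:
 assumes N: "N > 0" and n: "n > 0" and s: "sign_pattern N \<sigma>"
 obtains d :: nat and g z where "!!i. i < d ==> g i \<in> Vsp n N \<sigma>" "!!i. i < d ==> Im (z i) > 0"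
  "!!i j. i < d ==> j < d ==> g j (z i) = (if i = j then 1 else 0)"
  "!!f. f \<in> Vsp n N \<sigma> ==> f = (\<Sum>i<d. cscale (f (z i)) (g i))"
proof -
 let ?V = "Vsp n N \<sigma>"
 obtain k where k: "!!f. f \<in> ?V ==> (!!r m. r \<in> cosets N ==> m < k ==> (deriv ^^ m) (qH n N r f) 0 = 0) ==> f = 0"
  using Vsp_order_zero[OF N n s] by blast
 define L1 where "L1 = (\<lambda>(r, m) f. (deriv ^^ m) (qH n N r f) 0) ` (cosets N \<times> {..<k})"
 have finL1: "finite L1" using cosets(1)[OF N] by (simp add: L1_def)
 have lin1: "cond_linear ?V l" if "l \<in> L1" for l
  using that cosets(2)[OF N] by (auto simp: L1_def intro: cond_linear_qH[OF N n s])
 have bd1: "d \<le> card L1" if lag: "lagrange ?V L1 d g l" for d g l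
 proof -
  have "inj_on l {..<d}"
  proof (rule inj_onI)
   fix i j assume ij: "i \<in> {..<d}" "j \<in> {..<d}" "l i = l j"
   have lg: "l i (g j) = (if i = j then 1 else 0)" if "i < d" "j < d" for i j
    using lag that unfolding lagrange_def by blast
   have "l i (g i) = 1" "l j (g i) = (if j = i then 1 else 0)" using lg[of i i] lg[of j i] ij by auto
   then show "i = j" unfolding ij(3) by (auto split: if_splits)
  qed
  moreover have "l ` {..<d} \<subseteq> L1" using lag by (auto simp: lagrange_def)
  ultimately show ?thesis using card_inj_on_le[OF _ _ finL1] by fastforce
 qed
 have sep1: "f = 0" if "f \<in> ?V" "!!l. l \<in> L1 ==> l f = 0" for f
 proof (rule k[OF that(1)])
  fix r m assume "r \<in> cosets N" "m < k"
  then have "(\<lambda>f. (deriv ^^ m) (qH n N r f) 0) \<in> L1" unfolding L1_def by (intro image_eqI[of _ _ "(r, m)"]) auto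
  from that(2)[OF this] show "(deriv ^^ m) (qH n N r f) 0 = 0" .
 qed
 have "\<exists>d g l. lagrange ?V L1 d g l \<and> (\<forall>f\<in>?V. f = (\<Sum>i<d. cscale (l i f) (g i)))"
  by (rule lagrange_exists[OF Vsp_subspace lin1 sep1 bd1])
 then obtain d1 g1 l1 where lag1: "lagrange ?V L1 d1 g1 l1" "\<forall>f\<in>?V. f = (\<Sum>i<d1. cscale (l1 i f) (g1 i))"
  by (elim exE conjE) (rule that)
 define L2 where "L2 = (\<lambda>z f. f z :: complex) ` {z. Im z > 0}"
 have lin2: "cond_linear ?V l" if "l \<in> L2" for l
  using that by (auto simp: L2_def cond_linear_def cscale_def)
 have sep2: "f = 0" if "f \<in> ?V" "!!l. l \<in> L2 ==> l f = 0" for f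
 proof
  fix x show "f x = 0 x"
   using that(2)[of "\<lambda>f. f x"] VspD(1)[OF that(1), of x] by (cases "Im x > 0") (auto simp: L2_def)
 qed
 have bd2: "d \<le> d1" if lag: "lagrange ?V L2 d g l" for d g l
 proof -
  note ind = lagrange_independent[OF Vsp_subspace lin2 lag]
  have "g ` {..<d} \<subseteq> cfun.span (g1 ` {..<d1})"
  proof
   fix f assume "f \<in> g ` {..<d}"
   then have "f \<in> ?V" using lag by (auto simp: lagrange_def)
   from bspec[OF lag1(2) this] show "f \<in> cfun.span (g1 ` {..<d1})"
   proof (rule ssubst)
    show "(\<Sum>i<d1. cscale (l1 i f) (g1 i)) \<in> cfun.span (g1 ` {..<d1})"
     by (intro cfun.span_sum cfun.span_scale cfun.span_base) auto
   qed
  qed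
  from cfun.independent_span_bound[OF _ ind(2) this] have "card (g ` {..<d}) \<le> card (g1 ` {..<d1})" by simp
  also have "\<dots> \<le> d1" using card_image_le[of "{..<d1}" g1] by simp
  finally show ?thesis using card_image[OF ind(1)] by simp
 qed
 have "\<exists>d g l. lagrange ?V L2 d g l \<and> (\<forall>f\<in>?V. f = (\<Sum>i<d. cscale (l i f) (g i)))"
  by (rule lagrange_exists[OF Vsp_subspace lin2 sep2 bd2])
 then obtain d g l where lag: "lagrange ?V L2 d g l" "\<forall>f\<in>?V. f = (\<Sum>i<d. cscale (l i f) (g i))"
  by (elim exE conjE) (rule that)
 have "\<forall>i. \<exists>x. i < d --> Im x > 0 \<and> l i = (\<lambda>f. f x)" using lag(1) by (auto simp: lagrange_def L2_def)
 then obtain z where z: "!!i. i < d ==> Im (z i) > 0 \<and> l i = (\<lambda>f. f (z i))" by metis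
 show ?thesis
 proof (rule that[where d = d and g = g and z = z])
  show "f = (\<Sum>i<d. cscale (f (z i)) (g i))" if "f \<in> ?V" for f
  proof -
   have "(\<Sum>i<d. cscale (l i f) (g i)) = (\<Sum>i<d. cscale (f (z i)) (g i))"
    by (rule sum.cong) (use z in auto)
   with bspec[OF lag(2) that] show ?thesis by (rule trans)
  qed
 qed (use lag(1) z in \<open>auto simp: lagrange_def\<close>)
qed

subsection \<open>The kernel on the space of forms\<close>

definition latB :: "real => real => real" where
 "latB y v = (2 + 4 * sqrt (y * v)) * (2 + 4 * sqrt (y / v)) * (2 + 4 * sqrt (v / y)) * (2 + 4 * sqrt (1 / (y * v)))"

lemma lattice_summable:
 assumes "Im z > 0" "Im w > 0"
 shows "(\<lambda>g. 1 / (1 + iX g z w) ^ 4) summable_on A"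
  "(\<Sum>\<^sub>\<infinity>g\<in>A. 1 / (1 + iX g z w) ^ 4) \<le> latB (Im z) (Im w)"
proof -
 let ?f = "\<lambda>g. 1 / (1 + iX g z w) ^ 4"
 have nn: "?f g \<ge> 0" for g using iX_nonneg[OF assms, of g] by simp
 have le: "(\<integral>\<^sup>+g. ennreal (?f g) \<partial>count_space UNIV) \<le> ennreal (latB (Im z) (Im w))"
  unfolding latB_def by (rule lattice_sum_bound[OF assms])
 have int: "integrable (count_space UNIV) ?f"
  by (rule integrableI_nonneg) (use le nn in \<open>auto intro: order.strict_trans1\<close>)
 then have abs: "Infinite_Set_Sum.abs_summable_on ?f UNIV" by (simp add: abs_summable_on_def)
 then have sm: "?f summable_on UNIV" using abs_summable_equivalent[of ?f UNIV] Infinite_Sum.abs_summable_summable[of ?f UNIV] by blast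
 then show sA: "?f summable_on A" by (rule summable_on_subset_banach) simp
 have "infsum ?f A \<le> infsum ?f UNIV" by (rule infsum_mono2[OF sA sm]) (use nn in auto)
 also have "\<dots> = (\<integral>g. ?f g \<partial>count_space UNIV)"
  using infsetsum_infsum[OF abs] by (simp add: infsetsum_def)
 also have "\<dots> \<le> latB (Im z) (Im w)"
 proof -
  have "ennreal (\<integral>g. ?f g \<partial>count_space UNIV) \<le> ennreal (latB (Im z) (Im w))"
   using le nn_integral_eq_integral[OF int] nn by simp
  moreover have "latB (Im z) (Im w) \<ge> 0" using assms by (simp add: latB_def)
  ultimately show ?thesis by (simp add: ennreal_le_iff)
 qed
 finally show "infsum ?f A \<le> latB (Im z) (Im w)" .
qed

lemma norm_kap:
 assumes "Im z > 0" "Im w > 0" "idet g > 0"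
 shows "cmod (kap n g z w) * (Im z * Im w) ^ n = (of_int (idet g) / (iX g z w + 2 * of_int (idet g))) ^ n"
proof -
 have "cmod (kap n g z w) = of_int (idet g) ^ n / ((cmod (iL g z w))\<^sup>2) ^ n"
  using assms by (simp add: kap_def norm_divide norm_power power_mult)
 then show ?thesis unfolding norm_iL[OF assms(1,2)] using assms
  by (simp add: power_divide power_mult_distrib)
qed

text \<open>D / (X + 2 D) is at most 1, so the power n can be lowered to 4, for which the lattice
  sum converges.\<close>

lemma kap_bound:
 assumes z: "Im z > 0" "Im w > 0" and d: "idet g > 0" "idet g \<le> K" and n: "n \<ge> 4"
 shows "cmod (kap n g z w) * (Im z * Im w) ^ n \<le> of_int K ^ 4 * (1 / (1 + iX g z w) ^ 4)"
proof -
 define D where "D = real_of_int (idet g)"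
 have D: "1 \<le> D" "D \<le> of_int K" using d by (simp_all add: D_def)
 have X: "iX g z w \<ge> 0" by (rule iX_nonneg[OF z])
 have "cmod (kap n g z w) * (Im z * Im w) ^ n = (D / (iX g z w + 2 * D)) ^ n"
  using norm_kap[OF z d(1)] by (simp add: D_def)
 also have "\<dots> \<le> (D / (iX g z w + 2 * D)) ^ 4"
  using D X n by (intro power_decreasing) (auto simp: divide_le_eq)
 also have "\<dots> \<le> (of_int K / (1 + iX g z w)) ^ 4"
  using D X by (intro power_mono frac_le) auto
 finally show ?thesis by (simp add: power_divide)
qed

lemma kap_bound':
 assumes z: "Im z > 0" "Im w > 0" and d: "idet g > 0" "idet g \<le> K" and n: "n \<ge> 4"
 shows "cmod (kap n g z w) \<le> of_int K ^ 4 / (Im z * Im w) ^ n * (1 / (1 + iX g z w) ^ 4)"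
proof -
 have P: "(Im z * Im w) ^ n > 0" using z by simp
 from kap_bound[OF assms] show ?thesis
  unfolding times_divide_eq_left pos_le_divide_eq[OF P] .
qed

text \<open>A Poincare-type series in z for fixed w, put to 0 off the half-plane to match the
  normalisation of forms. Along with g also -g occurs in \<open>ALG N\<close>; \<open>fpsi\<close>
  counts both too, so the double counting cancels when values are reproduced.\<close>

definition hK :: "nat => nat => (nat => int) => complex => complex => complex" where
 "hK n N \<sigma> z w = (if Im z > 0 then \<Sum>\<^sub>\<infinity>g\<in>ALG N. of_int (chi \<sigma> g) * kap n g z w else 0)"

lemma chi_values:
 assumes s: "sign_pattern N \<sigma>" and g: "g \<in> ALG N"
 shows "chi \<sigma> g = 1 \<or> chi \<sigma> g = -1"
proof -
 obtain Q where Q: "exact_divisor Q N" "g \<in> AL N Q" using g by (auto simp: ALG_def)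
 have "\<sigma> Q \<in> {1, -1}" using s Q(1) unfolding sign_pattern_def by blast
 then show ?thesis using chi_AL[OF Q(2), of \<sigma>] by simp
qed

lemma norm_chi:
 assumes "sign_pattern N \<sigma>" "g \<in> ALG N"
 shows "cmod (of_int (chi \<sigma> g) * x) = cmod x"
 using chi_values[OF assms] by auto

lemma ALG_idet_le:
 assumes N: "N > 0" and g: "g \<in> ALG N"
 shows "idet g \<le> int N"
 using N g by (auto simp: ALG_def AL_idet exact_divisor_def dvd_imp_le)

lemma imul_inj_right:
 assumes "idet h \<noteq> 0" "imul g h = imul g' h"
 shows "g = g'"
proof -
 have "imul (imul g h) (iadj h) = imul (imul g' h) (iadj h)" using assms by simp
 then have "iscale (idet h) g = iscale (idet h) g'"
  by (simp add: imul_assoc imul_iadj(1) imul_iscale del: iscale.simps)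
 then show ?thesis using assms by (simp add: iscale_inj)
qed

lemma kernel_sum:
 assumes N: "N > 0" and s: "sign_pattern N \<sigma>" and n: "n \<ge> 4" and z: "Im z > 0" "Im w > 0" and h: "idet h > 0"
 shows "(\<lambda>g. norm (of_int (chi \<sigma> g) * kap n (imul g h) z w)) summable_on ALG N"
  "(\<lambda>g. of_int (chi \<sigma> g) * kap n (imul g h) z w) summable_on ALG N"
  "cmod (\<Sum>\<^sub>\<infinity>g\<in>ALG N. of_int (chi \<sigma> g) * kap n (imul g h) z w) * (Im z * Im w) ^ n
   \<le> of_int (int N * idet h) ^ 4 * latB (Im z) (Im w)"
proof -
 define C where "C = real_of_int (int N * idet h) ^ 4 / (Im z * Im w) ^ n"
 have le: "norm (of_int (chi \<sigma> g) * kap n (imul g h) z w) \<le> C * (1 / (1 + iX (imul g h) z w) ^ 4)" if g: "g \<in> ALG N" for g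
  unfolding norm_chi[OF s g] C_def
  by (rule kap_bound'[OF z _ _ n]) (use ALG_idet_pos[OF N g] ALG_idet_le[OF N g] h in \<open>auto intro: mult_right_mono\<close>)
 have inj: "inj_on (\<lambda>g. imul g h) (ALG N)" using imul_inj_right h by (metis (no_types, lifting) inj_onI less_irrefl)
 have sm: "(\<lambda>g. 1 / (1 + iX (imul g h) z w) ^ 4) summable_on ALG N"
  using lattice_summable(1)[OF z, of "(\<lambda>g. imul g h) ` ALG N"] summable_on_reindex[OF inj, of "\<lambda>g. 1 / (1 + iX g z w) ^ 4"]
  by (simp add: o_def)
 have sm': "(\<lambda>g. C * (1 / (1 + iX (imul g h) z w) ^ 4)) summable_on ALG N"
  using sm by (rule summable_on_cmult_right)
 show abs: "(\<lambda>g. norm (of_int (chi \<sigma> g) * kap n (imul g h) z w)) summable_on ALG N"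
  by (rule Infinite_Sum.abs_summable_on_comparison_test'[OF sm' le])
 then show sum: "(\<lambda>g. of_int (chi \<sigma> g) * kap n (imul g h) z w) summable_on ALG N"
  by (rule Infinite_Sum.abs_summable_summable)
 have "cmod (\<Sum>\<^sub>\<infinity>g\<in>ALG N. of_int (chi \<sigma> g) * kap n (imul g h) z w) \<le> (\<Sum>\<^sub>\<infinity>g\<in>ALG N. norm (of_int (chi \<sigma> g) * kap n (imul g h) z w))"
  by (rule norm_infsum_bound[OF abs])
 also have "\<dots> \<le> (\<Sum>\<^sub>\<infinity>g\<in>ALG N. C * (1 / (1 + iX (imul g h) z w) ^ 4))"
  by (rule infsum_mono[OF abs sm' le])
 also have "\<dots> = C * (\<Sum>\<^sub>\<infinity>g\<in>ALG N. 1 / (1 + iX (imul g h) z w) ^ 4)"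
  by (rule infsum_cmult_right')
 also have "(\<Sum>\<^sub>\<infinity>g\<in>ALG N. 1 / (1 + iX (imul g h) z w) ^ 4) = (\<Sum>\<^sub>\<infinity>g\<in>(\<lambda>g. imul g h) ` ALG N. 1 / (1 + iX g z w) ^ 4)"
  using infsum_reindex[OF inj, of "\<lambda>g. 1 / (1 + iX g z w) ^ 4"] by (simp add: o_def)
 also have "C * \<dots> \<le> C * latB (Im z) (Im w)"
  by (rule mult_left_mono[OF lattice_summable(2)[OF z]]) (use z h in \<open>auto simp: C_def intro!: divide_nonneg_pos\<close>)
 finally show "cmod (\<Sum>\<^sub>\<infinity>g\<in>ALG N. of_int (chi \<sigma> g) * kap n (imul g h) z w) * (Im z * Im w) ^ n
   \<le> of_int (int N * idet h) ^ 4 * latB (Im z) (Im w)"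
  using z by (simp add: C_def field_simps)
qed

text \<open>|iL|^2 is the square of the left side plus two squares and a positive multiple of the
  determinant. As a - c cnj w is the derivative of \<open>iL\<close> in z, the relative variation of
  \<open>iL\<close> in z is controlled by the height.\<close>

lemma norm_iL_ge:
 assumes z: "Im z > 0" "Im w > 0" and d: "idet (a, b, c, d) > 0"
 shows "Im z * cmod (of_int a - cnj w * of_int c) \<le> cmod (iL (a, b, c, d) z w)"
proof (rule power2_le_imp_le)
 define x y u v A B C D where "x = Re z" "y = Im z" "u = Re w" "v = Im w"
  and "A = real_of_int a" "B = real_of_int b" "C = real_of_int c" "D = real_of_int d"
 note defs = this
 have y: "y > 0" "v > 0" using z by (auto simp: defs)
 have D0: "A * D - B * C > 0" using d unfolding idet.simps defs by (metis of_int_diff of_int_mult of_int_0_less_iff)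
 have "(Im z * cmod (of_int a - cnj w * of_int c))\<^sup>2 = y\<^sup>2 * ((A - u * C)\<^sup>2 + (v * C)\<^sup>2)"
  unfolding power_mult_distrib cmod_power2 by (simp add: defs power_mult_distrib)
 also have "\<dots> \<le> ((A * x + B - u * (C * x + D)) - v * C * y)\<^sup>2 + ((A - u * C) * y + v * (C * x + D))\<^sup>2"
 proof -
  have "((A * x + B - u * (C * x + D)) - v * C * y)\<^sup>2 + ((A - u * C) * y + v * (C * x + D))\<^sup>2
   = y\<^sup>2 * ((A - u * C)\<^sup>2 + (v * C)\<^sup>2) + (A * x + B - u * (C * x + D))\<^sup>2 + (v * (C * x + D))\<^sup>2 + 2 * (y * v * (A * D - B * C))"
   by (simp add: power2_eq_square algebra_simps)
  moreover have "0 \<le> (A * x + B - u * (C * x + D))\<^sup>2 + (v * (C * x + D))\<^sup>2 + 2 * (y * v * (A * D - B * C))"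
   using y D0 by (intro add_nonneg_nonneg) auto
  ultimately show ?thesis by linarith
 qed
 also have "\<dots> = (cmod (iL (a, b, c, d) z w))\<^sup>2"
  unfolding cmod_power2 defs by (simp add: algebra_simps)
 finally show "(Im z * cmod (of_int a - cnj w * of_int c))\<^sup>2 \<le> (cmod (iL (a, b, c, d) z w))\<^sup>2" .
qed simp

text \<open>Within distance Im z0 / 2 the value of \<open>iL\<close> changes by at most half its
  modulus, so its power -2n grows by at most 2^(2n) = 4^n. The factor does not depend on g, which
  gives the majorant for the M-test below.\<close>

lemma kap_local_bound:
 assumes z0: "Im z0 > 0" "Im w > 0" and d: "idet g > 0" and z: "cmod (z - z0) \<le> Im z0 / 2"
 shows "cmod (kap n g z w) \<le> 4 ^ n * cmod (kap n g z0 w)"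
proof -
 obtain a b c d' where g: "g = (a, b, c, d')" by (cases g)
 have "iL g z0 w - iL g z w = (of_int a - cnj w * of_int c) * (z0 - z)"
  by (simp add: g algebra_simps)
 then have "cmod (iL g z0 w - iL g z w) = cmod (of_int a - cnj w * of_int c) * cmod (z - z0)"
  by (simp add: norm_mult norm_minus_commute)
 also have "\<dots> \<le> cmod (of_int a - cnj w * of_int c) * (Im z0 / 2)" using z by (intro mult_left_mono) auto
 also have "\<dots> \<le> cmod (iL g z0 w) / 2"
  using norm_iL_ge[OF z0, of a b c d'] d by (simp add: g mult.commute)
 finally have "cmod (iL g z0 w) / 2 \<le> cmod (iL g z w)"
  using norm_triangle_ineq2[of "iL g z0 w" "iL g z w"] by linarith
 moreover have pos: "cmod (iL g z0 w) > 0" using iL_nonzero[OF z0 d] by simp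
 ultimately have "of_int (idet g) ^ n / cmod (iL g z w) ^ (2 * n) \<le> of_int (idet g) ^ n / (cmod (iL g z0 w) / 2) ^ (2 * n)"
  using d by (intro divide_left_mono power_mono mult_pos_pos zero_less_power) auto
 also have "(cmod (iL g z0 w) / 2) ^ (2 * n) = cmod (iL g z0 w) ^ (2 * n) / 4 ^ n"
  by (simp add: power_divide power_mult)
 finally have "of_int (idet g) ^ n / cmod (iL g z w) ^ (2 * n) \<le> 4 ^ n * (of_int (idet g) ^ n / cmod (iL g z0 w) ^ (2 * n))"
  by (simp add: mult.commute)
 then show ?thesis using d by (simp add: kap_def norm_divide norm_power)
qed

lemma hK_holomorphic:
 assumes N: "N > 0" and s: "sign_pattern N \<sigma>" and n: "n \<ge> 4" and w: "Im w > 0"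
 shows "(\<lambda>z. hK n N \<sigma> z w) holomorphic_on upper_half_plane"
proof -
 have "(\<lambda>z. hK n N \<sigma> z w) holomorphic_on ball z0 (Im z0 / 2)" if z0: "Im z0 > 0" for z0
 proof -
  define M where "M g = 4 ^ n * norm (of_int (chi \<sigma> g) * kap n (imul g (1, 0, 0, 1)) z0 w)" for g
  have sM: "M summable_on ALG N" unfolding M_def
   by (intro summable_on_cmult_right kernel_sum(1)[OF N s n z0 w]) simp
  have pos: "Im z > 0" if "z \<in> cball z0 (Im z0 / 2)" for z
  proof -
   have "\<bar>Im z0 - Im z\<bar> \<le> cmod (z0 - z)" using abs_Im_le_cmod[of "z0 - z"] by simp
   then show ?thesis using that z0 by (auto simp: dist_norm)
  qed
  have "uniform_limit (cball z0 (Im z0 / 2)) (\<lambda>X z. \<Sum>g\<in>X. of_int (chi \<sigma> g) * kap n g z w)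
   (\<lambda>z. \<Sum>\<^sub>\<infinity>g\<in>ALG N. of_int (chi \<sigma> g) * kap n g z w) (finite_subsets_at_top (ALG N))"
  proof (rule Weierstrass_m_test_general[OF _ sM])
   fix g z assume g: "g \<in> ALG N" and z: "z \<in> cball z0 (Im z0 / 2)"
   show "norm (of_int (chi \<sigma> g) * kap n g z w) \<le> M g"
    unfolding M_def norm_chi[OF s g] imul_one
    by (rule kap_local_bound[OF z0 w ALG_idet_pos[OF N g]]) (use z in \<open>simp add: dist_norm norm_minus_commute\<close>)
  qed
  then have "(\<lambda>z. \<Sum>\<^sub>\<infinity>g\<in>ALG N. of_int (chi \<sigma> g) * kap n g z w) holomorphic_on ball z0 (Im z0 / 2)"
  proof (rule holomorphic_uniform_limit[rotated])
   show "\<forall>\<^sub>F X in finite_subsets_at_top (ALG N). continuous_on (cball z0 (Im z0 / 2)) (\<lambda>z. \<Sum>g\<in>X. of_int (chi \<sigma> g) * kap n g z w)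
    \<and> (\<lambda>z. \<Sum>g\<in>X. of_int (chi \<sigma> g) * kap n g z w) holomorphic_on ball z0 (Im z0 / 2)"
   proof (rule eventually_finite_subsets_at_top_weakI)
    fix X assume X: "finite X" "X \<subseteq> ALG N"
    have "(\<lambda>z. \<Sum>g\<in>X. of_int (chi \<sigma> g) * kap n g z w) holomorphic_on cball z0 (Im z0 / 2)"
    proof (intro holomorphic_intros)
     fix g assume "g \<in> X"
     then have g: "idet g > 0" using X ALG_idet_pos[OF N] by blast
     obtain a b c d where ge: "g = (a, b, c, d)" by (cases g)
     show "(\<lambda>z. kap n g z w) holomorphic_on cball z0 (Im z0 / 2)"
      unfolding kap_def using iL_nonzero[OF pos w g] unfolding ge iL.simps
      by (intro holomorphic_intros) auto
    qed
    then show "continuous_on (cball z0 (Im z0 / 2)) (\<lambda>z. \<Sum>g\<in>X. of_int (chi \<sigma> g) * kap n g z w)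
    \<and> (\<lambda>z. \<Sum>g\<in>X. of_int (chi \<sigma> g) * kap n g z w) holomorphic_on ball z0 (Im z0 / 2)"
     using holomorphic_on_imp_continuous_on holomorphic_on_subset ball_subset_cball by blast
   qed
  qed auto
  then show ?thesis
   by (rule holomorphic_transform) (use pos ball_subset_cball in \<open>auto simp: hK_def\<close>)
 qed
 then show ?thesis unfolding holomorphic_on_def[of _ upper_half_plane]
  by (metis centre_in_ball field_differentiable_at_within half_gt_zero holomorphic_on_imp_differentiable_at open_ball upper_half_plane_iff)
qed

lemma sl_hK:
 assumes z: "Im z > 0" and h: "idet h > 0"
 shows "sl n h (\<lambda>z. hK n N \<sigma> z w) z = (\<Sum>\<^sub>\<infinity>g\<in>ALG N. of_int (chi \<sigma> g) * kap n (imul g h) z w)"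
proof -
 have "sl n h (\<lambda>z. hK n N \<sigma> z w) z = of_int (idet h) ^ n / iden h z ^ (2 * n) * (\<Sum>\<^sub>\<infinity>g\<in>ALG N. of_int (chi \<sigma> g) * kap n g (imob h z) w)"
  using Im_imob_pos[OF z h] by (simp add: sl_def hK_def)
 also have "\<dots> = (\<Sum>\<^sub>\<infinity>g\<in>ALG N. of_int (idet h) ^ n / iden h z ^ (2 * n) * (of_int (chi \<sigma> g) * kap n g (imob h z) w))"
  by (rule infsum_cmult_right'[symmetric])
 also have "\<dots> = (\<Sum>\<^sub>\<infinity>g\<in>ALG N. of_int (chi \<sigma> g) * kap n (imul g h) z w)"
  by (rule infsum_cong) (simp add: sl_kap[OF z h, of n, unfolded sl_def, symmetric] mult_ac)
 finally show ?thesis .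
qed

lemma latB_le:
 assumes "y \<ge> 1" "v > 0"
 shows "latB y v \<le> y * latB 1 v"
proof -
 have s: "sqrt y \<ge> 1" using assms by simp
 have 1: "2 + 4 * sqrt (y * v) \<le> sqrt y * (2 + 4 * sqrt (1 * v))"
  using assms s by (simp add: real_sqrt_mult algebra_simps)
 have 2: "2 + 4 * sqrt (y / v) \<le> sqrt y * (2 + 4 * sqrt (1 / v))"
  using assms s by (simp add: real_sqrt_divide algebra_simps)
 have 3: "2 + 4 * sqrt (v / y) \<le> 2 + 4 * sqrt (v / 1)"
  using assms by (simp add: divide_le_eq mult_le_cancel_left1)
 have 4: "2 + 4 * sqrt (1 / (y * v)) \<le> 2 + 4 * sqrt (1 / (1 * v))"
  using assms by (simp add: divide_le_eq frac_le)
 have "latB y v \<le> (sqrt y * (2 + 4 * sqrt (1 * v))) * (sqrt y * (2 + 4 * sqrt (1 / v))) * (2 + 4 * sqrt (v / 1)) * (2 + 4 * sqrt (1 / (1 * v)))"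
  unfolding latB_def using assms by (intro mult_mono 1 2 3 4) auto
 also have "\<dots> = (sqrt y * sqrt y) * latB 1 v" by (simp only: latB_def mult_ac)
 finally show ?thesis using assms by simp
qed

lemma hK_Vsp:
 assumes N: "N > 0" and s: "sign_pattern N \<sigma>" and n: "n \<ge> 4" and w: "Im w > 0"
 shows "(\<lambda>z. hK n N \<sigma> z w) \<in> Vsp n N \<sigma>"
proof (rule VspI[OF N s])
 show "hK n N \<sigma> z w = 0" if "Im z \<le> 0" for z using that by (simp add: hK_def)
 show "(\<lambda>z. hK n N \<sigma> z w) holomorphic_on upper_half_plane" by (rule hK_holomorphic[OF N s n w])
next
 fix h assume h: "h \<in> ALG N"
 have dh: "idet h > 0" by (rule ALG_idet_pos[OF N h])
 show "sl n h (\<lambda>z. hK n N \<sigma> z w) = cscale (of_int (chi \<sigma> h)) (\<lambda>z. hK n N \<sigma> z w)"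
 proof
  fix z
  show "sl n h (\<lambda>z. hK n N \<sigma> z w) z = cscale (of_int (chi \<sigma> h)) (\<lambda>z. hK n N \<sigma> z w) z"
  proof (cases "Im z > 0")
   case True
   \<comment> \<open>Translation by h permutes the summation index through \<open>rmul\<close>;
     since signs square to 1, the sign of h can be moved to the outside.\<close>
   have c2: "chi \<sigma> h * chi \<sigma> h = 1" using chi_values[OF s h] by auto
   have "sl n h (\<lambda>z. hK n N \<sigma> z w) z = (\<Sum>\<^sub>\<infinity>g\<in>ALG N. of_int (chi \<sigma> g) * kap n (imul g h) z w)"
    by (rule sl_hK[OF True dh])
   also have "\<dots> = (\<Sum>\<^sub>\<infinity>g\<in>ALG N. of_int (chi \<sigma> h) * (of_int (chi \<sigma> (rmul N h g)) * kap n (rmul N h g) z w))"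
   proof (rule infsum_cong)
    fix g assume g: "g \<in> ALG N"
    have "chi \<sigma> h * chi \<sigma> (rmul N h g) = chi \<sigma> g" using rmul(3)[OF N g h s] c2 by (simp add: mult.left_commute)
    then have "of_int (chi \<sigma> h) * of_int (chi \<sigma> (rmul N h g)) = (of_int (chi \<sigma> g) :: complex)"
     by (simp flip: of_int_mult)
    then show "of_int (chi \<sigma> g) * kap n (imul g h) z w = of_int (chi \<sigma> h) * (of_int (chi \<sigma> (rmul N h g)) * kap n (rmul N h g) z w)"
     by (simp add: kap_rmul[OF N g h] flip: mult.assoc)
   qed
   also have "\<dots> = of_int (chi \<sigma> h) * (\<Sum>\<^sub>\<infinity>g\<in>ALG N. of_int (chi \<sigma> (rmul N h g)) * kap n (rmul N h g) z w)"
    by (rule infsum_cmult_right')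
   also have "(\<Sum>\<^sub>\<infinity>g\<in>ALG N. of_int (chi \<sigma> (rmul N h g)) * kap n (rmul N h g) z w) = (\<Sum>\<^sub>\<infinity>g\<in>ALG N. of_int (chi \<sigma> g) * kap n g z w)"
    by (rule infsum_reindex_bij_betw[OF bij_rmul[OF N h]])
   finally show ?thesis using True by (simp add: cscale_def hK_def)
  next
   case False
   then have "sl n h (\<lambda>z. hK n N \<sigma> z w) z = 0" by (intro sl_zero[OF _ _ dh]) (auto simp: hK_def)
   then show ?thesis using False by (simp add: cscale_def hK_def)
  qed
 qed
next
 fix r assume "r \<in> cosets N"
 then have d: "idet r = 1" using cosets(2)[OF N] by simp
 define M where "M = real N ^ 4 * latB 1 (Im w) / Im w ^ n"
 have "cmod (sl n r (\<lambda>z. hK n N \<sigma> z w) z) * Im z \<le> M" if z: "Im z > 1" for z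
 proof -
  have z0: "Im z > 0" using z by simp
  have "cmod (sl n r (\<lambda>z. hK n N \<sigma> z w) z) * (Im z * Im w) ^ n \<le> real N ^ 4 * latB (Im z) (Im w)"
   using kernel_sum(3)[OF N s n z0 w, of r] sl_hK[OF z0, of r] d by simp
  also have "\<dots> \<le> real N ^ 4 * (Im z * latB 1 (Im w))"
   using z w by (intro mult_left_mono latB_le) auto
  finally have "cmod (sl n r (\<lambda>z. hK n N \<sigma> z w) z) * Im z ^ n \<le> M * Im z"
   using w by (simp add: M_def power_mult_distrib field_simps)
  \<comment> \<open>The lattice bound grows only linearly in Im z, so n \<ge> 4 leaves more than the
    single power of Im z that \<open>VspI\<close> asks for.\<close>
  moreover have "Im z ^ 2 \<le> Im z ^ n" using z n by (intro power_increasing) auto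
  ultimately have "cmod (sl n r (\<lambda>z. hK n N \<sigma> z w) z) * Im z ^ 2 \<le> M * Im z"
   by (meson mult_left_mono norm_ge_zero order_trans)
  then have "(cmod (sl n r (\<lambda>z. hK n N \<sigma> z w) z) * Im z) * Im z \<le> M * Im z" by (simp add: power2_eq_square mult.assoc)
  then show ?thesis using z0 by (simp only: mult_le_cancel_right_pos)
 qed
 then show "\<exists>M. \<forall>z. Im z > 1 --> cmod (sl n r (\<lambda>z. hK n N \<sigma> z w) z) * Im z \<le> M" by blast
qed

subsection \<open>Elliptic and parabolic contributions\<close>

lemma one_le_square: "1 \<le> \<bar>t::real\<bar> ==> 1 \<le> t\<^sup>2"
 by (metis one_le_power power2_abs)

lemma int_square_ge_1: "c \<noteq> 0 ==> 1 \<le> (real_of_int c)\<^sup>2"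
 by (rule one_le_square) linarith

text \<open>For positive determinant and d the hyperbolic distance from z to g z, this is 2 det g
  (cosh d - 1): it measures how far g moves z.\<close>

definition iE :: "imat => complex => real" where
 "iE g z = iX g z z - 2 * of_int (idet g)"

lemma iE_eq:
 assumes y: "Im z > 0"
 shows "iE (a, b, c, d) z = (of_int a - of_int d - 2 * Re z * of_int c)\<^sup>2
  + ((of_int a * Re z + of_int b - Re z * (of_int c * Re z + of_int d)) / Im z + of_int c * Im z)\<^sup>2"
proof -
 define x y A B C D where "x = Re z" "y = Im z" and "A = real_of_int a" "B = real_of_int b" "C = real_of_int c" "D = real_of_int d"
 note defs = this
 have y0: "y > 0" using y by (simp add: defs)
 have "(A - x * C)\<^sup>2 * (y / y) + (A * x + B - x * (C * x + D))\<^sup>2 / (y * y) + C\<^sup>2 * (y * y) + (C * x + D)\<^sup>2 * (y / y) - 2 * (A * D - B * C)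
  = (A - D - 2 * x * C)\<^sup>2 + ((A * x + B - x * (C * x + D)) / y + C * y)\<^sup>2"
 proof -
  define q where "q = (A * x + B - x * (C * x + D)) / y"
  have q: "A * x + B - x * (C * x + D) = q * y" using y0 by (simp add: q_def)
  have B: "B = q * y - A * x + x * (C * x + D)" using q by simp
  have yy: "(q * y)\<^sup>2 / (y * y) = q\<^sup>2" "y / y = 1" using y0 by (simp_all add: power2_eq_square)
  show ?thesis unfolding q_def[symmetric] q yy unfolding B
   using y0 by (simp add: power2_eq_square algebra_simps)
 qed
 then show ?thesis by (simp add: iE_def defs)
qed

lemma iE_nonneg: "Im z > 0 ==> iE g z \<ge> 0"
 using iX_ge_2det[of z z g] by (simp add: iE_def)

text \<open>The real fixed points are x0 + q and x0 - q, and \<open>iE\<close> is C^2 / y^2 times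
  the product of the squared distances from z to them. Each distance is at least y. The parabolic
  case is q = 0.\<close>

lemma iE_hyperbolic:
 assumes y: "Im z > 0" and c: "c \<noteq> 0" and disc: "(d - a)\<^sup>2 + 4 * b * c \<ge> 0"
 shows "iE (a, b, c, d) z \<ge> (Im z)\<^sup>2"
proof -
 define x y A B C D where "x = Re z" "y = Im z" and "A = real_of_int a" "B = real_of_int b" "C = real_of_int c" "D = real_of_int d"
 note defs = this
 have y0: "y > 0" using y by (simp add: defs)
 have C1: "C\<^sup>2 \<ge> 1" using int_square_ge_1[OF c] by (simp add: defs)
 have dis: "(D - A)\<^sup>2 + 4 * B * C \<ge> 0"
 proof -
  have "real_of_int ((d - a)\<^sup>2 + 4 * b * c) \<ge> 0" using disc by (simp only: of_int_0_le_iff)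
  then show ?thesis by (simp add: defs)
 qed
 define x0 where "x0 = (A - D) / (2 * C)"
 define q where "q = sqrt ((D - A)\<^sup>2 + 4 * B * C) / (2 * \<bar>C\<bar>)"
 define u where "u = x - x0"
 have C0: "C \<noteq> 0" using c by (simp add: defs)
 have AD: "A = D + 2 * C * x0" using C0 by (simp add: x0_def)
 have "q\<^sup>2 = ((D - A)\<^sup>2 + 4 * B * C) / (4 * C\<^sup>2)" using dis by (simp add: q_def power_divide power_mult_distrib)
 then have "4 * C\<^sup>2 * q\<^sup>2 = (D - A)\<^sup>2 + 4 * B * C" using C0 by simp
 moreover have "4 * (C * (B + C * (x0\<^sup>2 - q\<^sup>2))) = ((D - A)\<^sup>2 + 4 * B * C) - 4 * C\<^sup>2 * q\<^sup>2"
  by (simp add: AD power2_eq_square algebra_simps)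
 ultimately have B: "B = - C * (x0\<^sup>2 - q\<^sup>2)" using C0 by simp
 have "iE (a, b, c, d) z = C\<^sup>2 * (4 * u\<^sup>2 + ((y\<^sup>2 - u\<^sup>2 + q\<^sup>2) / y)\<^sup>2)"
 proof -
  have e1: "(A * x + B - x * (C * x + D)) / y + C * y = C * ((y\<^sup>2 - u\<^sup>2 + q\<^sup>2) / y)"
   using y0 unfolding B AD u_def by (simp add: field_simps power2_eq_square)
  have e2: "A - D - 2 * x * C = - 2 * C * u" unfolding AD u_def by (simp add: algebra_simps)
  show ?thesis unfolding iE_eq[OF y] defs[symmetric] e1 e2 power_mult_distrib by (simp add: distrib_left)
 qed
 also have "4 * u\<^sup>2 + ((y\<^sup>2 - u\<^sup>2 + q\<^sup>2) / y)\<^sup>2 = ((y\<^sup>2 + (u + q)\<^sup>2) * (y\<^sup>2 + (u - q)\<^sup>2)) / y\<^sup>2"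
  using y0 by (simp add: field_simps power2_eq_square)
 also have "C\<^sup>2 * \<dots> \<ge> 1 * ((y\<^sup>2 * y\<^sup>2) / y\<^sup>2)"
  using C1 by (intro mult_mono divide_right_mono) auto
 also have "1 * ((y\<^sup>2 * y\<^sup>2) / y\<^sup>2) = (Im z)\<^sup>2" using y0 by (simp add: defs power2_eq_square)
 finally show ?thesis .
qed

text \<open>The fixed points are now x0 + \<i> q and its conjugate. The same product formula holds,
  and the distance from z to the lower fixed point is at least y.\<close>

lemma iE_elliptic:
 assumes c: "c \<noteq> 0" and disc: "(d - a)\<^sup>2 + 4 * b * c < 0"
 shows "\<exists>z0. Im z0 > 0 \<and> (\<forall>z. Im z > 0 --> (Re z - Re z0)\<^sup>2 + (Im z - Im z0)\<^sup>2 \<le> iE (a, b, c, d) z)"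
proof -
 define A B C D where "A = real_of_int a" "B = real_of_int b" "C = real_of_int c" "D = real_of_int d"
 note defs = this
 have C1: "C\<^sup>2 \<ge> 1" using int_square_ge_1[OF c] by (simp add: defs)
 have dis: "(D - A)\<^sup>2 + 4 * B * C < 0"
 proof -
  have "real_of_int ((d - a)\<^sup>2 + 4 * b * c) < 0" using disc by (simp only: of_int_less_0_iff)
  then show ?thesis by (simp add: defs)
 qed
 define x0 where "x0 = (A - D) / (2 * C)"
 define q where "q = sqrt (- ((D - A)\<^sup>2 + 4 * B * C)) / (2 * \<bar>C\<bar>)"
 have C0: "C \<noteq> 0" using c by (simp add: defs)
 have q0: "q > 0" using dis C0 by (simp add: q_def)
 have AD: "A = D + 2 * C * x0" using C0 by (simp add: x0_def)
 have "q\<^sup>2 = - ((D - A)\<^sup>2 + 4 * B * C) / (4 * C\<^sup>2)" using dis by (simp add: q_def power_divide power_mult_distrib)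
 then have "4 * C\<^sup>2 * q\<^sup>2 = - ((D - A)\<^sup>2 + 4 * B * C)" using C0 by simp
 moreover have "4 * (C * (B + C * (x0\<^sup>2 + q\<^sup>2))) = ((D - A)\<^sup>2 + 4 * B * C) + 4 * C\<^sup>2 * q\<^sup>2"
  by (simp add: AD power2_eq_square algebra_simps)
 ultimately have B: "B = - C * (x0\<^sup>2 + q\<^sup>2)" using C0 by simp
 have "(x - x0)\<^sup>2 + (y - q)\<^sup>2 \<le> iE (a, b, c, d) z" if z: "Im z > 0" "x = Re z" "y = Im z" for z x y
 proof -
  have y0: "y > 0" using z by simp
  define u where "u = x - x0"
  have "iE (a, b, c, d) z = C\<^sup>2 * (4 * u\<^sup>2 + ((y\<^sup>2 - u\<^sup>2 - q\<^sup>2) / y)\<^sup>2)"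
  proof -
   have e1: "(A * x + B - x * (C * x + D)) / y + C * y = C * ((y\<^sup>2 - u\<^sup>2 - q\<^sup>2) / y)"
    using y0 unfolding B AD u_def by (simp add: field_simps power2_eq_square)
   have e2: "A - D - 2 * x * C = - 2 * C * u" unfolding AD u_def by (simp add: algebra_simps)
   show ?thesis unfolding iE_eq[OF z(1)] defs[symmetric] z(2,3)[symmetric] e1 e2 power_mult_distrib by (simp add: distrib_left)
  qed
  also have "4 * u\<^sup>2 + ((y\<^sup>2 - u\<^sup>2 - q\<^sup>2) / y)\<^sup>2 = ((u\<^sup>2 + (y - q)\<^sup>2) * (u\<^sup>2 + (y + q)\<^sup>2)) / y\<^sup>2"
   using y0 by (simp add: field_simps power2_eq_square)
  also have "C\<^sup>2 * \<dots> \<ge> 1 * (((u\<^sup>2 + (y - q)\<^sup>2) * y\<^sup>2) / y\<^sup>2)"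
  proof (intro mult_mono divide_right_mono C1)
   have "y\<^sup>2 \<le> (y + q)\<^sup>2" using y0 q0 by (intro power_mono) auto
   then show "y\<^sup>2 \<le> u\<^sup>2 + (y + q)\<^sup>2" by (simp add: add_increasing)
  qed auto
  finally show ?thesis using y0 by (simp add: u_def)
 qed
 then show ?thesis using q0 by (intro exI[of _ "Complex x0 q"]) auto
qed

definition NS :: "int => imat set" where
 "NS D = {(a, b, c, d). a * d - b * c = D \<and> \<not> (b = 0 \<and> c = 0 \<and> a = d)}"

definition NF :: "int => imat set" where
 "NF D = {(a, b, c, d). a * d - b * c = D \<and> c \<noteq> 0 \<and>
  (\<exists>z. \<bar>Re z\<bar> \<le> 1 / 2 \<and> Im z \<ge> 4 / 5 \<and> iE (a, b, c, d) z < 1 / 2)}"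

text \<open>iE < 1/2 bounds the sum of squares \<open>iX\<close> by 2 D + 1. Since c is a nonzero
  integer, the term c^2 y^2 bounds both c and y; with |Re z| \<le> 1/2 this bounds a and d, and
  finally b.\<close>

lemma finite_NF:
 assumes D: "D > 0"
 shows "finite (NF D)"
proof -
 define M where "M = 2 * D + 1"
 define K where "K = M * M + 3 * M"
 have M3: "M \<ge> 3" using D by (simp add: M_def)
 have "NF D \<subseteq> {-K..K} \<times> {-K..K} \<times> {-K..K} \<times> {-K..K}"
 proof
  fix g assume "g \<in> NF D"
  then obtain a b c d z where g: "g = (a, b, c, d)" "a * d - b * c = D" "c \<noteq> 0"
   and z: "\<bar>Re z\<bar> \<le> 1 / 2" "Im z \<ge> 4 / 5" "iE (a, b, c, d) z < 1 / 2" by (auto simp: NF_def)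
  define x y where "x = Re z" and "y = Im z"
  define m where "m = real_of_int M"
  have m3: "m \<ge> 3" using M3 by (simp add: m_def)
  have y0: "y > 0" "y \<ge> 4 / 5" using z by (auto simp: y_def)
  have "iE (a, b, c, d) z = iX g z z - 2 * of_int D" using g(2) by (simp add: iE_def g(1) del: iX.simps)
  then have "iX g z z \<le> m" using z(3) by (simp add: m_def M_def)
  then have X: "(of_int a - x * of_int c)\<^sup>2 + (of_int a * x + of_int b - x * (of_int c * x + of_int d))\<^sup>2 / (y * y)
   + (of_int c)\<^sup>2 * (y * y) + (of_int c * x + of_int d)\<^sup>2 \<le> m" using y0 by (simp add: g x_def y_def)
  have nn: "0 \<le> (of_int a * x + of_int b - x * (of_int c * x + of_int d))\<^sup>2 / (y * y)"
   "0 \<le> (of_int c)\<^sup>2 * (y * y)" "0 \<le> (of_int a - x * of_int c)\<^sup>2" "0 \<le> (of_int c * x + of_int d)\<^sup>2" for a b c d :: int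
   using y0 by auto
  have mm: "m \<le> m * m" using m3 mult_right_mono[of 1 m m] by simp
  have e1: "(of_int a - x * of_int c)\<^sup>2 \<le> m" and e2: "(of_int a * x + of_int b - x * (of_int c * x + of_int d))\<^sup>2 / (y * y) \<le> m"
   and e3: "(of_int c)\<^sup>2 * (y * y) \<le> m" and e4: "(of_int c * x + of_int d)\<^sup>2 \<le> m"
   using X nn(1)[of a b c d] nn(2)[of c] nn(3)[of a c] nn(4)[of c d] by linarith+
  have sq: "\<bar>t\<bar> \<le> m" if "t\<^sup>2 \<le> m" for t
  proof (rule power2_le_imp_le)
   show "\<bar>t\<bar>\<^sup>2 \<le> m\<^sup>2" using that mm by (simp add: power2_eq_square)
  qed (use m3 in simp)
  have c1: "1 \<le> (real_of_int c)\<^sup>2" by (rule int_square_ge_1[OF g(3)])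
  have "1 * (y * y) \<le> (real_of_int c)\<^sup>2 * (y * y)" using c1 by (intro mult_right_mono) auto
  then have "y\<^sup>2 \<le> m" using e3 by (simp add: power2_eq_square)
  from sq[OF this] have ym: "y \<le> m" using y0 by simp
  have "(16 / 25) * (real_of_int c)\<^sup>2 \<le> (y * y) * (real_of_int c)\<^sup>2"
   using y0 mult_mono[of "4/5" y "4/5" y] by (intro mult_right_mono) auto
  then have "(real_of_int c)\<^sup>2 \<le> m * 2" using e3 m3 by (simp add: mult.commute)
  also have "\<dots> \<le> m\<^sup>2" using m3 mult_left_mono[of 2 m m] by (simp add: power2_eq_square)
  finally have cm: "\<bar>real_of_int c\<bar> \<le> m" using m3 by (simp add: abs_le_square_iff[symmetric])
  have x: "\<bar>x\<bar> \<le> 1 / 2" using z(1) by (simp add: x_def)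
  have xc: "\<bar>x * of_int c\<bar> \<le> m / 2" using mult_mono[OF x cm] m3 by (simp add: abs_mult)
  have am: "\<bar>real_of_int a\<bar> \<le> 2 * m" using sq[OF e1] xc m3 by linarith
  have dm: "\<bar>real_of_int d\<bar> \<le> 2 * m" using sq[OF e4] xc m3 by (simp add: mult.commute)
  have "(of_int a * x + of_int b - x * (of_int c * x + of_int d))\<^sup>2 \<le> m * (y * y)" using e2 y0 by (simp add: field_simps)
  also have "\<dots> \<le> (m * m) * (m * m)" using ym y0 mm m3 by (intro mult_mono) auto
  also have "\<dots> = (m * m)\<^sup>2" by (simp add: power2_eq_square)
  finally have bq: "\<bar>of_int a * x + of_int b - x * (of_int c * x + of_int d)\<bar> \<le> m * m"
   using m3 by (simp add: abs_le_square_iff[symmetric])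
  have "\<bar>of_int a * x\<bar> \<le> 2 * m * (1 / 2)" unfolding abs_mult using am x m3 by (intro mult_mono) auto
  moreover have "\<bar>x * (of_int c * x + of_int d)\<bar> \<le> (1 / 2) * m" unfolding abs_mult using sq[OF e4] x by (intro mult_mono) auto
  ultimately have bm: "\<bar>real_of_int b\<bar> \<le> m * m + 3 * m" using bq m3 by linarith
  have K: "real_of_int K = m * m + 3 * m" by (simp add: K_def m_def)
  have mmm: "2 * m \<le> m * m + 3 * m" "m \<le> m * m + 3 * m" using mm m3 by linarith+
  have "\<bar>real_of_int a\<bar> \<le> of_int K" "\<bar>real_of_int b\<bar> \<le> of_int K" "\<bar>real_of_int c\<bar> \<le> of_int K" "\<bar>real_of_int d\<bar> \<le> of_int K"
   unfolding K using am bm cm dm mmm by linarith+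
  then have "\<bar>a\<bar> \<le> K" "\<bar>b\<bar> \<le> K" "\<bar>c\<bar> \<le> K" "\<bar>d\<bar> \<le> K" by linarith+
  then show "g \<in> {-K..K} \<times> {-K..K} \<times> {-K..K} \<times> {-K..K}" by (auto simp: g abs_le_iff)
 qed
 then show ?thesis by (rule finite_subset) simp
qed

text \<open>This explains the threshold 1/2 in \<open>NF\<close>: on the Siegel set y^2 \<ge> 16/25
  > 1/2, so \<open>iE_hyperbolic\<close> excludes a nonnegative discriminant when c \<noteq>
  0.\<close>

lemma NF_elliptic:
 assumes "g \<in> NF D"
 shows "\<exists>z0. Im z0 > 0 \<and> (\<forall>z. Im z > 0 --> (Re z - Re z0)\<^sup>2 + (Im z - Im z0)\<^sup>2 \<le> iE g z)"
proof -
 obtain a b c d z where g: "g = (a, b, c, d)" "c \<noteq> 0"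
   and z: "Im z \<ge> 4 / 5" "iE (a, b, c, d) z < 1 / 2" using assms by (auto simp: NF_def)
 have "(4 / 5)\<^sup>2 \<le> (Im z)\<^sup>2" using z by (intro power_mono) auto
 then have "\<not> (d - a)\<^sup>2 + 4 * b * c \<ge> 0"
  using iE_hyperbolic[of z c d a b] g z by (auto simp: power2_eq_square)
 then show ?thesis unfolding g(1) by (intro iE_elliptic g) simp
qed

text \<open>Away from the finitely many elliptic matrices of \<open>NF D\<close> and from the parabolic ones
 fixing \<open>\<infinity>\<close>, points of the Siegel set are moved by a distance that is bounded below.\<close>

lemma NS_cases:
 assumes g: "g \<in> NS D" and z: "\<bar>Re z\<bar> \<le> 1 / 2" "Im z \<ge> 4 / 5"
 shows "g \<in> NF D \<or> (\<exists>a b. g = (a, b, 0, a) \<and> a * a = D \<and> b \<noteq> 0) \<or> iE g z \<ge> 1 / 2"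
proof -
 obtain a b c d where ge: "g = (a, b, c, d)" "a * d - b * c = D" "\<not> (b = 0 \<and> c = 0 \<and> a = d)"
  using g by (auto simp: NS_def)
 show ?thesis
 proof (cases "c = 0")
  case True
  show ?thesis
  proof (cases "a = d")
   case False
   then have "1 \<le> \<bar>real_of_int a - of_int d\<bar>" by linarith
   then have "1 \<le> (real_of_int a - of_int d)\<^sup>2" by (rule one_le_square)
   then have "iE g z \<ge> 1" unfolding ge(1) using z by (subst iE_eq) (auto simp: True add_increasing2)
   then show ?thesis by simp
  qed (use ge True in auto)
 next
  case False
  then show ?thesis using ge z by (auto simp: NF_def not_less[symmetric])
 qed
qed

text \<open>The modulus of a kernel term on the diagonal, normalised to 1 at a fixed point of g. In
  terms of the distance d from z to g z it is cosh (d/2)^(-2n).\<close>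

definition nt :: "nat => imat => complex => real" where
 "nt n g z = (4 * of_int (idet g) / (iX g z z + 2 * of_int (idet g))) ^ n"

lemma nt_eq:
 assumes "Im z > 0" "idet g > 0"
 shows "nt n g z = (1 / (1 + iE g z / (4 * of_int (idet g)))) ^ n"
proof -
 define D where "D = real_of_int (idet g)"
 have D: "D > 0" using assms by (simp add: D_def)
 have e1: "iX g z z + 2 * D = iE g z + 4 * D" by (simp add: iE_def D_def)
 have e2: "4 * D / (iE g z + 4 * D) = 1 / (1 + iE g z / (4 * D))"
  using D iE_nonneg[OF assms(1), of g] by (simp add: field_simps)
 show ?thesis unfolding nt_def D_def[symmetric] e1 e2 ..
qed

lemma measurable_iX [measurable]: "(\<lambda>z. iX g z z) \<in> borel_measurable borel"
proof -
 obtain a b c d where "g = (a, b, c, d)" by (cases g)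
 then show ?thesis by simp
qed

lemma measurable_nt [measurable]: "nt n g \<in> borel_measurable borel"
 unfolding nt_def by measurable

text \<open>Four of the n factors secure the convergence of the lattice sum, the other n - 4 decay
  geometrically.\<close>

lemma nt_bound_4:
 assumes z: "Im z > 0" and d: "idet g > 0" and n: "n \<ge> 4" and r: "1 / (1 + iE g z / (4 * of_int (idet g))) \<le> r"
 shows "nt n g z \<le> r ^ (n - 4) * ((4 * of_int (idet g)) ^ 4 * (1 / (1 + iX g z z) ^ 4))"
proof -
 define D where "D = real_of_int (idet g)"
 define t where "t = 1 / (1 + iE g z / (4 * D))"
 have D: "D \<ge> 1" using d by (simp add: D_def)
 have X: "iX g z z \<ge> 0" by (rule iX_nonneg[OF z z])
 have E: "iE g z \<ge> 0" by (rule iE_nonneg[OF z])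
 have t0: "t \<ge> 0" using E D by (simp add: t_def)
 have "nt n g z = t ^ n" using nt_eq[OF z d] by (simp add: t_def D_def)
 also have "\<dots> = t ^ (n - 4) * t ^ 4" using n by (simp flip: power_add)
 also have "\<dots> \<le> r ^ (n - 4) * (4 * D / (1 + iX g z z)) ^ 4"
 proof (intro mult_mono power_mono)
  have "t = 4 * D / (iX g z z + 2 * D)" using nt_eq[OF z d, of 1] by (simp add: t_def nt_def D_def)
  also have "\<dots> \<le> 4 * D / (1 + iX g z z)" using D X by (intro divide_left_mono mult_pos_pos) auto
  finally show "t \<le> 4 * D / (1 + iX g z z)" .
  have "t \<le> r" using r by (simp only: t_def D_def)
  then show "0 \<le> r ^ (n - 4)" using t0 by (intro zero_le_power) linarith
 qed (use t0 r X D in \<open>auto simp: t_def D_def\<close>)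
 finally show ?thesis by (simp add: D_def power_divide)
qed

section \<open>Integrals of the matrix terms over the Siegel set\<close>

lemma latB_diag:
 assumes "y \<ge> 4 / 5"
 shows "latB y y \<le> 1700 * y"
proof -
 have y: "y > 0" using assms by simp
 have "latB y y = (2 + 4 * y) * 36 * (2 + 4 / y)" using y by (simp add: latB_def real_sqrt_divide)
 also have "\<dots> \<le> (13 / 2 * y) * 36 * 7"
  using assms by (intro mult_mono) (auto simp: field_simps)
 also have "\<dots> \<le> 1700 * y" using y by simp
 finally show ?thesis .
qed

text \<open>The width exp (-t) of the strip cancels Im z = exp t, and the length of the t-interval
  remains. So a bound linear in the height diverges only logarithmically at the cusp.\<close>

lemma nn_integral_sieg_low:
 assumes Y: "Y \<ge> 1"
 shows "(\<integral>\<^sup>+z. indicator sieg z * (indicator {..Y} (Im z) * ennreal (Im z)) \<partial>hyp) \<le> ennreal (ln Y - ln (4 / 5))"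
proof -
 have "(\<integral>\<^sup>+z. indicator sieg z * (indicator {..Y} (Im z) * ennreal (Im z)) \<partial>hyp)
  \<le> (\<integral>\<^sup>+t. indicator {ln (4 / 5)..} t * ennreal (exp (- t)) * (indicator {..Y} (exp t) * ennreal (exp t)) \<partial>lborel)"
  by (rule nn_integral_sieg_Im) measurable
 also have "\<dots> \<le> (\<integral>\<^sup>+t. indicator {ln (4 / 5)..ln Y} t \<partial>lborel)"
 proof (rule nn_integral_mono)
  fix t :: real
  have e: "ennreal (exp (- t)) * ennreal (exp t) = 1"
   by (subst ennreal_mult[symmetric]) (auto simp flip: exp_add)
  have "exp t \<le> Y \<longleftrightarrow> t \<le> ln Y" using Y by (simp add: ln_ge_iff)
  then show "indicator {ln (4 / 5)..} t * ennreal (exp (- t)) * (indicator {..Y} (exp t) * ennreal (exp t)) \<le> indicator {ln (4 / 5)..ln Y} t"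
   using e by (auto split: split_indicator)
 qed
 also have "\<dots> = ennreal (ln Y - ln (4 / 5))"
 proof -
  have "ln (4 / 5) \<le> ln Y" using Y by (subst ln_le_cancel_iff) auto
  then show ?thesis by simp
 qed
 finally show ?thesis .
qed

lemma nn_integral_sieg_high:
 assumes Y: "Y \<ge> 1"
 shows "(\<integral>\<^sup>+z. indicator sieg z * indicator {Y<..} (Im z) \<partial>hyp) \<le> ennreal (1 / Y)"
proof -
 have "(\<integral>\<^sup>+z. indicator sieg z * indicator {Y<..} (Im z) \<partial>hyp)
  \<le> (\<integral>\<^sup>+t. indicator {ln (4 / 5)..} t * ennreal (exp (- t)) * indicator {Y<..} (exp t) \<partial>lborel)"
  by (rule nn_integral_sieg_Im) measurable
 also have "\<dots> \<le> (\<integral>\<^sup>+t. ennreal (exp (- t)) * indicator {ln Y..} t \<partial>lborel)"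
 proof (rule nn_integral_mono)
  fix t :: real
  have "Y < exp t ==> ln Y \<le> t" using Y ln_less_cancel_iff[of Y "exp t"] by simp
  then show "indicator {ln (4 / 5)..} t * ennreal (exp (- t)) * indicator {Y<..} (exp t) \<le> ennreal (exp (- t)) * indicator {ln Y..} t"
   by (auto split: split_indicator)
 qed
 also have "\<dots> = ennreal (0 - (- exp (- ln Y)))"
 proof (rule nn_integral_FTC_atLeast)
  have "((\<lambda>x::real. exp (- x)) \<longlongrightarrow> 0) at_top"
   by (rule filterlim_compose[OF exp_at_bot filterlim_uminus_at_bot_at_top])
  then show "((\<lambda>x::real. - exp (- x)) \<longlongrightarrow> 0) at_top" using tendsto_minus by fastforce
 qed (auto intro!: derivative_eq_intros)
 also have "0 - (- exp (- ln Y)) = 1 / Y" using Y by (simp add: exp_minus inverse_eq_divide)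
 finally show ?thesis .
qed

lemma abs_exp_diff_ge:
 assumes "m > 0" "m \<le> exp s" "m \<le> exp t"
 shows "m * \<bar>s - t\<bar> \<le> \<bar>exp s - exp (t::real)\<bar>"
proof -
 have *: "m * (s - t) \<le> exp s - exp t" if "t \<le> s" "m \<le> exp t" for s t :: real
 proof -
  have "m * (s - t) \<le> exp t * (s - t)" using that by (intro mult_right_mono) auto
  also have "\<dots> \<le> exp t * (exp (s - t) - 1)"
  proof (rule mult_left_mono)
   show "s - t \<le> exp (s - t) - 1" using exp_ge_add_one_self[of "s - t"] by linarith
  qed simp
  also have "\<dots> = exp s - exp t" by (simp add: algebra_simps flip: exp_add)
  finally show ?thesis .
 qed
 show ?thesis
 proof (cases "t \<le> s")
  case True
  then show ?thesis using *[OF True assms(3)] by simp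
 next
  case False
  then show ?thesis using *[of s t] assms(2) by (simp add: abs_minus_commute)
 qed
qed

text \<open>An elliptic matrix contributes an integral of the size of its \<open>1 / \<surd>n\<close>-neighbourhood.\<close>

lemma elliptic_integral:
 assumes g: "g \<in> NF D" and D: "D > 0"
 shows "\<exists>C\<ge>0. \<forall>n\<ge>2. (\<integral>\<^sup>+z. indicator sieg z * ennreal (nt n g z) \<partial>hyp) \<le> ennreal (C / real n)"
proof -
 obtain z0 where z0: "Im z0 > 0" "!!z. Im z > 0 ==> (Re z - Re z0)\<^sup>2 + (Im z - Im z0)\<^sup>2 \<le> iE g z"
  using NF_elliptic[OF g] by blast
 have dg: "idet g = D" using g by (auto simp: NF_def)
 define t0 where "t0 = ln (Im z0)"
 \<comment> \<open>m is a lower bound for the heights of z and z0. Therefore Euclidean distances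
   dominate m times the differences in the coordinates t and s, where s is centred at
   \<open>Re z0 * exp (- t)\<close>.\<close>
 define m where "m = min (4 / 5) (Im z0)"
 have m: "m > 0" "m \<le> 4 / 5" "m \<le> Im z0" using z0 by (auto simp: m_def)
 define k where "k = m\<^sup>2 / (4 * of_int D)"
 have k: "k > 0" using m D by (simp add: k_def)
 define C where "C = 4 * (pi\<^sup>2 / k)"
 have "(\<integral>\<^sup>+z. indicator sieg z * ennreal (nt n g z) \<partial>hyp) \<le> ennreal (C / real n)" if n: "n \<ge> 2" for n
 proof -
  \<comment> \<open>The n factors are split into two halves, and Bernoulli's inequality turns one
    half into a quadratic in t, the other into a quadratic in s. Each one-dimensional integral then
    contributes a constant times 1 / sqrt n.\<close>
  define j where "j = n div 2"
  have j: "j > 0" "2 * j \<le> n" "n \<le> 4 * j" using n by (auto simp: j_def)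
  define q where "q = real j * k"
  have q: "q > 0" using j k by (simp add: q_def)
  have pt: "indicator sieg (Complex (exp t * s) (exp t)) * ennreal (nt n g (Complex (exp t * s) (exp t)))
   \<le> ennreal (1 / (1 + q * (t - t0)\<^sup>2)) * ennreal (1 / (1 + q * (s - Re z0 * exp (- t))\<^sup>2))" for s t
  proof (cases "Complex (exp t * s) (exp t) \<in> sieg")
   case True
   define z where "z = Complex (exp t * s) (exp t)"
   have y: "Im z = exp t" "Im z > 0" "exp t \<ge> 4 / 5" using True by (auto simp: z_def sieg_def)
   define a where "a = (s - Re z0 * exp (- t))\<^sup>2"
   define b where "b = (t - t0)\<^sup>2"
   have ab: "a \<ge> 0" "b \<ge> 0" by (simp_all add: a_def b_def)
   have "m\<^sup>2 * a \<le> (Re z - Re z0)\<^sup>2"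
   proof -
    have "Re z - Re z0 = exp t * (s - Re z0 * exp (- t))" by (simp add: z_def algebra_simps flip: exp_add)
    then have "(Re z - Re z0)\<^sup>2 = (exp t)\<^sup>2 * a" by (simp add: a_def power_mult_distrib)
    moreover have "m\<^sup>2 \<le> (exp t)\<^sup>2" using m y by (intro power_mono) auto
    ultimately show ?thesis using ab by (simp add: mult_right_mono)
   qed
   moreover have "m\<^sup>2 * b \<le> (Im z - Im z0)\<^sup>2"
   proof -
    have "m * \<bar>t - t0\<bar> \<le> \<bar>exp t - exp t0\<bar>" by (rule abs_exp_diff_ge) (use m y z0 in \<open>auto simp: t0_def\<close>)
    then have "(m * \<bar>t - t0\<bar>)\<^sup>2 \<le> \<bar>exp t - exp t0\<bar>\<^sup>2" using m by (intro power_mono) auto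
    then show ?thesis using z0 y by (simp add: b_def power_mult_distrib t0_def)
   qed
   ultimately have E: "m\<^sup>2 * (a + b) \<le> iE g z" using z0(2)[OF y(2)] by (simp add: distrib_left)
   then have Ek: "k * (a + b) \<le> iE g z / (4 * of_int D)" using D by (simp add: k_def divide_right_mono)
   have "nt n g z = 1 / (1 + iE g z / (4 * of_int D)) ^ n" using nt_eq[OF y(2), of g n] D by (simp add: dg power_one_over)
   also have "\<dots> \<le> 1 / ((1 + q * b) * (1 + q * a))"
   proof (rule divide_left_mono)
    have "(1 + q * b) * (1 + q * a) \<le> (1 + k * b) ^ j * (1 + k * a) ^ j"
    proof (intro mult_mono)
     have "k * b \<ge> 0" "k * a \<ge> 0" using ab k by simp_all
     then have kk: "k * b \<ge> -1" "k * a \<ge> -1" by linarith+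
     show "1 + q * b \<le> (1 + k * b) ^ j" "1 + q * a \<le> (1 + k * a) ^ j"
      using Bernoulli_inequality[OF kk(1), of j] Bernoulli_inequality[OF kk(2), of j] by (simp_all add: q_def mult_ac)
    qed (use ab k q in \<open>auto intro: add_nonneg_nonneg\<close>)
    also have "\<dots> \<le> (1 + k * (a + b)) ^ j * (1 + k * (a + b)) ^ j"
     using ab k by (intro mult_mono power_mono zero_le_power add_left_mono mult_left_mono) auto
    also have "\<dots> = (1 + k * (a + b)) ^ (2 * j)" by (simp add: mult_2 power_add)
    also have "\<dots> \<le> (1 + k * (a + b)) ^ n" using ab k j by (intro power_increasing) auto
    also have "\<dots> \<le> (1 + iE g z / (4 * of_int D)) ^ n" using Ek ab k by (intro power_mono) auto
    finally show "(1 + q * b) * (1 + q * a) \<le> (1 + iE g z / (4 * of_int D)) ^ n" .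
    have "1 + iE g z / (4 * of_int D) > 0" using iE_nonneg[OF y(2), of g] D by (simp add: add_pos_nonneg)
    then show "0 < (1 + iE g z / (4 * of_int D)) ^ n * ((1 + q * b) * (1 + q * a))"
     using ab q by (intro mult_pos_pos zero_less_power) (auto intro: add_pos_nonneg)
   qed simp
   finally have "ennreal (nt n g z) \<le> ennreal (1 / (1 + q * b) * (1 / (1 + q * a)))" by (intro ennreal_leI) simp
   also have "\<dots> = ennreal (1 / (1 + q * b)) * ennreal (1 / (1 + q * a))"
    using ab q by (intro ennreal_mult) auto
   finally show ?thesis using True unfolding a_def b_def z_def by simp
  qed simp
  have "(\<integral>\<^sup>+z. indicator sieg z * ennreal (nt n g z) \<partial>hyp)
   = (\<integral>\<^sup>+t. \<integral>\<^sup>+s. indicator sieg (Complex (exp t * s) (exp t)) * ennreal (nt n g (Complex (exp t * s) (exp t))) \<partial>lborel \<partial>lborel)"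
   by (rule nn_integral_hyp) measurable
  also have "\<dots> \<le> (\<integral>\<^sup>+t. \<integral>\<^sup>+s. ennreal (1 / (1 + q * (t - t0)\<^sup>2)) * ennreal (1 / (1 + q * (s - Re z0 * exp (- t))\<^sup>2)) \<partial>lborel \<partial>lborel)"
   by (intro nn_integral_mono pt)
  also have "\<dots> \<le> (\<integral>\<^sup>+t. ennreal (1 / (1 + q * (t - t0)\<^sup>2)) * ennreal (pi / sqrt q) \<partial>lborel)"
  proof (rule nn_integral_mono)
   fix t :: real
   have "(\<integral>\<^sup>+s. ennreal (1 / (1 + q * (t - t0)\<^sup>2)) * ennreal (1 / (1 + q * (s - Re z0 * exp (- t))\<^sup>2)) \<partial>lborel)
    = ennreal (1 / (1 + q * (t - t0)\<^sup>2)) * (\<integral>\<^sup>+s. ennreal (1 / (1 + q * (s - Re z0 * exp (- t))\<^sup>2)) \<partial>lborel)"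
    by (rule nn_integral_cmult) measurable
   also have "\<dots> \<le> ennreal (1 / (1 + q * (t - t0)\<^sup>2)) * ennreal (pi / sqrt q)"
    by (intro mult_left_mono nn_integral_inverse_quadratic q) simp
   finally show "(\<integral>\<^sup>+s. ennreal (1 / (1 + q * (t - t0)\<^sup>2)) * ennreal (1 / (1 + q * (s - Re z0 * exp (- t))\<^sup>2)) \<partial>lborel)
    \<le> ennreal (1 / (1 + q * (t - t0)\<^sup>2)) * ennreal (pi / sqrt q)" .
  qed
  also have "\<dots> = (\<integral>\<^sup>+t. ennreal (1 / (1 + q * (t - t0)\<^sup>2)) \<partial>lborel) * ennreal (pi / sqrt q)"
   by (rule nn_integral_multc) measurable
  also have "\<dots> \<le> ennreal (pi / sqrt q) * ennreal (pi / sqrt q)"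
   by (intro mult_right_mono nn_integral_inverse_quadratic q) simp
  also have "\<dots> = ennreal (pi\<^sup>2 / q)" using q by (simp add: ennreal_mult[symmetric] power2_eq_square)
  also have "\<dots> \<le> ennreal (C / real n)"
  proof (rule ennreal_leI)
   have "pi\<^sup>2 / q = (pi\<^sup>2 / k) * (1 / real j)" by (simp add: q_def mult.commute)
   also have "\<dots> \<le> (pi\<^sup>2 / k) * (4 / real n)" using j k n by (intro mult_left_mono) (auto simp: field_simps)
   finally show "pi\<^sup>2 / q \<le> C / real n" by (simp add: C_def mult.commute)
  qed
  finally show ?thesis .
 qed
 moreover have "C \<ge> 0" using k by (simp add: C_def)
 ultimately show ?thesis by blast
qed

text \<open>The number of possible diagonals of parabolic matrices (a, b, 0, a) of determinant D. It
  vanishes if D is not a square and then switches off the slowly decaying error.\<close>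

definition sqn :: "int => nat" where "sqn D = card {a. a * a = D}"

lemma finite_sqrts: "finite {a::int. a * a = D}"
proof (rule finite_subset)
 have "\<bar>a\<bar> \<le> a * a" for a :: int
  by (metis abs_ge_self abs_mult_self_eq abs_zero int_one_le_iff_zero_less mult_le_cancel_left1 order_le_less abs_ge_zero not_less)
 note le = this
 show "{a. a * a = D} \<subseteq> {- \<bar>D\<bar>..\<bar>D\<bar>}"
 proof
  fix a assume "a \<in> {a. a * a = D}"
  then have "\<bar>a\<bar> \<le> D" using le[of a] by simp
  then show "a \<in> {- \<bar>D\<bar>..\<bar>D\<bar>}" by auto
 qed
qed simp

text \<open>Here \<open>iE\<close> is b^2 / y^2. Bernoulli's inequality bounds the n-th power below
  by 1 + b^2 / q with q = 4 D y^2 / n, and the sum over b is of size sqrt q.\<close>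

lemma parabolic_sum:
 assumes z: "Im z > 0" and a: "a * a = D" "D > 0" and n: "n \<ge> 1"
 shows "(\<integral>\<^sup>+b. ennreal (nt n (a, b, 0, a) z) \<partial>count_space (UNIV - {0})) \<le> ennreal (8 * sqrt (of_int D) * Im z / sqrt (real n))"
proof -
 define q where "q = 4 * of_int D * (Im z)\<^sup>2 / real n"
 have q: "q > 0" using z a n by (simp add: q_def)
 define f where "f b = ennreal (1 / (1 + (real_of_int b)\<^sup>2 / q))" for b
 have le: "ennreal (nt n (a, b, 0, a) z) \<le> f b" for b
 proof -
  have d: "idet (a, b, 0, a) > 0" using a by simp
  have E: "iE (a, b, 0, a) z = (of_int b)\<^sup>2 / (Im z)\<^sup>2" using z by (simp add: iE_eq power_divide)
  define t where "t = (real_of_int b)\<^sup>2 / (Im z)\<^sup>2 / (4 * of_int D)"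
  have t: "t \<ge> 0" using a by (simp add: t_def)
  have "nt n (a, b, 0, a) z = 1 / (1 + t) ^ n" using nt_eq[OF z d, of n] unfolding E using a by (simp add: t_def power_one_over)
  also have "\<dots> \<le> 1 / (1 + real n * t)"
   using t Bernoulli_inequality[of t n] by (intro divide_left_mono mult_pos_pos) (auto simp: add_pos_nonneg)
  also have "real n * t = (real_of_int b)\<^sup>2 / q" by (simp add: t_def q_def mult_ac)
  finally show ?thesis unfolding f_def by (rule ennreal_leI)
 qed
 have "(\<integral>\<^sup>+b. ennreal (nt n (a, b, 0, a) z) \<partial>count_space (UNIV - {0})) \<le> (\<integral>\<^sup>+b. f b \<partial>count_space (UNIV - {0}))"
  by (intro nn_integral_mono le)
 also have "\<dots> = (\<integral>\<^sup>+b. f b * indicator (UNIV - {0}) b \<partial>count_space UNIV)"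
  by (rule nn_integral_count_space_indicator) simp
 also have "\<dots> = (\<Sum>k. f (int k) * indicator (UNIV - {0}) (int k)) + (\<Sum>k. f (- int k - 1) * indicator (UNIV - {0}) (- int k - 1))"
  by (rule nn_integral_count_space_int)
 also have "(\<Sum>k. f (int k) * indicator (UNIV - {0}) (int k)) = (\<Sum>k. f (int (Suc k)) * indicator (UNIV - {0}) (int (Suc k)))"
  using suminf_offset[of "\<lambda>k. f (int k) * indicator (UNIV - {0}) (int k)" 1] by simp
 also have "\<dots> = (\<Sum>k. ennreal (1 / (1 + (real (Suc k))\<^sup>2 / q)))"
  by (simp add: f_def)
 also have "(\<Sum>k. f (- int k - 1) * indicator (UNIV - {0}) (- int k - 1)) = (\<Sum>k. ennreal (1 / (1 + (real (Suc k))\<^sup>2 / q)))"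
 proof (rule suminf_cong)
  fix k
  have "(real_of_int (- int k - 1))\<^sup>2 = (real (Suc k))\<^sup>2" by (simp add: power2_eq_square algebra_simps)
  moreover have "- int k - 1 \<noteq> 0" by simp
  ultimately show "f (- int k - 1) * indicator (UNIV - {0}) (- int k - 1) = ennreal (1 / (1 + (real (Suc k))\<^sup>2 / q))"
   unfolding f_def by simp
 qed
 also have "(\<Sum>k. ennreal (1 / (1 + (real (Suc k))\<^sup>2 / q))) + (\<Sum>k. ennreal (1 / (1 + (real (Suc k))\<^sup>2 / q))) \<le> ennreal (2 * sqrt q) + ennreal (2 * sqrt q)"
  by (intro add_mono suminf_inverse_quadratic q)
 also have "\<dots> = ennreal (4 * sqrt q)" using q by (simp flip: ennreal_plus)
 also have "4 * sqrt q = 8 * sqrt (of_int D) * Im z / sqrt (real n)"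
  using z by (simp add: q_def real_sqrt_divide real_sqrt_mult)
 finally show ?thesis .
qed

definition Sn :: "nat => int => complex => ennreal" where
 "Sn n D z = (\<integral>\<^sup>+g. ennreal (nt n g z) \<partial>count_space (NS D))"

text \<open>The base 1 / (1 + iE / (4 D)) of \<open>nt\<close> at the threshold iE = 1/2.\<close>

definition erho :: "int => real" where "erho D = 1 / (1 + 1 / (8 * of_int D))"

text \<open>The classes of \<open>NS_cases\<close> are bounded separately: finitely many elliptic
  terms, the parabolic sums, and the rest by the full lattice sum with a geometrically small factor.
  The last two bounds grow linearly with the height.\<close>

lemma Sn_le:
 assumes D: "D > 0" and n: "n \<ge> 4" and z: "z \<in> sieg"
 shows "Sn n D z \<le> (\<Sum>g\<in>NF D. ennreal (nt n g z))
  + (of_nat (sqn D) * ennreal (8 * sqrt (of_int D) / sqrt (real n)) * ennreal (Im z)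
    + ennreal (erho D ^ (n - 4) * ((4 * of_int D) ^ 4 * 1700)) * ennreal (Im z))"
proof -
 have zz: "\<bar>Re z\<bar> \<le> 1 / 2" "Im z \<ge> 4 / 5" "Im z > 0" using z by (auto simp: sieg_def)
 define A where "A = {a::int. a * a = D}"
 have finA: "finite A" unfolding A_def by (rule finite_sqrts)
 define Pa where "Pa a = (\<lambda>b. (a, b, 0::int, a)) ` (UNIV - {0::int})" for a :: int
 let ?U = "count_space (UNIV :: imat set)"
 define C4 where "C4 = erho D ^ (n - 4) * (4 * of_int D) ^ 4"
 have rho: "erho D > 0" using D by (simp add: erho_def add_pos_pos)
 have C4: "C4 \<ge> 0" using rho D by (simp add: C4_def)
 have pt: "ennreal (nt n g z) * indicator (NS D) g \<le>
  (\<Sum>g'\<in>NF D. ennreal (nt n g' z) * indicator {g'} g) + ((\<Sum>a\<in>A. ennreal (nt n g z) * indicator (Pa a) g) + ennreal C4 * ennreal (1 / (1 + iX g z z) ^ 4))" for g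
 proof (cases "g \<in> NS D")
  case True
  then have d: "idet g = D" by (auto simp: NS_def)
  from NS_cases[OF True zz(1,2)] consider "g \<in> NF D" | a b where "g = (a, b, 0, a)" "a * a = D" "b \<noteq> 0" | "iE g z \<ge> 1 / 2" by blast
  then show ?thesis
  proof cases
   case 1
   have "ennreal (nt n g z) * indicator (NS D) g = ennreal (nt n g z) * indicator {g} g" using True by simp
   also have "\<dots> \<le> (\<Sum>g'\<in>NF D. ennreal (nt n g' z) * indicator {g'} g)"
    by (rule member_le_sum[OF 1]) (use finite_NF[OF D] in auto)
   finally show ?thesis by (simp add: add_increasing2)
  next
   case 2
   have "ennreal (nt n g z) * indicator (NS D) g = ennreal (nt n g z) * indicator (Pa a) g"
    using True 2 by (simp add: Pa_def)
   also have "\<dots> \<le> (\<Sum>a\<in>A. ennreal (nt n g z) * indicator (Pa a) g)"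
    by (rule member_le_sum) (use finA 2 in \<open>auto simp: A_def\<close>)
   finally show ?thesis by (simp add: add_increasing add_increasing2)
  next
   case 3
   have "nt n g z \<le> erho D ^ (n - 4) * ((4 * of_int (idet g)) ^ 4 * (1 / (1 + iX g z z) ^ 4))"
   proof (rule nt_bound_4[OF zz(3) _ n])
    have "1 / (8 * real_of_int D) \<le> iE g z / (4 * of_int D)" using 3 D by (simp add: field_simps)
    then show "1 / (1 + iE g z / (4 * of_int (idet g))) \<le> erho D"
    proof -
     have "iE g z / (4 * of_int D) \<ge> 0" using 3 D by (intro divide_nonneg_pos) auto
     then show ?thesis
      unfolding erho_def d using D \<open>1 / (8 * real_of_int D) \<le> iE g z / (4 * of_int D)\<close>
      by (intro divide_left_mono) (auto intro!: mult_pos_pos add_pos_nonneg)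
    qed
   qed (use d D in auto)
   then have "ennreal (nt n g z) \<le> ennreal (C4 * (1 / (1 + iX g z z) ^ 4))"
    by (intro ennreal_leI) (simp add: C4_def d)
   also have "\<dots> = ennreal C4 * ennreal (1 / (1 + iX g z z) ^ 4)"
    using C4 iX_nonneg[OF zz(3) zz(3), of g] by (intro ennreal_mult) auto
   finally show ?thesis using True by (simp add: add_increasing)
  qed
 qed simp
 have "Sn n D z = (\<integral>\<^sup>+g. ennreal (nt n g z) * indicator (NS D) g \<partial>?U)"
  unfolding Sn_def by (rule nn_integral_count_space_indicator) simp
 also have "\<dots> \<le> (\<integral>\<^sup>+g. (\<Sum>g'\<in>NF D. ennreal (nt n g' z) * indicator {g'} g) + ((\<Sum>a\<in>A. ennreal (nt n g z) * indicator (Pa a) g) + ennreal C4 * ennreal (1 / (1 + iX g z z) ^ 4)) \<partial>?U)"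
  by (intro nn_integral_mono pt)
 also have "\<dots> = (\<Sum>g'\<in>NF D. \<integral>\<^sup>+g. ennreal (nt n g' z) * indicator {g'} g \<partial>?U)
  + ((\<Sum>a\<in>A. \<integral>\<^sup>+g. ennreal (nt n g z) * indicator (Pa a) g \<partial>?U) + ennreal C4 * (\<integral>\<^sup>+g. ennreal (1 / (1 + iX g z z) ^ 4) \<partial>?U))"
  by (simp add: nn_integral_add nn_integral_sum nn_integral_cmult del: nn_integral_indicator_singleton nn_integral_indicator_singleton')
 also have "\<dots> \<le> (\<Sum>g\<in>NF D. ennreal (nt n g z))
  + ((\<Sum>a\<in>A. ennreal (8 * sqrt (of_int D) * Im z / sqrt (real n))) + ennreal C4 * ennreal (1700 * Im z))"
 proof (intro add_mono sum_mono mult_left_mono)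
  fix g' show "(\<integral>\<^sup>+g. ennreal (nt n g' z) * indicator {g'} g \<partial>?U) \<le> ennreal (nt n g' z)"
   by (subst nn_integral_cmult_indicator) auto
 next
  fix a assume a: "a \<in> A"
  have inj: "inj_on (\<lambda>b. (a, b, 0::int, a)) (UNIV - {0})" by (auto simp: inj_on_def)
  have "(\<integral>\<^sup>+g. ennreal (nt n g z) * indicator (Pa a) g \<partial>?U) = (\<integral>\<^sup>+g. ennreal (nt n g z) \<partial>count_space (Pa a))"
   by (rule nn_integral_count_space_indicator[symmetric]) simp
  also have "\<dots> = (\<integral>\<^sup>+b. ennreal (nt n (a, b, 0, a) z) \<partial>count_space (UNIV - {0}))"
   by (rule nn_integral_bij_count_space[symmetric]) (simp add: bij_betw_def inj Pa_def)
  also have "\<dots> \<le> ennreal (8 * sqrt (of_int D) * Im z / sqrt (real n))"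
   by (rule parabolic_sum[OF zz(3)]) (use a D n in \<open>auto simp: A_def\<close>)
  finally show "(\<integral>\<^sup>+g. ennreal (nt n g z) * indicator (Pa a) g \<partial>?U) \<le> ennreal (8 * sqrt (of_int D) * Im z / sqrt (real n))" .
 next
  have "(\<integral>\<^sup>+g. ennreal (1 / (1 + iX g z z) ^ 4) \<partial>?U) \<le> ennreal (latB (Im z) (Im z))"
   unfolding latB_def by (rule lattice_sum_bound[OF zz(3) zz(3)])
  also have "\<dots> \<le> ennreal (1700 * Im z)" by (intro ennreal_leI latB_diag zz)
  finally show "(\<integral>\<^sup>+g. ennreal (1 / (1 + iX g z z) ^ 4) \<partial>?U) \<le> ennreal (1700 * Im z)" .
 qed simp
 also have "(\<Sum>a\<in>A. ennreal (8 * sqrt (of_int D) * Im z / sqrt (real n))) = of_nat (sqn D) * ennreal (8 * sqrt (of_int D) / sqrt (real n)) * ennreal (Im z)"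
 proof -
  have "ennreal (8 * sqrt (of_int D) * Im z / sqrt (real n)) = ennreal (8 * sqrt (of_int D) / sqrt (real n)) * ennreal (Im z)"
   using zz D by (subst ennreal_mult[symmetric]) auto
  then show ?thesis by (simp add: sqn_def A_def mult.assoc)
 qed
 also have "ennreal C4 * ennreal (1700 * Im z) = ennreal (erho D ^ (n - 4) * ((4 * of_int D) ^ 4 * 1700)) * ennreal (Im z)"
  using zz C4 rho D by (simp add: C4_def ennreal_mult[symmetric] mult_ac)
 finally show ?thesis .
qed

text \<open>The linear growth in the height has a divergent integral over the whole Siegel set; cut
  off at height Y it costs ln Y.\<close>

lemma Sn_integral:
 assumes D: "D > 0"
 shows "\<exists>C\<ge>0. \<forall>n\<ge>4. \<forall>Y\<ge>1. (\<integral>\<^sup>+z. indicator sieg z * (indicator {..Y} (Im z) * Sn n D z) \<partial>hyp)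
  \<le> ennreal (C / real n + (real (sqn D) / sqrt (real n) + erho D ^ n) * (C * (ln Y + 1)))"
proof -
 have "\<forall>g\<in>NF D. \<exists>C\<ge>0. \<forall>n\<ge>2. (\<integral>\<^sup>+z. indicator sieg z * ennreal (nt n g z) \<partial>hyp) \<le> ennreal (C / real n)"
  using elliptic_integral[OF _ D] by blast
 then obtain Cg where Cg: "!!g. g \<in> NF D ==> Cg g \<ge> 0"
  "!!g n. g \<in> NF D ==> n \<ge> 2 ==> (\<integral>\<^sup>+z. indicator sieg z * ennreal (nt n g z) \<partial>hyp) \<le> ennreal (Cg g / real n)"
  by metis
 have rho: "erho D > 0" using D by (simp add: erho_def add_pos_pos)
 define C1 where "C1 = (\<Sum>g\<in>NF D. Cg g)"
 define C2 where "C2 = 8 * sqrt (real_of_int D)"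
 define C3 where "C3 = (4 * real_of_int D) ^ 4 * 1700 / erho D ^ 4"
 define C where "C = C1 + C2 + C3"
 have C: "C1 \<ge> 0" "C2 \<ge> 0" "C3 \<ge> 0" using Cg(1) D rho by (auto simp: C1_def C2_def C3_def intro: sum_nonneg)
 have "(\<integral>\<^sup>+z. indicator sieg z * (indicator {..Y} (Im z) * Sn n D z) \<partial>hyp)
  \<le> ennreal (C / real n + (real (sqn D) / sqrt (real n) + erho D ^ n) * (C * (ln Y + 1)))" if n: "n \<ge> 4" and Y: "Y \<ge> 1" for n Y
 proof -
  define p where "p = of_nat (sqn D) * ennreal (8 * sqrt (of_int D) / sqrt (real n))"
  define r where "r = ennreal (erho D ^ (n - 4) * ((4 * of_int D) ^ 4 * 1700))"
  let ?low = "\<lambda>z. indicator sieg z * (indicator {..Y} (Im z) * ennreal (Im z)) :: ennreal"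
  have "(\<integral>\<^sup>+z. indicator sieg z * (indicator {..Y} (Im z) * Sn n D z) \<partial>hyp)
   \<le> (\<integral>\<^sup>+z. (\<Sum>g\<in>NF D. indicator sieg z * ennreal (nt n g z)) + (p + r) * ?low z \<partial>hyp)"
  proof (rule nn_integral_mono)
   fix z
   show "indicator sieg z * (indicator {..Y} (Im z) * Sn n D z) \<le> (\<Sum>g\<in>NF D. indicator sieg z * ennreal (nt n g z)) + (p + r) * ?low z"
    using Sn_le[OF D n, of z] by (auto simp: p_def r_def distrib_right sum_distrib_left[symmetric] split: split_indicator)
  qed
  also have "\<dots> = (\<Sum>g\<in>NF D. \<integral>\<^sup>+z. indicator sieg z * ennreal (nt n g z) \<partial>hyp) + (p + r) * (\<integral>\<^sup>+z. ?low z \<partial>hyp)"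
   by (subst nn_integral_add, measurable, subst nn_integral_sum, measurable, subst nn_integral_cmult, measurable)
  also have "\<dots> \<le> (\<Sum>g\<in>NF D. ennreal (Cg g / real n)) + (p + r) * ennreal (ln Y - ln (4 / 5))"
   using n by (intro add_mono sum_mono mult_left_mono Cg nn_integral_sieg_low Y) auto
  also have "\<dots> = ennreal (C1 / real n + (real (sqn D) * (C2 / sqrt (real n)) + C3 * erho D ^ n) * (ln Y - ln (4 / 5)))"
  proof -
   have 1: "(\<Sum>g\<in>NF D. ennreal (Cg g / real n)) = ennreal (C1 / real n)"
    using Cg(1) by (simp add: sum_ennreal C1_def sum_divide_distrib)
   have 2: "p = ennreal (real (sqn D) * (C2 / sqrt (real n)))"
    unfolding p_def C2_def ennreal_of_nat_eq_real_of_nat using D by (intro ennreal_mult[symmetric]) auto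
   have "erho D ^ (n - 4) = erho D ^ n / erho D ^ 4" using rho n by (simp add: power_diff)
   then have 3: "r = ennreal (C3 * erho D ^ n)" by (simp add: r_def C3_def mult_ac)
   have l: "ln Y - ln (4 / 5) \<ge> 0" using Y ln_le_cancel_iff[of "4 / 5" Y] by simp
   have nn: "real (sqn D) * (C2 / sqrt (real n)) \<ge> 0" "C3 * erho D ^ n \<ge> 0" "C1 / real n \<ge> 0" using C rho by auto
   show ?thesis unfolding 1 2 3 using nn l by (simp add: ennreal_mult[symmetric] ennreal_plus[symmetric] del: ennreal_plus)
  qed
  also have "\<dots> \<le> ennreal (C / real n + (real (sqn D) / sqrt (real n) + erho D ^ n) * (C * (ln Y + 1)))"
  proof (rule ennreal_leI, rule add_mono)
   show "C1 / real n \<le> C / real n" using C by (intro divide_right_mono) (auto simp: C_def)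
   have l5: "- ln (4 / 5 :: real) \<le> 1"
   proof -
    have "- ln (4 / 5 :: real) = ln (5 / 4)" by (simp add: ln_div)
    also have "\<dots> \<le> 5 / 4 - 1" by (rule ln_le_minus_one) simp
    finally show ?thesis by simp
   qed
   have "(real (sqn D) * (C2 / sqrt (real n)) + C3 * erho D ^ n) * (ln Y - ln (4 / 5))
    \<le> (real (sqn D) * (C / sqrt (real n)) + C * erho D ^ n) * (ln Y + 1)"
   proof (rule mult_mono)
    show "real (sqn D) * (C2 / sqrt (real n)) + C3 * erho D ^ n \<le> real (sqn D) * (C / sqrt (real n)) + C * erho D ^ n"
     using C rho by (intro add_mono mult_left_mono mult_right_mono divide_right_mono) (auto simp: C_def)
    show "ln Y - ln (4 / 5) \<le> ln Y + 1" using l5 by simp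
    show "0 \<le> real (sqn D) * (C / sqrt (real n)) + C * erho D ^ n" using C rho by (simp add: C_def)
    show "0 \<le> ln Y - ln (4 / 5)" using Y ln_le_cancel_iff[of "4 / 5" Y] by simp
   qed
   also have "\<dots> = (real (sqn D) / sqrt (real n) + erho D ^ n) * (C * (ln Y + 1))"
    by (simp add: algebra_simps)
   finally show "(real (sqn D) * (C2 / sqrt (real n)) + C3 * erho D ^ n) * (ln Y - ln (4 / 5))
    \<le> (real (sqn D) / sqrt (real n) + erho D ^ n) * (C * (ln Y + 1))" .
  qed
  finally show ?thesis .
 qed
 moreover have "C \<ge> 0" using C by (simp add: C_def)
 ultimately show ?thesis by blast
qed

subsection \<open>The trace formula\<close>

text \<open>The inverse of the constant in \<open>reproducing\<close>.\<close>

definition hc :: "nat => complex" where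
 "hc n = of_real ((-1) ^ n * 4 ^ n / hypJ (2 * n))"

lemma hypJ_pos: "n \<ge> 2 ==> hypJ n > 0"
 using hypJ_lower_bound[of n] by (rule less_le_trans[rotated]) auto

lemma measurable_iden [measurable]: "iden g \<in> borel_measurable borel"
 by (cases g) (simp add: fun_eq_iff cong: measurable_cong)

lemma measurable_iL [measurable]: "(\<lambda>w. iL g z w) \<in> borel_measurable borel"
proof -
 obtain a b c d where "g = (a, b, c, d)" by (cases g)
 then show ?thesis by simp
qed

lemma measurable_kap [measurable]: "(\<lambda>w. kap n g z w) \<in> borel_measurable borel"
 unfolding kap_def by measurable

text \<open>The integrand of \<open>reproducing\<close> at g^-1 w. The automorphy factors of f and
  of Im w cancel against that of the denominator, which turns into \<open>iL g z w\<close> by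
  \<open>iL_imob_right\<close>.\<close>

lemma unfold_term:
 assumes N: "N > 0" and f: "f \<in> Vsp n N \<sigma>" and g: "g \<in> ALG N" and w: "Im w > 0"
 shows "f (imob (iadj g) w) * of_real (Im (imob (iadj g) w) ^ (2 * n)) / (z - cnj (imob (iadj g) w)) ^ (2 * n)
  = of_int (chi \<sigma> g) * f w * of_real (Im w ^ (2 * n)) * kap n g z w"
proof -
 define h where "h = iadj g"
 have h: "h \<in> ALG N" unfolding h_def by (rule iadj_ALG[OF g])
 have dh: "idet h = idet g" by (simp add: h_def)
 have d: "idet g > 0" by (rule ALG_idet_pos[OF N g])
 define D where "D = (of_int (idet g) :: complex)"
 define j where "j = iden h w"
 have D: "D \<noteq> 0" using d by (simp add: D_def)
 have j: "j \<noteq> 0" unfolding j_def by (rule iden_nonzero[OF w]) (simp add: dh d)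
 have cj: "cnj j \<noteq> 0" using j by simp
 have f1: "f (imob h w) = of_int (chi \<sigma> g) * f w * j ^ (2 * n) / D ^ n"
 proof -
  have "sl n h f w = of_int (chi \<sigma> h) * f w" using VspD(3)[OF f h] by (simp add: cscale_def)
  then have "D ^ n / j ^ (2 * n) * f (imob h w) = of_int (chi \<sigma> g) * f w"
   by (simp add: sl_def D_def j_def dh chi_def)
  then show ?thesis using D j by (simp add: field_simps)
 qed
 have i1: "of_real (Im (imob h w) ^ (2 * n)) = D ^ (2 * n) * of_real (Im w ^ (2 * n)) / (j * cnj j) ^ (2 * n)"
 proof -
  have "of_real (Im (imob h w)) = D * of_real (Im w) / (j * cnj j)"
   unfolding Im_imob complex_norm_square[symmetric] j_def[symmetric] dh by (simp add: D_def)
  then show ?thesis by (simp add: power_divide power_mult_distrib)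
 qed
 have l1: "z - cnj (imob h w) = iL g z w / cnj j"
  using iL_imob_right[of h w "(1, 0, 0, 1)" z] j cj by (simp add: j_def h_def field_simps)
 have "f (imob h w) * of_real (Im (imob h w) ^ (2 * n)) / (z - cnj (imob h w)) ^ (2 * n)
  = of_int (chi \<sigma> g) * f w * of_real (Im w ^ (2 * n)) * (D ^ (2 * n) / D ^ n) / iL g z w ^ (2 * n)"
  unfolding f1 i1 l1 power_divide power_mult_distrib using j cj by simp
 also have "D ^ (2 * n) / D ^ n = D ^ n" using D by (simp add: mult_2 power_add)
 finally show ?thesis by (simp add: h_def D_def kap_def)
qed

text \<open>Unfolding: 1 is inserted as the sum of \<open>fphi\<close> over the translates of w, sum
  and integral are exchanged, and g^-1 w is substituted in each term. The sum over g then assembles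
  to \<open>hK\<close> and the single weight \<open>fphi N w\<close> remains.\<close>

lemma kernel_reproducing:
 assumes N: "N > 0" and s: "sign_pattern N \<sigma>" and n: "n \<ge> 4" and f: "f \<in> Vsp n N \<sigma>" and z: "Im z > 0"
 shows "integrable hyp (\<lambda>w. of_real (fphi N w) * f w * of_real (Im w ^ (2 * n)) * hK n N \<sigma> z w)"
  "f z = hc n * (\<integral>w. of_real (fphi N w) * f w * of_real (Im w ^ (2 * n)) * hK n N \<sigma> z w \<partial>hyp)"
proof -
 let ?G = "ALG N"
 note fphi_measurable[OF N, measurable] Vsp_measurable[OF f, measurable]
 have n2: "n \<ge> 2" using n by simp
 obtain M where M: "!!w. Im w > 0 ==> cmod (f w) * Im w ^ n \<le> M" using VspD(4)[OF f] by blast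
 define F where "F w = f w * of_real (Im w ^ (2 * n)) / (z - cnj w) ^ (2 * n)" for w
 have mF [measurable]: "F \<in> borel_measurable borel" unfolding F_def by measurable
 have intF: "integrable hyp F" and valF: "integral\<^sup>L hyp F = of_real ((-1) ^ n / 4 ^ n * hypJ (2 * n)) * f z"
  unfolding F_def using reproducing[OF n2 VspD(2)[OF f] _ M z] by simp_all
 define A where "A g w = of_real (fphi N (imob g w)) * F w" for g w
 define B where "B g w = of_real (fphi N w) * (of_int (chi \<sigma> g) * f w * of_real (Im w ^ (2 * n)) * kap n g z w)" for g w
 have mA [measurable]: "A g \<in> borel_measurable borel" for g unfolding A_def by measurable
 have mB [measurable]: "B g \<in> borel_measurable borel" for g unfolding B_def by measurable
 have AB: "A g (imob (iadj g) w) = B g w" if "g \<in> ?G" "Im w > 0" for g w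
  using unfold_term[OF N f that, of z] imob_iadj(2)[OF ALG_idet_pos[OF N that(1)] that(2)]
  by (simp add: A_def B_def F_def)
 have dadj: "idet (iadj g) > 0" if "g \<in> ?G" for g using ALG_idet_pos[OF N that] by simp
 interpret G: sigma_finite_measure "count_space ?G" by (rule sigma_finite_measure_count_space_countable) (rule countable_imat)
 interpret P: pair_sigma_finite "count_space ?G" hyp ..
 have mp: "case_prod X \<in> borel_measurable (count_space ?G \<Otimes>\<^sub>M hyp)" if "!!g. X g \<in> borel_measurable borel" for X :: "imat => complex => complex"
  by (rule measurable_pair_measure_countable1[OF countable_imat]) (use that in simp)
 have nnA: "(\<integral>\<^sup>+g. \<integral>\<^sup>+w. ennreal (norm (A g w)) \<partial>hyp \<partial>count_space ?G) = (\<integral>\<^sup>+w. ennreal (norm (F w)) \<partial>hyp)"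
 proof -
  have "(\<integral>\<^sup>+g. \<integral>\<^sup>+w. ennreal (norm (A g w)) \<partial>hyp \<partial>count_space ?G) = (\<integral>\<^sup>+w. \<integral>\<^sup>+g. ennreal (norm (A g w)) \<partial>count_space ?G \<partial>hyp)"
   by (rule nn_integral_count_space_nn_integral[symmetric]) (simp_all add: countable_imat)
  also have "\<dots> = (\<integral>\<^sup>+w. ennreal (norm (F w)) \<partial>hyp)"
  proof (rule nn_integral_cong_AE)
   show "AE w in hyp. (\<integral>\<^sup>+g. ennreal (norm (A g w)) \<partial>count_space ?G) = ennreal (norm (F w))"
    using AE_hyp_pos
   proof eventually_elim
    case (elim w)
    have "(\<integral>\<^sup>+g. ennreal (norm (A g w)) \<partial>count_space ?G) = (\<integral>\<^sup>+g. ennreal (fphi N (imob g w)) * ennreal (norm (F w)) \<partial>count_space ?G)"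
     by (rule nn_integral_cong) (simp add: A_def norm_mult fphi_nonneg ennreal_mult)
    also have "\<dots> = ennreal (norm (F w))" by (simp add: nn_integral_multc fphi_sum[OF N elim])
    finally show ?case .
   qed
  qed
  finally show ?thesis .
 qed
 have nnF: "(\<integral>\<^sup>+w. ennreal (norm (F w)) \<partial>hyp) < \<infinity>" using intF by (simp add: integrable_iff_bounded)
 have intA: "integrable (count_space ?G \<Otimes>\<^sub>M hyp) (case_prod A)"
 proof (rule integrableI_bounded)
  have "(\<integral>\<^sup>+p. ennreal (norm (case_prod A p)) \<partial>(count_space ?G \<Otimes>\<^sub>M hyp)) = (\<integral>\<^sup>+g. \<integral>\<^sup>+w. ennreal (norm (A g w)) \<partial>hyp \<partial>count_space ?G)"
   using hyp.nn_integral_fst[of "\<lambda>p. ennreal (norm (case_prod A p))" "count_space ?G"] mp[OF mA] by simp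
  then show "(\<integral>\<^sup>+p. ennreal (norm (case_prod A p)) \<partial>(count_space ?G \<Otimes>\<^sub>M hyp)) < \<infinity>" using nnA nnF by simp
 qed (rule mp[OF mA])
 have nnAB: "(\<integral>\<^sup>+w. ennreal (norm (A g w)) \<partial>hyp) = (\<integral>\<^sup>+w. ennreal (norm (B g w)) \<partial>hyp)" if g: "g \<in> ?G" for g
 proof -
  have "(\<integral>\<^sup>+w. ennreal (norm (A g w)) \<partial>hyp) = (\<integral>\<^sup>+w. ennreal (norm (A g (imob (iadj g) w))) \<partial>hyp)"
   by (rule nn_integral_hyp_imob[OF _ dadj[OF g], symmetric]) measurable
  also have "\<dots> = (\<integral>\<^sup>+w. ennreal (norm (B g w)) \<partial>hyp)"
   by (rule nn_integral_cong_AE) (use AE_hyp_pos in eventually_elim, simp add: AB[OF g])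
  finally show ?thesis .
 qed
 have intB: "integrable (count_space ?G \<Otimes>\<^sub>M hyp) (case_prod B)"
 proof (rule integrableI_bounded)
  have "(\<integral>\<^sup>+p. ennreal (norm (case_prod B p)) \<partial>(count_space ?G \<Otimes>\<^sub>M hyp)) = (\<integral>\<^sup>+g. \<integral>\<^sup>+w. ennreal (norm (B g w)) \<partial>hyp \<partial>count_space ?G)"
   using hyp.nn_integral_fst[of "\<lambda>p. ennreal (norm (case_prod B p))" "count_space ?G"] mp[OF mB] by simp
  also have "\<dots> = (\<integral>\<^sup>+g. \<integral>\<^sup>+w. ennreal (norm (A g w)) \<partial>hyp \<partial>count_space ?G)"
   by (rule nn_integral_cong) (simp add: nnAB)
  finally show "(\<integral>\<^sup>+p. ennreal (norm (case_prod B p)) \<partial>(count_space ?G \<Otimes>\<^sub>M hyp)) < \<infinity>" using nnA nnF by simp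
 qed (rule mp[OF mB])
 have sumB: "(\<integral>g. B g w \<partial>count_space ?G) = of_real (fphi N w) * f w * of_real (Im w ^ (2 * n)) * hK n N \<sigma> z w"
  if w: "Im w > 0" for w
 proof -
  let ?k = "\<lambda>g. of_int (chi \<sigma> g) * kap n g z w"
  have "(\<lambda>g. norm (?k g)) summable_on ?G" using kernel_sum(1)[OF N s n z w, of "(1, 0, 0, 1)"] by simp
  then have abs: "Infinite_Set_Sum.abs_summable_on ?k ?G" using abs_summable_equivalent[of ?k ?G] by simp
  have "(\<integral>g. B g w \<partial>count_space ?G) = (\<integral>g. of_real (fphi N w) * f w * of_real (Im w ^ (2 * n)) * ?k g \<partial>count_space ?G)"
   by (rule Bochner_Integration.integral_cong) (simp_all add: B_def mult_ac)
  also have "\<dots> = of_real (fphi N w) * f w * of_real (Im w ^ (2 * n)) * (\<integral>g. ?k g \<partial>count_space ?G)"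
   by (rule integral_mult_right_zero)
  also have "(\<integral>g. ?k g \<partial>count_space ?G) = infsum ?k ?G"
   using infsetsum_infsum[OF abs] by (simp add: infsetsum_def)
  finally show ?thesis using z by (simp add: hK_def)
 qed
 have intBw: "integrable hyp (\<lambda>w. \<integral>g. B g w \<partial>count_space ?G)" using P.integrable_snd[OF intB] .
 define E where "E w = of_real (fphi N w) * f w * of_real (Im w ^ (2 * n)) * hK n N \<sigma> z w" for w
 have E0: "E w = 0" if "\<not> Im w > 0" for w using VspD(1)[OF f, of w] that by (simp add: E_def)
 define B' where "B' w = (\<integral>g. B g w \<partial>count_space ?G)" for w
 \<comment> \<open>Measurability of the integrand, which contains \<open>hK\<close> as a function of
   its second variable, comes from Fubini for \<open>B'\<close>: the two agree on the half-plane,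
   and \<open>E\<close> vanishes elsewhere because f does.\<close>
 have "E = (\<lambda>w. indicator {w. Im w > 0} w *\<^sub>R B' w)"
  using sumB E0 by (auto simp: E_def B'_def fun_eq_iff split: split_indicator)
 moreover have "B' \<in> borel_measurable hyp" using intBw unfolding B'_def by (rule borel_measurable_integrable)
 moreover have "{w. Im w > 0} \<in> sets hyp" by simp
 ultimately have mE: "E \<in> borel_measurable hyp" by simp
 have AE_E: "AE w in hyp. B' w = E w"
  using AE_hyp_pos by eventually_elim (simp add: B'_def E_def sumB)
 show "integrable hyp (\<lambda>w. of_real (fphi N w) * f w * of_real (Im w ^ (2 * n)) * hK n N \<sigma> z w)"
  unfolding E_def[symmetric] using intBw mE AE_E unfolding B'_def[symmetric]
  by (subst integrable_cong_AE[symmetric]) (auto intro: borel_measurable_integrable)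
 have "integral\<^sup>L hyp F = (\<integral>w. (\<integral>g. A g w \<partial>count_space ?G) \<partial>hyp)"
 proof (rule integral_cong_AE)
  show "(\<lambda>w. \<integral>g. A g w \<partial>count_space ?G) \<in> borel_measurable hyp"
   using P.integrable_snd[OF intA] by (rule borel_measurable_integrable)
  show "AE w in hyp. F w = (\<integral>g. A g w \<partial>count_space ?G)"
   using AE_hyp_pos
  proof eventually_elim
   case (elim w)
   have int1: "integrable (count_space ?G) (\<lambda>g. fphi N (imob g w))"
    by (rule integrableI_nonneg) (use fphi_sum[OF N elim] fphi_nonneg in auto)
   have "ennreal (\<integral>g. fphi N (imob g w) \<partial>count_space ?G) = 1"
    using nn_integral_eq_integral[OF int1] fphi_sum[OF N elim] fphi_nonneg by simp
   then have "(\<integral>g. fphi N (imob g w) \<partial>count_space ?G) = 1" by (simp add: ennreal_eq_1)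
   then have "(\<integral>g. complex_of_real (fphi N (imob g w)) \<partial>count_space ?G) = 1" by simp
   then show ?case unfolding A_def by simp
  qed
 qed simp
 also have "\<dots> = (\<integral>g. (\<integral>w. A g w \<partial>hyp) \<partial>count_space ?G)"
  using P.Fubini_integral[OF intA] .
 also have "\<dots> = (\<integral>g. (\<integral>w. B g w \<partial>hyp) \<partial>count_space ?G)"
 proof (rule Bochner_Integration.integral_cong[OF refl])
  fix g assume "g \<in> space (count_space ?G)"
  then have g: "g \<in> ?G" by simp
  have "(\<integral>w. A g w \<partial>hyp) = (\<integral>w. A g (imob (iadj g) w) \<partial>hyp)"
   by (rule integral_hyp_imob(1)[OF mA dadj[OF g], symmetric])
  also have "\<dots> = (\<integral>w. B g w \<partial>hyp)"
  proof (rule integral_cong_AE)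
   show "AE w in hyp. A g (imob (iadj g) w) = B g w" using AE_hyp_pos by eventually_elim (rule AB[OF g])
  qed measurable
  finally show "(\<integral>w. A g w \<partial>hyp) = (\<integral>w. B g w \<partial>hyp)" .
 qed
 also have "\<dots> = (\<integral>w. B' w \<partial>hyp)" unfolding B'_def using P.Fubini_integral[OF intB, symmetric] .
 also have "\<dots> = (\<integral>w. E w \<partial>hyp)"
  by (rule integral_cong_AE) (use mE AE_E intBw in \<open>auto simp: B'_def[symmetric] intro: borel_measurable_integrable\<close>)
 finally have "of_real ((-1) ^ n / 4 ^ n * hypJ (2 * n)) * f z = (\<integral>w. E w \<partial>hyp)" unfolding valF .
 then have "hc n * (of_real ((-1) ^ n / 4 ^ n * hypJ (2 * n)) * f z) = hc n * (\<integral>w. E w \<partial>hyp)" by simp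
 moreover have "hc n * of_real ((-1) ^ n / 4 ^ n * hypJ (2 * n)) = 1"
 proof -
  have "(-1) ^ n * 4 ^ n / hypJ (2 * n) * ((-1) ^ n / 4 ^ n * hypJ (2 * n)) = ((-1) ^ n * (-1) ^ n :: real)"
   using hypJ_pos[of "2 * n"] n by (simp add: field_simps)
  also have "\<dots> = 1" by (simp flip: power_mult_distrib)
  finally show ?thesis unfolding hc_def of_real_mult[symmetric] by simp
 qed
 ultimately show "f z = hc n * (\<integral>w. of_real (fphi N w) * f w * of_real (Im w ^ (2 * n)) * hK n N \<sigma> z w \<partial>hyp)"
  unfolding E_def by (simp add: mult.assoc[symmetric])
qed

text \<open>A common shape for the identity, the Hecke operator and its square, so that one trace
  formula serves all three. Indexing by I keeps repetitions among the products of Hecke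
  matrices.\<close>

definition opU :: "nat => 'i set => ('i => imat) => (complex => complex) => complex => complex" where
 "opU n I b f = (\<lambda>z. \<Sum>i\<in>I. sl n (b i) f z)"

definition trker :: "nat => nat => (nat => int) => 'i set => ('i => imat) => complex => complex" where
 "trker n N \<sigma> I b w = (\<Sum>i\<in>I. \<Sum>\<^sub>\<infinity>g\<in>ALG N. of_int (chi \<sigma> g) * kap n (imul g (b i)) w w)"

lemma opU_sum: "opU n I b (\<Sum>j\<in>J. cscale (c j) (g j)) = (\<Sum>j\<in>J. cscale (c j) (opU n I b (g j)))"
proof -
 have e: "(\<Sum>j\<in>J. cscale (c j) (h j)) z = (\<Sum>j\<in>J. c j * h j z)" for h :: "_ => complex => complex" and z
  by (induction J rule: infinite_finite_induct) (auto simp: cscale_def)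
 show ?thesis
 proof
  fix z
  have "opU n I b (\<Sum>j\<in>J. cscale (c j) (g j)) z = (\<Sum>i\<in>I. \<Sum>j\<in>J. c j * sl n (b i) (g j) z)"
   unfolding opU_def by (simp add: sl_def e sum_distrib_left sum_divide_distrib mult_ac)
  also have "\<dots> = (\<Sum>j\<in>J. \<Sum>i\<in>I. c j * sl n (b i) (g j) z)" by (rule sum.swap)
  finally show "opU n I b (\<Sum>j\<in>J. cscale (c j) (g j)) z = (\<Sum>j\<in>J. cscale (c j) (opU n I b (g j))) z"
   by (simp add: e opU_def sum_distrib_left)
 qed
qed

lemma opU_hK:
 assumes "finite I" "!!i. i \<in> I ==> idet (b i) > 0" "Im z > 0"
 shows "opU n I b (\<lambda>z. hK n N \<sigma> z w) z = (\<Sum>i\<in>I. \<Sum>\<^sub>\<infinity>g\<in>ALG N. of_int (chi \<sigma> g) * kap n (imul g (b i)) z w)"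
 unfolding opU_def using assms by (intro sum.cong refl sl_hK) auto

text \<open>Expand the kernel in its first variable in the interpolation basis, apply the operator
  and set both variables equal to w: this gives the sum of
  \<open>hK n N \<sigma> (z j) w * opU n I b (g j) w\<close>. Integrated against the weight, the
  j-th term reproduces the value of the transformed \<open>g j\<close> at \<open>z j\<close>. The
  sum is the trace because evaluation at \<open>z j\<close> is the coordinate dual to
  \<open>g j\<close>.\<close>

lemma trace_formula:
 assumes N: "N > 0" and s: "sign_pattern N \<sigma>" and n: "n \<ge> 4"
  and I: "finite I" "!!i. i \<in> I ==> idet (b i) > 0"
  and U: "!!f. f \<in> Vsp n N \<sigma> ==> opU n I b f \<in> Vsp n N \<sigma>"
  and g: "!!j. j < d ==> g j \<in> Vsp n N \<sigma>" and z: "!!j. j < d ==> Im (z j) > 0"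
  and ex: "!!f. f \<in> Vsp n N \<sigma> ==> f = (\<Sum>j<(d::nat). cscale (f (z j)) (g j))"
 shows "integrable hyp (\<lambda>w. of_real (fphi N w) * (of_real (Im w ^ (2 * n)) * trker n N \<sigma> I b w))"
  "(\<Sum>j<d. opU n I b (g j) (z j)) = hc n * (\<integral>w. of_real (fphi N w) * (of_real (Im w ^ (2 * n)) * trker n N \<sigma> I b w) \<partial>hyp)"
proof -
 have e: "(\<Sum>j<d. cscale (c j) (h j)) w = (\<Sum>j<d. c j * h j w)" for c h and w :: complex
  by (induction d) (auto simp: cscale_def)
 have pt: "(\<Sum>j<d. of_real (fphi N w) * opU n I b (g j) w * of_real (Im w ^ (2 * n)) * hK n N \<sigma> (z j) w)
  = of_real (fphi N w) * (of_real (Im w ^ (2 * n)) * trker n N \<sigma> I b w)" for w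
 proof (cases "Im w > 0")
  case True
  define k where "k = (\<lambda>z. hK n N \<sigma> z w)"
  have "k \<in> Vsp n N \<sigma>" unfolding k_def by (rule hK_Vsp[OF N s n True])
  from arg_cong[OF ex[OF this], of "opU n I b"]
  have "opU n I b k = (\<Sum>j<d. cscale (k (z j)) (opU n I b (g j)))" unfolding opU_sum .
  then have "opU n I b k w = (\<Sum>j<d. k (z j) * opU n I b (g j) w)" by (simp only: e)
  moreover have "opU n I b k w = trker n N \<sigma> I b w"
   unfolding k_def trker_def by (rule opU_hK[OF I True])
  ultimately have "trker n N \<sigma> I b w = (\<Sum>j<d. hK n N \<sigma> (z j) w * opU n I b (g j) w)" by (simp add: k_def)
  then show ?thesis by (simp add: sum_distrib_left mult_ac)
 next
  case False
  then have "w \<notin> fdom N" by (auto simp: fdom_def)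
  then show ?thesis by (simp add: fphi_def)
 qed
 note rep = kernel_reproducing[OF N s n U[OF g] z]
 have "integrable hyp (\<lambda>w. \<Sum>j<d. of_real (fphi N w) * opU n I b (g j) w * of_real (Im w ^ (2 * n)) * hK n N \<sigma> (z j) w)"
  by (intro Bochner_Integration.integrable_sum rep(1)) auto
 then show "integrable hyp (\<lambda>w. of_real (fphi N w) * (of_real (Im w ^ (2 * n)) * trker n N \<sigma> I b w))"
  by (simp only: pt)
 have "(\<Sum>j<d. opU n I b (g j) (z j)) = (\<Sum>j<d. hc n * (\<integral>w. of_real (fphi N w) * opU n I b (g j) w * of_real (Im w ^ (2 * n)) * hK n N \<sigma> (z j) w \<partial>hyp))"
  by (intro sum.cong refl rep(2)) auto
 also have "\<dots> = hc n * (\<integral>w. (\<Sum>j<d. of_real (fphi N w) * opU n I b (g j) w * of_real (Im w ^ (2 * n)) * hK n N \<sigma> (z j) w) \<partial>hyp)"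
  by (subst Bochner_Integration.integral_sum, rule rep(1)) (simp_all add: sum_distrib_left)
 finally show "(\<Sum>j<d. opU n I b (g j) (z j)) = hc n * (\<integral>w. of_real (fphi N w) * (of_real (Im w ^ (2 * n)) * trker n N \<sigma> I b w) \<partial>hyp)"
  by (simp only: pt)
qed

section \<open>The diagonal of the kernel below and above a cutoff height\<close>

lemma iX_conj:
 assumes r: "idet r = 1" and z: "Im z > 0" "Im w > 0" 
 shows "iX g (imob r z) (imob r w) = iX (imul (imul (iadj r) g) r) z w"
proof -
 define j where "j = iden r z"
 define k where "k = iden r w"
 have j: "cmod j > 0" and k: "cmod k > 0" using iden_nonzero[of _ r] z r by (simp_all add: j_def k_def)
 have j0: "iden r z \<noteq> 0" "iden r w \<noteq> 0" using j k by (auto simp: j_def k_def)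
 have p: "Im (imob r z) > 0" "Im (imob r w) > 0" using Im_imob_pos z r by simp_all
 have I: "Im (imob r z) = Im z / (cmod j)\<^sup>2" "Im (imob r w) = Im w / (cmod k)\<^sup>2"
  by (simp_all add: Im_imob r j_def k_def)
 have "iL (imul (imul (iadj r) g) r) z w = iL (imul (iadj r) g) (imob r z) w * j"
  unfolding j_def by (rule iL_imul[OF j0(1)])
 also have "iL (imul (iadj r) g) (imob r z) w = iL g (imob r z) (imob r w) * cnj k"
  unfolding k_def by (rule iL_imob_right[OF j0(2), symmetric])
 finally have L: "iL (imul (imul (iadj r) g) r) z w = iL g (imob r z) (imob r w) * cnj k * j" .
 have "Im z * Im w * (iX (imul (imul (iadj r) g) r) z w + 2 * of_int (idet g)) = (cmod (iL (imul (imul (iadj r) g) r) z w))\<^sup>2"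
  using norm_iL[OF z] r by simp
 also have "\<dots> = (cmod (iL g (imob r z) (imob r w)))\<^sup>2 * ((cmod j)\<^sup>2 * (cmod k)\<^sup>2)"
  unfolding L by (simp add: norm_mult power_mult_distrib)
 also have "\<dots> = Im z * Im w * (iX g (imob r z) (imob r w) + 2 * of_int (idet g))"
  unfolding norm_iL[OF p] unfolding I using j k by simp
 finally show ?thesis using z by simp
qed

lemma nt_conj:
 assumes "idet r = 1" "Im z > 0"
 shows "nt n g (imob r z) = nt n (imul (imul (iadj r) g) r) z"
 using iX_conj[OF assms(1) assms(2) assms(2), of g] assms(1) by (simp add: nt_def)

text \<open>Normalised so that nonzero scalar matrices give exactly 1 (\<open>tau_scalar\<close>),
  with modulus \<open>nt\<close> in general (\<open>norm_tau\<close>).\<close>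

definition tau :: "nat => imat => complex => complex" where
 "tau n g w = of_real ((-1) ^ n * 4 ^ n * Im w ^ (2 * n)) * kap n g w w"

lemma norm_tau:
 assumes "Im w > 0" "idet g > 0"
 shows "cmod (tau n g w) = nt n g w"
proof -
 have "cmod (tau n g w) = 4 ^ n * (cmod (kap n g w w) * (Im w * Im w) ^ n)"
  using assms by (simp add: tau_def norm_mult norm_power power_mult power2_eq_square power_mult_distrib abs_mult power_abs)
 also have "\<dots> = nt n g w"
  unfolding norm_kap[OF assms(1) assms(1) assms(2)] nt_def by (simp flip: power_mult_distrib)
 finally show ?thesis .
qed

lemma tau_scalar:
 assumes "Im w > 0" "a \<noteq> 0"
 shows "tau n (a, 0, 0, a) w = 1"
proof -
 have "w - cnj w = 2 * \<i> * of_real (Im w)" by (simp add: complex_eq_iff)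
 moreover have "iL (a, 0, 0, a) w w = of_int a * (w - cnj w)" by (simp add: algebra_simps)
 ultimately have L: "iL (a, 0, 0, a) w w = of_int a * (2 * \<i> * of_real (Im w))" by metis
 have "iL (a, 0, 0, a) w w ^ (2 * n) = of_int a ^ (2 * n) * (- 4) ^ n * of_real (Im w) ^ (2 * n)"
 proof -
  have "(of_int a * (2 * \<i> * of_real (Im w)))\<^sup>2 = (of_int a)\<^sup>2 * (- 4) * (of_real (Im w))\<^sup>2"
   by (simp add: power_mult_distrib)
  then show ?thesis unfolding L by (simp only: power_mult power_mult_distrib)
 qed
 moreover have "of_int (idet (a, 0, 0, a)) ^ n = (of_int a ^ (2 * n) :: complex)" by (simp add: power_mult power2_eq_square)
 moreover have "(- 4) ^ n = ((-1) ^ n * 4 ^ n :: complex)" by (simp flip: power_mult_distrib)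
 ultimately show ?thesis using assms by (simp add: tau_def kap_def)
qed

definition isc :: "imat => bool" where "isc g \<longleftrightarrow> (\<exists>a. g = (a, 0, 0, a))"

definition scs :: "nat => imat => imat set" where "scs N b = {g\<in>ALG N. isc (imul g b)}"

lemma finite_scs:
 assumes N: "N > 0" and b: "idet b > 0"
 shows "finite (scs N b)"
proof -
 let ?K = "int N * idet b"
 have "(\<lambda>g. imul g b) ` scs N b \<subseteq> (\<lambda>a. (a, 0, 0, a)) ` {- ?K..?K}"
 proof
  fix h assume "h \<in> (\<lambda>g. imul g b) ` scs N b"
  then obtain g a where g: "g \<in> ALG N" "h = imul g b" "imul g b = (a, 0, 0, a)" by (auto simp: scs_def isc_def)
  have "a * a = idet g * idet b" using arg_cong[OF g(3), of idet] by simp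
  also have "\<dots> \<le> ?K" using ALG_idet_le[OF N g(1)] b by (intro mult_right_mono) auto
  finally have aK: "a * a \<le> ?K" .
  have "\<bar>a\<bar> \<le> a * a"
  proof (cases "a = 0")
   case False
   then have "\<bar>a\<bar> * 1 \<le> \<bar>a\<bar> * \<bar>a\<bar>" by (intro mult_left_mono) auto
   then show ?thesis by (simp add: abs_mult_self_eq)
  qed simp
  then have "a \<in> {- ?K..?K}" using aK by auto
  then show "h \<in> (\<lambda>a. (a, 0, 0, a)) ` {- ?K..?K}" using g by auto
 qed
 then have "finite ((\<lambda>g. imul g b) ` scs N b)" by (rule finite_subset) simp
 moreover have "inj_on (\<lambda>g. imul g b) (scs N b)" using imul_inj_right[of b] b by (intro inj_onI) auto
 ultimately show ?thesis by (rule finite_imageD)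
qed

lemma nn_integral_infsum:
 fixes f :: "'a => real"
 assumes f: "f summable_on A" and nn: "!!x. x \<in> A ==> f x \<ge> 0"
 shows "ennreal (infsum f A) = (\<integral>\<^sup>+x. ennreal (f x) \<partial>count_space A)"
proof -
 have "(\<lambda>x. norm (f x)) summable_on A" using f by (rule summable_on_cong[THEN iffD1, rotated]) (simp add: nn)
 then have abs: "Infinite_Set_Sum.abs_summable_on f A" using abs_summable_equivalent[of f A] by blast
 then have int: "integrable (count_space A) f" by (simp add: abs_summable_on_def)
 have "(\<integral>\<^sup>+x. ennreal (f x) \<partial>count_space A) = ennreal (\<integral>x. f x \<partial>count_space A)"
  by (rule nn_integral_eq_integral[OF int]) (simp add: AE_count_space nn)
 also have "(\<integral>x. f x \<partial>count_space A) = infsum f A" using infsetsum_infsum[OF abs] by (simp add: infsetsum_def)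
 finally show ?thesis ..
qed

definition ks :: "nat => nat => (nat => int) => 'i set => ('i => imat) => complex => complex" where
 "ks n N \<sigma> I b w = of_real ((-1) ^ n * 4 ^ n * Im w ^ (2 * n)) * trker n N \<sigma> I b w"

text \<open>The main term of the trace before multiplication by the volume: the signed number of
  group elements g for which g b is scalar.\<close>

definition s0 :: "nat => (nat => int) => 'i set => ('i => imat) => complex" where
 "s0 N \<sigma> I b = (\<Sum>i\<in>I. \<Sum>g\<in>scs N (b i). of_int (chi \<sigma> g))"

lemma finite_exact_divisors: "N > 0 ==> finite {Q. exact_divisor Q N}"
 by (rule finite_subset[of _ "{Q. Q dvd N}"]) (auto simp: exact_divisor_def)

text \<open>Conjugation by r sends g b, injectively in g, to a nonscalar integer matrix of
  determinant Q det b. The group is then forgotten and all integer matrices of these determinants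
  are summed.\<close>

lemma nonscalar_sum_le:
 assumes N: "N > 0" and b: "idet b > 0" and r: "idet r = 1" and z: "Im z > 0"
 shows "(\<integral>\<^sup>+g. ennreal (nt n (imul g b) (imob r z)) \<partial>count_space (ALG N - scs N b))
  \<le> (\<Sum>Q\<in>{Q. exact_divisor Q N}. Sn n (int Q * idet b) z)"
proof -
 let ?A = "ALG N - scs N b"
 let ?E = "{Q. exact_divisor Q N}"
 define c where "c g = imul (imul (iadj r) (imul g b)) r" for g
 have cback: "imul (imul r (c g)) (iadj r) = imul g b" for g
  by (simp add: c_def imul_assoc imul_iadj(1) imul_iscale r del: iscale.simps)
   (simp add: imul_assoc[symmetric] imul_iadj(1) imul_iscale r del: iscale.simps)
 have inj: "inj_on c ?A"
 proof (rule inj_onI)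
  fix g g' assume "c g = c g'"
  then have "imul g b = imul g' b" using cback[of g] cback[of g'] by simp
  then show "g = g'" using imul_inj_right[of b g g'] b by simp
 qed
 have mem: "\<exists>Q\<in>?E. c g \<in> NS (int Q * idet b)" if g: "g \<in> ?A" for g
 proof -
  obtain Q where Q: "exact_divisor Q N" "g \<in> AL N Q" using g by (auto simp: ALG_def)
  have d: "idet (c g) = int Q * idet b" using AL_idet[OF Q(2)] r by (simp add: c_def)
  have "\<not> isc (c g)"
  proof
   assume "isc (c g)"
   then obtain a where a: "c g = iscale a (1, 0, 0, 1)" by (auto simp: isc_def)
   have "imul g b = iscale a (1, 0, 0, 1)"
    unfolding cback[of g, symmetric] a by (simp add: imul_iscale imul_iadj(1) iscale_iscale r del: iscale.simps)
   then have "isc (imul g b)" by (auto simp: isc_def)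
   then show False using g by (auto simp: scs_def)
  qed
  then have "c g \<in> NS (int Q * idet b)" using d unfolding NS_def isc_def by (cases "c g") auto
  then show ?thesis using Q by blast
 qed
 have "(\<integral>\<^sup>+g. ennreal (nt n (imul g b) (imob r z)) \<partial>count_space ?A) = (\<integral>\<^sup>+g. ennreal (nt n (c g) z) \<partial>count_space ?A)"
  by (simp add: nt_conj[OF r z] c_def)
 also have "\<dots> = (\<integral>\<^sup>+g. ennreal (nt n g z) \<partial>count_space (c ` ?A))"
  by (rule nn_integral_bij_count_space) (simp add: bij_betw_def inj)
 also have "\<dots> = (\<integral>\<^sup>+g. ennreal (nt n g z) * indicator (c ` ?A) g \<partial>count_space UNIV)"
  by (rule nn_integral_count_space_indicator) simp
 also have "\<dots> \<le> (\<integral>\<^sup>+g. (\<Sum>Q\<in>?E. ennreal (nt n g z) * indicator (NS (int Q * idet b)) g) \<partial>count_space UNIV)"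
 proof (rule nn_integral_mono)
  fix g
  show "ennreal (nt n g z) * indicator (c ` ?A) g \<le> (\<Sum>Q\<in>?E. ennreal (nt n g z) * indicator (NS (int Q * idet b)) g)"
  proof (cases "g \<in> c ` ?A")
   case True
   then obtain g' where g': "g = c g'" "g' \<in> ?A" by (rule imageE)
   obtain Q where Q: "Q \<in> ?E" "g \<in> NS (int Q * idet b)" using mem[OF g'(2)] unfolding g'(1) by (rule bexE)
   have "ennreal (nt n g z) * indicator (c ` ?A) g = ennreal (nt n g z) * indicator (NS (int Q * idet b)) g"
    using True Q by simp
   also have "\<dots> \<le> (\<Sum>Q\<in>?E. ennreal (nt n g z) * indicator (NS (int Q * idet b)) g)"
    by (rule member_le_sum[OF Q(1)]) (use finite_exact_divisors[OF N] in auto)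
   finally show ?thesis .
  qed simp
 qed
 also have "\<dots> = (\<Sum>Q\<in>?E. \<integral>\<^sup>+g. ennreal (nt n g z) * indicator (NS (int Q * idet b)) g \<partial>count_space UNIV)"
  by (rule nn_integral_sum) simp
 also have "\<dots> = (\<Sum>Q\<in>?E. Sn n (int Q * idet b) z)"
  unfolding Sn_def by (intro sum.cong refl nn_integral_count_space_indicator[symmetric]) simp
 finally show ?thesis .
qed

lemma ks_low:
 assumes N: "N > 0" and s: "sign_pattern N \<sigma>" and n: "n \<ge> 4"
  and I: "finite I" "!!i. i \<in> I ==> idet (b i) > 0" and r: "idet r = 1" and z: "Im z > 0"
 shows "ennreal (cmod (ks n N \<sigma> I b (imob r z) - s0 N \<sigma> I b)) \<le> (\<Sum>i\<in>I. \<Sum>Q\<in>{Q. exact_divisor Q N}. Sn n (int Q * idet (b i)) z)"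
proof -
 define w where "w = imob r z"
 have w: "Im w > 0" unfolding w_def by (rule Im_imob_pos) (use r z in auto)
 define p where "p = complex_of_real ((-1) ^ n * 4 ^ n * Im w ^ (2 * n))"
 define D where "D i = (\<Sum>\<^sub>\<infinity>g\<in>ALG N - scs N (b i). of_int (chi \<sigma> g) * tau n (imul g (b i)) w)" for i
 have each: "p * (\<Sum>\<^sub>\<infinity>g\<in>ALG N. of_int (chi \<sigma> g) * kap n (imul g (b i)) w w) = (\<Sum>g\<in>scs N (b i). of_int (chi \<sigma> g)) + D i"
  and each': "ennreal (cmod (D i)) \<le> (\<Sum>Q\<in>{Q. exact_divisor Q N}. Sn n (int Q * idet (b i)) z)" if i: "i \<in> I" for i
 proof -
  have bi: "idet (b i) > 0" using I i by blast
  let ?k = "\<lambda>g. of_int (chi \<sigma> g) * kap n (imul g (b i)) w w"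
  let ?t = "\<lambda>g. of_int (chi \<sigma> g) * tau n (imul g (b i)) w"
  have tk: "?t = (\<lambda>g. p * ?k g)" by (simp add: tau_def p_def fun_eq_iff)
  have S: "?t summable_on ALG N" unfolding tk by (intro summable_on_cmult_right kernel_sum(2)[OF N s n w w bi])
  have sub: "scs N (b i) \<subseteq> ALG N" by (auto simp: scs_def)
  have fin: "finite (scs N (b i))" by (rule finite_scs[OF N bi])
  have "p * (\<Sum>\<^sub>\<infinity>g\<in>ALG N. ?k g) = (\<Sum>\<^sub>\<infinity>g\<in>ALG N. ?t g)" unfolding tk by (rule infsum_cmult_right'[symmetric])
  also have "\<dots> = infsum ?t (scs N (b i)) + infsum ?t (ALG N - scs N (b i))"
  proof -
   have "infsum ?t (scs N (b i) \<union> (ALG N - scs N (b i))) = infsum ?t (scs N (b i)) + infsum ?t (ALG N - scs N (b i))"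
    by (rule infsum_Un_disjoint[OF summable_on_subset_banach[OF S sub] summable_on_subset_banach[OF S]]) blast+
   moreover have "scs N (b i) \<union> (ALG N - scs N (b i)) = ALG N" using sub by blast
   ultimately show ?thesis by metis
  qed
  also have "infsum ?t (scs N (b i)) = (\<Sum>g\<in>scs N (b i). ?t g)" using fin by simp
  also have "\<dots> = (\<Sum>g\<in>scs N (b i). of_int (chi \<sigma> g))"
  proof (rule sum.cong[OF refl])
   fix g assume g: "g \<in> scs N (b i)"
   then obtain a where a: "imul g (b i) = (a, 0, 0, a)" by (auto simp: scs_def isc_def)
   have "idet (imul g (b i)) > 0" using ALG_idet_pos[OF N, of g] g sub bi by auto
   then have "a \<noteq> 0" by (auto simp: a)
   then show "?t g = of_int (chi \<sigma> g)" using tau_scalar[OF w, of a n] by (simp add: a)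
  qed
  finally show "p * (\<Sum>\<^sub>\<infinity>g\<in>ALG N. ?k g) = (\<Sum>g\<in>scs N (b i). of_int (chi \<sigma> g)) + D i" by (simp add: D_def)
  have nt: "norm (?t g) = nt n (imul g (b i)) w" if "g \<in> ALG N" for g
   unfolding norm_chi[OF s that] by (rule norm_tau[OF w]) (use ALG_idet_pos[OF N that] bi in simp)
  have abs: "(\<lambda>g. norm (?t g)) summable_on ALG N"
  proof -
   have "(\<lambda>g. cmod p * norm (?k g)) summable_on ALG N"
    by (intro summable_on_cmult_right kernel_sum(1)[OF N s n w w bi])
   moreover have "norm (?t g) = cmod p * norm (?k g)" for g by (simp add: tau_def p_def norm_mult)
   ultimately show ?thesis by (simp only:)
  qed
  then have abs': "(\<lambda>g. norm (?t g)) summable_on (ALG N - scs N (b i))" by (rule summable_on_subset_banach) auto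
  have "cmod (D i) \<le> (\<Sum>\<^sub>\<infinity>g\<in>ALG N - scs N (b i). norm (?t g))" unfolding D_def by (rule norm_infsum_bound[OF abs'])
  then have "ennreal (cmod (D i)) \<le> ennreal (\<Sum>\<^sub>\<infinity>g\<in>ALG N - scs N (b i). norm (?t g))" by (rule ennreal_leI)
  also have "\<dots> = (\<integral>\<^sup>+g. ennreal (norm (?t g)) \<partial>count_space (ALG N - scs N (b i)))" by (rule nn_integral_infsum[OF abs']) simp
  also have "\<dots> = (\<integral>\<^sup>+g. ennreal (nt n (imul g (b i)) (imob r z)) \<partial>count_space (ALG N - scs N (b i)))"
   by (rule nn_integral_cong) (use nt in \<open>simp add: w_def\<close>)
  also have "\<dots> \<le> (\<Sum>Q\<in>{Q. exact_divisor Q N}. Sn n (int Q * idet (b i)) z)" by (rule nonscalar_sum_le[OF N bi r z])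
  finally show "ennreal (cmod (D i)) \<le> (\<Sum>Q\<in>{Q. exact_divisor Q N}. Sn n (int Q * idet (b i)) z)" .
 qed
 have "ks n N \<sigma> I b w = (\<Sum>i\<in>I. p * (\<Sum>\<^sub>\<infinity>g\<in>ALG N. of_int (chi \<sigma> g) * kap n (imul g (b i)) w w))"
  unfolding ks_def trker_def p_def by (rule sum_distrib_left)
 also have "\<dots> = s0 N \<sigma> I b + (\<Sum>i\<in>I. D i)"
  unfolding s0_def sum.distrib[symmetric] by (rule sum.cong[OF refl each])
 finally have "cmod (ks n N \<sigma> I b w - s0 N \<sigma> I b) \<le> (\<Sum>i\<in>I. cmod (D i))" by (simp add: norm_sum)
 then have "ennreal (cmod (ks n N \<sigma> I b w - s0 N \<sigma> I b)) \<le> ennreal (\<Sum>i\<in>I. cmod (D i))" by (rule ennreal_leI)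
 also have "\<dots> = (\<Sum>i\<in>I. ennreal (cmod (D i)))" by (simp add: sum_ennreal)
 also have "\<dots> \<le> (\<Sum>i\<in>I. \<Sum>Q\<in>{Q. exact_divisor Q N}. Sn n (int Q * idet (b i)) z)" by (intro sum_mono each')
 finally show ?thesis by (simp add: w_def)
qed

text \<open>Schwarz's lemma of order 1 in q, on the disc that corresponds to heights of at least
  Y.\<close>

lemma cusp_decay:
 assumes N: "N > 0" and n: "n > 0" and s: "sign_pattern N \<sigma>" and f: "f \<in> Vsp n N \<sigma>" and r: "idet r = 1"
  and Y: "Y > 0" and B: "!!z. Im z \<ge> Y ==> cmod (sl n r f z) \<le> B" and z: "Im z \<ge> Y"
 shows "cmod (sl n r f z) \<le> B * exp (- (2 * pi / real N) * (Im z - Y))"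
proof -
 define c where "c = 2 * pi / real N"
 have c: "c > 0" using N by (simp add: c_def)
 note H = qH[OF N n s f r]
 define R where "R = exp (- c * Y)"
 have R: "0 < R" "R < 1" using c Y by (simp_all add: R_def)
 define q where "q = exp (2 * of_real pi * \<i> * z / of_nat N)"
 have nq: "cmod q = exp (- c * Im z)" unfolding q_def norm_qexp c_def ..
 have "B \<ge> 0" using B[OF z] by (rule order_trans[rotated]) simp
 have "cmod (qH n N r f q) \<le> B * (cmod q / R) ^ 1"
 proof (rule zero_order_bound[OF H(1) _ R])
  fix p assume p: "cmod p \<le> R"
  show "cmod (qH n N r f p) \<le> B"
  proof (cases "p = 0")
   case True then show ?thesis using \<open>B \<ge> 0\<close> by (simp add: qH_def)
  next
   case False
   define v where "v = of_nat N / (2 * of_real pi * \<i>) * Ln p"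
   have "v = of_real (real N / (2 * pi)) * (- \<i> * Ln p)" by (simp add: v_def field_simps)
   then have Iv: "Im v = real N / (2 * pi) * (- ln (cmod p))" using False by (simp del: of_real_divide of_real_mult)
   have "ln (cmod p) \<le> ln R" using p False R by simp
   then have "- ln (cmod p) \<ge> c * Y" by (simp add: R_def)
   then have "Im v \<ge> real N / (2 * pi) * (c * Y)" unfolding Iv by (intro mult_left_mono) auto
   then have v: "Im v \<ge> Y" using N by (simp add: c_def)
   have "qH n N r f p = sl n r f v" using False by (simp add: qH_def v_def)
   then show ?thesis using B[OF v] by simp
  qed
 qed (use nq R z c in \<open>auto simp: R_def qH_def\<close>)
 moreover have "sl n r f z = qH n N r f q" unfolding q_def by (rule H(2)) (use z Y in simp)
 moreover have "cmod q / R = exp (- c * (Im z - Y))" unfolding nq R_def by (simp add: exp_diff[symmetric] algebra_simps)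
 ultimately show ?thesis by (simp add: c_def)
qed

lemma latB_le_prod:
 assumes "y \<ge> 1" "v \<ge> 1"
 shows "latB y v \<le> 1296 * (y * v)"
proof -
 have yv: "y * v \<ge> 1" using mult_mono[of 1 y 1 v] assms by simp
 have s: "sqrt (y * v) \<ge> 1" using yv by simp
 have a: "sqrt (y / v) * sqrt (v / y) = 1" using assms by (simp flip: real_sqrt_mult)
 have b: "sqrt (y / v) \<le> sqrt (y * v)" "sqrt (v / y) \<le> sqrt (y * v)"
 proof -
  have "y / v \<le> y / 1" "y * 1 \<le> y * v" using assms by (intro divide_left_mono mult_left_mono; simp)+
  then show "sqrt (y / v) \<le> sqrt (y * v)" by simp
  have "v / y \<le> v / 1" "1 * v \<le> y * v" using assms by (intro divide_left_mono mult_right_mono; simp)+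
  then show "sqrt (v / y) \<le> sqrt (y * v)" by simp
 qed
 have "(2 + 4 * sqrt (y / v)) * (2 + 4 * sqrt (v / y)) = 20 + 8 * sqrt (y / v) + 8 * sqrt (v / y)"
  using a by (simp add: algebra_simps)
 also have "\<dots> \<le> 36 * sqrt (y * v)" using b s by linarith
 finally have 1: "(2 + 4 * sqrt (y / v)) * (2 + 4 * sqrt (v / y)) \<le> 36 * sqrt (y * v)" .
 have 2: "2 + 4 * sqrt (y * v) \<le> 6 * sqrt (y * v)" using s by simp
 have 3: "2 + 4 * sqrt (1 / (y * v)) \<le> 6" using yv by (simp add: real_sqrt_divide divide_le_eq)
 have "latB y v = (2 + 4 * sqrt (y * v)) * ((2 + 4 * sqrt (y / v)) * (2 + 4 * sqrt (v / y))) * (2 + 4 * sqrt (1 / (y * v)))"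
  by (simp add: latB_def mult_ac)
 also have "\<dots> \<le> (6 * sqrt (y * v)) * (36 * sqrt (y * v)) * 6"
  using assms s by (intro mult_mono 1 2 3) auto
 also have "\<dots> = 1296 * (sqrt (y * v) * sqrt (y * v))" by simp
 also have "sqrt (y * v) * sqrt (y * v) = y * v" using yv by simp
 finally show ?thesis .
qed

text \<open>The factor 4^n is absorbed by the kernel: X \<ge> 2 D gives 4 D / (X + 2 D) \<le> 1, so
  the power n can be lowered to 4 with constants independent of n. Conjugation by r brings the cusp
  to infinity, where \<open>latB\<close> bounds the sum.\<close>

lemma offdiag_bound:
 assumes N: "N > 0" and s: "sign_pattern N \<sigma>" and n: "n \<ge> 4" and b: "idet b > 0" and r: "idet r = 1"
  and z: "Im z > 0" "Im z' > 0"
 shows "4 ^ n * (cmod (\<Sum>\<^sub>\<infinity>g\<in>ALG N. of_int (chi \<sigma> g) * kap n (imul g b) (imob r z') (imob r z)) * (Im (imob r z') * Im (imob r z)) ^ n)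
  \<le> (4 * of_int (int N * idet b)) ^ 4 * latB (Im z') (Im z)"
proof -
 define w where "w = imob r z"
 define w' where "w' = imob r z'"
 have w: "Im w > 0" "Im w' > 0" unfolding w_def w'_def using Im_imob_pos r z by simp_all
 define K where "K = real_of_int (int N * idet b)"
 define P where "P = 4 ^ n * (Im w' * Im w) ^ n"
 have P: "P > 0" using w by (simp add: P_def)
 define c where "c g = imul (imul (iadj r) (imul g b)) r" for g
 let ?k = "\<lambda>g. of_int (chi \<sigma> g) * kap n (imul g b) w' w"
 have abs: "(\<lambda>g. norm (?k g)) summable_on ALG N" by (rule kernel_sum(1)[OF N s n w(2) w(1) b])
 have le: "norm (?k g) \<le> (4 * K) ^ 4 / P * (1 / (1 + iX (c g) z' z) ^ 4)" if g: "g \<in> ALG N" for g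
 proof -
  define D where "D = real_of_int (idet (imul g b))"
  have dpos: "idet (imul g b) > 0" using ALG_idet_pos[OF N g] b by simp
  then have "1 \<le> idet (imul g b)" by linarith
  then have "of_int 1 \<le> real_of_int (idet (imul g b))" by (simp only: of_int_le_iff)
  then have D: "D \<ge> 1" by (simp only: D_def of_int_1)
  have DK: "D \<le> K" using ALG_idet_le[OF N g] b unfolding D_def K_def by (simp add: mult_right_mono)
  define X where "X = iX (c g) z' z"
  have Xeq: "X = iX (imul g b) w' w" unfolding X_def c_def w'_def w_def by (rule iX_conj[OF r z(2) z(1), symmetric])
  have X: "X \<ge> 0" "X \<ge> 2 * D" unfolding Xeq D_def by (rule iX_nonneg[OF w(2) w(1)], rule iX_ge_2det[OF w(2) w(1)])
  have "P * norm (?k g) = 4 ^ n * (D / (X + 2 * D)) ^ n"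
   unfolding norm_chi[OF s g] P_def using norm_kap[OF w(2) w(1) dpos, of n] by (simp add: Xeq D_def mult_ac)
  also have "\<dots> = (4 * D / (X + 2 * D)) ^ n" by (simp add: power_divide power_mult_distrib)
  also have "\<dots> \<le> (4 * D / (X + 2 * D)) ^ 4" using D X n by (intro power_decreasing) (auto simp: divide_le_eq)
  also have "\<dots> \<le> (4 * K / (1 + X)) ^ 4" using D DK X by (intro power_mono frac_le) auto
  finally have "P * norm (?k g) \<le> (4 * K) ^ 4 * (1 / (1 + X) ^ 4)" by (simp add: power_divide)
  then have "norm (?k g) \<le> (4 * K) ^ 4 * (1 / (1 + X) ^ 4) / P" using P by (simp only: pos_le_divide_eq mult.commute)
  then show ?thesis by (simp add: X_def mult.commute)
 qed
 have inj: "inj_on c (ALG N)"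
 proof (rule inj_onI)
  fix g g' assume eq: "c g = c g'"
  have cback: "imul (imul r (c g)) (iadj r) = imul g b" for g
   by (simp add: c_def imul_assoc imul_iadj(1) imul_iscale r del: iscale.simps)
    (simp add: imul_assoc[symmetric] imul_iadj(1) imul_iscale r del: iscale.simps)
  then have "imul g b = imul g' b" using eq by metis
  then show "g = g'" using imul_inj_right[of b g g'] b by simp
 qed
 have sm: "(\<lambda>g. 1 / (1 + iX (c g) z' z) ^ 4) summable_on ALG N"
  using lattice_summable(1)[OF z(2) z(1), of "c ` ALG N"] summable_on_reindex[OF inj, of "\<lambda>g. 1 / (1 + iX g z' z) ^ 4"]
  by (simp add: o_def)
 have "cmod (infsum ?k (ALG N)) \<le> (\<Sum>\<^sub>\<infinity>g\<in>ALG N. norm (?k g))" by (rule norm_infsum_bound[OF abs])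
 also have "\<dots> \<le> (\<Sum>\<^sub>\<infinity>g\<in>ALG N. (4 * K) ^ 4 / P * (1 / (1 + iX (c g) z' z) ^ 4))"
  by (rule infsum_mono[OF abs summable_on_cmult_right[OF sm] le])
 also have "\<dots> = (4 * K) ^ 4 / P * (\<Sum>\<^sub>\<infinity>g\<in>ALG N. 1 / (1 + iX (c g) z' z) ^ 4)" by (rule infsum_cmult_right')
 also have "(\<Sum>\<^sub>\<infinity>g\<in>ALG N. 1 / (1 + iX (c g) z' z) ^ 4) = (\<Sum>\<^sub>\<infinity>g\<in>c ` ALG N. 1 / (1 + iX g z' z) ^ 4)"
  using infsum_reindex[OF inj, of "\<lambda>g. 1 / (1 + iX g z' z) ^ 4"] by (simp add: o_def)
 also have "(4 * K) ^ 4 / P * \<dots> \<le> (4 * K) ^ 4 / P * latB (Im z') (Im z)"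
  by (rule mult_left_mono[OF lattice_summable(2)[OF z(2) z(1)]]) (use P in simp)
 finally have "cmod (infsum ?k (ALG N)) * P \<le> (4 * K) ^ 4 * latB (Im z') (Im z)" using P by (simp add: field_simps)
 then show ?thesis by (simp add: P_def K_def w_def w'_def mult_ac)
qed

text \<open>High in a cusp the diagonal of the kernel is tiny: as a function of the first variable it is
 a cusp form, so it decays exponentially from height about \<open>n N\<close> on.\<close>

lemma ks_high:
 assumes N: "N > 0" and s: "sign_pattern N \<sigma>" and n: "n \<ge> 4"
  and I: "finite I" "!!i. i \<in> I ==> idet (b i) > 0"
  and U: "!!f. f \<in> Vsp n N \<sigma> ==> opU n I b f \<in> Vsp n N \<sigma>"
  and r: "idet r = 1" and z: "Im z \<ge> 2 * (real n * real N)"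
 shows "cmod (ks n N \<sigma> I b (imob r z)) \<le> (\<Sum>i\<in>I. (4 * of_int (int N * idet (b i))) ^ 4) * 1296 * (real n * real N)\<^sup>2 * exp (- 4 * real n)"
proof -
 define C where "C = (\<Sum>i\<in>I. (4 * real_of_int (int N * idet (b i))) ^ 4) * 1296"
 have C: "C \<ge> 0" unfolding C_def using I by (intro mult_nonneg_nonneg sum_nonneg) auto
 define Y where "Y = real n * real N"
 define y where "y = Im z"
 have Y: "Y \<ge> 1"
 proof -
  have "1 * 1 \<le> real n * real N" using n N by (intro mult_mono) auto
  then show ?thesis by (simp add: Y_def)
 qed
 have y: "y \<ge> 2 * Y" "y \<ge> 1" "y > 0" using z Y by (auto simp: y_def Y_def)
 define w where "w = imob r z"
 have w: "Im w > 0" unfolding w_def by (rule Im_imob_pos) (use r y in \<open>auto simp: y_def\<close>)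
 define v where "v = Im w"
 have v: "v > 0" using w by (simp add: v_def)
 define F where "F = opU n I b (\<lambda>z. hK n N \<sigma> z w)"
 have FV: "F \<in> Vsp n N \<sigma>" unfolding F_def by (rule U[OF hK_Vsp[OF N s n w]])
 have Fval: "F x = (\<Sum>i\<in>I. \<Sum>\<^sub>\<infinity>g\<in>ALG N. of_int (chi \<sigma> g) * kap n (imul g (b i)) x w)" if "Im x > 0" for x
  unfolding F_def by (rule opU_hK[OF I that])
 have Fb: "4 ^ n * v ^ n * (cmod (sl n r F x) * Im x ^ n) \<le> C * (Im x * y)" if x: "Im x \<ge> 1" for x
 proof -
  have x0: "Im x > 0" using x by simp
  define u where "u = imob r x"
  have u: "Im u > 0" unfolding u_def by (rule Im_imob_pos) (use r x0 in auto)
  have "cmod (sl n r F x) * Im x ^ n = cmod (F u) * Im u ^ n"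
   unfolding u_def by (rule norm_sl) (use x0 r in auto)
  then have "4 ^ n * v ^ n * (cmod (sl n r F x) * Im x ^ n) = 4 ^ n * (cmod (F u) * (Im u * v) ^ n)"
   by (simp add: power_mult_distrib)
  also have "\<dots> \<le> 4 ^ n * ((\<Sum>i\<in>I. cmod (\<Sum>\<^sub>\<infinity>g\<in>ALG N. of_int (chi \<sigma> g) * kap n (imul g (b i)) u w)) * (Im u * v) ^ n)"
   unfolding Fval[OF u] using u v by (intro mult_left_mono mult_right_mono norm_sum) auto
  also have "\<dots> = (\<Sum>i\<in>I. 4 ^ n * (cmod (\<Sum>\<^sub>\<infinity>g\<in>ALG N. of_int (chi \<sigma> g) * kap n (imul g (b i)) u w) * (Im u * v) ^ n))"
   by (simp add: sum_distrib_left sum_distrib_right)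
  also have "\<dots> \<le> (\<Sum>i\<in>I. (4 * of_int (int N * idet (b i))) ^ 4 * latB (Im x) y)"
   unfolding u_def w_def v_def y_def
   by (intro sum_mono offdiag_bound[OF N s n _ r]) (use I x0 y in \<open>auto simp: y_def\<close>)
  also have "\<dots> \<le> (\<Sum>i\<in>I. (4 * of_int (int N * idet (b i))) ^ 4 * (1296 * (Im x * y)))"
   by (intro sum_mono mult_left_mono latB_le_prod x y) auto
  also have "\<dots> = C * (Im x * y)" unfolding C_def by (simp only: sum_distrib_right mult.assoc)
  finally show ?thesis .
 qed
 \<comment> \<open>A bound for the translate of \<open>F\<close> above height Y. One of the n powers
   of Im x pays for the linear growth of the lattice bound, which leaves Y^(n - 1).\<close>
 define B where "B = C * y / (4 ^ n * v ^ n * Y ^ (n - 1))"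
 have dec: "cmod (sl n r F z) \<le> B * exp (- (2 * pi / real N) * (Im z - Y))"
 proof (rule cusp_decay[OF N _ s FV r])
  show "n > 0" using n by simp
  show "Y > 0" using Y by simp
  show "Y \<le> Im z" using y Y by (simp add: y_def)
  fix x assume x: "Im x \<ge> Y"
  have x1: "Im x \<ge> 1" using x Y by simp
  have nn: "n = Suc (n - 1)" using n by simp
  have "Im x ^ n = Im x ^ (n - 1) * Im x" by (subst nn) (simp add: mult.commute del: Suc_diff_1)
  then have "(4 ^ n * v ^ n * cmod (sl n r F x) * Im x ^ (n - 1)) * Im x \<le> (C * y) * Im x"
   using Fb[OF x1] by (simp add: mult_ac)
  then have "4 ^ n * v ^ n * cmod (sl n r F x) * Im x ^ (n - 1) \<le> C * y" using x1 by (simp only: mult_le_cancel_right_pos)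
  moreover have "4 ^ n * v ^ n * cmod (sl n r F x) * Y ^ (n - 1) \<le> 4 ^ n * v ^ n * cmod (sl n r F x) * Im x ^ (n - 1)"
   using x Y v by (intro mult_left_mono power_mono) auto
  ultimately have "4 ^ n * v ^ n * cmod (sl n r F x) * Y ^ (n - 1) \<le> C * y" by linarith
  moreover have "4 ^ n * v ^ n * Y ^ (n - 1) > 0" using v Y by (intro mult_pos_pos zero_less_power) auto
  ultimately show "cmod (sl n r F x) \<le> B" unfolding B_def by (simp add: pos_le_divide_eq mult_ac)
 qed
 have "cmod (ks n N \<sigma> I b w) = 4 ^ n * v ^ n * (cmod (F w) * v ^ n)"
 proof -
  have "trker n N \<sigma> I b w = F w" using Fval[OF w] by (simp add: trker_def)
  then show ?thesis using v by (simp add: ks_def norm_mult norm_power abs_mult power_abs v_def mult_2 power_add)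
 qed
 also have "cmod (F w) * v ^ n = cmod (sl n r F z) * y ^ n"
  unfolding w_def v_def y_def by (rule norm_sl[symmetric]) (use r y in \<open>auto simp: y_def\<close>)
 also have "4 ^ n * v ^ n * (cmod (sl n r F z) * y ^ n) \<le> 4 ^ n * v ^ n * ((B * exp (- (2 * pi / real N) * (Im z - Y))) * y ^ n)"
  using dec v y by (intro mult_left_mono mult_right_mono) auto
 also have "\<dots> = C * y * (y ^ n / Y ^ (n - 1)) * exp (- (2 * pi / real N) * (y - Y))"
  using v by (simp add: B_def y_def)
 also have "\<dots> \<le> C * Y\<^sup>2 * exp (- 4 * real n)"
 proof -
  \<comment> \<open>With y = t Y, t \<ge> 2 and Y = n N the expression is C Y^2 t^(n + 1) exp (-2 pi
    (t - 1) n). By t \<le> exp (t - 1) and 2 pi \<ge> 6 it is at most C Y^2 exp (-4 (t - 1)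
    n).\<close>
  define t where "t = y / Y"
  have t: "t \<ge> 2" using y Y by (simp add: t_def field_simps)
  have yt: "y = t * Y" using Y by (simp add: t_def)
  have "Y ^ n = Y ^ (n - 1) * Y" using n by (cases n) simp_all
  then have "y ^ n / Y ^ (n - 1) = t ^ n * Y"
   unfolding yt power_mult_distrib using Y by simp
  then have e0: "C * y * (y ^ n / Y ^ (n - 1)) * exp (- (2 * pi / real N) * (y - Y))
   = C * Y\<^sup>2 * (t * (t ^ n * exp (- (2 * pi / real N) * (y - Y))))"
   by (simp add: yt power2_eq_square mult_ac)
  have "exp (- (2 * pi / real N) * (y - Y)) = exp (- (2 * pi) * (t - 1) * real n)"
   using N by (simp add: yt Y_def field_simps)
  also have "\<dots> \<le> exp (- 6 * (t - 1) * real n)"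
  proof -
   have "6 \<le> 2 * pi" using pi_gt3 by simp
   then have "6 * ((t - 1) * real n) \<le> 2 * pi * ((t - 1) * real n)" using t by (intro mult_right_mono) auto
   moreover have "- (2 * pi) * (t - 1) * real n = - (2 * pi * ((t - 1) * real n))" "- 6 * (t - 1) * real n = - (6 * ((t - 1) * real n))"
    by (simp_all only: mult.assoc mult_minus_left)
   ultimately show ?thesis by (simp only: exp_le_cancel_iff neg_le_iff_le)
  qed
  finally have e1: "exp (- (2 * pi / real N) * (y - Y)) \<le> exp (- 6 * (t - 1) * real n)" .
  have te: "t \<le> exp (t - 1)" using exp_ge_add_one_self[of "t - 1"] by simp
  have "t ^ n \<le> exp (t - 1) ^ n" using te t by (intro power_mono) auto
  also have "\<dots> = exp ((t - 1) * real n)" by (simp add: exp_of_nat_mult[symmetric] mult.commute)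
  finally have tn: "t ^ n \<le> exp ((t - 1) * real n)" .
  have "exp (t - 1) \<le> exp ((t - 1) * real n)" using t n mult_left_mono[of 1 "real n" "t - 1"] by simp
  then have t1: "t \<le> exp ((t - 1) * real n)" using te by linarith
  have "t * (t ^ n * exp (- (2 * pi / real N) * (y - Y))) \<le> exp ((t - 1) * real n) * (exp ((t - 1) * real n) * exp (- 6 * (t - 1) * real n))"
   using t by (intro mult_mono t1 tn e1) auto
  also have "\<dots> = exp (- 4 * ((t - 1) * real n))" by (simp flip: exp_add) (simp add: algebra_simps)
  also have "\<dots> \<le> exp (- 4 * real n)" using t mult_right_mono[of 1 "t - 1" "real n"] by simp
  finally show ?thesis unfolding e0 using C Y by (intro mult_left_mono) auto
 qed
 finally show ?thesis unfolding w_def[symmetric] by (simp only: C_def Y_def)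
qed

section \<open>Integrating the diagonal of the kernel\<close>

lemma measurable_pair_count:
 assumes "countable A" "!!g. g \<in> A ==> X g \<in> measurable N L"
 shows "(\<lambda>(w, g). X g w) \<in> measurable (N \<Otimes>\<^sub>M count_space A) L"
proof -
 have "(\<lambda>(g, w). X g w) \<in> measurable (count_space A \<Otimes>\<^sub>M N) L"
  by (rule measurable_pair_measure_countable1[OF assms(1)]) (use assms(2) in simp)
 then show ?thesis by (subst measurable_pair_swap_iff) (simp add: case_prod_unfold)
qed

lemma measurable_iL_diag [measurable]: "(\<lambda>w. iL g w w) \<in> borel_measurable borel"
proof -
 obtain a b c d where "g = (a, b, c, d)" by (cases g)
 then show ?thesis by simp
qed

lemma measurable_kap_diag [measurable]: "(\<lambda>w. kap n g w w) \<in> borel_measurable borel"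
 unfolding kap_def by measurable

lemma measurable_Sn [measurable]: "Sn n D \<in> borel_measurable borel"
proof -
 interpret G: sigma_finite_measure "count_space (NS D)"
  by (rule sigma_finite_measure_count_space_countable) (rule countable_imat)
 have "(\<lambda>w. \<integral>\<^sup>+g. ennreal (nt n g w) \<partial>count_space (NS D)) \<in> borel_measurable borel"
  by (rule G.borel_measurable_nn_integral, rule measurable_pair_count[OF countable_imat]) measurable
 then show ?thesis by (simp add: Sn_def[abs_def])
qed

text \<open>\<open>nn_integral_fphi_le\<close> asks for a Borel function on the whole plane. Writing
  the infinite sum as an integral over counting measure makes measurability automatic, and on the
  half-plane absolute convergence identifies the two.\<close>

lemma ks_measurable_extension:
 assumes N: "N > 0" and s: "sign_pattern N \<sigma>" and n: "n \<ge> 4"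
  and I: "!!i. i \<in> I ==> idet (b i) > 0"
 obtains k where "k \<in> borel_measurable borel" "!!w. Im w > 0 ==> k w = ks n N \<sigma> I b w"
proof
 let ?G = "ALG N"
 interpret G: sigma_finite_measure "count_space ?G"
  by (rule sigma_finite_measure_count_space_countable) (rule countable_imat)
 define k where "k w = of_real ((-1) ^ n * 4 ^ n * Im w ^ (2 * n)) * (\<Sum>i\<in>I. \<integral>g. of_int (chi \<sigma> g) * kap n (imul g (b i)) w w \<partial>count_space ?G)" for w
 have m: "(\<lambda>w. \<integral>g. of_int (chi \<sigma> g) * kap n (imul g (b i)) w w \<partial>count_space ?G) \<in> borel_measurable borel" for i
  by (rule G.borel_measurable_lebesgue_integral, rule measurable_pair_count[OF countable_imat]) measurable
 note m [measurable]
 show "k \<in> borel_measurable borel" unfolding k_def by measurable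
 fix w :: complex assume w: "Im w > 0"
 have "(\<integral>g. of_int (chi \<sigma> g) * kap n (imul g (b i)) w w \<partial>count_space ?G) = (\<Sum>\<^sub>\<infinity>g\<in>?G. of_int (chi \<sigma> g) * kap n (imul g (b i)) w w)"
  if i: "i \<in> I" for i
 proof -
  let ?k = "\<lambda>g. of_int (chi \<sigma> g) * kap n (imul g (b i)) w w"
  have "(\<lambda>g. norm (?k g)) summable_on ?G" by (rule kernel_sum(1)[OF N s n w w I[OF i]])
  then have "Infinite_Set_Sum.abs_summable_on ?k ?G" using abs_summable_equivalent[of ?k ?G] by blast
  from infsetsum_infsum[OF this] show ?thesis by (simp only: infsetsum_def)
 qed
 then show "k w = ks n N \<sigma> I b w" by (simp add: k_def ks_def trker_def)
qed

text \<open>The coefficient of the parabolic error; it vanishes if none of the determinants Q det (b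
  i) is a square.\<close>

definition sqtot :: "nat => 'i set => ('i => imat) => real" where
 "sqtot N I b = (\<Sum>i\<in>I. \<Sum>Q\<in>{Q. exact_divisor Q N}. real (sqn (int Q * idet (b i))))"

lemma quad_geometric_bounded:
 fixes x :: real
 assumes "0 \<le> x" "x < 1"
 shows "\<exists>C\<ge>0. \<forall>n. (real n)\<^sup>2 * x ^ n \<le> C"
proof -
 have "(\<lambda>n. real n * sqrt x ^ n) \<longlonglongrightarrow> 0" using powser_times_n_limit_0[of "sqrt x"] assms by simp
 then have "Bseq (\<lambda>n. real n * sqrt x ^ n)" by (intro convergent_imp_Bseq convergentI)
 then obtain K where K: "K > 0" "!!n. norm (real n * sqrt x ^ n) \<le> K" by (auto simp: Bseq_def)
 have "(real n)\<^sup>2 * x ^ n \<le> K * K" for n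
 proof -
  have "(real n)\<^sup>2 * x ^ n = (real n * sqrt x ^ n) * (real n * sqrt x ^ n)"
   using assms by (simp add: power2_eq_square mult_ac flip: power_mult_distrib)
  also have "\<dots> \<le> K * K" using K(2)[of n] K(1) assms by (intro mult_mono) auto
  finally show ?thesis .
 qed
 then show ?thesis using K(1) by (intro exI[of _ "K * K"]) auto
qed

text \<open>At the cutoff Y = 2 n N the inequality ln Y + 1 \<le> Y bounds the geometric term by a
  multiple of n erho^n, which is O(1/n).\<close>

lemma Sn_integral_simple:
 assumes D: "D > 0" and N: "N > 0"
 shows "\<exists>C\<ge>0. \<forall>n\<ge>4. (\<integral>\<^sup>+z. indicator sieg z * (indicator {..2 * (real n * real N)} (Im z) * Sn n D z) \<partial>hyp)
  \<le> ennreal (C * (1 / real n + real (sqn D) * ((ln (2 * (real n * real N)) + 1) / sqrt (real n))))"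
proof -
 obtain C where C: "C \<ge> 0" "!!n Y. n \<ge> 4 ==> Y \<ge> 1 ==> (\<integral>\<^sup>+z. indicator sieg z * (indicator {..Y} (Im z) * Sn n D z) \<partial>hyp)
  \<le> ennreal (C / real n + (real (sqn D) / sqrt (real n) + erho D ^ n) * (C * (ln Y + 1)))"
  using Sn_integral[OF D] by blast
 have e: "0 \<le> erho D" "erho D < 1"
 proof -
  define x where "x = 1 / (8 * real_of_int D)"
  have x: "x > 0" unfolding x_def using D by simp
  have "erho D = 1 / (1 + x)" by (simp add: erho_def x_def)
  then show "0 \<le> erho D" "erho D < 1" using x by (simp_all add: divide_less_eq)
 qed
 obtain B where B: "B \<ge> 0" "!!n. (real n)\<^sup>2 * erho D ^ n \<le> B" using quad_geometric_bounded[OF e] by blast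
 define K where "K = C + C * (2 * real N * B)"
 have K0: "0 \<le> C * (2 * real N * B)" using C B by simp
 then have K: "K \<ge> 0" "C \<le> K" using C by (simp_all add: K_def)
 have "(\<integral>\<^sup>+z. indicator sieg z * (indicator {..2 * (real n * real N)} (Im z) * Sn n D z) \<partial>hyp)
  \<le> ennreal (K * (1 / real n + real (sqn D) * ((ln (2 * (real n * real N)) + 1) / sqrt (real n))))" if n: "n \<ge> 4" for n
 proof -
  define Y where "Y = 2 * (real n * real N)"
  have "1 * 1 \<le> real n * real N" using n N by (intro mult_mono) auto
  then have Y: "Y \<ge> 1" "Y > 0" by (simp_all add: Y_def)
  have lY: "0 \<le> ln Y + 1" "ln Y + 1 \<le> Y" using Y ln_le_minus_one[of Y] ln_ge_zero[of Y] by simp_all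
  have "erho D ^ n * (ln Y + 1) \<le> erho D ^ n * Y" using lY e by (intro mult_left_mono) auto
  also have "\<dots> = 2 * real N * ((real n)\<^sup>2 * erho D ^ n) / real n" using n by (simp add: Y_def power2_eq_square)
  also have "\<dots> \<le> 2 * real N * B / real n" using B(2)[of n] by (intro divide_right_mono mult_left_mono) auto
  finally have "erho D ^ n * (ln Y + 1) \<le> 2 * real N * B / real n" .
  then have 1: "C * (erho D ^ n * (ln Y + 1)) \<le> C * (2 * real N * B / real n)" using C by (intro mult_left_mono)
  have 2: "C * (real (sqn D) * ((ln Y + 1) / sqrt (real n))) \<le> K * (real (sqn D) * ((ln Y + 1) / sqrt (real n)))"
   using K lY by (intro mult_right_mono) auto
  have "C / real n + (real (sqn D) / sqrt (real n) + erho D ^ n) * (C * (ln Y + 1))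
   = C / real n + C * (real (sqn D) * ((ln Y + 1) / sqrt (real n))) + C * (erho D ^ n * (ln Y + 1))"
   by (simp add: algebra_simps)
  also have "\<dots> \<le> C / real n + K * (real (sqn D) * ((ln Y + 1) / sqrt (real n))) + C * (2 * real N * B / real n)"
   using 1 2 by linarith
  also have "\<dots> = K * (1 / real n + real (sqn D) * ((ln Y + 1) / sqrt (real n)))"
   by (simp add: K_def algebra_simps add_divide_distrib)
  finally show ?thesis using C(2)[OF n Y(1)] unfolding Y_def[symmetric] by (meson ennreal_leI order_trans)
 qed
 then show ?thesis using K by blast
qed

text \<open>The Siegel set is cut at Y = 2 n N, where \<open>ks_high\<close> takes over. Below,
  \<open>ks_low\<close> and the integrals of \<open>Sn\<close> bound the deviation from
  \<open>s0\<close>. Above, the kernel is negligible, and the constant \<open>s0\<close> is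
  integrated over a set of measure at most 1/Y.\<close>

lemma ks_integral_estimate:
 assumes N: "N > 0" and s: "sign_pattern N \<sigma>"
  and I: "finite I" "!!i. i \<in> I ==> idet (b i) > 0"
  and U: "!!n f. n \<ge> 4 ==> f \<in> Vsp n N \<sigma> ==> opU n I b f \<in> Vsp n N \<sigma>"
 shows "\<exists>C\<ge>0. \<forall>n\<ge>4. integrable hyp (\<lambda>w. of_real (fphi N w) * ks n N \<sigma> I b w) -->
  cmod ((\<integral>w. of_real (fphi N w) * ks n N \<sigma> I b w \<partial>hyp) - s0 N \<sigma> I b * of_real (fvol N))
   \<le> C * (1 / real n + sqtot N I b * ((ln (2 * (real n * real N)) + 1) / sqrt (real n)))"
proof -
 let ?E = "{Q. exact_divisor Q N}"
 define J where "J = I \<times> ?E"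
 define D where "D p = int (snd p) * idet (b (fst p))" for p :: "_ \<times> nat"
 have finJ: "finite J" unfolding J_def using I finite_exact_divisors[OF N] by simp
 have Dpos: "D p > 0" if "p \<in> J" for p
  using that I(2) exact_divisor_pos[OF N] unfolding J_def D_def by (auto intro!: mult_pos_pos)
 have "\<forall>p\<in>J. \<exists>C\<ge>0. \<forall>n\<ge>4. (\<integral>\<^sup>+z. indicator sieg z * (indicator {..2 * (real n * real N)} (Im z) * Sn n (D p) z) \<partial>hyp)
  \<le> ennreal (C * (1 / real n + real (sqn (D p)) * ((ln (2 * (real n * real N)) + 1) / sqrt (real n))))"
  using Sn_integral_simple[OF Dpos N] by blast
 from bchoice[OF this] obtain C where C0: "!!p. p \<in> J ==> C p \<ge> 0"
  and C: "!!p n. p \<in> J ==> n \<ge> 4 ==> (\<integral>\<^sup>+z. indicator sieg z * (indicator {..2 * (real n * real N)} (Im z) * Sn n (D p) z) \<partial>hyp)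
  \<le> ennreal (C p * (1 / real n + real (sqn (D p)) * ((ln (2 * (real n * real N)) + 1) / sqrt (real n))))"
  by blast
 define K1 where "K1 = (\<Sum>p\<in>J. C p)"
 have K1: "K1 \<ge> 0" "!!p. p \<in> J ==> C p \<le> K1"
  unfolding K1_def using C0 finJ by (auto intro: sum_nonneg member_le_sum)
 define H0 where "H0 = (\<Sum>i\<in>I. (4 * real_of_int (int N * idet (b i))) ^ 4) * 1296"
 have H0: "H0 \<ge> 0" unfolding H0_def by (intro mult_nonneg_nonneg sum_nonneg) auto
 define K2 where "K2 = H0 * real N + cmod (s0 N \<sigma> I b)"
 have K2: "K2 \<ge> 0" using H0 by (simp add: K2_def)
 define K where "K = real (card (cosets N)) * (real (card J) * K1 + K1 + K2)"
 have K: "K \<ge> 0" unfolding K_def using K1 K2 by simp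
 have "cmod ((\<integral>w. of_real (fphi N w) * ks n N \<sigma> I b w \<partial>hyp) - s0 N \<sigma> I b * of_real (fvol N))
   \<le> K * (1 / real n + sqtot N I b * ((ln (2 * (real n * real N)) + 1) / sqrt (real n)))"
  if n: "n \<ge> 4" and int: "integrable hyp (\<lambda>w. of_real (fphi N w) * ks n N \<sigma> I b w)" for n
 proof -
  define Y where "Y = 2 * (real n * real N)"
  define L where "L = (ln Y + 1) / sqrt (real n)"
  have nN: "1 * 1 \<le> real n * real N" using n N by (intro mult_mono) auto
  then have Y: "Y \<ge> 1" "Y > 0" by (simp_all add: Y_def)
  have L: "L \<ge> 0" unfolding L_def using Y by (intro divide_nonneg_nonneg) auto
  define S where "S = s0 N \<sigma> I b"
  obtain k where k [measurable]: "k \<in> borel_measurable borel" and keq: "!!w. Im w > 0 ==> k w = ks n N \<sigma> I b w"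
  proof (rule ks_measurable_extension[OF N s n, where I=I and b=b])
   fix i assume "i \<in> I" then show "idet (b i) > 0" by (rule I(2))
  qed (rule that)
  have intS: "integrable hyp (\<lambda>w. of_real (fphi N w) * S)"
   by (intro integrable_mult_left integrable_of_real integrable_fphi N)
  have "(\<integral>w. of_real (fphi N w) * S \<partial>hyp) = S * of_real (fvol N)"
   by (simp add: fvol_def)
  then have "(\<integral>w. of_real (fphi N w) * ks n N \<sigma> I b w \<partial>hyp) - S * of_real (fvol N)
   = (\<integral>w. of_real (fphi N w) * (ks n N \<sigma> I b w - S) \<partial>hyp)"
   unfolding right_diff_distrib using Bochner_Integration.integral_diff[OF int intS] by metis
  then have "cmod ((\<integral>w. of_real (fphi N w) * ks n N \<sigma> I b w \<partial>hyp) - S * of_real (fvol N))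
   \<le> (\<integral>w. norm (of_real (fphi N w) * (ks n N \<sigma> I b w - S)) \<partial>hyp)" by (simp add: integral_norm_bound)
  then have "ennreal (cmod ((\<integral>w. of_real (fphi N w) * ks n N \<sigma> I b w \<partial>hyp) - S * of_real (fvol N)))
   \<le> ennreal (\<integral>w. norm (of_real (fphi N w) * (ks n N \<sigma> I b w - S)) \<partial>hyp)" by (rule ennreal_leI)
  also have "\<dots> = (\<integral>\<^sup>+w. ennreal (norm (of_real (fphi N w) * (ks n N \<sigma> I b w - S))) \<partial>hyp)"
  proof (rule nn_integral_eq_integral[symmetric])
   have "integrable hyp (\<lambda>w. of_real (fphi N w) * (ks n N \<sigma> I b w - S))"
    unfolding right_diff_distrib by (rule Bochner_Integration.integrable_diff[OF int intS])
   then show "integrable hyp (\<lambda>w. norm (of_real (fphi N w) * (ks n N \<sigma> I b w - S)))" by (rule integrable_norm)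
  qed simp
  also have "\<dots> = (\<integral>\<^sup>+w. ennreal (fphi N w) * ennreal (cmod (k w - S)) \<partial>hyp)"
  proof (rule nn_integral_cong_AE)
   show "AE w in hyp. ennreal (norm (of_real (fphi N w) * (ks n N \<sigma> I b w - S))) = ennreal (fphi N w) * ennreal (cmod (k w - S))"
    using AE_hyp_pos by eventually_elim (simp add: norm_mult fphi_nonneg ennreal_mult keq)
  qed
  also have "\<dots> \<le> (\<Sum>r\<in>cosets N. \<integral>\<^sup>+z. indicator sieg z * ennreal (cmod (k (imob r z) - S)) \<partial>hyp)"
   by (rule nn_integral_fphi_le[OF N]) measurable
  also have "\<dots> \<le> (\<Sum>r\<in>cosets N. ennreal (real (card J) * K1 * (1 / real n) + K1 * sqtot N I b * L + K2 * (1 / real n)))"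
  proof (rule sum_mono)
   fix r assume "r \<in> cosets N"
   then have r: "idet r = 1" by (rule cosets(2)[OF N])
   define H where "H = H0 * (real n * real N)\<^sup>2 * exp (- 4 * real n) + cmod S"
   have H: "H \<ge> 0" using H0 by (simp add: H_def)
   \<comment> \<open>Both parts of \<open>H\<close> contribute O(1/n): the kernel part because n^2
     exp (-4 n) \<le> 1, the constant part because Y \<ge> n.\<close>
   have HY: "H * (1 / Y) \<le> K2 * (1 / real n)"
   proof -
    have "real n * exp (- 4 * real n) \<le> 1 / real n"
    proof -
     have "real n \<le> exp (real n)" using exp_ge_add_one_self[of "real n"] by linarith
     then have "real n * real n \<le> exp (real n) * exp (real n)" by (intro mult_mono) auto
     also have "\<dots> = exp (2 * real n)" by (simp flip: exp_add)
     also have "\<dots> \<le> exp (4 * real n)" by simp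
     finally show ?thesis using n by (simp add: exp_minus field_simps)
    qed
    then have "H0 * real N * (real n * exp (- 4 * real n)) \<le> H0 * real N * (1 / real n)" using H0 by (intro mult_left_mono) auto
    moreover have "H0 * (real n * real N)\<^sup>2 * exp (- 4 * real n) * (1 / Y) = H0 * real N * (real n * exp (- 4 * real n)) / 2"
     using n N by (simp add: Y_def power2_eq_square)
    moreover have "H0 * real N * (real n * exp (- 4 * real n)) \<ge> 0" using H0 by simp
    moreover have "cmod S * (1 / Y) \<le> cmod S * (1 / real n)"
    proof -
     have "real n * 1 \<le> real n * (2 * real N)" using N by (intro mult_left_mono) auto
     then have "real n \<le> Y" by (simp add: Y_def)
     then show ?thesis using n by (intro mult_left_mono divide_left_mono) auto
    qed
    ultimately show ?thesis by (simp only: H_def K2_def S_def[symmetric] distrib_right)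
   qed
   have pt: "indicator sieg z * ennreal (cmod (k (imob r z) - S))
    \<le> (\<Sum>p\<in>J. indicator sieg z * (indicator {..Y} (Im z) * Sn n (D p) z)) + ennreal H * (indicator sieg z * indicator {Y<..} (Im z))" for z
   proof (cases "z \<in> sieg")
    case True
    then have z: "Im z > 0" by (rule sieg_Im_pos)
    have "Im (imob r z) > 0" by (rule Im_imob_pos) (use z r in auto)
    then have kk: "k (imob r z) = ks n N \<sigma> I b (imob r z)" by (rule keq)
    show ?thesis
    proof (cases "Im z \<le> Y")
     case low: True
     have "ennreal (cmod (k (imob r z) - S)) \<le> (\<Sum>i\<in>I. \<Sum>Q\<in>?E. Sn n (int Q * idet (b i)) z)"
      unfolding kk S_def by (rule ks_low[OF N s n I r z])
     also have "\<dots> = (\<Sum>p\<in>J. Sn n (D p) z)" unfolding J_def D_def by (simp add: sum.cartesian_product case_prod_unfold)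
     finally show ?thesis using True low by simp
    next
     case high: False
     have "cmod (ks n N \<sigma> I b (imob r z)) \<le> H0 * (real n * real N)\<^sup>2 * exp (- 4 * real n)"
      unfolding H0_def by (rule ks_high[OF N s n I U[OF n] r]) (use high in \<open>simp_all add: Y_def\<close>)
     then have "cmod (k (imob r z) - S) \<le> H" unfolding kk H_def
      using norm_triangle_ineq4[of "ks n N \<sigma> I b (imob r z)" S] by linarith
     then show ?thesis using True high by (simp add: ennreal_leI)
    qed
   qed simp
   have "(\<integral>\<^sup>+z. indicator sieg z * ennreal (cmod (k (imob r z) - S)) \<partial>hyp)
    \<le> (\<integral>\<^sup>+z. (\<Sum>p\<in>J. indicator sieg z * (indicator {..Y} (Im z) * Sn n (D p) z)) + ennreal H * (indicator sieg z * indicator {Y<..} (Im z)) \<partial>hyp)"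
    by (rule nn_integral_mono) (rule pt)
   also have "\<dots> = (\<integral>\<^sup>+z. (\<Sum>p\<in>J. indicator sieg z * (indicator {..Y} (Im z) * Sn n (D p) z)) \<partial>hyp)
    + (\<integral>\<^sup>+z. ennreal H * (indicator sieg z * indicator {Y<..} (Im z)) \<partial>hyp)"
    by (rule nn_integral_add) measurable
   also have "\<dots> = (\<Sum>p\<in>J. \<integral>\<^sup>+z. indicator sieg z * (indicator {..Y} (Im z) * Sn n (D p) z) \<partial>hyp)
    + ennreal H * (\<integral>\<^sup>+z. indicator sieg z * indicator {Y<..} (Im z) \<partial>hyp)"
    by (subst nn_integral_sum, measurable, subst nn_integral_cmult, measurable)
   also have "\<dots> \<le> (\<Sum>p\<in>J. ennreal (C p * (1 / real n + real (sqn (D p)) * L))) + ennreal H * ennreal (1 / Y)"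
    unfolding L_def Y_def using Y by (intro add_mono sum_mono C n mult_left_mono nn_integral_sieg_high) (simp_all add: Y_def)
   also have "\<dots> \<le> (\<Sum>p\<in>J. ennreal (K1 * (1 / real n + real (sqn (D p)) * L))) + ennreal H * ennreal (1 / Y)"
    using K1 L by (intro add_right_mono sum_mono ennreal_leI mult_right_mono) auto
   also have "\<dots> = ennreal ((\<Sum>p\<in>J. K1 * (1 / real n + real (sqn (D p)) * L)) + H * (1 / Y))"
   proof -
    have 1: "0 \<le> K1 * (1 / real n + real (sqn (D p)) * L)" for p using K1 L by simp
    have 2: "0 \<le> H * (1 / Y)" using H Y by simp
    have 3: "ennreal H * ennreal (1 / Y) = ennreal (H * (1 / Y))" using H Y by (intro ennreal_mult[symmetric]) auto
    show ?thesis unfolding 3 using 1 2 by (subst sum_ennreal) (auto simp del: times_divide_eq_right intro!: ennreal_plus[symmetric] sum_nonneg)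
   qed
   also have "\<dots> \<le> ennreal (real (card J) * K1 * (1 / real n) + K1 * sqtot N I b * L + K2 * (1 / real n))"
   proof (rule ennreal_leI)
    have "(\<Sum>p\<in>J. real (sqn (D p))) = sqtot N I b"
     unfolding J_def D_def sqtot_def by (simp add: sum.cartesian_product case_prod_unfold)
    then have "(\<Sum>p\<in>J. K1 * (1 / real n + real (sqn (D p)) * L)) = real (card J) * K1 * (1 / real n) + K1 * sqtot N I b * L"
     by (simp add: distrib_left sum.distrib flip: sum_distrib_left sum_distrib_right)
    then show "(\<Sum>p\<in>J. K1 * (1 / real n + real (sqn (D p)) * L)) + H * (1 / Y) \<le> real (card J) * K1 * (1 / real n) + K1 * sqtot N I b * L + K2 * (1 / real n)"
     using HY by linarith
   qed
   finally show "(\<integral>\<^sup>+z. indicator sieg z * ennreal (cmod (k (imob r z) - S)) \<partial>hyp)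
    \<le> ennreal (real (card J) * K1 * (1 / real n) + K1 * sqtot N I b * L + K2 * (1 / real n))" .
  qed
  also have "\<dots> = ennreal (real (card (cosets N)) * (real (card J) * K1 * (1 / real n) + K1 * sqtot N I b * L + K2 * (1 / real n)))"
   by (simp add: ennreal_mult' flip: ennreal_of_nat_eq_real_of_nat)
  finally have "cmod ((\<integral>w. of_real (fphi N w) * ks n N \<sigma> I b w \<partial>hyp) - S * of_real (fvol N))
   \<le> real (card (cosets N)) * (real (card J) * K1 * (1 / real n) + K1 * sqtot N I b * L + K2 * (1 / real n))"
  proof (subst (asm) ennreal_le_iff)
   have "0 \<le> sqtot N I b" unfolding sqtot_def by (intro sum_nonneg) auto
   then show "0 \<le> real (card (cosets N)) * (real (card J) * K1 * (1 / real n) + K1 * sqtot N I b * L + K2 * (1 / real n))"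
    using K1 K2 L by (intro mult_nonneg_nonneg add_nonneg_nonneg) auto
  qed
  also have "\<dots> \<le> K * (1 / real n + sqtot N I b * L)"
  proof -
   have sq: "0 \<le> sqtot N I b * L" using L unfolding sqtot_def by (intro mult_nonneg_nonneg sum_nonneg) auto
   have "real (card J) * K1 * (1 / real n) + K1 * sqtot N I b * L + K2 * (1 / real n)
    \<le> (real (card J) * K1 + K1 + K2) * (1 / real n) + (real (card J) * K1 + K1 + K2) * (sqtot N I b * L)"
   proof -
    have "K1 * (sqtot N I b * L) \<le> (real (card J) * K1 + K1 + K2) * (sqtot N I b * L)"
     using K1 K2 sq by (intro mult_right_mono) auto
    moreover have "(real (card J) * K1 + K2) * (1 / real n) \<le> (real (card J) * K1 + K1 + K2) * (1 / real n)"
     using K1 by (intro mult_right_mono) auto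
    moreover have "real (card J) * K1 * (1 / real n) + K2 * (1 / real n) = (real (card J) * K1 + K2) * (1 / real n)"
     by (simp only: distrib_right)
    moreover have "K1 * sqtot N I b * L = K1 * (sqtot N I b * L)" by (simp only: mult.assoc)
    ultimately show ?thesis by linarith
   qed
   then have "real (card (cosets N)) * (real (card J) * K1 * (1 / real n) + K1 * sqtot N I b * L + K2 * (1 / real n))
    \<le> real (card (cosets N)) * ((real (card J) * K1 + K1 + K2) * (1 / real n) + (real (card J) * K1 + K1 + K2) * (sqtot N I b * L))"
    by (intro mult_left_mono) auto
   moreover have "c * (A * u + A * v) = c * A * (u + v)" for c A u v :: real by (simp only: distrib_left mult.assoc)
   ultimately show ?thesis unfolding K_def by metis
  qed
  finally show ?thesis by (simp only: S_def L_def Y_def)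
 qed
 then show ?thesis using K by blast
qed

subsection \<open>Elementary symmetric functions of the eigenvalues\<close>

fun esym :: "nat => complex list => complex" where
 "esym 0 xs = 1"
| "esym (Suc k) [] = 0"
| "esym (Suc k) (x # xs) = esym (Suc k) xs + x * esym k xs"

definition psum :: "nat => complex list => complex" where
 "psum i xs = (\<Sum>x\<leftarrow>xs. x ^ i)"

lemma esym_eq_0: "k > length xs ==> esym k xs = 0"
proof (induction xs arbitrary: k)
 case Nil then show ?case by (cases k) auto
next
 case (Cons x xs) then show ?case by (cases k) auto
qed

lemma coeff_prod_linear_big:
 fixes xs :: "complex list"
 shows "n > length xs ==> coeff (\<Prod>x\<leftarrow>xs. [:- x, 1:]) n = 0"
proof (induction xs arbitrary: n)
 case (Cons x xs) then show ?case by (cases n) auto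
qed simp

lemma coeff_prod_linear:
 "k \<le> length xs ==> coeff (\<Prod>x\<leftarrow>xs. [:- x, 1:]) (length xs - k) = (-1) ^ k * esym k xs"
proof (induction xs arbitrary: k)
 case Nil then show ?case by simp
next
 case (Cons x xs)
 define p where "p = (\<Prod>x\<leftarrow>xs. [:- x, 1:])"
 have e: "(\<Prod>x\<leftarrow>x # xs. [:- x, 1:]) = Polynomial.smult (- x) p + pCons 0 p" by (simp add: p_def)
 show ?case
 proof (cases k)
  case 0
  then show ?thesis unfolding e using coeff_prod_linear_big[of xs "Suc (length xs)"] Cons.IH[of 0] by (simp add: p_def)
 next
  case (Suc l)
  then have l: "l \<le> length xs" using Cons.prems by simp
  have 1: "coeff p (length xs - l) = (-1) ^ l * esym l xs" unfolding p_def by (rule Cons.IH[OF l])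
  have 2: "coeff (pCons 0 p) (length xs - l) = (-1) ^ Suc l * esym (Suc l) xs"
  proof (cases "l = length xs")
   case True then show ?thesis using esym_eq_0[of xs "Suc l"] by simp
  next
   case False
   then have s: "Suc l \<le> length xs" using l by simp
   then have "length xs - l = Suc (length xs - Suc l)" by simp
   then show ?thesis using Cons.IH[OF s] by (simp add: p_def)
  qed
  show ?thesis unfolding e Suc using 1 2 by (simp add: algebra_simps)
 qed
qed

text \<open>In generating functions: the product of the factors 1 + y T over all entries y is
  divided by the factor 1 + x T of the head.\<close>

lemma esym_alternating:
 "(\<Sum>i\<le>j. (-1) ^ i * x ^ i * esym (j - i) (x # xs)) = esym j xs"
proof (induction j)
 case (Suc j)
 have "(\<Sum>i\<le>Suc j. (-1) ^ i * x ^ i * esym (Suc j - i) (x # xs))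
  = esym (Suc j) (x # xs) + (\<Sum>i\<le>j. - x * ((-1) ^ i * x ^ i * esym (j - i) (x # xs)))"
  unfolding sum.atMost_Suc_shift by (simp add: mult_ac)
 also have "(\<Sum>i\<le>j. - x * ((-1) ^ i * x ^ i * esym (j - i) (x # xs))) = - x * esym j xs"
  unfolding sum_distrib_left[symmetric] Suc ..
 finally show ?case by simp
qed simp

text \<open>Induction on the list. The powers of the new entry x are summed by
  \<open>esym_alternating\<close>; in the rest \<open>R\<close> the recursion of \<open>esym\<close>
  leads to the identity for the shorter list, at j and at j - 1.\<close>

lemma newton_identity:
 "of_nat (Suc j) * esym (Suc j) xs = (\<Sum>i\<le>j. (-1) ^ i * esym (j - i) xs * psum (Suc i) xs)"
proof (induction xs arbitrary: j)
 case Nil then show ?case by (simp add: psum_def)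
next
 case (Cons x xs)
 define R where "R j = (\<Sum>i\<le>j. (-1) ^ i * esym (j - i) (x # xs) * psum (Suc i) xs)" for j
 have "(\<Sum>i\<le>j. (-1) ^ i * esym (j - i) (x # xs) * psum (Suc i) (x # xs))
  = (\<Sum>i\<le>j. x * ((-1) ^ i * x ^ i * esym (j - i) (x # xs)) + (-1) ^ i * esym (j - i) (x # xs) * psum (Suc i) xs)"
  by (rule sum.cong[OF refl]) (simp add: psum_def algebra_simps)
 also have "\<dots> = x * esym j xs + R j"
  unfolding sum.distrib sum_distrib_left[symmetric] esym_alternating R_def ..
 finally have e: "(\<Sum>i\<le>j. (-1) ^ i * esym (j - i) (x # xs) * psum (Suc i) (x # xs)) = x * esym j xs + R j" .
 show ?case
 proof (cases j)
  case 0
  have "R 0 = esym 1 xs" using Cons.IH[of 0] by (simp add: R_def)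
  then show ?thesis unfolding e using 0 by simp
 next
  case (Suc l)
  have "R (Suc l) = (\<Sum>i\<le>l. (-1) ^ i * esym (Suc l - i) (x # xs) * psum (Suc i) xs) + (-1) ^ Suc l * psum (Suc (Suc l)) xs"
   by (simp add: R_def)
  also have "(\<Sum>i\<le>l. (-1) ^ i * esym (Suc l - i) (x # xs) * psum (Suc i) xs)
   = (\<Sum>i\<le>l. (-1) ^ i * esym (Suc l - i) xs * psum (Suc i) xs + x * ((-1) ^ i * esym (l - i) xs * psum (Suc i) xs))"
   by (rule sum.cong[OF refl]) (simp add: Suc_diff_le algebra_simps)
  also have "\<dots> = (\<Sum>i\<le>l. (-1) ^ i * esym (Suc l - i) xs * psum (Suc i) xs) + x * (of_nat (Suc l) * esym (Suc l) xs)"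
   unfolding sum.distrib sum_distrib_left[symmetric] Cons.IH ..
  also have "\<dots> + (-1) ^ Suc l * psum (Suc (Suc l)) xs = (\<Sum>i\<le>Suc l. (-1) ^ i * esym (Suc l - i) xs * psum (Suc i) xs) + x * (of_nat (Suc l) * esym (Suc l) xs)"
   by simp
  also have "\<dots> = of_nat (Suc (Suc l)) * esym (Suc (Suc l)) xs + x * (of_nat (Suc l) * esym (Suc l) xs)"
   unfolding Cons.IH ..
  finally show ?thesis unfolding e unfolding Suc by (simp add: algebra_simps)
 qed
qed

text \<open>The coefficients of exp (- M T^2 / 2), the generating function of the elementary
  symmetric functions when the second power sum is M and all others are 0.\<close>

definition esym_limit :: "real => nat => complex" where
 "esym_limit M k = (if even k then (- of_real M / 2) ^ (k div 2) / fact (k div 2) else 0)"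

lemma esym_limit_rec:
 assumes "j \<ge> 1"
 shows "- (esym_limit M (j - 1) * of_real M) / of_nat (Suc j) = esym_limit M (Suc j)"
proof (cases "even j")
 case True
 then have "odd (j - 1)" using assms by simp
 then show ?thesis using True by (simp add: esym_limit_def)
next
 case False
 then obtain u where j: "j = 2 * u + 1" by (rule oddE)
 have 1: "esym_limit M (j - 1) = (- of_real M / 2) ^ u / fact u" by (simp add: esym_limit_def j)
 have 2: "esym_limit M (Suc j) = (- of_real M / 2) ^ Suc u / fact (Suc u)" by (simp add: esym_limit_def j)
 have 3: "of_nat (Suc j) = (2 * of_nat (Suc u) :: complex)" by (simp add: j)
 have "- (a / f * m) / (2 * s) = (- m / 2 * a) / (s * f)" for a f m s :: complex by (simp add: mult_ac)
 then show ?thesis unfolding 1 2 3 power_Suc fact_Suc of_nat_mult by (simp add: algebra_simps)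
qed

text \<open>Newton's identities turn the power sum asymptotics into those of the elementary symmetric
 functions; after scaling, only the second power sum survives in the limit.\<close>

lemma esym_tendsto:
 fixes es :: "nat => complex list" and q :: "nat => real"
 assumes p: "!!i. (\<lambda>n. psum (Suc i) (es n) / of_real (q n) ^ Suc i) \<longlonglongrightarrow> (if i = 1 then of_real M else 0)"
 shows "(\<lambda>n. esym k (es n) / of_real (q n) ^ k) \<longlonglongrightarrow> esym_limit M k"
proof (induction k rule: less_induct)
 case (less k)
 show ?case
 proof (cases k)
  case 0 then show ?thesis by (simp add: esym_limit_def)
 next
  case (Suc j)
  have "(\<lambda>n. (\<Sum>i\<le>j. (-1) ^ i * (esym (j - i) (es n) / of_real (q n) ^ (j - i)) * (psum (Suc i) (es n) / of_real (q n) ^ Suc i)) / of_nat (Suc j))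
   \<longlonglongrightarrow> (\<Sum>i\<le>j. (-1) ^ i * esym_limit M (j - i) * (if i = 1 then of_real M else 0)) / of_nat (Suc j)"
   by (intro tendsto_divide tendsto_sum tendsto_mult tendsto_const less p) (use Suc in \<open>auto simp del: of_nat_Suc\<close>)
  moreover have "(\<Sum>i\<le>j. (-1) ^ i * (esym (j - i) (es n) / of_real (q n) ^ (j - i)) * (psum (Suc i) (es n) / of_real (q n) ^ Suc i)) / of_nat (Suc j)
   = esym k (es n) / of_real (q n) ^ k" for n
  proof -
   have "(\<Sum>i\<le>j. (-1) ^ i * (esym (j - i) (es n) / of_real (q n) ^ (j - i)) * (psum (Suc i) (es n) / of_real (q n) ^ Suc i))
    = (\<Sum>i\<le>j. (-1) ^ i * esym (j - i) (es n) * psum (Suc i) (es n) / of_real (q n) ^ k)"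
   proof (rule sum.cong[OF refl])
    fix i assume "i \<in> {..j}"
    then have "k = (j - i) + Suc i" using Suc by simp
    then have "of_real (q n) ^ k = (of_real (q n) ^ (j - i) * of_real (q n) ^ Suc i :: complex)" by (metis power_add)
    then show "(-1) ^ i * (esym (j - i) (es n) / of_real (q n) ^ (j - i)) * (psum (Suc i) (es n) / of_real (q n) ^ Suc i)
     = (-1) ^ i * esym (j - i) (es n) * psum (Suc i) (es n) / of_real (q n) ^ k" by (simp add: mult_ac)
   qed
   also have "\<dots> = of_nat (Suc j) * esym (Suc j) (es n) / of_real (q n) ^ k"
    unfolding newton_identity sum_divide_distrib ..
   finally have e: "(\<Sum>i\<le>j. (-1) ^ i * (esym (j - i) (es n) / of_real (q n) ^ (j - i)) * (psum (Suc i) (es n) / of_real (q n) ^ Suc i))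
    = of_nat (Suc j) * esym (Suc j) (es n) / of_real (q n) ^ k" .
   have ne: "(of_nat (Suc j) :: complex) \<noteq> 0" by (rule of_nat_neq_0)
   show ?thesis unfolding e using ne by (simp add: Suc del: of_nat_Suc)
  qed
  moreover have "(\<Sum>i\<le>j. (-1) ^ i * esym_limit M (j - i) * (if i = 1 then of_real M else 0)) / of_nat (Suc j) = esym_limit M k"
  proof -
   have "(\<Sum>i\<le>j. (-1) ^ i * esym_limit M (j - i) * (if i = 1 then of_real M else 0))
    = (\<Sum>i\<le>j. if i = 1 then - (esym_limit M (j - 1) * of_real M) else 0)"
    by (rule sum.cong) auto
   also have "\<dots> = (if j \<ge> 1 then - (esym_limit M (j - 1) * of_real M) else 0)" by simp
   finally show ?thesis
    unfolding Suc using esym_limit_rec[of j M] by (cases "j \<ge> 1") (simp_all add: esym_limit_def not_le)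
  qed
  ultimately show ?thesis by simp
 qed
qed

lemma esym_sign:
 fixes es :: "nat => complex list" and q :: "nat => real"
 assumes p: "!!i. (\<lambda>n. psum (Suc i) (es n) / of_real (q n) ^ Suc i) \<longlonglongrightarrow> (if i = 1 then of_real M else 0)"
  and M: "M > 0" and q: "\<forall>\<^sub>F n in sequentially. q n > 0"
 shows "\<forall>\<^sub>F n in sequentially. sgn (Re (esym (2 * r) (es n))) = (-1) ^ r"
proof -
 have lim: "(\<lambda>n. (-1) ^ r * Re (esym (2 * r) (es n) / of_real (q n) ^ (2 * r))) \<longlonglongrightarrow> (-1) ^ r * Re (esym_limit M (2 * r))"
  by (intro tendsto_mult tendsto_const tendsto_Re esym_tendsto p)
 have "(-1) ^ r * Re (esym_limit M (2 * r)) = (M / 2) ^ r / fact r"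
 proof -
  have "esym_limit M (2 * r) = of_real ((-1) ^ r * ((M / 2) ^ r / fact r))"
  proof -
   have "- complex_of_real M / 2 = - 1 * of_real (M / 2)" by simp
   then have "(- complex_of_real M / 2) ^ r = (- 1) ^ r * of_real (M / 2) ^ r" by (simp only: power_mult_distrib)
   then show ?thesis by (simp add: esym_limit_def)
  qed
  then have "Re (esym_limit M (2 * r)) = (-1) ^ r * ((M / 2) ^ r / fact r)" by (simp only: Re_complex_of_real)
  then show ?thesis by (simp flip: mult.assoc power_mult_distrib)
 qed
 moreover have "(M / 2) ^ r / fact r > 0" using M by simp
 ultimately have "0 < (-1) ^ r * Re (esym_limit M (2 * r))" by simp
 from order_tendstoD(1)[OF lim this]
 have "\<forall>\<^sub>F n in sequentially. (-1) ^ r * Re (esym (2 * r) (es n) / of_real (q n) ^ (2 * r)) > 0" .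
 then show ?thesis using q
 proof eventually_elim
  case (elim n)
  have "Re (esym (2 * r) (es n) / of_real (q n) ^ (2 * r)) = Re (esym (2 * r) (es n)) / q n ^ (2 * r)"
   by (simp only: of_real_power[symmetric] Re_divide_of_real)
  then have "(-1) ^ r * Re (esym (2 * r) (es n)) / q n ^ (2 * r) > 0" using elim(1) by simp
  then have "(-1) ^ r * Re (esym (2 * r) (es n)) > 0" using elim(2) by (simp add: zero_less_divide_iff)
  then show ?case by (cases "even r") (simp_all add: sgn_if)
 qed
qed

subsection \<open>The characteristic polynomial in a Lagrange basis\<close>

text \<open>In such a basis the coordinates of f are its values at the points \<open>z i\<close>.
  Hence an operator T has the matrix entries \<open>T (g j) (z i)\<close>, and traces become sums of
  values.\<close>

definition LB :: "(complex => complex) set => nat => (nat => complex => complex) => (nat => complex) => bool" where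
 "LB V d g z \<longleftrightarrow> (\<forall>i<d. g i \<in> V) \<and> (\<forall>i<d. Im (z i) > 0) \<and>
  (\<forall>i<d. \<forall>j<d. g j (z i) = (if i = j then 1 else 0)) \<and>
  (\<forall>f\<in>V. f = (\<Sum>i<d. cscale (f (z i)) (g i)))"

lemma LBD:
 assumes "LB V d g z"
 shows "i < d ==> g i \<in> V" "i < d ==> Im (z i) > 0"
  "i < d ==> j < d ==> g j (z i) = (if i = j then 1 else 0)"
  "f \<in> V ==> f = (\<Sum>i<d. cscale (f (z i)) (g i))"
 using assms unfolding LB_def by blast+

definition LM :: "((complex => complex) => complex => complex) => nat => (nat => complex => complex) => (nat => complex) => complex mat" where
 "LM T d g z = mat d d (\<lambda>(i, j). T (g j) (z i))"

definition lincomb_hom :: "((complex => complex) => complex => complex) => bool" where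
 "lincomb_hom T \<longleftrightarrow> (\<forall>J::nat set. \<forall>c g. T (\<Sum>j\<in>J. cscale (c j) (g j)) = (\<Sum>j\<in>J. cscale (c j) (T (g j))))"

lemma lincomb_homD:
 "lincomb_hom T ==> T (\<Sum>j\<in>(J::nat set). cscale (c j) (g j)) = (\<Sum>j\<in>J. cscale (c j) (T (g j)))"
 unfolding lincomb_hom_def by blast

lemma sum_cscale_apply: "(\<Sum>j\<in>J. cscale (c j) (h j)) w = (\<Sum>j\<in>J. c j * h j w)"
 by (induction J rule: infinite_finite_induct) (auto simp: cscale_def)

lemma sum_kronecker: "i < (d::nat) ==> (\<Sum>j<d. c j * (if i = j then 1 else 0)) = (c i :: complex)"
 by (subst sum.cong[OF refl, of _ _ "\<lambda>j. if j = i then c i else 0"]) auto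

lemma LB_basis:
 assumes L: "LB V d g z" and V: "cfun.subspace V"
 shows "inj_on g {..<d}" "cfun.independent (g ` {..<d})" "cfun.span (g ` {..<d}) = V" "cfun.dim V = d"
proof -
 let ?L = "(\<lambda>i f. f (z i)) ` {..<d} :: ((complex => complex) => complex) set"
 have lin: "!!l. l \<in> ?L ==> cond_linear V l" by (auto simp: cond_linear_def cscale_def)
 have lag: "lagrange V ?L d g (\<lambda>i f. f (z i))"
  unfolding lagrange_def using LBD[OF L] by auto
 show inj: "inj_on g {..<d}" and ind: "cfun.independent (g ` {..<d})"
  using lagrange_independent[OF V lin lag] by blast+
 show span: "cfun.span (g ` {..<d}) = V"
 proof (rule antisym)
  show "cfun.span (g ` {..<d}) \<subseteq> V" by (rule cfun.span_minimal[OF _ V]) (use LBD(1)[OF L] in auto)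
  show "V \<subseteq> cfun.span (g ` {..<d})"
  proof
   fix f assume f: "f \<in> V"
   have "(\<Sum>i<d. cscale (f (z i)) (g i)) \<in> cfun.span (g ` {..<d})"
    by (intro cfun.span_sum cfun.span_scale cfun.span_base imageI) simp
   then show "f \<in> cfun.span (g ` {..<d})" using LBD(4)[OF L f] by metis
  qed
 qed
 have "card (g ` {..<d}) = cfun.dim V"
  by (rule cfun.basis_card_eq_dim) (use span ind cfun.span_superset[of "g ` {..<d}"] in auto)
 then show "cfun.dim V = d" by (simp add: card_image[OF inj])
qed

lemma sum_set_nth: "distinct bs ==> (\<Sum>v\<in>set bs. F v) = (\<Sum>i<length bs. F (bs ! i))"
 by (rule sum.reindex_bij_betw[symmetric]) (rule bij_betw_nth, auto)

text \<open>The definite description requires that all bases give the same polynomial. For another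
  basis, the matrix \<open>P\<close> of its values at the points \<open>z i\<close> is the change of
  basis; it is invertible because the \<open>g j\<close> expand in that basis.\<close>

lemma char_poly_on_eq:
 assumes L: "LB V d g z" and V: "cfun.subspace V" and T: "!!f. f \<in> V ==> T f \<in> V" and lin: "lincomb_hom T"
 shows "char_poly_on V T = char_poly (LM T d g z)"
 unfolding char_poly_on_def
proof (rule the_equality)
 note B = LB_basis[OF L V]
 let ?A = "LM T d g z"
 have exp: "T (g j) = (\<Sum>i<d. cscale (?A $$ (i, j)) (g i))" if "j < d" for j
 proof -
  have "T (g j) = (\<Sum>i<d. cscale (T (g j) (z i)) (g i))" by (rule LBD(4)[OF L T[OF LBD(1)[OF L that]]])
  also have "\<dots> = (\<Sum>i<d. cscale (?A $$ (i, j)) (g i))" by (rule sum.cong) (use that in \<open>auto simp: LM_def\<close>)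
  finally show ?thesis .
 qed
 show "\<exists>bs A. distinct bs \<and> cfun.independent (set bs) \<and> cfun.span (set bs) = V \<and>
  A \<in> carrier_mat (length bs) (length bs) \<and>
  (\<forall>j<length bs. T (bs ! j) = (\<Sum>i<length bs. cscale (A $$ (i, j)) (bs ! i))) \<and> char_poly ?A = char_poly A"
 proof (intro exI conjI)
  have s: "set (map g [0..<d]) = g ` {..<d}" by auto
  show "distinct (map g [0..<d])" using B(1) by (simp add: distinct_map atLeast0LessThan)
  show "cfun.independent (set (map g [0..<d]))" unfolding s by (rule B(2))
  show "cfun.span (set (map g [0..<d])) = V" unfolding s by (rule B(3))
  show "?A \<in> carrier_mat (length (map g [0..<d])) (length (map g [0..<d]))" by (simp add: LM_def)
  show "\<forall>j<length (map g [0..<d]). T (map g [0..<d] ! j) = (\<Sum>i<length (map g [0..<d]). cscale (?A $$ (i, j)) (map g [0..<d] ! i))"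
  proof (intro allI impI)
   fix j assume "j < length (map g [0..<d])"
   then have j: "j < d" by simp
   have "(\<Sum>i<length (map g [0..<d]). cscale (?A $$ (i, j)) (map g [0..<d] ! i)) = (\<Sum>i<d. cscale (?A $$ (i, j)) (g i))"
    by (rule sum.cong) auto
   then show "T (map g [0..<d] ! j) = (\<Sum>i<length (map g [0..<d]). cscale (?A $$ (i, j)) (map g [0..<d] ! i))"
    using exp[OF j] j by simp
  qed
 qed (rule refl)
 fix p
 assume "\<exists>bs A. distinct bs \<and> cfun.independent (set bs) \<and> cfun.span (set bs) = V \<and>
  A \<in> carrier_mat (length bs) (length bs) \<and>
  (\<forall>j<length bs. T (bs ! j) = (\<Sum>i<length bs. cscale (A $$ (i, j)) (bs ! i))) \<and> p = char_poly A"
 then obtain bs A where bs: "distinct bs" "cfun.independent (set bs)" "cfun.span (set bs) = V"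
  and A0: "A \<in> carrier_mat (length bs) (length bs)"
  and TA0: "!!j. j < length bs ==> T (bs ! j) = (\<Sum>i<length bs. cscale (A $$ (i, j)) (bs ! i))" and p: "p = char_poly A"
  by (elim exE conjE) (rule that, auto)
 have sub: "set bs \<subseteq> V" using cfun.span_superset[of "set bs"] bs(3) by simp
 have "card (set bs) = cfun.dim V" by (rule cfun.basis_card_eq_dim) (use sub bs in auto)
 then have len: "length bs = d" using distinct_card[OF bs(1)] B(4) by simp
 have A: "A \<in> carrier_mat d d" using A0 len by simp
 have TA: "T (bs ! j) = (\<Sum>i<d. cscale (A $$ (i, j)) (bs ! i))" if "j < d" for j using TA0[of j] that len by simp
 have bsV: "bs ! j \<in> V" if "j < d" for j using sub that len by auto
 define P where "P = mat d d (\<lambda>(i, j). (bs ! j) (z i))"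
 have P: "P \<in> carrier_mat d d" by (simp add: P_def)
 have cA: "?A \<in> carrier_mat d d" by (simp add: LM_def)
 have "\<exists>u. g j = (\<Sum>i<d. cscale (u i) (bs ! i))" if "j < d" for j
 proof -
  have "g j \<in> cfun.span (set bs)" using LBD(1)[OF L that] bs(3) by simp
  then obtain u where u: "g j = (\<Sum>v\<in>set bs. cscale (u v) v)" unfolding cfun.span_finite[OF finite_set] by (rule rangeE)
  have "g j = (\<Sum>i<d. cscale (u (bs ! i)) (bs ! i))"
   unfolding u sum_set_nth[OF bs(1)] len ..
  then show ?thesis by (rule exI[of _ "\<lambda>i. u (bs ! i)"])
 qed
 then obtain u where u: "!!j. j < d ==> g j = (\<Sum>i<d. cscale (u j i) (bs ! i))" by metis
 define Q where "Q = mat d d (\<lambda>(i, j). u j i)"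
 have Q: "Q \<in> carrier_mat d d" by (simp add: Q_def)
 have PQ: "P * Q = 1\<^sub>m d"
 proof (rule eq_matI)
  fix i j assume "i < dim_row (1\<^sub>m d :: complex mat)" "j < dim_col (1\<^sub>m d :: complex mat)"
  then have ij: "i < d" "j < d" by simp_all
  have "(P * Q) $$ (i, j) = (\<Sum>k<d. (bs ! k) (z i) * u j k)"
   using ij by (simp add: P_def Q_def scalar_prod_def atLeast0LessThan)
  also have "\<dots> = g j (z i)" unfolding u[OF ij(2)] sum_cscale_apply by (simp add: mult.commute)
  finally show "(P * Q) $$ (i, j) = 1\<^sub>m d $$ (i, j)" using LBD(3)[OF L ij] ij by simp
 qed (simp_all add: P_def Q_def)
 have QP: "Q * P = 1\<^sub>m d" by (rule mat_mult_left_right_inverse[OF P Q PQ])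
 have AP: "?A * P = P * A"
 proof (rule eq_matI)
  fix i j assume "i < dim_row (P * A)" "j < dim_col (P * A)"
  then have ij: "i < d" "j < d" using A by (simp_all add: P_def)
  have "(?A * P) $$ (i, j) = (\<Sum>k<d. T (g k) (z i) * (bs ! j) (z k))"
   using ij by (simp add: P_def LM_def scalar_prod_def atLeast0LessThan)
  also have "\<dots> = T (\<Sum>k<d. cscale ((bs ! j) (z k)) (g k)) (z i)"
   using lin unfolding lincomb_hom_def by (simp add: sum_cscale_apply mult.commute)
  also have "(\<Sum>k<d. cscale ((bs ! j) (z k)) (g k)) = bs ! j" by (rule LBD(4)[OF L bsV[OF ij(2)], symmetric])
  also have "T (bs ! j) (z i) = (\<Sum>k<d. (bs ! k) (z i) * A $$ (k, j))" unfolding TA[OF ij(2)] sum_cscale_apply by (simp add: mult.commute)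
  also have "\<dots> = (P * A) $$ (i, j)" using ij A by (simp add: P_def scalar_prod_def atLeast0LessThan)
  finally show "(?A * P) $$ (i, j) = (P * A) $$ (i, j)" .
 qed (use A in \<open>simp_all add: P_def LM_def\<close>)
 have "similar_mat ?A A"
 proof (rule similar_matI[OF _ PQ QP])
  show "{?A, A, P, Q} \<subseteq> carrier_mat d d" using cA A P Q by simp
  have "?A = ?A * (P * Q)" using cA by (simp add: PQ)
  also have "\<dots> = (?A * P) * Q" by (rule assoc_mult_mat[symmetric, OF cA P Q])
  finally show "?A = P * A * Q" unfolding AP .
 qed
 then show "p = char_poly ?A" unfolding p by (rule char_poly_similar[symmetric])
qed

lemma trace_mult_comm:
 fixes X Y :: "complex mat"
 assumes "X \<in> carrier_mat d d" "Y \<in> carrier_mat d d"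
 shows "(\<Sum>i<d. (X * Y) $$ (i, i)) = (\<Sum>i<d. (Y * X) $$ (i, i))"
proof -
 have "(\<Sum>i<d. (X * Y) $$ (i, i)) = (\<Sum>i<d. \<Sum>j<d. X $$ (i, j) * Y $$ (j, i))"
  by (rule sum.cong) (use assms in \<open>auto simp: scalar_prod_def atLeast0LessThan\<close>)
 also have "\<dots> = (\<Sum>j<d. \<Sum>i<d. X $$ (i, j) * Y $$ (j, i))" by (rule sum.swap)
 also have "\<dots> = (\<Sum>j<d. (Y * X) $$ (j, j))"
  by (rule sum.cong) (use assms in \<open>auto simp: scalar_prod_def atLeast0LessThan mult.commute\<close>)
 finally show ?thesis .
qed

text \<open>Schur triangularisation: the traces of a matrix and of its square are similarity
  invariants, and the square of a triangular matrix has the squares of the diagonal entries on its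
  diagonal.\<close>

lemma eigenvalue_list:
 fixes A :: "complex mat"
 assumes A: "A \<in> carrier_mat d d"
 obtains es where "char_poly A = (\<Prod>e\<leftarrow>es. [:- e, 1:])" "length es = d" "!!e. e \<in> set es ==> eigenvalue A e"
  "psum 1 es = (\<Sum>i<d. A $$ (i, i))" "psum 2 es = (\<Sum>i<d. \<Sum>j<d. A $$ (i, j) * A $$ (j, i))"
proof -
 obtain es where es: "char_poly A = (\<Prod>e\<leftarrow>es. [:- e, 1:])" "length es = d" using char_poly_factorized[OF A] by blast
 obtain B P Q where "schur_decomposition A es = (B, P, Q)" by (cases "schur_decomposition A es") auto
 from schur_decomposition[OF A es(1) this] have w: "similar_mat_wit A B P Q" and tri: "upper_triangular B" and diag: "diag_mat B = es" by auto
 note W = similar_mat_witD2[OF A w]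
 have tr: "(\<Sum>i<d. (P * X * Q) $$ (i, i)) = (\<Sum>i<d. X $$ (i, i))" if X: "X \<in> carrier_mat d d" for X
 proof -
  have "(\<Sum>i<d. (P * X * Q) $$ (i, i)) = (\<Sum>i<d. (Q * (P * X)) $$ (i, i))"
   by (rule trace_mult_comm) (use W X in auto)
  also have "Q * (P * X) = (Q * P) * X" by (rule assoc_mult_mat[symmetric, OF W(7) W(6) X])
  also have "\<dots> = X" using W(2) X by simp
  finally show ?thesis .
 qed
 have dB: "dim_row B = d" "dim_col B = d" using W(5) by auto
 have ps: "psum i es = (\<Sum>k<d. B $$ (k, k) ^ i)" for i
  unfolding psum_def diag[symmetric] diag_mat_def by (simp add: dB o_def interv_sum_list_conv_sum_set_nat atLeast0LessThan)
 show ?thesis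
 proof (rule that[OF es])
  show "eigenvalue A e" if "e \<in> set es" for e
  proof -
   have "poly (\<Prod>e\<leftarrow>es. [:- e, 1:]) e = 0" using that by (induction es) auto
   then show ?thesis unfolding eigenvalue_root_char_poly[OF A] es(1) .
  qed
  have "(\<Sum>i<d. A $$ (i, i)) = (\<Sum>i<d. B $$ (i, i))" unfolding W(3) by (rule tr[OF W(5)])
  then show "psum 1 es = (\<Sum>i<d. A $$ (i, i))" by (simp add: ps)
  have "P * B * Q * (P * B * Q) = P * (B * B) * Q"
  proof -
   have BQ: "B * Q \<in> carrier_mat d d" and PBQ: "P * (B * Q) \<in> carrier_mat d d" using W by auto
   have "P * B * Q = P * (B * Q)" using W by (intro assoc_mult_mat) auto
   then have "P * B * Q * (P * B * Q) = P * (B * Q) * (P * (B * Q))" by metis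
   also have "\<dots> = P * (B * Q * (P * (B * Q)))" by (rule assoc_mult_mat[OF W(6) BQ PBQ])
   also have "B * Q * (P * (B * Q)) = B * (Q * (P * (B * Q)))" by (rule assoc_mult_mat[OF W(5) W(7) PBQ])
   also have "Q * (P * (B * Q)) = Q * P * (B * Q)" by (rule assoc_mult_mat[OF W(7) W(6) BQ, symmetric])
   also have "\<dots> = B * Q" unfolding W(2) by (rule left_mult_one_mat[OF BQ])
   also have "B * (B * Q) = B * B * Q" by (rule assoc_mult_mat[OF W(5) W(5) W(7), symmetric])
   also have "P * (B * B * Q) = P * (B * B) * Q" using W by (intro assoc_mult_mat[symmetric]) auto
   finally show ?thesis .
  qed
  then have "(\<Sum>i<d. (A * A) $$ (i, i)) = (\<Sum>i<d. (P * (B * B) * Q) $$ (i, i))" using W(3) by metis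
  also have "\<dots> = (\<Sum>i<d. (B * B) $$ (i, i))" by (rule tr) (use W in auto)
  also have "\<dots> = (\<Sum>i<d. B $$ (i, i) ^ 2)"
  proof (rule sum.cong[OF refl])
   fix i assume "i \<in> {..<d}"
   then have i: "i < d" by simp
   have "(B * B) $$ (i, i) = (\<Sum>j<d. B $$ (i, j) * B $$ (j, i))"
    using i dB by (simp add: scalar_prod_def atLeast0LessThan)
   also have "\<dots> = (\<Sum>j<d. if j = i then B $$ (i, i) ^ 2 else 0)"
   proof (rule sum.cong[OF refl])
    fix j assume "j \<in> {..<d}"
    then have j: "j < d" by simp
    show "B $$ (i, j) * B $$ (j, i) = (if j = i then B $$ (i, i) ^ 2 else 0)"
     using tri i j dB unfolding upper_triangular_def by (cases i j rule: linorder_cases) (auto simp: power2_eq_square)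
   qed
   also have "\<dots> = B $$ (i, i) ^ 2" using i by simp
   finally show "(B * B) $$ (i, i) = B $$ (i, i) ^ 2" .
  qed
  finally have "psum 2 es = (\<Sum>i<d. (A * A) $$ (i, i))" by (simp add: ps)
  also have "\<dots> = (\<Sum>i<d. \<Sum>j<d. A $$ (i, j) * A $$ (j, i))"
   by (rule sum.cong) (use A in \<open>auto simp: scalar_prod_def atLeast0LessThan\<close>)
  finally show "psum 2 es = (\<Sum>i<d. \<Sum>j<d. A $$ (i, j) * A $$ (j, i))" .
 qed
qed

lemma LB_eigenfunction:
 assumes L: "LB V d g z" and V: "cfun.subspace V" and T: "!!f. f \<in> V ==> T f \<in> V" and lin: "lincomb_hom T"
  and e: "eigenvalue (LM T d g z) e"
 obtains f i where "f \<in> V" "T f = cscale e f" "i < d" "f (z i) \<noteq> 0"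
proof -
 obtain v where v: "v \<in> carrier_vec d" "v \<noteq> 0\<^sub>v d" "LM T d g z *\<^sub>v v = e \<cdot>\<^sub>v v"
  using e unfolding eigenvalue_def eigenvector_def by (auto simp: LM_def)
 define f where "f = (\<Sum>j<d. cscale (v $ j) (g j))"
 have fV: "f \<in> V" unfolding f_def by (intro cfun.subspace_sum V cfun.subspace_scale LBD(1)[OF L]) auto
 have fz: "f (z i) = v $ i" if "i < d" for i
 proof -
  have "f (z i) = (\<Sum>j<d. v $ j * (if i = j then 1 else 0))"
   unfolding f_def sum_cscale_apply by (rule sum.cong) (use LBD(3)[OF L that] in auto)
  then show ?thesis unfolding sum_kronecker[OF that] .
 qed
 have Tz: "T f (z i) = e * f (z i)" if i: "i < d" for i
 proof -
  have "T f = (\<Sum>j<d. cscale (v $ j) (T (g j)))" unfolding f_def using lin unfolding lincomb_hom_def by blast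
  then have "T f (z i) = (\<Sum>j<d. T (g j) (z i) * v $ j)" by (simp add: sum_cscale_apply mult.commute)
  also have "\<dots> = (LM T d g z *\<^sub>v v) $ i" using i v(1) by (simp add: LM_def scalar_prod_def atLeast0LessThan)
  also have "\<dots> = e * f (z i)" unfolding v(3) using i v(1) by (simp add: fz)
  finally show ?thesis .
 qed
 have "T f = (\<Sum>i<d. cscale (T f (z i)) (g i))" by (rule LBD(4)[OF L T[OF fV]])
 also have "\<dots> = (\<Sum>i<d. cscale ((cscale e f) (z i)) (g i))" by (rule sum.cong) (auto simp: Tz cscale_def)
 also have "\<dots> = cscale e f" by (rule LBD(4)[OF L, symmetric]) (rule cfun.subspace_scale[OF V fV])
 finally have Tf: "T f = cscale e f" .
 obtain i where "i < d" "v $ i \<noteq> 0" using v(1,2) by (metis carrier_vecD eq_vecI index_zero_vec(1) index_zero_vec(2))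
 then show ?thesis using that[OF fV Tf] fz by metis
qed


subsection \<open>Traces of Hecke operators\<close>

text \<open>The weight \<kappa> by which traces are divided; up to the sign and 4^n it is
  \<open>hc n\<close>.\<close>

definition tw :: "nat => real" where "tw n = 1 / hypJ (2 * n)"

lemma tw_pos: "n \<ge> 1 ==> tw n > 0"
 unfolding tw_def using hypJ_pos[of "2 * n"] by simp

lemma tw_le:
 assumes "n \<ge> 1"
 shows "tw n \<le> exp 8 * real n"
proof -
 have "tw n \<le> 1 / (4 * exp (- 8) / real (2 * n))"
  unfolding tw_def by (rule divide_left_mono) (use hypJ_lower_bound[of "2 * n"] hypJ_pos[of "2 * n"] assms in auto)
 also have "\<dots> = exp 8 * real n / 2" by (simp add: exp_minus field_simps)
 also have "\<dots> \<le> exp 8 * real n" by simp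
 finally show ?thesis .
qed

lemma tw_at_top: "filterlim tw at_top sequentially"
proof -
 have "(\<lambda>n. hypJ (2 * n)) \<longlonglongrightarrow> 0"
  using LIMSEQ_subseq_LIMSEQ[OF hypJ_tendsto_0, of "\<lambda>n. 2 * n"] by (simp add: strict_mono_def o_def)
 moreover have "\<forall>\<^sub>F n in sequentially. 0 < hypJ (2 * n)"
  using eventually_ge_at_top[of 1] by eventually_elim (rule hypJ_pos, simp)
 ultimately have "filterlim (\<lambda>n. inverse (hypJ (2 * n))) at_top sequentially" by (rule filterlim_inverse_at_top)
 then show ?thesis by (simp add: tw_def[abs_def] inverse_eq_divide)
qed

lemma log_over_sqrt: "a > 0 ==> (\<lambda>n. (ln (2 * (real n * a)) + 1) / sqrt (real n)) \<longlonglongrightarrow> 0"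
 by real_asymp

text \<open>The sign and 4^n in \<open>hc\<close> have been moved into \<open>ks\<close>, so
  division by \<open>tw n\<close> leaves the integral of
  \<open>fphi N w * ks n N \<sigma> I b w\<close>. The constant C is chosen before n and the basis,
  which makes the estimate uniform in the weight.\<close>

lemma trace_estimate:
 assumes N: "N > 0" and s: "sign_pattern N \<sigma>"
  and I: "finite I" "!!i. i \<in> I ==> idet (b i) > 0"
  and U: "!!n f. n \<ge> 4 ==> f \<in> Vsp n N \<sigma> ==> opU n I b f \<in> Vsp n N \<sigma>"
 shows "\<exists>C\<ge>0. \<forall>n\<ge>4. \<forall>d g z. LB (Vsp n N \<sigma>) d g z -->
  cmod ((\<Sum>j<d. opU n I b (g j) (z j)) / of_real (tw n) - s0 N \<sigma> I b * of_real (fvol N))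
   \<le> C * (1 / real n + sqtot N I b * ((ln (2 * (real n * real N)) + 1) / sqrt (real n)))"
proof -
 obtain C where C: "C \<ge> 0" and est: "!!n. n \<ge> 4 ==> integrable hyp (\<lambda>w. of_real (fphi N w) * ks n N \<sigma> I b w) ==>
  cmod ((\<integral>w. of_real (fphi N w) * ks n N \<sigma> I b w \<partial>hyp) - s0 N \<sigma> I b * of_real (fvol N))
   \<le> C * (1 / real n + sqtot N I b * ((ln (2 * (real n * real N)) + 1) / sqrt (real n)))"
  using ks_integral_estimate[where I=I and b=b, OF N s I U] by auto
 have "cmod ((\<Sum>j<d. opU n I b (g j) (z j)) / of_real (tw n) - s0 N \<sigma> I b * of_real (fvol N))
   \<le> C * (1 / real n + sqtot N I b * ((ln (2 * (real n * real N)) + 1) / sqrt (real n)))"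
  if n: "n \<ge> 4" and L: "LB (Vsp n N \<sigma>) d g z" for n d g z
 proof -
  define J where "J = (\<integral>w. of_real (fphi N w) * (of_real (Im w ^ (2 * n)) * trker n N \<sigma> I b w) \<partial>hyp)"
  define a where "a = complex_of_real ((-1) ^ n * 4 ^ n)"
  have tf: "integrable hyp (\<lambda>w. of_real (fphi N w) * (of_real (Im w ^ (2 * n)) * trker n N \<sigma> I b w))"
   "(\<Sum>j<d. opU n I b (g j) (z j)) = hc n * J"
   unfolding J_def by (rule trace_formula[where d=d and g=g and z=z, OF N s n I U[OF n] LBD(1)[OF L] LBD(2)[OF L] LBD(4)[OF L]]; assumption)+
  have ks: "(\<lambda>w. of_real (fphi N w) * ks n N \<sigma> I b w) = (\<lambda>w. a * (of_real (fphi N w) * (of_real (Im w ^ (2 * n)) * trker n N \<sigma> I b w)))"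
   by (simp add: ks_def a_def fun_eq_iff)
  have int: "integrable hyp (\<lambda>w. of_real (fphi N w) * ks n N \<sigma> I b w)"
   unfolding ks by (rule integrable_mult_right[OF tf(1)])
  have "(\<integral>w. of_real (fphi N w) * ks n N \<sigma> I b w \<partial>hyp) = a * J"
   unfolding ks J_def by (rule integral_mult_right_zero)
  moreover have "(\<Sum>j<d. opU n I b (g j) (z j)) / of_real (tw n) = a * J"
   unfolding tf(2) hc_def tw_def a_def using hypJ_pos[of "2 * n"] n by simp
  ultimately show ?thesis using est[OF n int] by simp
 qed
 then show ?thesis using C by blast
qed

lemma HeckeU_opU: "HeckeU n m f = opU n (HB m) (\<lambda>\<beta>. \<beta>) f"
 by (simp add: HeckeU_def opU_def)

lemma HeckeU_HeckeU_opU: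
 assumes m: "m > 0" and zero: "!!z. Im z \<le> 0 ==> f z = 0"
 shows "HeckeU n m (HeckeU n m f) = opU n (HB m \<times> HB m) (\<lambda>p. imul (fst p) (snd p)) f"
proof
 fix z
 have d: "idet \<beta> > 0" if "\<beta> \<in> HB m" for \<beta> using HB_idet[OF that] m by simp
 have "HeckeU n m (HeckeU n m f) z = (\<Sum>\<beta>'\<in>HB m. \<Sum>\<beta>\<in>HB m. sl n \<beta>' (sl n \<beta> f) z)"
  unfolding HeckeU_def sl_sum ..
 also have "\<dots> = (\<Sum>\<beta>\<in>HB m. \<Sum>\<beta>'\<in>HB m. sl n \<beta>' (sl n \<beta> f) z)" by (rule sum.swap)
 also have "\<dots> = (\<Sum>\<beta>\<in>HB m. \<Sum>\<beta>'\<in>HB m. sl n (imul \<beta> \<beta>') f z)"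
  by (intro sum.cong refl fun_cong[OF sl_imul_zero[where f=f, OF zero d d, symmetric]])
 also have "\<dots> = opU n (HB m \<times> HB m) (\<lambda>p. imul (fst p) (snd p)) f z"
  by (simp add: opU_def sum.cartesian_product case_prod_unfold)
 finally show "HeckeU n m (HeckeU n m f) z = opU n (HB m \<times> HB m) (\<lambda>p. imul (fst p) (snd p)) f z" .
qed

text \<open>Q is coprime to m, so if Q m were a square, m would be one too.\<close>

lemma nonsquare_mult:
 assumes "N > 0" "exact_divisor Q N" "coprime N m" "\<not> is_square m" "m > 0"
 shows "a * a \<noteq> int Q * int m"
proof
 assume eq: "a * a = int Q * int m"
 have "coprime Q m" by (rule coprime_divisors[of Q N m m]) (use assms in \<open>auto simp: exact_divisor_def\<close>)
 moreover have "Q > 0" by (rule exact_divisor_pos[OF assms(1,2)])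
 moreover have "nat \<bar>a\<bar> ^ 2 = Q * m"
 proof -
  have "int (nat \<bar>a\<bar> ^ 2) = \<bar>a\<bar>\<^sup>2" by simp
  also have "\<dots> = a * a" by (simp only: power2_abs power2_eq_square)
  also have "\<dots> = int (Q * m)" using eq by simp
  finally show ?thesis by (simp only: of_nat_eq_iff)
 qed
 then have "\<exists>y. Q * m = y ^ 2" by - (rule exI[of _ "nat \<bar>a\<bar>"], rule sym)
 then have "is_square (Q * m)" by (simp only: is_nth_power_def)
 ultimately show False using is_nth_power_mult_coprime_natD(2)[of Q m 2] assms by blast
qed

text \<open>A scalar or parabolic matrix with diagonal entry a has determinant a^2, while all
  determinants here are of the form Q m. So the main term and the slow error term both
  vanish.\<close>

lemma HB_nonscalar:
 assumes N: "N > 0" and m: "m > 0" and cop: "coprime N m" and sq: "\<not> is_square m"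
 shows "s0 N \<sigma> (HB m) (\<lambda>\<beta>. \<beta>) = 0" "sqtot N (HB m) (\<lambda>\<beta>. \<beta>) = 0"
proof -
 have "scs N \<beta> = {}" if "\<beta> \<in> HB m" for \<beta>
 proof (rule ccontr)
  assume "scs N \<beta> \<noteq> {}"
  then obtain g a where g: "g \<in> ALG N" "imul g \<beta> = (a, 0, 0, a)" by (auto simp: scs_def isc_def)
  then obtain Q where Q: "exact_divisor Q N" "g \<in> AL N Q" by (auto simp: ALG_def)
  have "idet g * idet \<beta> = a * a" using arg_cong[OF g(2), of idet] by simp
  then show False using nonsquare_mult[OF N Q(1) cop sq m, of a] AL_idet[OF Q(2)] HB_idet[OF that] by simp
 qed
 then show "s0 N \<sigma> (HB m) (\<lambda>\<beta>. \<beta>) = 0" by (simp add: s0_def)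
 have "sqn (int Q * idet \<beta>) = 0" if "\<beta> \<in> HB m" "exact_divisor Q N" for \<beta> Q
  using nonsquare_mult[OF N that(2) cop sq m] HB_idet[OF that(1)] by (simp add: sqn_def)
 then show "sqtot N (HB m) (\<lambda>\<beta>. \<beta>) = 0" by (simp add: sqtot_def)
qed

text \<open>Both Hecke factors are upper triangular. If their product with g on the left is scalar,
  then g is upper triangular too, with diagonal entries divisible by Q and product Q; hence Q = 1
  and the sign is 1. So the sum merely counts matrices, of which there is at least one.\<close>

lemma HB_square_scalars:
 assumes N: "N > 0" and m: "m > 0" and s: "sign_pattern N \<sigma>"
 shows "\<exists>S>0. s0 N \<sigma> (HB m \<times> HB m) (\<lambda>p. imul (fst p) (snd p)) = of_real S"
proof -
 let ?I = "HB m \<times> HB m" and ?b = "\<lambda>p. imul (fst p) (snd p)"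
 have chi1: "chi \<sigma> g = 1" if p: "p \<in> ?I" and g: "g \<in> scs N (?b p)" for p g
 proof -
  obtain \<beta> \<beta>' where b: "p = (\<beta>, \<beta>')" "\<beta> \<in> HB m" "\<beta>' \<in> HB m" using p by blast
  obtain a1 b1 d1 where 1: "\<beta> = (a1, b1, 0, d1)" "a1 > 0" using b(2) by (auto simp: HB_def)
  obtain a2 b2 d2 where 2: "\<beta>' = (a2, b2, 0, d2)" "a2 > 0" using b(3) by (auto simp: HB_def)
  obtain Q where Q: "exact_divisor Q N" "g \<in> AL N Q" using g by (auto simp: scs_def ALG_def)
  obtain x y u v where gx: "g = (x, y, u, v)" by (cases g)
  have "isc (imul g (?b p))" using g by (simp add: scs_def)
  then have "u * (a1 * a2) = 0" by (auto simp: isc_def gx b(1) 1(1) 2(1))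
  then have u: "u = 0" using 1(2) 2(2) by simp
  have xv: "int Q dvd x" "int Q dvd v" "x * v = int Q" using Q(2) by (auto simp: AL_def gx u)
  have Qp: "Q > 0" by (rule exact_divisor_pos[OF N Q(1)])
  have "int Q * int Q dvd int Q * 1" using mult_dvd_mono[OF xv(1,2)] xv(3) by simp
  then have "int Q dvd 1" using Qp by (simp only: dvd_mult_cancel_left) simp
  then have "Q = 1" by simp
  then show ?thesis using AL_idet[OF Q(2)] s by (simp add: chi_def sign_pattern_def)
 qed
 define S where "S = (\<Sum>p\<in>?I. real (card (scs N (?b p))))"
 have "s0 N \<sigma> ?I ?b = (\<Sum>p\<in>?I. \<Sum>g\<in>scs N (?b p). 1)"
  unfolding s0_def by (intro sum.cong refl) (simp add: chi1)
 then have e: "s0 N \<sigma> ?I ?b = of_real S" by (simp add: S_def)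
 \<comment> \<open>The product of these two matrices is m times the identity, so g = 1
   contributes.\<close>
 define p :: "imat \<times> imat" where "p = ((1, 0, 0, int m), (int m, 0, 0, 1))"
 have p: "p \<in> ?I" using m by (auto simp: p_def HB_def)
 have "exact_divisor 1 N" by (simp add: exact_divisor_def)
 then have "(1, 0, 0, 1) \<in> ALG N" by (auto simp: ALG_def AL_def)
 then have "(1, 0, 0, 1) \<in> scs N (?b p)" by (auto simp: scs_def isc_def p_def)
 moreover have "finite (scs N (?b p))" by (rule finite_scs[OF N]) (use m in \<open>simp add: p_def\<close>)
 ultimately have "card (scs N (?b p)) > 0" by (auto simp: card_gt_0_iff)
 moreover have "finite ?I" using finite_HB[OF m] by simp
 ultimately have "S > 0" unfolding S_def using p by (intro sum_pos2[of _ p]) auto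
 then show ?thesis using e by blast
qed

lemma hecke_normalized_HeckeU:
 "m > 0 ==> n > 0 ==> hecke_normalized (2 * n) m f = cscale (of_real (1 / sqrt (real m))) (HeckeU n m f)"
 by (simp add: hecke_normalized_eq HeckeU_def cscale_def)

lemma lincomb_hom_hecke:
 assumes "m > 0" "n > 0"
 shows "lincomb_hom (hecke_normalized (2 * n) m)"
 unfolding lincomb_hom_def
proof (intro allI ext)
 fix J :: "nat set" and c g w
 define a where "a = complex_of_real (1 / sqrt (real m))"
 have T: "hecke_normalized (2 * n) m f w = a * opU n (HB m) (\<lambda>\<beta>. \<beta>) f w" for f
  unfolding hecke_normalized_HeckeU[OF assms] HeckeU_opU by (simp only: cscale_def a_def)
 show "hecke_normalized (2 * n) m (\<Sum>j\<in>J. cscale (c j) (g j)) w = (\<Sum>j\<in>J. cscale (c j) (hecke_normalized (2 * n) m (g j))) w"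
  unfolding sum_cscale_apply T opU_sum by (simp add: sum_distrib_left mult_ac)
qed

lemma hecke_normalized_Vsp:
 assumes "N > 0" "m > 0" "coprime N m" "n > 0" "f \<in> Vsp n N \<sigma>"
 shows "hecke_normalized (2 * n) m f \<in> Vsp n N \<sigma>"
 unfolding hecke_normalized_HeckeU[OF assms(2,4)]
 by (rule cfun.subspace_scale[OF Vsp_subspace HeckeU_Vsp[OF assms(1-3,5)]])

text \<open>Sup norm bound: if \<open>f\<close> has eigenvalue \<open>e\<close>, applying the operator \<open>k\<close> times gives
 \<open>\<bar>e\<bar>\<^sup>k sup \<bar>f\<bar> y\<^sup>n \<le> \<Lambda>\<^sup>k sup \<bar>f\<bar> y\<^sup>n\<close>.\<close>

lemma hecke_eigenvalue_bound:
 assumes N: "N > 0" and m: "m > 0" and cop: "coprime N m" and n: "n > 0"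
  and L: "LB (Vsp n N \<sigma>) d g z" and e: "eigenvalue (LM (hecke_normalized (2 * n) m) d g z) e"
 shows "cmod e \<le> real (card (HB m))"
proof (rule ccontr)
 define \<Lambda> where "\<Lambda> = real (card (HB m))"
 assume "\<not> cmod e \<le> real (card (HB m))"
 then have big: "cmod e > \<Lambda>" by (simp add: \<Lambda>_def)
 have "(1, 0, 0, int m) \<in> HB m" using m by (auto simp: HB_def)
 then have L0: "\<Lambda> > 0" using finite_HB[OF m] by (auto simp: \<Lambda>_def card_gt_0_iff)
 obtain f i where f: "f \<in> Vsp n N \<sigma>" and ef: "hecke_normalized (2 * n) m f = cscale e f" and i: "i < d" "f (z i) \<noteq> 0"
  using LB_eigenfunction[OF L Vsp_subspace hecke_normalized_Vsp[OF N m cop n] lincomb_hom_hecke[OF m n] e] by blast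
 obtain M where M: "!!w. Im w > 0 ==> cmod (f w) * Im w ^ n \<le> M" using VspD(4)[OF f] by blast
 have step: "cmod e ^ k * (cmod (f w) * Im w ^ n) \<le> \<Lambda> ^ k * M" if "Im w > 0" for w k
  using that
 proof (induction k arbitrary: w)
  case 0 then show ?case using M by simp
 next
  case (Suc k)
  have "e * f w = of_real (1 / sqrt (real m)) * HeckeU n m f w"
   using fun_cong[OF ef, of w] unfolding hecke_normalized_HeckeU[OF m n] by (simp only: cscale_def)
  then have "cmod e * cmod (f w) = 1 / sqrt (real m) * cmod (HeckeU n m f w)"
   by (metis norm_mult norm_of_real abs_of_nonneg zero_le_divide_1_iff real_sqrt_ge_zero of_nat_0_le_iff)
  also have "\<dots> \<le> 1 * cmod (HeckeU n m f w)" using m by (intro mult_right_mono) auto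
  also have "\<dots> \<le> (\<Sum>\<beta>\<in>HB m. cmod (sl n \<beta> f w))" unfolding HeckeU_def by (simp add: norm_sum)
  finally have 1: "cmod e * cmod (f w) \<le> (\<Sum>\<beta>\<in>HB m. cmod (sl n \<beta> f w))" .
  have "cmod e ^ Suc k * (cmod (f w) * Im w ^ n) = cmod e ^ k * (cmod e * cmod (f w) * Im w ^ n)" by simp
  also have "\<dots> \<le> cmod e ^ k * ((\<Sum>\<beta>\<in>HB m. cmod (sl n \<beta> f w)) * Im w ^ n)"
   using 1 Suc.prems by (intro mult_left_mono mult_right_mono) auto
  also have "\<dots> = (\<Sum>\<beta>\<in>HB m. cmod e ^ k * (cmod (sl n \<beta> f w) * Im w ^ n))"
   by (simp add: sum_distrib_left sum_distrib_right)
  also have "\<dots> \<le> (\<Sum>\<beta>\<in>HB m. \<Lambda> ^ k * M)"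
  proof (rule sum_mono)
   fix \<beta> assume "\<beta> \<in> HB m"
   then have d: "idet \<beta> > 0" using HB_idet[of \<beta> m] m by simp
   show "cmod e ^ k * (cmod (sl n \<beta> f w) * Im w ^ n) \<le> \<Lambda> ^ k * M"
    unfolding norm_sl[OF Suc.prems d] by (rule Suc.IH) (rule Im_imob_pos[OF Suc.prems d])
  qed
  also have "\<dots> = \<Lambda> ^ Suc k * M" by (simp add: \<Lambda>_def)
  finally show ?case .
 qed
 define x where "x = cmod (f (z i)) * Im (z i) ^ n"
 have zi: "Im (z i) > 0" by (rule LBD(2)[OF L i(1)])
 have x: "x > 0" using i(2) zi by (simp add: x_def)
 have "1 < cmod e / \<Lambda>" using big L0 by simp
 then obtain k where k: "M / x < (cmod e / \<Lambda>) ^ k" using real_arch_pow by blast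
 then have "M < (cmod e / \<Lambda>) ^ k * x" using x by (simp only: pos_divide_less_eq)
 then have "M * \<Lambda> ^ k < cmod e ^ k * x" using L0 by (simp add: power_divide pos_less_divide_eq mult.commute)
 then show False using step[OF zi, of k] by (simp add: x_def mult.commute)
qed

subsection \<open>Reality of the coefficients\<close>

text \<open>It conjugates the coefficients of the expansion at infinity and gives a real structure
  on the space. On matrices it corresponds to conjugation by the diagonal matrix with entries 1 and
  -1, which is \<open>ibar\<close>.\<close>

definition fconj :: "(complex => complex) => complex => complex" where
 "fconj f = (\<lambda>z. cnj (f (- cnj z)))"

fun ibar :: "imat => imat" where "ibar (a, b, c, d) = (a, - b, - c, d)"

lemma fconj_fconj [simp]: "fconj (fconj f) = f"
 by (simp add: fconj_def)

lemma sl_fconj: "sl n g (fconj f) = fconj (sl n (ibar g) f)"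
proof
 fix z
 obtain a b c d where g: "g = (a, b, c, d)" by (cases g)
 have 1: "iden (ibar g) (- cnj z) = cnj (iden g z)" by (simp add: g)
 have "imob (ibar g) (- cnj z) = - cnj (imob g z)" by (simp add: g add_divide_distrib diff_divide_distrib)
 then have 2: "f (imob (ibar g) (- cnj z)) = f (- cnj (imob g z))" by simp
 have 3: "idet (ibar g) = idet g" by (simp add: g)
 show "sl n g (fconj f) z = fconj (sl n (ibar g) f) z"
  by (simp add: sl_def fconj_def 1 2 3)
qed

lemma ibar_ALG: "g \<in> ALG N ==> ibar g \<in> ALG N" "chi \<sigma> (ibar g) = chi \<sigma> g"
 by (cases g; auto simp: ALG_def AL_def chi_def)+

lemma fconj_Vsp:
 assumes f: "f \<in> Vsp n N \<sigma>"
 shows "fconj f \<in> Vsp n N \<sigma>"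
proof -
 have zero: "fconj f z = 0" if "Im z \<le> 0" for z using VspD(1)[OF f, of "- cnj z"] that by (simp add: fconj_def)
 have "(\<lambda>z. f (- z)) holomorphic_on cnj ` upper_half_plane"
  by (rule holomorphic_on_compose_gen[OF _ VspD(2)[OF f], of uminus, unfolded o_def])
   (auto simp: upper_half_plane_def intro!: holomorphic_intros)
 then have "cnj \<circ> (\<lambda>z. f (- z)) \<circ> cnj holomorphic_on upper_half_plane"
  by (rule holomorphic_on_compose_cnj_cnj) (simp add: upper_half_plane_def open_halfspace_Im_gt)
 then have hol: "fconj f holomorphic_on upper_half_plane" by (simp add: fconj_def o_def)
 have inv: "sl n g (fconj f) = cscale (of_int (chi \<sigma> g)) (fconj f)" if "g \<in> ALG N" for g
  unfolding sl_fconj VspD(3)[OF f ibar_ALG(1)[OF that]] ibar_ALG(2) by (simp add: fconj_def cscale_def)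
 obtain M where M: "!!z. Im z > 0 ==> cmod (f z) * Im z ^ n \<le> M" using VspD(4)[OF f] by blast
 have "cmod (fconj f z) * Im z ^ n \<le> M" if "Im z > 0" for z using M[of "- cnj z"] that by (simp add: fconj_def)
 then show ?thesis unfolding Vsp_def using zero hol inv by blast
qed

text \<open>On \<open>HB m\<close>, complex conjugation replaces the entry \<open>b\<close> by \<open>- b\<close>, which is reduced modulo \<open>d\<close> again.\<close>

lemma HeckeU_fconj:
 assumes s: "sign_pattern N \<sigma>" and f: "f \<in> Vsp n N \<sigma>" and m: "m > 0"
 shows "HeckeU n m (fconj f) = fconj (HeckeU n m f)"
proof
 fix z
 define \<phi> where "\<phi> g = (case g of (a, b, c, d) => (a, (- b) mod d, c, d))" for g :: imat
 have inv: "\<phi> (\<phi> g) = g" "\<phi> g \<in> HB m" if "g \<in> HB m" for g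
  using that by (auto simp: \<phi>_def HB_def mod_minus_eq)
 have bij: "bij_betw \<phi> (HB m) (HB m)" by (rule bij_betw_byWitness[of _ \<phi>]) (use inv in auto)
 have sl: "sl n (ibar g) f = sl n (\<phi> g) f" if g: "g \<in> HB m" for g
 proof -
  obtain a b d where gg: "g = (a, b, 0, d)" using g by (auto simp: HB_def)
  let ?t = "(1, (- b) div d, 0, 1)"
  have t: "?t \<in> AL N 1" by (simp add: AL_def)
  have "ibar g = imul ?t (\<phi> g)" by (simp add: gg \<phi>_def)
  then have "sl n (ibar g) f = sl n (imul ?t (\<phi> g)) f" by simp
  also have "\<dots> = sl n (\<phi> g) (sl n ?t f)"
   by (rule sl_imul_zero[where f=f, OF VspD(1)[OF f]]) (use HB_idet[OF inv(2)[OF g]] m in auto)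
  also have "sl n ?t f = f" by (rule Vsp_AL1[OF s f t])
  finally show ?thesis .
 qed
 have "HeckeU n m (fconj f) z = (\<Sum>g\<in>HB m. fconj (sl n (\<phi> g) f) z)"
  unfolding HeckeU_def sl_fconj by (rule sum.cong) (simp_all add: sl)
 also have "\<dots> = (\<Sum>g\<in>HB m. fconj (sl n g f) z)" by (rule sum.reindex_bij_betw[OF bij])
 also have "\<dots> = fconj (HeckeU n m f) z" by (simp add: fconj_def HeckeU_def)
 finally show "HeckeU n m (fconj f) z = fconj (HeckeU n m f) z" .
qed

lemma LB_fconj:
 assumes L: "LB (Vsp n N \<sigma>) d g z"
 shows "LB (Vsp n N \<sigma>) d (\<lambda>i. fconj (g i)) (\<lambda>i. - cnj (z i))"
 unfolding LB_def
proof (intro conjI allI impI ballI)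
 fix i assume i: "i < d"
 show "fconj (g i) \<in> Vsp n N \<sigma>" by (rule fconj_Vsp[OF LBD(1)[OF L i]])
 show "Im (- cnj (z i)) > 0" using LBD(2)[OF L i] by simp
 fix j assume j: "j < d"
 show "fconj (g j) (- cnj (z i)) = (if i = j then 1 else 0)" using LBD(3)[OF L i j] by (simp add: fconj_def)
next
 fix f assume f: "f \<in> Vsp n N \<sigma>"
 show "f = (\<Sum>i<d. cscale (f (- cnj (z i))) (fconj (g i)))"
 proof
  fix w
  have "fconj f (- cnj w) = (\<Sum>i<d. cscale (fconj f (z i)) (g i)) (- cnj w)"
   using LBD(4)[OF L fconj_Vsp[OF f]] by (rule fun_cong)
  then have "cnj (fconj f (- cnj w)) = (\<Sum>i<d. cnj (fconj f (z i)) * cnj (g i (- cnj w)))"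
   by (simp add: sum_cscale_apply)
  then show "f w = (\<Sum>i<d. cscale (f (- cnj (z i))) (fconj (g i))) w"
   by (simp add: sum_cscale_apply fconj_def)
 qed
qed

text \<open>In the conjugate interpolation basis the operator has the conjugate matrix. The
  characteristic polynomial does not depend on the basis, so it equals its own conjugate.\<close>

lemma char_poly_on_real:
 assumes N: "N > 0" and m: "m > 0" and cop: "coprime N m" and n: "n > 0" and s: "sign_pattern N \<sigma>"
  and L: "LB (Vsp n N \<sigma>) d g z"
 shows "coeff (char_poly_on (Vsp n N \<sigma>) (hecke_normalized (2 * n) m)) k \<in> \<real>"
proof -
 let ?T = "hecke_normalized (2 * n) m"
 let ?A = "LM ?T d g z"
 interpret c: comm_ring_hom cnj by unfold_locales auto
 have cp: "char_poly_on (Vsp n N \<sigma>) ?T = char_poly (LM ?T d g z)" if "LB (Vsp n N \<sigma>) d g z" for d g z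
  by (rule char_poly_on_eq[OF that Vsp_subspace hecke_normalized_Vsp[OF N m cop n] lincomb_hom_hecke[OF m n]])
 have "LM ?T d (\<lambda>i. fconj (g i)) (\<lambda>i. - cnj (z i)) = map_mat cnj ?A"
 proof (rule eq_matI)
  fix i j assume "i < dim_row (map_mat cnj ?A)" "j < dim_col (map_mat cnj ?A)"
  then have ij: "i < d" "j < d" by (simp_all add: LM_def)
  have "?T (fconj (g j)) (- cnj (z i)) = cnj (?T (g j) (z i))"
   unfolding hecke_normalized_HeckeU[OF m n] HeckeU_fconj[OF s LBD(1)[OF L ij(2)] m]
   by (simp add: cscale_def fconj_def)
  then show "LM ?T d (\<lambda>i. fconj (g i)) (\<lambda>i. - cnj (z i)) $$ (i, j) = map_mat cnj ?A $$ (i, j)"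
   using ij by (simp add: LM_def)
 qed (simp_all add: LM_def)
 then have "char_poly (map_mat cnj ?A) = char_poly ?A" using cp[OF L] cp[OF LB_fconj[OF L]] by simp
 moreover have "char_poly (map_mat cnj ?A) = map_poly cnj (char_poly ?A)" by (rule c.char_poly_hom[of _ d]) (simp add: LM_def)
 ultimately have "coeff (char_poly ?A) k = cnj (coeff (char_poly ?A) k)" by (metis coeff_map_poly complex_cnj_zero)
 then show ?thesis unfolding cp[OF L] Reals_cnj_iff by simp
qed

subsection \<open>Asymptotics in the weight\<close>

lemma Vsp_LB:
 assumes "N > 0" "n > 0" "sign_pattern N \<sigma>"
 obtains d g z where "LB (Vsp n N \<sigma>) d g z"
proof (rule Vsp_lagrange[OF assms])
 fix d :: nat and g z
 assume a: "!!i. i < d ==> g i \<in> Vsp n N \<sigma>" "!!i. i < d ==> Im (z i) > 0"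
  "!!i j. i < d ==> j < d ==> g j (z i) = (if i = j then 1 else 0)"
  "!!f. f \<in> Vsp n N \<sigma> ==> f = (\<Sum>i<d. cscale (f (z i)) (g i))"
 have "LB (Vsp n N \<sigma>) d g z" unfolding LB_def by (intro conjI allI impI ballI a)
 then show thesis by (rule that)
qed

text \<open>The trace estimate is applied three times: to the identity, which bounds the dimension,
  to \<open>HB m\<close> for the first power sum, and to \<open>HB m \<times> HB m\<close> for the
  second. C, M and E do not depend on n-specific choices such as the basis.\<close>

lemma spectral_data:
 assumes N: "N > 0" and m: "m > 0" and cop: "coprime N m" and sq: "\<not> is_square m" and s: "sign_pattern N \<sigma>"
 shows "\<exists>C M E. M > 0 \<and> E \<longlonglongrightarrow> 0 \<and> (\<forall>n\<ge>4. \<exists>es.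
  (\<forall>r. hecke_coeff r m N (2 * n) \<sigma> = (-1) ^ r * esym r es \<and> hecke_coeff r m N (2 * n) \<sigma> \<in> \<real>) \<and>
  (\<forall>e\<in>set es. cmod e \<le> real (card (HB m))) \<and> real (length es) \<le> C * tw n \<and>
  cmod (psum 1 es) \<le> C \<and> cmod (psum 2 es / of_real (tw n) - of_real M) \<le> E n)"
proof -
 let ?b2 = "\<lambda>p. imul (fst p) (snd p)"
 have dB: "idet \<beta> > 0" if "\<beta> \<in> HB m" for \<beta> using HB_idet[OF that] m by simp
 define R where "R n = (ln (2 * (real n * real N)) + 1) / sqrt (real n)" for n
 have R: "R \<longlonglongrightarrow> 0" unfolding R_def[abs_def] by (rule log_over_sqrt) (use N in simp)
 obtain S where S: "S > 0" "s0 N \<sigma> (HB m \<times> HB m) ?b2 = of_real S" using HB_square_scalars[OF N m s] by blast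
 have "\<exists>C\<ge>0. \<forall>n\<ge>4. \<forall>d g z. LB (Vsp n N \<sigma>) d g z -->
  cmod ((\<Sum>j<d. opU n {()} (\<lambda>_. (1, 0, 0, 1)) (g j) (z j)) / of_real (tw n) - s0 N \<sigma> {()} (\<lambda>_. (1, 0, 0, 1)) * of_real (fvol N))
   \<le> C * (1 / real n + sqtot N {()} (\<lambda>_. (1, 0, 0, 1)) * R n)"
  unfolding R_def by (rule trace_estimate[OF N s]) (simp_all add: opU_def)
 then obtain C0 where C0: "C0 \<ge> 0" "!!n d g z. n \<ge> 4 ==> LB (Vsp n N \<sigma>) d g z ==>
  cmod ((\<Sum>j<d. opU n {()} (\<lambda>_. (1, 0, 0, 1)) (g j) (z j)) / of_real (tw n) - s0 N \<sigma> {()} (\<lambda>_. (1, 0, 0, 1)) * of_real (fvol N))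
   \<le> C0 * (1 / real n + sqtot N {()} (\<lambda>_. (1, 0, 0, 1)) * R n)" by blast
 have "\<exists>C\<ge>0. \<forall>n\<ge>4. \<forall>d g z. LB (Vsp n N \<sigma>) d g z -->
  cmod ((\<Sum>j<d. opU n (HB m) (\<lambda>\<beta>. \<beta>) (g j) (z j)) / of_real (tw n) - s0 N \<sigma> (HB m) (\<lambda>\<beta>. \<beta>) * of_real (fvol N))
   \<le> C * (1 / real n + sqtot N (HB m) (\<lambda>\<beta>. \<beta>) * R n)"
  unfolding R_def by (rule trace_estimate[OF N s finite_HB[OF m] dB]) (auto intro: HeckeU_Vsp[OF N m cop] simp flip: HeckeU_opU)
 then obtain C1 where C1: "C1 \<ge> 0" "!!n d g z. n \<ge> 4 ==> LB (Vsp n N \<sigma>) d g z ==>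
  cmod ((\<Sum>j<d. HeckeU n m (g j) (z j)) / of_real (tw n)) \<le> C1 * (1 / real n)"
  unfolding HB_nonscalar[OF N m cop sq] HeckeU_opU by auto
 have UU: "HeckeU n m (HeckeU n m f) = opU n (HB m \<times> HB m) ?b2 f" if "f \<in> Vsp n N \<sigma>" for n f
  by (rule HeckeU_HeckeU_opU[OF m]) (rule VspD(1)[OF that])
 have U2: "opU n (HB m \<times> HB m) ?b2 f \<in> Vsp n N \<sigma>" if "f \<in> Vsp n N \<sigma>" for n f
  using HeckeU_Vsp[OF N m cop HeckeU_Vsp[OF N m cop that]] unfolding UU[OF that] .
 have "\<exists>C\<ge>0. \<forall>n\<ge>4. \<forall>d g z. LB (Vsp n N \<sigma>) d g z -->
  cmod ((\<Sum>j<d. opU n (HB m \<times> HB m) ?b2 (g j) (z j)) / of_real (tw n) - s0 N \<sigma> (HB m \<times> HB m) ?b2 * of_real (fvol N))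
   \<le> C * (1 / real n + sqtot N (HB m \<times> HB m) ?b2 * R n)"
  unfolding R_def by (rule trace_estimate[OF N s]) (use finite_HB[OF m] dB U2 in auto)
 then obtain C2 where C2: "C2 \<ge> 0" "!!n d g z. n \<ge> 4 ==> LB (Vsp n N \<sigma>) d g z ==>
  cmod ((\<Sum>j<d. opU n (HB m \<times> HB m) ?b2 (g j) (z j)) / of_real (tw n) - of_real S * of_real (fvol N))
   \<le> C2 * (1 / real n + sqtot N (HB m \<times> HB m) ?b2 * R n)" unfolding S(2) by blast
 define E where "E n = C2 * (1 / real n + sqtot N (HB m \<times> HB m) ?b2 * R n)" for n
 have E: "E \<longlonglongrightarrow> 0"
 proof -
  have "E \<longlonglongrightarrow> C2 * (0 + sqtot N (HB m \<times> HB m) ?b2 * 0)"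
   unfolding E_def[abs_def] by (intro tendsto_intros R lim_1_over_n)
  then show ?thesis by simp
 qed
 define F where "F n = C0 * (1 / real n + sqtot N {()} (\<lambda>_. (1, 0, 0, 1)) * R n)" for n
 have "F \<longlonglongrightarrow> C0 * (0 + sqtot N {()} (\<lambda>_. (1, 0, 0, 1)) * 0)"
  unfolding F_def[abs_def] by (intro tendsto_intros R lim_1_over_n)
 then have "Bseq F" by (intro convergent_imp_Bseq convergentI)
 then obtain B where B: "!!n. norm (F n) \<le> B" by (auto simp: Bseq_def)
 define C where "C = max (B + cmod (s0 N \<sigma> {()} (\<lambda>_. (1, 0, 0, 1)) * of_real (fvol N))) (C1 * exp 8)"
 define M where "M = S * fvol N / real m"
 have M: "M > 0" using S(1) fvol_pos[OF N] m by (simp add: M_def)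
 have "\<exists>es. (\<forall>r. hecke_coeff r m N (2 * n) \<sigma> = (-1) ^ r * esym r es \<and> hecke_coeff r m N (2 * n) \<sigma> \<in> \<real>) \<and>
  (\<forall>e\<in>set es. cmod e \<le> real (card (HB m))) \<and> real (length es) \<le> C * tw n \<and>
  cmod (psum 1 es) \<le> C \<and> cmod (psum 2 es / of_real (tw n) - of_real M) \<le> E n" if n: "n \<ge> 4" for n
 proof -
  let ?V = "Vsp n N \<sigma>" and ?T = "hecke_normalized (2 * n) m"
  have n0: "n > 0" "n \<ge> 1" using n by simp_all
  have tw: "tw n > 0" by (rule tw_pos[OF n0(2)])
  obtain d g z where L: "LB ?V d g z" by (rule Vsp_LB[OF N n0(1) s])
  have TV: "!!f. f \<in> ?V ==> ?T f \<in> ?V" by (rule hecke_normalized_Vsp[OF N m cop n0(1)])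
  have lin: "lincomb_hom ?T" by (rule lincomb_hom_hecke[OF m n0(1)])
  let ?A = "LM ?T d g z"
  have A: "?A \<in> carrier_mat d d" by (simp add: LM_def)
  obtain es where es: "char_poly ?A = (\<Prod>e\<leftarrow>es. [:- e, 1:])" "length es = d" "!!e. e \<in> set es ==> eigenvalue ?A e"
   "psum 1 es = (\<Sum>i<d. ?A $$ (i, i))" "psum 2 es = (\<Sum>i<d. \<Sum>j<d. ?A $$ (i, j) * ?A $$ (j, i))"
  proof (rule eigenvalue_list[OF A])
  qed (rule that)
  have V: "cusp_forms_sign (2 * n) N \<sigma> = ?V" by (rule cusp_forms_sign_eq_Vsp[OF N n0(1) s])
  have cp: "char_poly_on ?V ?T = char_poly ?A" by (rule char_poly_on_eq[OF L Vsp_subspace TV lin])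
  have dim: "cfun.dim ?V = d" by (rule LB_basis(4)[OF L Vsp_subspace])
  have co: "hecke_coeff r m N (2 * n) \<sigma> = (-1) ^ r * esym r es" for r
   unfolding hecke_coeff_def Let_def V cp dim es(1)
   using coeff_prod_linear[of r es] esym_eq_0[of es r] es(2) by simp
  have re: "hecke_coeff r m N (2 * n) \<sigma> \<in> \<real>" for r
   unfolding hecke_coeff_def Let_def V using char_poly_on_real[OF N m cop n0(1) s L] by simp
  have ev: "cmod e \<le> real (card (HB m))" if "e \<in> set es" for e
   by (rule hecke_eigenvalue_bound[OF N m cop n0(1) L es(3)[OF that]])
  have len: "real (length es) \<le> C * tw n"
  proof -
   have "(\<Sum>j<d. opU n {()} (\<lambda>_. (1, 0, 0, 1)) (g j) (z j)) = (\<Sum>j<d. 1)"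
    by (rule sum.cong) (use LBD(3)[OF L] in \<open>auto simp: opU_def\<close>)
   then have "cmod (of_nat d / of_real (tw n) - s0 N \<sigma> {()} (\<lambda>_. (1, 0, 0, 1)) * of_real (fvol N)) \<le> F n"
    using C0(2)[OF n L] by (simp add: F_def)
   moreover have "F n \<le> B" using B[of n] by simp
   moreover have "cmod (of_nat d / of_real (tw n)) = real d / tw n" using tw by (simp add: norm_divide)
   ultimately have "real d / tw n \<le> B + cmod (s0 N \<sigma> {()} (\<lambda>_. (1, 0, 0, 1)) * of_real (fvol N))"
    using norm_triangle_sub[of "of_nat d / of_real (tw n)" "s0 N \<sigma> {()} (\<lambda>_. (1, 0, 0, 1)) * of_real (fvol N)"] by linarith
   also have "\<dots> \<le> C" unfolding C_def by (rule max.cobounded1)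
   finally show ?thesis using tw es(2) by (simp add: pos_divide_le_eq)
  qed
  define a where "a = complex_of_real (1 / sqrt (real m))"
  have a2: "a * a = of_real (1 / real m)" unfolding a_def of_real_mult[symmetric] using m by simp
  have na: "cmod a \<le> 1" using m by (simp add: a_def norm_divide)
  have TU: "?T f w = a * HeckeU n m f w" for f w
   unfolding hecke_normalized_HeckeU[OF m n0(1)] by (simp only: cscale_def a_def)
  have p1: "cmod (psum 1 es) \<le> C"
  proof -
   have "psum 1 es = a * (\<Sum>j<d. HeckeU n m (g j) (z j))"
    unfolding es(4) sum_distrib_left by (rule sum.cong) (auto simp: LM_def TU)
   then have "cmod (psum 1 es) \<le> 1 * cmod (\<Sum>j<d. HeckeU n m (g j) (z j))"
    unfolding norm_mult using na by (intro order_trans[OF eq_refl mult_right_mono]) (simp_all add: norm_mult)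
   also have "cmod (\<Sum>j<d. HeckeU n m (g j) (z j)) \<le> C1 * (1 / real n) * tw n"
    using C1(2)[OF n L] tw by (simp only: norm_divide norm_of_real abs_of_pos pos_divide_le_eq)
   \<comment> \<open>The rate O(1/n), available because no parabolic matrices occur, offsets the
     growth of \<open>tw n\<close>.\<close>
   also have "C1 * (1 / real n) * tw n \<le> C1 * (1 / real n) * (exp 8 * real n)"
    using C1(1) tw_le[OF n0(2)] by (intro mult_left_mono) auto
   also have "\<dots> = C1 * exp 8" using n0 by simp
   also have "\<dots> \<le> C" unfolding C_def by (rule max.cobounded2)
   finally show ?thesis by simp
  qed
  have p2: "cmod (psum 2 es / of_real (tw n) - of_real M) \<le> E n"
  proof -
   \<comment> \<open>A diagonal entry of the squared matrix is the value at \<open>z i\<close> of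
     the operator applied twice to \<open>g i\<close>, as one sees by expanding the first image in
     the interpolation basis.\<close>
   have "(\<Sum>j<d. ?A $$ (i, j) * ?A $$ (j, i)) = of_real (1 / real m) * opU n (HB m \<times> HB m) ?b2 (g i) (z i)" if i: "i < d" for i
   proof -
    have gi: "g i \<in> ?V" by (rule LBD(1)[OF L i])
    have "?T (?T (g i)) = ?T (\<Sum>j<d. cscale (?T (g i) (z j)) (g j))" using LBD(4)[OF L TV[OF gi]] by simp
    also have "\<dots> = (\<Sum>j<d. cscale (?T (g i) (z j)) (?T (g j)))" by (rule lincomb_homD[OF lin])
    finally have "?T (?T (g i)) (z i) = (\<Sum>j<d. ?T (g i) (z j) * ?T (g j) (z i))" by (simp only: sum_cscale_apply)
    also have "\<dots> = (\<Sum>j<d. ?A $$ (i, j) * ?A $$ (j, i))" by (rule sum.cong) (use i in \<open>auto simp: LM_def\<close>)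
    finally have "(\<Sum>j<d. ?A $$ (i, j) * ?A $$ (j, i)) = ?T (?T (g i)) (z i)" ..
    also have "\<dots> = a * (\<Sum>\<beta>\<in>HB m. sl n \<beta> (cscale a (HeckeU n m (g i))) (z i))"
     unfolding TU hecke_normalized_HeckeU[OF m n0(1)] a_def[symmetric] by (simp only: HeckeU_def cscale_def)
    also have "\<dots> = a * a * HeckeU n m (HeckeU n m (g i)) (z i)"
     unfolding sl_cscale by (simp add: HeckeU_def[of n m "HeckeU n m (g i)"] cscale_def sum_distrib_left mult.assoc)
    finally show ?thesis unfolding a2 UU[OF gi] .
   qed
   then have "psum 2 es = of_real (1 / real m) * (\<Sum>i<d. opU n (HB m \<times> HB m) ?b2 (g i) (z i))"
    unfolding es(5) sum_distrib_left by (intro sum.cong refl) auto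
   then have "psum 2 es / of_real (tw n) - of_real M
    = of_real (1 / real m) * ((\<Sum>i<d. opU n (HB m \<times> HB m) ?b2 (g i) (z i)) / of_real (tw n) - of_real S * of_real (fvol N))"
    by (simp add: M_def algebra_simps)
   then have "cmod (psum 2 es / of_real (tw n) - of_real M)
    = cmod (of_real (1 / real m)) * cmod ((\<Sum>i<d. opU n (HB m \<times> HB m) ?b2 (g i) (z i)) / of_real (tw n) - of_real S * of_real (fvol N))"
    by (simp only: norm_mult)
   also have "\<dots> \<le> 1 * cmod ((\<Sum>i<d. opU n (HB m \<times> HB m) ?b2 (g i) (z i)) / of_real (tw n) - of_real S * of_real (fvol N))"
    by (rule mult_right_mono) (use m in \<open>simp_all add: norm_divide\<close>)
   finally have "cmod (psum 2 es / of_real (tw n) - of_real M)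
    \<le> 1 * cmod ((\<Sum>i<d. opU n (HB m \<times> HB m) ?b2 (g i) (z i)) / of_real (tw n) - of_real S * of_real (fvol N))" .
   then show ?thesis using C2(2)[OF n L] unfolding E_def by linarith
  qed
  show ?thesis using co re ev len p1 p2 by blast
 qed
 then show ?thesis using M E by blast
qed

lemma norm_psum_le: "(!!x. x \<in> set xs ==> cmod x \<le> L) ==> cmod (psum i xs) \<le> real (length xs) * L ^ i"
proof (induction xs)
 case (Cons x xs)
 have "cmod (psum i (x # xs)) \<le> cmod (x ^ i) + cmod (psum i xs)"
  unfolding psum_def list.map sum_list.Cons by (rule norm_triangle_ineq)
 also have "\<dots> \<le> L ^ i + real (length xs) * L ^ i"
  using Cons by (intro add_mono) (simp_all add: norm_power power_mono)
 finally show ?case by (simp add: distrib_right)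
qed (simp add: psum_def)

theorem corollary1p4:
  fixes r m N :: nat and \<sigma> :: "nat \<Rightarrow> int"
  assumes "m \<ge> 1" and "\<not> is_square m"
    and "N \<ge> 1" and "coprime N m"
    and "sign_pattern N \<sigma>"
  shows "finite {k :: nat. even k \<and> k \<ge> 2 \<and>
           \<not> (hecke_coeff (2 * r) m N k \<sigma> \<in> \<real> \<and>
              hecke_coeff (2 * r) m N k \<sigma> \<noteq> 0 \<and>
              sgn (Re (hecke_coeff (2 * r) m N k \<sigma>)) = (-1) ^ r)}"
proof -
 let ?L = "real (card (HB m))"
 have pos: "N > 0" "m > 0" using assms by simp_all
 obtain C M E where M: "M > 0" and E: "E \<longlonglongrightarrow> 0" and data: "\<forall>n\<ge>4. \<exists>es.
  (\<forall>r. hecke_coeff r m N (2 * n) \<sigma> = (-1) ^ r * esym r es \<and> hecke_coeff r m N (2 * n) \<sigma> \<in> \<real>) \<and>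
  (\<forall>e\<in>set es. cmod e \<le> ?L) \<and> real (length es) \<le> C * tw n \<and>
  cmod (psum 1 es) \<le> C \<and> cmod (psum 2 es / of_real (tw n) - of_real M) \<le> E n"
  using spectral_data[OF pos assms(4) assms(2) assms(5)] by blast
 then have "\<forall>n. \<exists>es. n \<ge> 4 --> (\<forall>r. hecke_coeff r m N (2 * n) \<sigma> = (-1) ^ r * esym r es \<and> hecke_coeff r m N (2 * n) \<sigma> \<in> \<real>) \<and>
  (\<forall>e\<in>set es. cmod e \<le> ?L) \<and> real (length es) \<le> C * tw n \<and>
  cmod (psum 1 es) \<le> C \<and> cmod (psum 2 es / of_real (tw n) - of_real M) \<le> E n" by blast
 from choice[OF this] obtain es where
  co: "!!n r. n \<ge> 4 ==> hecke_coeff r m N (2 * n) \<sigma> = (-1) ^ r * esym r (es n)"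
  and re: "!!n r. n \<ge> 4 ==> hecke_coeff r m N (2 * n) \<sigma> \<in> \<real>"
  and ev: "!!n e. n \<ge> 4 ==> e \<in> set (es n) ==> cmod e \<le> ?L"
  and len: "!!n. n \<ge> 4 ==> real (length (es n)) \<le> C * tw n"
  and p1: "!!n. n \<ge> 4 ==> cmod (psum 1 (es n)) \<le> C"
  and p2: "!!n. n \<ge> 4 ==> cmod (psum 2 (es n) / of_real (tw n) - of_real M) \<le> E n" by blast
 \<comment> \<open>On this scale p_2 / q^2 has the limit M > 0, whereas p_1 / q and p_i / q^i for i
   \<ge> 3 tend to 0.\<close>
 define q where "q n = sqrt (tw n)" for n
 have q: "filterlim q at_top sequentially"
  unfolding q_def[abs_def] by (rule filterlim_compose[OF sqrt_at_top tw_at_top])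
 have qp: "q n > 0" if "n \<ge> 4" for n using tw_pos[of n] that by (simp add: q_def)
 have q2: "q n ^ 2 = tw n" if "n \<ge> 4" for n using tw_pos[of n] that by (simp add: q_def)
 have ev4: "\<forall>\<^sub>F n in sequentially. (4::nat) \<le> n" by (rule eventually_ge_at_top)
 have inv: "(\<lambda>n. c / q n ^ k) \<longlonglongrightarrow> 0" if "k > 0" for c k
  by (intro tendsto_divide_0[OF tendsto_const] filterlim_at_top_imp_at_infinity filterlim_pow_at_top[OF that q])
 have lim: "(\<lambda>n. psum (Suc i) (es n) / of_real (q n) ^ Suc i) \<longlonglongrightarrow> (if i = 1 then of_real M else 0)" for i
 proof -
  consider "i = 0" | "i = 1" | "i \<ge> 2" by linarith
  then show ?thesis
  proof cases
   case 1
   have "(\<lambda>n. psum 1 (es n) / of_real (q n)) \<longlonglongrightarrow> 0"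
   proof (rule Lim_null_comparison[OF _ inv[of 1 C]])
    show "\<forall>\<^sub>F n in sequentially. norm (psum 1 (es n) / of_real (q n)) \<le> C / q n ^ 1"
     using ev4 by eventually_elim (use p1 qp in \<open>simp add: norm_divide divide_right_mono less_imp_le\<close>)
   qed simp
   then show ?thesis using 1 by simp
  next
   case 2
   have "(\<lambda>n. psum 2 (es n) / of_real (tw n) - of_real M) \<longlonglongrightarrow> 0"
    by (rule Lim_null_comparison[OF _ E]) (use ev4 in eventually_elim, rule p2)
   then have "(\<lambda>n. psum 2 (es n) / of_real (tw n)) \<longlonglongrightarrow> of_real M" by (rule LIM_zero_cancel)
   moreover have "\<forall>\<^sub>F n in sequentially. psum 2 (es n) / of_real (tw n) = psum 2 (es n) / of_real (q n) ^ 2"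
    using ev4 by eventually_elim (simp add: q2 flip: of_real_power)
   ultimately have "(\<lambda>n. psum 2 (es n) / of_real (q n) ^ 2) \<longlonglongrightarrow> of_real M" by (rule Lim_transform_eventually)
   then show ?thesis using 2 by (simp add: numeral_2_eq_2)
  next
   \<comment> \<open>There are O(q^2) eigenvalues, all bounded, so each power sum is O(q^2).
     Division by q^(i + 1) leaves i - 1 \<ge> 1 powers of q in the denominator.\<close>
   case 3
   have "(\<lambda>n. psum (Suc i) (es n) / of_real (q n) ^ Suc i) \<longlonglongrightarrow> 0"
   proof (rule Lim_null_comparison[OF _ inv[of "i - 1" "C * ?L ^ Suc i"]])
    show "\<forall>\<^sub>F n in sequentially. norm (psum (Suc i) (es n) / of_real (q n) ^ Suc i) \<le> C * ?L ^ Suc i / q n ^ (i - 1)"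
     using ev4
    proof eventually_elim
     case (elim n)
     have "cmod (psum (Suc i) (es n)) \<le> real (length (es n)) * ?L ^ Suc i" by (rule norm_psum_le) (rule ev[OF elim])
     also have "\<dots> \<le> C * q n ^ 2 * ?L ^ Suc i" unfolding q2[OF elim] by (intro mult_right_mono len[OF elim]) simp
     finally have "cmod (psum (Suc i) (es n)) \<le> C * ?L ^ Suc i * q n ^ 2" by (simp only: mult_ac)
     then have "cmod (psum (Suc i) (es n)) / q n ^ Suc i \<le> C * ?L ^ Suc i * q n ^ 2 / q n ^ Suc i"
      using qp[OF elim] by (intro divide_right_mono) auto
     also have "q n ^ Suc i = q n ^ 2 * q n ^ (i - 1)" using 3 by (simp flip: power_add)
     then have "C * ?L ^ Suc i * q n ^ 2 / q n ^ Suc i = C * ?L ^ Suc i / q n ^ (i - 1)"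
      using qp[OF elim] by (simp only:) simp
     finally show ?case using qp[OF elim] by (simp only: norm_divide norm_power norm_of_real abs_of_pos)
    qed
   qed (use 3 in simp)
   then show ?thesis using 3 by simp
  qed
 qed
 have "\<forall>\<^sub>F n in sequentially. q n > 0" using ev4 by eventually_elim (rule qp)
 from esym_sign[OF lim M this, of r] ev4
 have "\<forall>\<^sub>F n in sequentially. hecke_coeff (2 * r) m N (2 * n) \<sigma> \<in> \<real> \<and> sgn (Re (hecke_coeff (2 * r) m N (2 * n) \<sigma>)) = (-1) ^ r"
  by eventually_elim (use re[of _ "2 * r"] in \<open>simp add: co\<close>)
 then obtain n0 where n0: "!!n. n \<ge> n0 ==> hecke_coeff (2 * r) m N (2 * n) \<sigma> \<in> \<real> \<and> sgn (Re (hecke_coeff (2 * r) m N (2 * n) \<sigma>)) = (-1) ^ r"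
  unfolding eventually_sequentially by blast
 show ?thesis
 proof (rule finite_subset[of _ "(\<lambda>n. 2 * n) ` {..<n0}"])
  show "{k :: nat. even k \<and> k \<ge> 2 \<and> \<not> (hecke_coeff (2 * r) m N k \<sigma> \<in> \<real> \<and>
       hecke_coeff (2 * r) m N k \<sigma> \<noteq> 0 \<and> sgn (Re (hecke_coeff (2 * r) m N k \<sigma>)) = (-1) ^ r)} \<subseteq> (\<lambda>n. 2 * n) ` {..<n0}"
  proof
   fix k assume k: "k \<in> {k :: nat. even k \<and> k \<ge> 2 \<and> \<not> (hecke_coeff (2 * r) m N k \<sigma> \<in> \<real> \<and>
       hecke_coeff (2 * r) m N k \<sigma> \<noteq> 0 \<and> sgn (Re (hecke_coeff (2 * r) m N k \<sigma>)) = (-1) ^ r)}"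
   then obtain n where n: "k = 2 * n" by (auto elim: evenE)
   have "n < n0"
   proof (rule ccontr)
    assume "\<not> n < n0"
    then have *: "hecke_coeff (2 * r) m N k \<sigma> \<in> \<real>" "sgn (Re (hecke_coeff (2 * r) m N k \<sigma>)) = (-1) ^ r"
     using n0[of n] n by auto
    then have "hecke_coeff (2 * r) m N k \<sigma> \<noteq> 0" by auto
    then show False using k * by auto
   qed
   then show "k \<in> (\<lambda>n. 2 * n) ` {..<n0}" using n by blast
  qed
 qed simp
qed

end
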